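(* Let $F_{27}:=(6,\{01,02,03,13,45\})$. Then $\lambda_{F_{27}}=135/1024$. Furthermore, the $F_{27}$-problem is perfectly $B$-stable with \[B:=(8,\{01,12,23,30,45,56,67,74,00,11,22,33,44,55,66,77\}),\] and the unique (up to automorphisms of $B$) maximiser of $p(F_{27},B(\boldsymbol x))$ over $\boldsymbol x\in\mathbb S_8$ is $\boldsymbol x=(1/8,1/8,1/8,1/8,1/8,1/8,1/8,1/8)$.
   Context: All graphs are finite and simple. $(m,E)$ denotes the graph or pattern with vertex set $\{0,\dots,m-1\}$ and edge set $E$; $ij$ abbreviates $\{i,j\}$ ($ii$ is a loop). For graphs $F,G$ with $\kappa\le n$ vertices, $p(F,G)$ is the number of $\kappa$-subsets of $V(G)$ inducing a subgraph isomorphic to $F$, divided by $\binom n\kappa$; $p(F,n)$ is the maximum of $p(F,G)$ over $n$-vertex graphs $G$; $\lambda_F=\lim_{n\to\infty}p(F,n)$ (the limit exists). A pattern is a graph in which loops are allowed; its automorphisms are the bijections of the vertex set preserving edges, non-edges, loops and non-loops. For a pattern $B$ on $\{0,\dots,m-1\}$ and disjoint (possibly empty) sets $V_0,\dots,V_{m-1}$, the blowup $B(V_0,\dots,V_{m-1})$ is the simple graph on $\bigcup V_i$ in which distinct $x\in V_i$, $y\in V_j$ are adjacent iff $\{i,j\}\in E(B)$ (so $V_i$ is a clique if $i$ has a loop and independent otherwise); $B()$ is the family of all blowups. $\mathbb S_m=\{\boldsymbol x\in\mathbb R^m:x_i\ge0,\sum x_i=1\}$, and $p(F,B(\boldsymbol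 x))$ is the limit as $n\to\infty$ of $p(F,B(V_0,\dots,V_{m-1}))$ with $|V_i|=(x_i+o(1))n$. $\delta_{\mathrm{edit}}(G,B())$ is the minimum number of vertex pairs whose adjacency must be changed to turn $G$ into a graph isomorphic to a blowup of $B$ (of the same order). The $F$-problem is perfectly $B$-stable if there is $C>0$ such that every graph $G$ with $n\ge C$ vertices satisfies $\delta_{\mathrm{edit}}(G,B())\le C\,(p(F,n)-p(F,G))\,n^2$. *)

theory Defs
  imports Complex_Main "HOL-Library.Disjoint_Sets"
begin

text \<open>
  Graphs and patterns are pairs of a vertex set and an edge set, where an edge between
  \<open>i\<close> and \<open>j\<close> is the set \<open>{i, j}\<close>. In particular the singleton \<open>{i}\<close> is the loop at \<open>i\<close>.
\<close>

type_synonym 'a pattern = "'a set \<times> 'a set set"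

abbreviation verts :: "'a pattern \<Rightarrow> 'a set" where
  "verts G \<equiv> fst G"

abbreviation edges :: "'a pattern \<Rightarrow> 'a set set" where
  "edges G \<equiv> snd G"

definition simple_graph :: "'a pattern \<Rightarrow> bool" where
  "simple_graph G \<longleftrightarrow> finite (verts G) \<and> (\<forall>e\<in>edges G. e \<subseteq> verts G \<and> card e = 2)"

definition induced :: "'a pattern \<Rightarrow> 'a set \<Rightarrow> 'a pattern" where
  "induced G S = (S, {e \<in> edges G. e \<subseteq> S})"

text \<open>The case \<open>x = y\<close> below says that loops and non-loops are preserved.\<close>

definition pattern_iso :: "('a \<Rightarrow> 'b) \<Rightarrow> 'a pattern \<Rightarrow> 'b pattern \<Rightarrow> bool" where
  "pattern_iso f G H \<longleftrightarrow> bij_betw f (verts G) (verts H) \<and>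
     (\<forall>x\<in>verts G. \<forall>y\<in>verts G. {x, y} \<in> edges G \<longleftrightarrow> {f x, f y} \<in> edges H)"

definition isomorphic :: "'a pattern \<Rightarrow> 'b pattern \<Rightarrow> bool" where
  "isomorphic G H \<longleftrightarrow> (\<exists>f. pattern_iso f G H)"

abbreviation automorphism :: "'a pattern \<Rightarrow> ('a \<Rightarrow> 'a) \<Rightarrow> bool" where
  "automorphism B f \<equiv> pattern_iso f B B"

text \<open>\<open>p(F, G)\<close>; it is 0 if \<open>G\<close> has fewer vertices than \<open>F\<close>.\<close>

definition density :: "'a pattern \<Rightarrow> 'b pattern \<Rightarrow> real" where
  "density F G =
     real (card {S. S \<subseteq> verts G \<and> card S = card (verts F) \<and> isomorphic (induced G S) F})
     / real (card (verts G) choose card (verts F))"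

text \<open>
  \<open>p(F, n)\<close>. Every finite graph is isomorphic to one whose vertices are natural numbers.
  The set of densities is finite although the set of graphs is not.
\<close>

definition max_density :: "'a pattern \<Rightarrow> nat \<Rightarrow> real" where
  "max_density F n =
     Max {density F G | G :: nat pattern. simple_graph G \<and> card (verts G) = n}"

definition blowup_parts :: "'b pattern \<Rightarrow> ('b \<Rightarrow> 'a set) \<Rightarrow> bool" where
  "blowup_parts B V \<longleftrightarrow> (\<forall>i\<in>verts B. finite (V i)) \<and> disjoint_family_on V (verts B)"

definition blowup :: "'b pattern \<Rightarrow> ('b \<Rightarrow> 'a set) \<Rightarrow> 'a pattern" where
  "blowup B V =
     ((\<Union>i\<in>verts B. V i),
      {{x, y} | x y. x \<noteq> y \<and>
         (\<exists>i\<in>verts B. \<exists>j\<in>verts B. x \<in> V i \<and> y \<in> V j \<and> {i, j} \<in> edges B)})"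

definition blowups :: "'b pattern \<Rightarrow> 'a pattern set" where
  "blowups B = {blowup B V | V. blowup_parts B V}"

definition edit_distance :: "'a pattern \<Rightarrow> 'b pattern \<Rightarrow> nat" where
  "edit_distance G B =
     Min {card (sym_diff (edges G) (edges H)) | H. simple_graph H \<and> verts H = verts G \<and>
            (\<exists>K \<in> (blowups B :: 'a pattern set). isomorphic H K)}"

definition perfectly_stable :: "'a pattern \<Rightarrow> 'b pattern \<Rightarrow> bool" where
  "perfectly_stable F B \<longleftrightarrow>
     (\<exists>C::real. C > 0 \<and>
       (\<forall>G :: nat pattern. simple_graph G \<and> real (card (verts G)) \<ge> C \<longrightarrow>
          real (edit_distance G B)
            \<le> C * (max_density F (card (verts G)) - density F G) * real (card (verts G)) ^ 2))"

definition simplex :: "'b set \<Rightarrow> ('b \<Rightarrow> real) set" where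
  "simplex I = {x. (\<forall>i\<in>I. 0 \<le> x i) \<and> (\<Sum>i\<in>I. x i) = 1}"

text \<open>
  \<open>p(F, B(x))\<close> is the common limit over all sequences of parts with \<open>|V\<^sub>i| = (x\<^sub>i + o(1)) n\<close>.
\<close>

definition blowup_density :: "'a pattern \<Rightarrow> 'b pattern \<Rightarrow> ('b \<Rightarrow> real) \<Rightarrow> real" where
  "blowup_density F B x =
     (THE l. \<forall>V :: nat \<Rightarrow> 'b \<Rightarrow> nat set.
        (\<forall>n. blowup_parts B (V n)) \<and>
        (\<forall>i\<in>verts B. (\<lambda>n. real (card (V n i)) / real n) \<longlonglongrightarrow> x i)
        \<longrightarrow> (\<lambda>n. density F (blowup B (V n))) \<longlonglongrightarrow> l)"

definition is_maximiser :: "'a pattern \<Rightarrow> 'b pattern \<Rightarrow> ('b \<Rightarrow> real) \<Rightarrow> bool" where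
  "is_maximiser F B x \<longleftrightarrow> x \<in> simplex (verts B) \<and>
     (\<forall>y\<in>simplex (verts B). blowup_density F B y \<le> blowup_density F B x)"

text \<open>Vectors are compared on \<open>verts B\<close> only, as their other values are irrelevant.\<close>

definition is_unique_maximiser :: "'a pattern \<Rightarrow> 'b pattern \<Rightarrow> ('b \<Rightarrow> real) \<Rightarrow> bool" where
  "is_unique_maximiser F B x \<longleftrightarrow> is_maximiser F B x \<and>
     (\<forall>y. is_maximiser F B y \<longrightarrow>
        (\<exists>f. automorphism B f \<and> (\<forall>i\<in>verts B. y i = x (f i))))"

definition F27 :: "nat pattern" where
  "F27 = ({0..<6}, {{0,1}, {0,2}, {0,3}, {1,3}, {4,5}})"

definition B27 :: "nat pattern" where
  "B27 = ({0..<8},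
     {{0,1}, {1,2}, {2,3}, {3,0}, {4,5}, {5,6}, {6,7}, {7,4},
      {0,0}, {1,1}, {2,2}, {3,3}, {4,4}, {5,5}, {6,6}, {7,7}})"

end

theory Submission
  imports Defs "HOL-Combinatorics.Multiset_Permutations" "HOL-Library.FuncSet"
begin

text \<open>
  The upper bound is a flag algebra calculation in exact arithmetic. For a graph on seven vertices
  let the surplus be \<open>54432000\<close> minus \<open>58982400\<close> times its number of induced copies of \<open>F27\<close>, minus
  the contributions of three quadratic forms. The variables of a form are the densities of the
  extensions (flags) of a fixed small rooted graph: one vertex, three independent vertices, or an
  induced path. The forms are positive semidefinite (\<open>value_nonneg\<close>), so their averages over the
  choices of the roots are not negative. On the other hand the surplus is never negative, and it is
  at least \<open>41784\<close> unless the graph is a blowup of \<open>B27\<close> (\<open>surplus_dichotomy\<close>); this is a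
  computation over all graphs on seven vertices. Averaging the surplus over seven random vertices
  gives \<open>copy_density_bound\<close>: the density of labelled copies is at most \<open>3 / 4096\<close>, and a graph
  close to this bound has few seven-tuples that do not occur in blowups (its defect). The bound is
  stated for weighted graphs and tuples drawn with replacement, so it holds without an error term.
  As \<open>F27\<close> has four automorphisms, \<open>3 / 4096\<close> becomes \<open>6! / 4 * 3 / 4096 = 135 / 1024\<close>.

  The pattern \<open>B27\<close> consists of two cycles of length four whose vertices carry loops. In a blowup an
  induced path with three vertices (a seed) lies in three consecutive parts of one cycle, and the
  adjacencies to the seed tell for each vertex in which part of this cycle it is, or that it is in
  the other cycle. If the defect is small, two seeds in different cycles exist
  (\<open>many_two_seeds\<close>), and placing every vertex by means of them shows that a near-optimal graph
  is close to a blowup (\<open>close_to_blowup\<close>).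

  For perfect stability take the placement \<open>p\<close> of the vertices with the fewest wrong pairs. A wrong
  pair together with a seed gives tuples that do not occur in blowups, and so does each vertex with
  many wrong pairs, because no other placement of it would be better. Hence the proportion of
  wrong pairs is bounded by a multiple of the defect (\<open>deviation_le_defect\<close>). The upper bound with
  the defect then says that the graph has fewer copies than the bound, in proportion to the number
  of wrong pairs. This must be compared with the blowup given by \<open>p\<close>, which need not attain the
  bound, as its parts have slightly different sizes. The remedy is to give the vertices weights
  such that all eight parts have weight \<open>1 / 8\<close>: the weighted blowup attains the bound exactly, and
  the weights are so close to uniform that the difference of the two copy densities, to which only
  tuples with a wrong pair contribute, hardly changes (\<open>reweighted_gain\<close>).

  Finally the density of copies in a blowup is an explicit polynomial in the sizes of the parts
  (\<open>pattern_density_eq\<close>), which is maximal only for equal parts (\<open>pattern_density_maximal\<close>).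
\<close>

section \<open>Sums over the orderings of seven indices\<close>

abbreviation orderings :: "nat list set" where
  "orderings \<equiv> permutations_of_set {..<7}"

text \<open>
  Sums over all orderings are evaluated by choosing one entry after the other, so that conditions
  on the first entries prune the remaining choices.
\<close>

primrec perm_sum :: "nat \<Rightarrow> nat list \<Rightarrow> (nat list \<Rightarrow> int) \<Rightarrow> int" where
  "perm_sum 0 xs F = F []"
| "perm_sum (Suc n) xs F = sum_list (map (\<lambda>x. perm_sum n (remove1 x xs) (\<lambda>l. F (x # l))) xs)"

lemma sum_permutations_eq_perm_sum:
  assumes "distinct xs" "length xs = n"
  shows "(\<Sum>l\<in>permutations_of_set (set xs). F l) = perm_sum n xs F"
  using assms
proof (induction n arbitrary: xs F)
  case 0
  then show ?case by simp
next
  case (Suc n)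
  have ne: "set xs \<noteq> {}" using Suc.prems by auto
  have "(\<Sum>l\<in>permutations_of_set (set xs). F l)
      = (\<Sum>l\<in>(\<Union>x\<in>set xs. (\<lambda>ys. x # ys) ` permutations_of_set (set xs - {x})). F l)"
    by (subst permutations_of_set_nonempty[OF ne]) simp
  also have "\<dots> = (\<Sum>x\<in>set xs. \<Sum>l\<in>(\<lambda>ys. x # ys) ` permutations_of_set (set xs - {x}). F l)"
    by (intro sum.UNION_disjoint) auto
  also have "\<dots> = (\<Sum>x\<in>set xs. \<Sum>l\<in>permutations_of_set (set (remove1 x xs)). F (x # l))"
    using Suc.prems by (simp add: sum.reindex inj_on_def set_remove1_eq)
  also have "\<dots> = (\<Sum>x\<in>set xs. perm_sum n (remove1 x xs) (\<lambda>l. F (x # l)))"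
    by (rule sum.cong[OF refl], rule Suc.IH) (use Suc.prems in \<open>auto simp: length_remove1\<close>)
  also have "\<dots> = perm_sum (Suc n) xs F"
    using Suc.prems by (simp add: sum_list_distinct_conv_sum_set)
  finally show ?case .
qed

lemma sum_orderings: "(\<Sum>l\<in>orderings. H l) = perm_sum 7 [0,1,2,3,4,5,6] H"
proof -
  have "{..<7} = set [0,1,2,3,4,5,6::nat]" by auto
  then show ?thesis by (subst sum_permutations_eq_perm_sum[symmetric]) auto
qed

lemma length_ordering: "l \<in> orderings \<Longrightarrow> length l = 7"
  by (simp add: length_finite_permutations_of_set)

lemma ordering_nth:
  assumes "l \<in> orderings" "i < 7" "j < 7"
  shows "l ! i < 7" "i \<noteq> j \<Longrightarrow> l ! i \<noteq> l ! j"
proof -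
  have l: "set l = {..<7}" "distinct l" "length l = 7"
    using assms(1) length_ordering[OF assms(1)] by (auto dest: permutations_of_setD)
  show "l ! i < 7" using l assms nth_mem[of i l] by (metis lessThan_iff)
  show "i \<noteq> j \<Longrightarrow> l ! i \<noteq> l ! j" using l assms by (simp add: nth_eq_iff_index_eq)
qed

text \<open>The list of positions \<open>p\<close> rearranges the arguments; rearranging permutes the orderings.\<close>

lemma sum_orderings_rearrange:
  assumes p: "distinct p" "set p = {..<7}"
  shows "(\<Sum>l\<in>permutations_of_set {..<7::nat}. H (map ((!) l) p)) = (\<Sum>l\<in>permutations_of_set {..<7}. H l)"
proof -
  let ?P = "permutations_of_set {..<7::nat}"
  have lp: "length p = 7" using p distinct_card[of p] by simp
  have len: "length l = 7" if "l \<in> ?P" for l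
    using that by (simp add: length_finite_permutations_of_set)
  have inj: "inj_on (\<lambda>l. map ((!) l) p) ?P"
  proof (rule inj_onI)
    fix k l assume kl: "k \<in> ?P" "l \<in> ?P" and eq: "map ((!) k) p = map ((!) l) p"
    have "k ! i = l ! i" if "i < 7" for i
      using eq p that by (auto simp: map_eq_conv)
    then show "k = l" using len[OF kl(1)] len[OF kl(2)] by (intro nth_equalityI) auto
  qed
  have im: "(\<lambda>l. map ((!) l) p) ` ?P \<subseteq> ?P"
  proof
    fix k assume "k \<in> (\<lambda>l. map ((!) l) p) ` ?P"
    then obtain l where l: "l \<in> ?P" and k: "k = map ((!) l) p" by auto
    have dl: "distinct l" "set l = {..<7}" using l by (auto dest: permutations_of_setD)
    have "set k = (!) l ` {..<length l}" using k p len[OF l] by simp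
    also have "\<dots> = set l" by (auto simp: set_conv_nth)
    finally have "set k = {..<7}" using dl by simp
    moreover have "distinct k"
      using k p dl len[OF l] by (auto simp: distinct_map inj_on_def nth_eq_iff_index_eq)
    ultimately show "k \<in> ?P" by auto
  qed
  have "(\<lambda>l. map ((!) l) p) ` ?P = ?P"
    using inj im by (intro card_subset_eq) (auto simp: card_image)
  then show ?thesis
    using sum.reindex[OF inj, of H] by simp
qed

text \<open>
  If a rearrangement swaps the orderings that satisfy \<open>C\<close> with those that do not, and the summand is
  invariant, then half of the orderings suffice. The next lemma is the same for a rotation of
  three positions.
\<close>

lemma sum_orderings_half:
  fixes H :: "nat list \<Rightarrow> int"
  assumes p: "distinct p" "set p = {..<7}"
    and H: "\<And>l. l \<in> orderings \<Longrightarrow> H (map ((!) l) p) = H l"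
    and C: "\<And>l. l \<in> orderings \<Longrightarrow> C (map ((!) l) p) = (\<not> C l)"
  shows "(\<Sum>l\<in>orderings. H l) = 2 * (\<Sum>l\<in>orderings. if C l then H l else 0)"
proof -
  have "(\<Sum>l\<in>orderings. H l) = (\<Sum>l\<in>orderings. if C l then H l else 0) + (\<Sum>l\<in>orderings. if \<not> C l then H l else 0)"
    unfolding sum.distrib[symmetric] by (intro sum.cong refl) auto
  also have "(\<Sum>l\<in>orderings. if \<not> C l then H l else 0)
      = (\<Sum>l\<in>orderings. if C (map ((!) l) p) then H (map ((!) l) p) else 0)"
    by (intro sum.cong refl) (simp add: H C)
  also have "\<dots> = (\<Sum>l\<in>orderings. if C l then H l else 0)"
    by (rule sum_orderings_rearrange[OF p, of "\<lambda>l. if C l then H l else 0"])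
  finally show ?thesis by simp
qed

lemma sum_orderings_third:
  fixes H :: "nat list \<Rightarrow> int"
  assumes p: "distinct p" "set p = {..<7}" and p': "distinct p'" "set p' = {..<7}"
    and H: "\<And>l. l \<in> orderings \<Longrightarrow> H (map ((!) l) p) = H l \<and> H (map ((!) l) p') = H l"
    and C: "\<And>l. l \<in> orderings \<Longrightarrow>
      of_bool (C l) + of_bool (C (map ((!) l) p)) + of_bool (C (map ((!) l) p')) = (1::int)"
  shows "(\<Sum>l\<in>orderings. H l) = 3 * (\<Sum>l\<in>orderings. if C l then H l else 0)"
proof -
  define G where "G l = of_bool (C l) * H l" for l
  have "(\<Sum>l\<in>orderings. H l) = (\<Sum>l\<in>orderings. G l + G (map ((!) l) p) + G (map ((!) l) p'))"
  proof (intro sum.cong refl)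
    fix l assume l: "l \<in> orderings"
    have "G l + G (map ((!) l) p) + G (map ((!) l) p')
      = (of_bool (C l) + of_bool (C (map ((!) l) p)) + of_bool (C (map ((!) l) p'))) * H l"
      using H[OF l] by (simp add: G_def algebra_simps)
    then show "H l = G l + G (map ((!) l) p) + G (map ((!) l) p')" by (simp only: C[OF l] mult_1)
  qed
  also have "\<dots> = 3 * (\<Sum>l\<in>orderings. G l)"
    using sum_orderings_rearrange[OF p, of G] sum_orderings_rearrange[OF p', of G] by (simp add: sum.distrib)
  also have "(\<Sum>l\<in>orderings. G l) = (\<Sum>l\<in>orderings. if C l then H l else 0)"
    by (intro sum.cong refl) (simp add: G_def)
  finally show ?thesis .
qed

lemma sum_orderings_relabel:
  assumes "\<sigma> permutes {..<7}"
  shows "(\<Sum>l\<in>orderings. H (map \<sigma> l)) = (\<Sum>l\<in>orderings. H l)"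
proof -
  let ?P = "permutations_of_set {..<7::nat}"
  have inj: "inj \<sigma>" using assms by (rule permutes_inj)
  have injm: "inj_on (map \<sigma>) ?P" using inj by (auto simp: inj_on_def inj_map_eq_map)
  have im: "map \<sigma> ` ?P \<subseteq> ?P"
  proof
    fix k assume "k \<in> map \<sigma> ` ?P"
    then obtain l where l: "set l = {..<7}" "distinct l" and k: "k = map \<sigma> l"
      by (auto simp: permutations_of_set_def)
    have "set k = {..<7}" using l k permutes_image[OF assms] by simp
    moreover have "distinct k" using l(2) k inj by (simp add: distinct_map inj_on_subset[OF inj])
    ultimately show "k \<in> ?P" by auto
  qed
  have "map \<sigma> ` ?P = ?P"
    using injm im by (intro card_subset_eq) (auto simp: card_image)
  then show ?thesis using sum.reindex[OF injm, of H] by simp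
qed


section \<open>Positive semidefinite forms from tables\<close>

text \<open>
  A table for a function of \<open>n\<close> bits lists its \<open>2 ^ n\<close> values in lexicographic order of the
  arguments.
\<close>

primrec lookup :: "bool list \<Rightarrow> 'a list \<Rightarrow> 'a" where
  "lookup [] = hd"
| "lookup (b # bs) = (\<lambda>t. lookup bs (if b then drop (2 ^ length bs) t else take (2 ^ length bs) t))"

primrec bool_lists :: "nat \<Rightarrow> bool list list" where
  "bool_lists 0 = [[]]"
| "bool_lists (Suc n) = map ((#) False) (bool_lists n) @ map ((#) True) (bool_lists n)"

lemma set_bool_lists: "set (bool_lists n) = {bs. length bs = n}"
proof (induction n)
  case (Suc n)
  show ?case
  proof (rule set_eqI)
    fix bs :: "bool list"
    show "bs \<in> set (bool_lists (Suc n)) \<longleftrightarrow> bs \<in> {bs. length bs = Suc n}"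
      by (cases bs) (auto simp: Suc.IH)
  qed
qed auto

lemma lookup_bool_lists:
  "length t = 2 ^ n \<Longrightarrow> list_all2 (\<lambda>bs v. lookup bs t = v) (bool_lists n) t"
proof (induction n arbitrary: t)
  case 0
  then obtain v where "t = [v]" by (auto simp: length_Suc_conv)
  then show ?case by simp
next
  case (Suc n)
  have len: "length bs = n" if "bs \<in> set (bool_lists n)" for bs
    using that by (simp add: set_bool_lists)
  have "list_all2 (\<lambda>bs v. lookup bs t = v)
    (map ((#) False) (bool_lists n) @ map ((#) True) (bool_lists n)) (take (2 ^ n) t @ drop (2 ^ n) t)"
  proof (rule list_all2_appendI)
    have "list_all2 (\<lambda>bs v. lookup bs (take (2 ^ n) t) = v) (bool_lists n) (take (2 ^ n) t)"
      using Suc.prems by (intro Suc.IH) simp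
    then show "list_all2 (\<lambda>bs v. lookup bs t = v) (map ((#) False) (bool_lists n)) (take (2 ^ n) t)"
      by (auto simp: list_all2_conv_all_nth len)
    have "list_all2 (\<lambda>bs v. lookup bs (drop (2 ^ n) t) = v) (bool_lists n) (drop (2 ^ n) t)"
      using Suc.prems by (intro Suc.IH) simp
    then show "list_all2 (\<lambda>bs v. lookup bs t = v) (map ((#) True) (bool_lists n)) (drop (2 ^ n) t)"
      by (auto simp: list_all2_conv_all_nth len)
  qed
  then show ?case by simp
qed

text \<open>
  Symmetric matrices are stored as the list of the rows of their upper triangle, each row
  starting with its diagonal entry.
\<close>

definition entry :: "int list list \<Rightarrow> nat \<Rightarrow> nat \<Rightarrow> int" where
  "entry Q i j = (if i \<le> j then Q ! i ! (j - i) else Q ! j ! (i - j))"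

lemma entry_sym: "entry Q i j = entry Q j i"
  by (simp add: entry_def)

primrec triangular :: "'a list list \<Rightarrow> bool" where
  "triangular [] = True"
| "triangular (r # R) = (length r = Suc (length R) \<and> triangular R)"

primrec dot :: "int list \<Rightarrow> real list \<Rightarrow> real" where
  "dot [] us = 0"
| "dot (a # as) us = of_int a * hd us + dot as (tl us)"

primrec quad :: "int list list \<Rightarrow> real list \<Rightarrow> real" where
  "quad [] us = 0"
| "quad (r # R) us = of_int (hd r) * (hd us)\<^sup>2 + 2 * hd us * dot (tl r) (tl us) + quad R (tl us)"

text \<open>
  One step of a Cholesky decomposition over the integers. The first row \<open>r\<close> is compared with the
  multiples of an integer vector \<open>w\<close>; the rounding error \<open>e\<close> is paid for by the diagonal, through
  \<open>2 e u v \<ge> - \<bar>e\<bar> (u\<^sup>2 + v\<^sup>2)\<close>.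
\<close>

primrec schur_update :: "int list list \<Rightarrow> int list \<Rightarrow> int list \<Rightarrow> int list list" where
  "schur_update [] w e = []"
| "schur_update (r # R) w e =
    ((hd r - hd w * hd w - \<bar>hd e\<bar>) # map2 (\<lambda>x y. x - hd w * y) (tl r) (tl w))
      # schur_update R (tl w) (tl e)"

text \<open>
  The vectors \<open>W\<close> are rounded rows of a Cholesky factor. No exact decomposition is needed: what
  the rounding leaves over is absorbed by the diagonal.
\<close>

primrec gram_check :: "int list list \<Rightarrow> int list list \<Rightarrow> bool" where
  "gram_check R [] = (R = [])"
| "gram_check R (w # W) = (R \<noteq> [] \<and> length w = length R \<and>
    (let e = map2 (\<lambda>x y. x - hd w * y) (tl (hd R)) (tl w)
     in sum_list (map abs e) \<le> hd (hd R) - hd w * hd w \<and>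
        gram_check (schur_update (tl R) (tl w) e) W))"

lemma dot_map2:
  "length as = length bs \<Longrightarrow> dot (map2 (\<lambda>x y. x - c * y) as bs) us = dot as us - of_int c * dot bs us"
  by (induction as bs arbitrary: us rule: list_induct2) (auto simp: algebra_simps)

lemma length_schur_update [simp]: "length (schur_update R w e) = length R"
  by (induction R arbitrary: w e) auto

lemma triangular_schur_update:
  "triangular R \<Longrightarrow> length w = length R \<Longrightarrow> triangular (schur_update R w e)"
  by (induction R arbitrary: w e) auto

primrec weighted_squares :: "int list \<Rightarrow> real list \<Rightarrow> real" where
  "weighted_squares [] us = 0"
| "weighted_squares (a # as) us = of_int \<bar>a\<bar> * (hd us)\<^sup>2 + weighted_squares as (tl us)"

lemma quad_schur_update:
  "triangular R \<Longrightarrow> length w = length R \<Longrightarrow> length e = length R \<Longrightarrow>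
    quad R us = quad (schur_update R w e) us + (dot w us)\<^sup>2 + weighted_squares e us"
proof (induction R arbitrary: w e us)
  case Nil
  then show ?case by simp
next
  case (Cons r R)
  obtain w0 w' e0 e' r0 r' where *: "w = w0 # w'" "e = e0 # e'" "r = r0 # r'"
    using Cons.prems by (cases w; cases e; cases r) auto
  have "quad R (tl us) = quad (schur_update R w' e') (tl us) + (dot w' (tl us))\<^sup>2
      + weighted_squares e' (tl us)"
    using Cons.prems * by (intro Cons.IH) auto
  moreover have "dot (map2 (\<lambda>x y. x - w0 * y) r' w') (tl us) = dot r' (tl us) - of_int w0 * dot w' (tl us)"
    using Cons.prems * by (intro dot_map2) auto
  ultimately show ?case
    by (simp add: *) (simp add: algebra_simps power2_eq_square)
qed

lemma error_bound:
  "of_int (sum_list (map abs e)) * u\<^sup>2 + 2 * u * dot e us + weighted_squares e us \<ge> 0"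
proof (induction e arbitrary: us)
  case Nil
  then show ?case by simp
next
  case (Cons a e)
  have "of_int \<bar>a\<bar> * u\<^sup>2 + 2 * u * (of_int a * v) + of_int \<bar>a\<bar> * v\<^sup>2 \<ge> (0::real)" for v
  proof (cases "a \<ge> 0")
    case True
    have "of_int \<bar>a\<bar> * u\<^sup>2 + 2 * u * (of_int a * v) + of_int \<bar>a\<bar> * v\<^sup>2 = of_int a * (u + v)\<^sup>2"
      using True by (simp add: power2_eq_square algebra_simps)
    then show ?thesis using True by simp
  next
    case False
    have "of_int \<bar>a\<bar> * u\<^sup>2 + 2 * u * (of_int a * v) + of_int \<bar>a\<bar> * v\<^sup>2 = of_int (- a) * (u - v)\<^sup>2"
      using False by (simp add: power2_eq_square algebra_simps)
    then show ?thesis using False by (simp add: mult_nonpos_nonneg)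
  qed
  from this[of "hd us"] Cons.IH[of "tl us"] show ?case
    by (simp add: algebra_simps)
qed

lemma quad_nonneg:
  assumes "triangular R" "gram_check R W"
  shows "quad R us \<ge> 0"
  using assms
proof (induction W arbitrary: R us)
  case Nil
  then show ?case by simp
next
  case (Cons w W)
  obtain r R' where R: "R = r # R'" using Cons.prems by (cases R) auto
  obtain r0 r' where r: "r = r0 # r'" using Cons.prems R by (cases r) auto
  obtain w0 w' where w: "w = w0 # w'" using Cons.prems R by (cases w) auto
  define e where "e = map2 (\<lambda>x y. x - w0 * y) r' w'"
  have len: "length r' = length R'" "length w' = length R'" "triangular R'"
    using Cons.prems R r w by auto
  have check: "sum_list (map abs e) \<le> r0 - w0 * w0" "gram_check (schur_update R' w' e) W"
    using Cons.prems R r w by (auto simp: e_def Let_def)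
  define u us' where "u = hd us" and "us' = tl us"
  have "quad (schur_update R' w' e) us' \<ge> 0"
    using check len by (intro Cons.IH) (auto simp: triangular_schur_update)
  moreover have "quad R' us' = quad (schur_update R' w' e) us' + (dot w' us')\<^sup>2 + weighted_squares e us'"
    using len by (intro quad_schur_update) (auto simp: e_def)
  moreover have "dot r' us' = of_int w0 * dot w' us' + dot e us'"
    using len by (simp add: e_def dot_map2)
  moreover have "of_int (sum_list (map abs e)) * u\<^sup>2 \<le> of_int (r0 - w0 * w0) * u\<^sup>2"
    using check(1) by (intro mult_right_mono) (auto simp only: of_int_le_iff zero_le_power2)
  moreover note error_bound[of e u us']
  moreover have "quad R us = of_int (r0 - w0 * w0) * u\<^sup>2 + (of_int w0 * u + dot w' us')\<^sup>2
      + 2 * u * dot e us' + weighted_squares e us' + quad (schur_update R' w' e) us'"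
    using calculation by (simp add: R r u_def us'_def power2_eq_square algebra_simps)
  ultimately show ?case
    using zero_le_power2[of "of_int w0 * u + dot w' us'"] by linarith
qed

lemma dot_sum: "dot as (map x [k..<k + length as]) = (\<Sum>j<length as. of_int (as ! j) * x (k + j))"
proof (induction as arbitrary: k)
  case (Cons a as)
  have "[k..<k + length (a # as)] = k # [Suc k..<Suc k + length as]"
    by (subst upt_conv_Cons) auto
  then show ?case
    using Cons.IH[of "Suc k"] by (simp add: sum.lessThan_Suc_shift del: upt_Suc sum.lessThan_Suc)
qed simp

lemma quad_sum:
  assumes "triangular R"
  shows "quad R (map x [k..<k + length R]) =
    (\<Sum>i<length R. \<Sum>j<length R. of_int (entry R i j) * x (k + i) * x (k + j))"
  using assms
proof (induction R arbitrary: k)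
  case (Cons r R)
  obtain r0 r' where r: "r = r0 # r'" using Cons.prems by (cases r) auto
  have len: "length r' = length R" using Cons.prems r by simp
  have e0: "entry (r # R) 0 0 = r0" "entry (r # R) 0 (Suc j) = r' ! j" "entry (r # R) (Suc j) 0 = r' ! j"
    "entry (r # R) (Suc i) (Suc j) = entry R i j" for i j
    by (auto simp: entry_def r)
  have "[k..<k + length (r # R)] = k # [Suc k..<Suc k + length R]"
    by (subst upt_conv_Cons) auto
  then have "quad (r # R) (map x [k..<k + length (r # R)]) =
     of_int r0 * (x k)\<^sup>2 + 2 * x k * dot r' (map x [Suc k..<Suc k + length r'])
      + quad R (map x [Suc k..<Suc k + length R])"
    by (simp add: r len)
  also have "\<dots> = of_int r0 * (x k)\<^sup>2 + 2 * x k * (\<Sum>j<length R. of_int (r' ! j) * x (Suc k + j))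
      + (\<Sum>i<length R. \<Sum>j<length R. of_int (entry R i j) * x (Suc k + i) * x (Suc k + j))"
    using Cons.prems Cons.IH[of "Suc k"] len dot_sum[of r' x "Suc k"] by simp
  also have "\<dots> = (\<Sum>i<length (r # R). \<Sum>j<length (r # R). of_int (entry (r # R) i j) * x (k + i) * x (k + j))"
    by (simp add: sum.lessThan_Suc_shift e0 sum.distrib power2_eq_square sum_distrib_left sum_distrib_right algebra_simps del: sum.lessThan_Suc)
  finally show ?case .
qed simp

text \<open>
  A symmetric matrix with a kernel vector \<open>z\<close> is positive semidefinite as soon as it is so on the
  vectors without component in the last direction, if that component of \<open>z\<close> is not zero.
\<close>

lemma psd_from_kernel:
  fixes q :: "nat \<Rightarrow> nat \<Rightarrow> real"
  assumes sym: "\<And>i j. q i j = q j i"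
    and ker: "\<And>i. i < Suc n \<Longrightarrow> (\<Sum>j<Suc n. q i j * z j) = 0"
    and z: "z n \<noteq> 0"
    and psd: "\<And>y. (\<Sum>i<n. \<Sum>j<n. q i j * y i * y j) \<ge> 0"
  shows "(\<Sum>i<Suc n. \<Sum>j<Suc n. q i j * x i * x j) \<ge> 0"
proof -
  define c where "c = x n / z n"
  define y where "y i = x i - c * z i" for i
  have yn: "y n = 0" using z by (simp add: y_def c_def)
  have "(\<Sum>j<Suc n. q i j * x i * x j) = (\<Sum>j<Suc n. q i j * x i * y j)" if "i < Suc n" for i
  proof -
    have "(\<Sum>j<Suc n. q i j * x i * x j) = (\<Sum>j<Suc n. q i j * x i * y j + c * x i * (q i j * z j))"
      by (intro sum.cong refl) (simp add: y_def algebra_simps)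
    also have "\<dots> = (\<Sum>j<Suc n. q i j * x i * y j) + c * x i * (\<Sum>j<Suc n. q i j * z j)"
      by (simp only: sum.distrib sum_distrib_left)
    finally show ?thesis using ker[OF that] by simp
  qed
  then have "(\<Sum>i<Suc n. \<Sum>j<Suc n. q i j * x i * x j) = (\<Sum>i<Suc n. \<Sum>j<Suc n. q i j * x i * y j)"
    by (rule sum.cong[OF refl]) (simp only: lessThan_iff)
  also have "\<dots> = (\<Sum>j<Suc n. \<Sum>i<Suc n. q i j * x i * y j)" by (rule sum.swap)
  also have "\<dots> = (\<Sum>j<Suc n. \<Sum>i<Suc n. q i j * y i * y j)"
  proof (rule sum.cong[OF refl])
    fix j assume "j \<in> {..<Suc n}"
    then have j: "j < Suc n" by simp
    have "(\<Sum>i<Suc n. q i j * x i * y j) = (\<Sum>i<Suc n. q i j * y i * y j + c * y j * (q j i * z i))"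
      by (intro sum.cong refl) (simp add: y_def sym[of j] algebra_simps)
    also have "\<dots> = (\<Sum>i<Suc n. q i j * y i * y j) + c * y j * (\<Sum>i<Suc n. q j i * z i)"
      by (simp only: sum.distrib sum_distrib_left)
    finally show "(\<Sum>i<Suc n. q i j * x i * y j) = (\<Sum>i<Suc n. q i j * y i * y j)"
      using ker[OF j] by simp
  qed
  also have "\<dots> = (\<Sum>j<n. \<Sum>i<n. q i j * y i * y j)" using yn by simp
  also have "\<dots> = (\<Sum>i<n. \<Sum>j<n. q i j * y i * y j)" by (rule sum.swap)
  finally show ?thesis using psd[of y] by simp
qed

lemma triangular_nth: "triangular R \<Longrightarrow> i < length R \<Longrightarrow> length (R ! i) = length R - i"
  by (induction R arbitrary: i) (auto simp: nth_Cons split: nat.splits)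

lemma triangular_butlast: "triangular R \<Longrightarrow> triangular (map butlast (butlast R))"
  by (induction R) auto

text \<open>The factor \<open>c\<close> only serves to make the integers in \<open>W\<close> more precise.\<close>

lemma form_nonneg:
  assumes tri: "triangular Q" and len: "length Q = Suc n" "length z = Suc n" and z: "z ! n \<noteq> 0"
    and ker: "list_all (\<lambda>i. sum_list (map2 (*) (map (entry Q i) [0..<Suc n]) z) = 0) [0..<Suc n]"
    and gram: "gram_check (map (map ((*) c)) (map butlast (butlast Q))) W" and c: "c > 0"
  shows "(\<Sum>i<Suc n. \<Sum>j<Suc n. of_int (entry Q i j) * x i * x j) \<ge> (0::real)"
proof (rule psd_from_kernel[where z = "\<lambda>j. of_int (z ! j)"])
  show "real_of_int (entry Q i j) = real_of_int (entry Q j i)" for i j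
    by (simp add: entry_sym)
  show "(\<Sum>j<Suc n. real_of_int (entry Q i j) * real_of_int (z ! j)) = 0" if "i < Suc n" for i
  proof -
    have "sum_list (map2 (*) (map (entry Q i) [0..<Suc n]) z) = 0"
      using ker that by (simp add: list_all_iff del: upt_Suc)
    moreover have "sum_list (map2 (*) (map (entry Q i) [0..<Suc n]) z) = (\<Sum>j<Suc n. entry Q i j * z ! j)"
      using len by (simp add: sum_list_sum_nth atLeast0LessThan del: upt_Suc sum.lessThan_Suc)
    ultimately have "real_of_int (\<Sum>j<Suc n. entry Q i j * z ! j) = 0" by simp
    then show ?thesis by simp
  qed
  show "real_of_int (z ! n) \<noteq> 0" using z by simp
  fix y :: "nat \<Rightarrow> real"
  define R where "R = map butlast (butlast Q)"
  have R: "triangular R" "length R = n" using tri len by (auto simp: R_def triangular_butlast)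
  have ent: "entry R i j = entry Q i j" if "i < n" "j < n" for i j
  proof -
    have "R ! i ! k = Q ! i ! k" if "i < n" "k < n - i" for i k
    proof -
      have "length (butlast (Q ! i)) = n - i"
        using tri len that triangular_nth[of Q i] by simp
      then show ?thesis using that len by (simp add: R_def nth_butlast)
    qed
    then show ?thesis using that by (auto simp: entry_def)
  qed
  have tc: "triangular (map (map ((*) c)) R)" using R(1) by (induction R) auto
  have entc: "entry (map (map ((*) c)) R) i j = c * entry R i j" if "i < n" "j < n" for i j
    using that R triangular_nth[OF R(1)] by (auto simp: entry_def)
  have "0 \<le> quad (map (map ((*) c)) R) (map y [0..<0 + length (map (map ((*) c)) R)])"
    using gram tc unfolding R_def by (intro quad_nonneg) auto
  also have "\<dots> = (\<Sum>i<n. \<Sum>j<n. of_int c * (of_int (entry Q i j) * y i * y j))"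
    using R by (subst quad_sum[OF tc]) (auto intro!: sum.cong simp: entc ent)
  also have "\<dots> = of_int c * (\<Sum>i<n. \<Sum>j<n. of_int (entry Q i j) * y i * y j)"
    by (simp add: sum_distrib_left)
  finally show "0 \<le> (\<Sum>i<n. \<Sum>j<n. of_int (entry Q i j) * y i * y j)"
    using c by (simp add: zero_le_mult_iff)
qed

section \<open>The certificate\<close>

text \<open>
  The numbers of the flags with one root \<open>r\<close> and further vertices \<open>x, y, z\<close>, indexed by the
  adjacencies of the pairs \<open>rx, ry, rz, xy, xz, yz\<close>. Equal numbers stand for isomorphic flags.
\<close>

definition classes_1 :: "nat list" where
  "classes_1 =
   [0,3,3,9,3,9,9,15,1,4,4,10,7,11,11,16,1,4,7,11,4,10,11,16,2,5,8,12,8,12,13,17,1,7,4,11,4,11,10,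
   16,2,8,5,12,8,13,12,17,2,8,8,13,5,12,12,17,6,19,19,14,19,14,14,18]"

definition form_1 :: "int list list" where
  "form_1 =
   [[707484,267348,-583656,-2098560,29184,1254036,1006644,592500,1086240,-1745232,585600,-165576,
   727044,-2133516,-616008,-15804,-23880,-329820,-352980,-557568],[4011048,3793236,-2807652,
   -662592,-1011828,88884,-1907280,1185924,-816228,214824,-1525296,2078520,-2420028,-2662284,
   5763564,5502132,-420108,-884520,977556],[4935420,-184236,-791580,-2842308,-945432,-2293284,
   610188,282852,177000,-1032900,811896,-227580,-2013192,6159528,5058180,-858396,-153792,1206708],
   [7720224,21804,-3174780,-2773812,-318468,-3346656,4613664,-1314876,1380852,-3580020,7164488,
   3234636,-3479148,-2691118,497828,1667124,707502],[336948,262800,154380,321720,11448,57300,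
   -224544,126420,-371616,23328,60564,-510768,-694296,724272,70944,-250656],[3356232,1549068,
   1263732,556452,-1648752,482136,74376,1728720,-2591874,288276,-2588040,-2281770,-354840,-796248,
   -842310],[1710900,1392624,2244000,-3413988,1216080,12540,198576,-3360192,-1029672,-111168,
   -441852,-518880,-152532,-1314312],[2416608,1733748,-3120852,1356816,988116,-1584972,-1537788,
   482940,-2983140,-3158508,-763380,670392,-1986888],[4224120,-5775576,2342760,54156,-587100,
   -4932420,-2270712,2148624,579780,-1366860,281376,-2062128],[8494086,-3596364,-422064,827520,
   6919596,2398704,-970848,616320,2546546,-434844,3235954],[1956612,573060,-341568,-2410320,
   -449580,147636,-1297308,-2198784,405300,-1476636],[968904,-1078956,845220,1167936,-2006748,
   -2915292,-871848,652752,-775212],[3988608,-1812096,-761244,2162124,1730004,-605088,-1579848,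
   1202280],[7925156,3483456,-3132324,-2068052,1199818,884178,1911930],[2880684,-4379184,-4143300,
   -607212,539976,92520],[10220688,7704900,189396,-876204,1317024],[10563276,2259642,-1296918,
   2242422],[3953136,-354192,978232],[777600,-512106],[4755064]]"

text \<open>
  The densities of the flags in the balanced blowup of \<open>B27\<close>, multiplied by \<open>512\<close>. Since the upper
  bound is attained there, they form a kernel vector of the quadratic form.
\<close>

definition kernel_1 :: "int list" where
  "kernel_1 =
   [12,60,24,60,48,87,0,111,0,24,0,0,12,6,6,29,6,6,15,6]"

text \<open>
  Rounded rows of a Cholesky factor of \<open>64\<close> times the form without its last row and column.
\<close>

definition gram_1 :: "int list list" where
  "gram_1 =
   [[6722,2545,-5557,-19980,278,11940,9584,5641,10342,-16616,5575,-1576,6922,-20313,-5865,-150,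
   -227,-3140,-3361],[15816,16244,-8146,-2726,-6016,-1183,-8626,3135,-629,-28,-5919,7297,-6524,
   -9829,23347,22301,-1195,-3038],[4586,2072,-1054,-3889,2610,5385,9943,-13959,9325,4641,-6129,
   -4681,-387,3081,-8678,-11551,4542],[4914,-2660,-1134,-220,2218,-533,-2628,1564,-193,-3801,1878,
   2151,-8519,4656,-3394,1096],[2405,-4164,2560,2945,6431,-6292,-835,-1342,-9308,-4400,-6642,4816,
   8174,9466,2036],[1484,-1246,-1785,-2808,3790,-887,142,3358,2030,1768,-682,-2421,-1187,-1160],
   [1088,1406,2000,-3039,1290,332,-1679,-1532,-576,-1059,10,-771,538],[766,703,-1127,684,323,-443,
   -433,62,-380,-652,-827,-70],[763,-593,395,276,-216,-309,-97,254,-812,-396,442],[689,-348,-132,1,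
   171,-142,101,320,642,-407],[869,601,705,110,697,586,-2249,-1654,267],[574,220,86,233,357,-1089,
   -495,60],[698,-18,201,413,-484,-493,-86],[586,105,-30,-342,30,-42],[540,-145,-259,-365,150],
   [1093,-368,27,-509],[962,247,-264],[628,63],[854]]"

text \<open>
  The flags with three independent roots \<open>a, b, c\<close> and further vertices \<open>x, y\<close>, indexed by the pairs
  \<open>ax, bx, cx, ay, by, cy, xy\<close>. The form is invariant under permutations of the roots, hence flags
  that differ by such a permutation share a number. The table for the induced path with middle
  vertex \<open>a\<close> and ends \<open>b, c\<close> is organised in the same way; its only symmetry exchanges the ends.
\<close>

definition classes_E :: "nat list" where
  "classes_E =
   [0,25,1,13,1,13,2,14,1,13,2,14,2,14,3,15,1,13,4,16,5,17,6,18,5,17,6,18,7,19,8,20,1,13,5,17,4,16,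
   6,18,5,17,7,19,6,18,8,20,2,14,6,18,6,18,9,21,7,19,10,22,10,22,11,23,1,13,5,17,5,17,7,19,4,16,6,
   18,6,18,8,20,2,14,6,18,7,19,10,22,6,18,9,21,10,22,11,23,2,14,7,19,6,18,10,22,6,18,10,22,9,21,11,
   23,3,15,8,20,8,20,11,23,8,20,11,23,11,23,12,24]"

definition form_E :: "int list list" where
  "form_E =
   [[46140,166728,133512,-228936,-172020,17412,125316,573528,5964,-771420,-4644,-175740,114672,
   -359580,87876,-85224,-333312,-146760,-242520,-168636,-16308,-107352,967104,28080,137820,
   -180648],[1413960,-222912,-967872,1273548,1922316,1199988,1177908,-41148,31800,-1816908,681084,
   733752,-2305416,-407808,-465852,-1574124,1154040,-3139044,-1414104,15564,-822012,2223288,504168,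
   747492,-1104972],[5621952,-165804,-6192228,-1205964,-737340,3962928,-4355940,-4240596,-2398332,
   -9225168,-1182312,-1696776,-486972,874884,-716832,21588,-307596,4675212,135864,-7796880,6842532,
   -243984,-77244,336792],[1781904,-314244,25896,-1040244,-2917932,-769536,3566472,-1761612,
   -527832,-1250316,2224284,-405564,801900,1845696,2400588,1096296,1582716,-679920,-395964,
   -4718124,466092,-981492,1131792],[11976972,3169248,2302560,-5790120,5246952,10522956,2650788,
   11602296,1889700,-1330368,-1397496,-1149072,615768,-603000,-1937075,-6676716,313788,6762426,
   -9824724,-209712,422388,-1008956],[5080812,1527672,-2450952,-1406052,7445280,-6317088,1946124,
   402924,-1915608,-1943544,-117924,-742044,5843208,-6210024,-660576,232620,-2402302,-3380064,
   1319604,457092,-833416],[1246800,613188,686148,718200,-300828,1825452,964020,-2094408,-407940,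
   -588564,-1240776,-34992,-2366088,-1878132,321144,214368,1111596,82764,719496,-993168],[9724980,
   -668304,-14816856,1827816,-6063480,846264,-4114032,1945956,-738924,-4162104,-4258860,-379188,
   -382032,-403752,-2627556,16124928,-193908,1504860,-1887960],[5517720,-1695144,6259620,7719696,
   1437276,496404,1473588,-1136328,-126924,-4324104,2675532,-5525700,-465192,8388480,-1699812,
   -512520,369240,-753108],[28042052,-7255704,7305504,-783756,2354988,-5398200,1097604,5110752,
   9157872,-5024088,1533816,1795692,-1991034,-24070860,411240,-1577016,1967972],[14246604,5666088,
   1871004,1428888,2628084,-1314756,543096,-12311724,8372388,-4016700,1282212,9322248,1511016,
   -3115236,307584,-16968],[15968088,2635644,1577016,514284,-1800864,780456,-1967700,293448,
   -8436000,523056,12893784,-10669020,-281772,506400,-952728],[1237368,-1201368,213876,-778344,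
   -1027740,-1778940,-823164,-2045076,722952,1895616,1232772,-420324,718476,-832044],[5507808,
   804900,718788,3128124,591492,4461180,1823904,-152340,3463884,-7157580,-154164,-1418304,1955700],
   [1553640,-314772,-473508,-2196072,2179836,-1053624,-498144,2812752,2976840,-100920,123828,
   -177948],[528240,739392,1197252,369324,1547040,-272664,-1575720,-1114824,182364,-466416,583704],
   [2734560,639048,2612016,1691304,116028,820464,-7089312,-352944,-1166364,1532304],[11802072,
   -6563412,2714952,-1405176,-5440392,-5794956,2995452,-694536,451752],[9001034,590988,-335856,
   5209284,-1606692,-1673652,-1207680,1697862],[7102428,747948,-7597020,-371028,-202152,-1063524,
   1850808],[1749072,-547260,-888768,-994848,276108,79020],[14636960,-5338332,-602448,125700,
   -448196],[26925984,50580,2508300,-3132600],[1121220,-49056,-212424],[602124,-743796],[3387936]]"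

definition kernel_E :: "int list" where
  "kernel_E =
   [0,6,4,0,2,14,0,12,0,2,0,0,0,4,0,0,9,0,8,0,0,2,0,0,0,1]"

definition gram_E :: "int list list" where
  "gram_E =
   [[1688,6321,5062,-8680,-6522,660,4751,21745,226,-29248,-176,-6663,4348,-13633,3332,-3231,-12637,
   -5564,-9195,-6394,-618,-4070,36667,1065,5225],[7101,-6515,-997,17284,16738,6586,-8740,-572,
   26322,-16219,12070,2743,-8643,-6641,-1323,-2938,15354,-20107,-7053,690,-3786,-12601,3596,2086],
   [17077,1571,-14680,1670,-1659,5072,-16610,2819,-15124,-27994,-4673,-5615,-5346,3732,-61,7588,
   -6098,16726,956,-29459,9968,142,-1042],[5926,-6147,3620,-2728,-2478,-3673,-642,-18002,-6008,
   -5434,4088,800,2716,945,18348,-3395,2107,-8386,-3065,-2010,7161,-2320],[13109,-2700,1785,-1408,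
   6160,4974,8861,3249,-9,-6253,-2021,-20,968,-8855,4058,-6760,-2547,1555,-2889,-1718,-343],[4612,
   404,-6120,-4964,14369,-3980,909,966,1900,-3221,133,2021,3825,-4638,5677,5557,-5031,-10143,-1569,
   22],[436,311,94,-443,-17,-15,55,-271,49,-50,-205,-54,-155,-234,-102,32,541,58,71],[1286,563,
   -2361,-562,-345,-229,-677,442,5,-634,431,-128,-1066,-1202,357,2091,658,71],[591,-505,42,198,-53,
   24,180,-3,-75,38,202,-392,-338,488,206,160,-17],[832,339,97,138,37,-181,-36,137,-355,-24,284,
   450,-89,-493,-286,15],[990,279,256,112,14,-115,35,-802,267,121,513,199,-73,-368,78],[610,130,
   163,79,-69,-52,27,-42,-71,158,315,-131,-13,62],[430,-32,-13,-46,-54,-80,-108,35,160,-38,65,-63,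
   54],[547,64,14,89,74,76,111,47,85,-207,7,-24],[389,1,1,32,30,-23,-27,102,-10,22,-3],[392,25,26,
   44,-5,-59,1,-28,22,-23],[400,-16,148,31,-31,-7,-89,-4,-29],[524,-53,-39,-110,39,-36,101,-15],
   [468,-13,-86,116,-117,10,-49],[477,138,-153,-28,-56,11],[475,-51,-5,-68,39],[462,5,36,13],[467,
   -1,17],[401,-10],[378]]"

definition classes_P :: "nat list" where
  "classes_P =
   [0,24,2,26,2,26,4,28,1,25,3,27,3,27,5,29,2,26,11,35,13,37,15,39,7,31,12,36,14,38,16,40,2,26,13,
   37,11,35,15,39,7,31,14,38,12,36,16,40,4,28,15,39,15,39,21,47,9,33,19,43,19,43,22,45,1,25,7,31,7,
   31,9,33,6,30,8,32,8,32,10,34,3,27,12,36,14,38,19,43,8,32,17,41,18,42,20,44,3,27,14,38,12,36,19,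
   43,8,32,18,42,17,41,20,44,5,29,16,40,16,40,22,45,10,34,20,44,20,44,23,46]"

definition form_P :: "int list list" where
  "form_P =
   [[11988696,1099620,-369324,2621556,-199512,-3750479,-660252,2656944,-961476,-4930140,-2172996,
   -5316348,-1855032,1775796,6357372,-2424120,1011156,-2628816,4781910,-2920632,-4094088,-5694216,
   5810100,4540548,-8548824,5157120,-8644656,-12207672,-484644,55068,-3033636,4668240,-87960,
   -185028,-3032040,-903552,5536752,-19272312,8514384,-952788,1338228,2966568,4932600,-980820,
   2581584,894696,-1632,10767556],[2010864,1232232,-1133148,-6160188,2296836,83016,-461244,-486744,
   904380,2920740,1892604,-386724,-2441064,-2145360,-559932,87216,-1306896,-361068,-1333980,
   -675348,678684,1791000,2775012,3134160,-98016,672972,-900732,-53748,183888,239472,2025876,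
   1493412,-518448,-476892,-36420,2398608,-7310112,2830776,-1296072,607476,326688,5551500,-248736,
   1190820,-1564548,143928,-396720],[3456276,-1173216,-3980052,1071324,32112,-4578864,-840900,
   -4450032,247440,5683476,1201992,-2212512,-3015192,-1646544,971580,-1306668,-1381932,-2748156,
   -2790612,975120,727380,-2109240,4122300,5020584,222384,2197632,460236,2268060,3057636,3561252,
   3018528,-101388,260208,1108248,2094192,-4432140,-2706840,-1958124,-1563408,-16380,6748572,
   -441732,-136920,884388,209820,-2502372],[4044828,2554308,-223848,169836,1157880,802572,-4877280,
   -4159692,-311472,1692108,5286540,4344672,1504200,2110140,2215344,2570460,4538232,2119476,
   -1201284,1768536,-472860,-7866372,1699188,-8009124,-8300148,-789168,-2748156,1659288,-1005984,
   -1716240,-954732,-482112,-2327448,-2433360,-922296,-92316,-2521656,-1820424,1751328,-2599608,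
   -3827100,-284064,1527876,-1195500,6008820],[23472884,-13470756,-599772,-1887744,-556224,-716292,
   -6904944,-10681548,-1075536,7156668,6663108,1227156,-1137648,4009296,653448,-549432,176316,
   -3347892,-6846012,-8963724,-9932832,2289036,-1457556,3830676,-4131912,-103932,-3334920,-1326924,
   -4945380,1655400,290976,2937960,-1807620,17792268,-5948904,5194716,434280,-7944,-16314336,
   3645348,-2884380,5756964,1329408,7133816],[12737844,503664,5516916,2327136,275796,3567960,
   5346300,2976024,-2052156,-2419296,-704772,1309980,-1047768,-257088,4877784,2739684,1531272,
   2381196,4926708,3941400,-3540468,537696,-839388,5989344,-708696,1957500,-4726200,1858788,57468,
   815736,-4430136,-5926452,-2870880,-905580,-3899052,-2190276,-1058760,3597204,-4327464,840060,
   -3836424,-2246940,-8784160],[160752,-484560,140988,-257928,-215100,1055364,359796,259848,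
   -470808,722796,249384,536844,-246504,749256,904908,938196,-14088,-55356,278856,-828,-277416,
   -149064,-561588,-475284,859536,-123780,-202824,-482988,181932,-163104,-282360,181452,-183684,
   -633168,-113496,67548,294276,-463068,-129288,-140544,-112896,214632],[15417312,3025356,5306004,
   -1637748,-8415420,-1610460,54192,6541416,-2462652,-2329728,-4345296,4129224,3334464,-711600,
   -4917000,2914176,6028644,-5771208,-8121192,882192,-5534832,8244072,-1384392,-6034128,-8650536,
   -1290828,2192892,-267000,-4729680,-6400680,1802076,5216388,5452596,2818944,-1106796,-6205764,
   -236664,1667484,-3241500,-1793700,-4735524],[1780944,-2220468,-3361308,712440,1351116,755508,
   1303608,755424,-163104,871476,96552,1578108,762648,956928,405516,435288,-1466280,1217160,
   -276132,159132,2066904,-412236,345864,-3140928,-1051332,-461928,65904,-1698492,-3450324,704244,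
   -2041716,639720,464880,-345948,-1792692,-1044108,121500,40776,-564132,-1624860],[30040620,
   16695024,-7660680,-7344432,-5666136,-5350764,1270020,-6266748,-301020,-1055208,2710356,958776,
   -1698324,-2620068,5026572,7739532,-29793972,14098536,793620,798144,-6053856,-9332748,-5074404,
   1285836,2742696,-90936,1513572,762384,25357680,7786788,10794396,3455484,-1471236,-10099752,
   4754820,1262412,-5598336,1996224,-7365504],[23946744,-7740372,-2856168,-3913728,-6229596,
   -686520,1035288,2525964,-1696020,6456,7094616,-2725116,-4055244,11313264,8501208,-13066476,
   5381952,6146700,-3242700,1360716,-7973976,2299644,-801408,2733708,-1374516,1673532,4988844,
   -4830000,7925244,-7934928,-3227916,-935256,-1986708,2131500,1108344,-6102084,651840,-309744],
   [25083960,3082500,-3400140,-7603440,3730992,980844,761004,-1808772,4051584,-2562300,8399268,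
   5950212,-6046056,8109708,-223140,219408,-4035588,2831028,-1283376,12663636,-624948,5542284,
   -3635208,2027076,-199524,-1210584,10506408,-6881400,472080,-4451484,-157548,10741992,-4507020,
   -2054928,1893924,-780492,-9325068],[4297560,2476884,-8916,647004,1794072,3514476,-1610016,
   1204488,733128,1846644,-885300,-2389812,-1542288,7561044,-3404040,1166472,250716,-835416,
   2930856,90972,-13764,-1076712,-328164,-1693152,-3745260,-2891100,-7412244,-3116952,-1339848,
   851148,375660,-3551364,219816,1983996,-327888,592368],[8358456,5665368,2699712,3236628,4738068,
   2459856,5988600,5394936,-1314252,-747240,-1253748,-10608552,3089232,-10175616,-7143600,-3466500,
   -3140184,1398612,-1076340,-4081560,-1008948,-347352,-2198352,-3358992,328392,-1260732,-5028768,
   -2717544,1980852,-6727068,-4139736,-1114476,2212956,-1340244,9748860],[9140616,-1073940,1296852,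
   -880404,4973496,2431116,473124,-5349660,2001264,1363644,-12001092,2928132,-8284812,-8328816,
   1531212,-223872,-2475756,-2465172,-3247728,837408,-838704,-2584152,-2421552,-4495080,3170616,
   -562404,-374292,1048428,-5513148,-1507980,-37908,1339404,-1537080,6792624],[6686076,846576,
   6822744,-425676,5387784,7154184,4731888,-225108,2306580,-1113300,-3582288,-1817856,-2016216,
   -4421868,-3171564,1726512,-2599476,-4258224,-2932932,-311232,-416712,-913956,4549116,683844,
   -2587356,-1025676,562260,-4433784,-1531440,-891048,-233400,-49992,4726800],[4341132,1239576,
   1635600,3033216,5997300,-227700,214344,2728668,-2549112,4403892,-6906036,-1801716,-2593716,
   2213448,2479920,1171668,-2460552,-484116,513312,-757788,597276,-9151188,2426652,-9864456,
   -4604880,153732,1479732,-2298348,-1549800,-647784,-1858080,4647144],[13630896,-2665800,4096992,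
   6256620,3533436,-3008904,1871988,-3323568,867372,-3111780,860568,-4623288,-4427028,-1441488,
   -1532808,-4837956,-2550720,-3063492,-890940,-2925468,3327252,-7367592,-3361848,-1907796,2087652,
   -9389076,-3419772,755184,2656824,1422816,7669992],[5080768,3885192,1872552,-3849252,3793080,
   3514332,-6194304,-3802044,-5989944,-9257532,1443576,422076,-526356,-2084172,-1504152,702744,
   220224,-1661916,224544,-2079276,7427952,-2274516,-2518788,175368,-1211964,-1138092,-919476,
   -1080192,-2017260,3054868],[13937964,10063848,754836,2110584,2994636,-6011124,-12575628,
   -7034280,-10996584,344316,-4948248,3168408,-8067936,-3580740,-976032,1534140,-4148196,-6664500,
   14049864,2943708,-5079432,-6165036,54684,-8381904,-5624076,-2702160,-1907340,-3284928,1066440],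
   [20598108,3391848,-3462288,11114184,-1520292,-4254372,-5631600,2808804,-7655556,2625648,593472,
   -4708524,-10558680,-1530132,1876560,-1076328,-870168,-6002112,9387180,-17465520,-6652428,
   -2069352,-7278888,-841176,-3933708,-5510352,-3352536,7150488],[8187240,-1199784,-1623240,
   5963424,2629536,3269292,5322084,-3532560,-1213968,5143476,-87636,-872376,-3426672,1040148,
   809220,-383292,1585008,-3567552,-940968,1456260,-424332,3218880,-256644,-569484,-256140,623508,
   -1402980],[7866756,2704212,-2920332,-2493300,-4810284,-12905652,3418032,-1910868,2057904,
   -312792,2400648,-1166604,-917808,-2275380,1231044,-5238132,5509536,1516884,-400704,1521708,
   6328476,-2961312,1236096,-363444,-1042308,805620],[19112112,20160,-5861352,-2399880,-1877700,
   -1218756,3734232,-6863328,-2786676,-6752820,-102048,-2073096,-1958976,3657420,-21553032,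
   15719340,-11319792,-2391060,-1041480,-428592,773172,1165488,-7147824,-1839696,5188704],
   [18899664,-3614052,14977332,16137336,626052,4677636,1609176,2108100,4360476,458172,2163588,
   4174320,3977232,3352968,-1451052,1362396,1228620,-3572750,8744064,5228904,-458940,-3615612,
   1572480,-14084828],[40398696,-8800644,10781016,-4916088,7842576,5435292,11696388,-1065900,
   -2765928,-1570080,1312308,3354600,-38968344,-10910052,-9638016,2684832,2018256,13455588,-918876,
   1540260,6237132,996888,10636344],[19801704,17312196,4018620,2281632,-4141080,-2647824,3522084,
   2127960,1383492,3834096,99288,16764732,-4299396,12056376,5636148,-3964056,-1349592,7813524,
   502740,-2151924,2894868,-16275852],[35010408,-1582980,11590080,-3106644,665868,-2495412,2356284,
   2395776,5974500,502968,-492228,-10032852,-2340828,1972344,-6055212,-2175348,9742428,-2110608,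
   -1297596,2193180,-12228948],[11760348,738852,-1521600,-6252744,4466352,2800464,246840,-2780484,
   -6153852,10180812,-4411956,8006520,-380760,-1581912,-1195176,-800256,698604,219276,-871872,
   -13087728],[11100720,-799536,1076424,-2197008,2128608,1685508,2636316,3724044,-12145152,3617508,
   -7473720,-3148452,-3667332,3524784,4936308,-2538120,-1910040,-1243200,-3917688],[10654836,
   1671108,2431296,-2628036,2806452,-224748,-987168,2481564,-3673128,-3205164,-2504484,313704,
   7842576,-3507264,-2367864,1500192,-1444296,-1450512],[11790588,3162756,-1054308,-1391328,
   3243792,8651736,-18086700,648144,-3118944,2086488,2587464,11387820,640908,1863360,1907880,
   2022360,8130144],[8123160,886824,167028,360924,339516,5938092,-4911144,7708176,1827300,916692,
   7397304,-971040,1605312,1708356,1170504,-7155264],[2555280,477636,365160,-616464,3859872,138564,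
   1138860,-1051296,-1201824,-2446692,1577208,-510048,-468168,-277008,-3845448],[2570520,508656,
   -923784,5368872,770844,-1066104,-1240464,-1697364,589740,932496,-2186976,-1129332,-1174704,
   -3992280],[3440844,4248708,810720,331992,644604,632280,-805272,1513272,3620148,-833808,427524,
   1247268,-208548],[11445684,-16562484,9645876,-3665928,1165056,670680,9343860,3975456,623844,
   -1276308,1360956,6921852],[91737804,-18989136,27732468,-2959608,-3517932,-28122804,715164,
   -6188844,4873248,1066692,-25262028],[26901708,-9109200,-1042668,-1026624,5150352,3418776,
   -821316,-8471604,-2763060,8219508],[25718424,9593940,859392,-4095132,2727228,3220152,4283856,
   3905148,-10454604],[8950992,1120980,2567688,2480184,3393132,554148,2562612,619548],[2532564,
   1268544,-2521968,1708680,1745448,758460,5554524],[25884324,-593760,2171412,-1450068,102864,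
   -511968],[6664092,-830520,-1452960,1100160,-3324744],[3039756,434952,1356156,1836828],[5051652,
   1363596,2103036],[1825888,556088],[29574896]]"

definition kernel_P :: "int list" where
  "kernel_P =
   [4,0,0,16,8,8,0,0,0,0,0,0,0,0,0,0,0,0,2,0,0,0,2,0,12,0,0,0,0,0,0,0,0,0,0,0,0,0,0,0,0,2,0,4,4,0,
   1,1]"

definition gram_P :: "int list list" where
  "gram_P =
   [[83093,7623,-2560,18173,-1383,-25998,-4577,18418,-6665,-34176,-15063,-36853,-12859,12310,44069,
   -16804,7009,-18223,33148,-20246,-28380,-39472,40276,31475,-59260,35749,-59925,-84623,-3360,382,
   -21029,32360,-610,-1283,-21018,-6263,38381,-133596,59022,-6605,9277,20564,34193,-6799,17896,
   6202,-11],[33152,21998,-23867,-106712,45884,2495,-12249,-6924,23572,54210,41357,-3762,-45243,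
   -47408,-5865,-96,-18516,-13895,-18522,-5208,20868,21857,40977,68081,-9923,25472,3809,-161,3107,
   8996,27758,26088,-8713,-3453,807,32849,-96290,35612,-21000,8421,948,88592,-2758,16575,-28609,
   2503],[38721,-2692,1327,-11850,-1242,-59937,-9016,-81848,-28113,58613,19168,-6395,-15006,-22272,
   14971,-10123,-10472,-31697,-40430,40,1066,-52575,18726,82685,-15125,24932,6716,31999,38983,
   39346,30041,3357,4443,15613,15028,-20060,-56596,-17635,-27427,577,52320,-5454,-10270,29819,
   1698],[37704,-27767,37310,6291,-3222,10447,-48960,-23979,43369,31035,45733,14051,25776,29866,
   30183,13748,65101,39875,13886,21517,-209,-47178,8350,-78427,-81822,-10059,-37916,43962,-10585,
   -7266,-19243,897,-30912,-33807,-12082,-11357,-49892,-28910,17484,3620,-57324,-3206,4371,-16553],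
   [36840,-50136,2464,-64574,-20804,21843,31440,-18019,-5495,16006,-20359,21797,4169,31482,-18048,
   -12792,18117,17085,-26036,-18536,3446,11703,-9823,5181,-73019,-22341,4857,51478,-8336,-14029,
   -5726,24177,42308,-14131,5837,-16826,10729,16551,3669,5742,1539,9595,15498],[22552,-3071,17341,
   -2430,6239,58264,-71089,15352,10390,9076,-31329,9458,4639,-8453,-13868,917,-33821,-30141,10258,
   -10613,26624,-7209,33243,7268,5893,-33998,12745,2968,20127,-8249,-8919,-16073,-53392,-25517,
   -28605,-5111,2908,-19295,-8018,11692,-2861,237],[2782,-2176,12530,-69055,-39791,-13632,16903,
   5649,7119,5145,9146,2241,-13150,-26912,22083,26744,-14649,8314,-540,104599,-7533,54762,-23217,
   25755,11457,12694,-25892,-14640,2106,816,3167,-123927,-5787,-34852,22197,-3761,28354,8668,2018,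
   -1466,-913],[17663,-10,3567,-47042,1722,-4092,-6791,3668,-26649,-20016,-53570,-1875,-15145,
   -59090,-3086,8337,-63063,-1307,2641,13526,-26884,16245,-26011,24239,12241,40669,1836,13480,
   -2560,-10299,46513,-15184,63469,36727,5459,37460,-1573,6173,7677,2310],[12093,-19444,-30625,
   12378,18708,-3646,-4664,10339,-19020,39968,-23895,-23390,-38466,18689,572,-15968,-4449,43535,
   14349,11224,10114,-24990,-9207,580,6316,-13491,-21564,-6593,-17706,-6332,-65815,46229,31066,
   13684,-6850,-10318,23165,24893,17780],[28408,4330,14224,2710,-4642,-7843,3706,-17501,24495,
   -8816,197,-37504,-2710,7722,-16856,-2726,-31358,12838,-25167,17283,-33367,-11674,-4535,19756,
   -881,-15036,-4646,-12720,65881,-39387,49723,8871,12091,-19228,-12440,14493,16896,12441],[11190,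
   -294,-2884,514,1684,4744,6938,4503,5879,7372,19770,-2226,-1,19608,996,-7946,-3578,5858,-1300,
   13487,-4868,-7427,-12046,2095,766,1192,3884,-8526,15519,-20438,-13934,-5434,-9065,3786,-6113,
   -6287,-4260],[11816,-4518,-1289,1200,5266,4021,-432,7846,10142,12172,-363,5858,11316,1421,
   -15192,-2065,-3664,3485,9761,1641,-10308,-6741,1049,2829,979,2187,10952,14080,-9493,-13079,
   -5320,-5750,2821,-7406,-4122,-4548],[3135,-111,-951,67,-2572,6150,-3449,-3005,-6740,304,-571,
   -2945,-1108,3445,1568,171,1942,-4882,-2734,1099,2504,-686,-3633,-1075,-2759,1899,-10637,6761,
   3245,2655,-2339,-2456,3771,3917,2813],[1889,396,605,902,-358,734,1749,2100,214,71,129,-1003,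
   -824,-1732,-1656,-1308,-475,1162,-4,-641,-283,665,-252,20,-87,1787,-1920,-668,132,116,-555,-653,
   -603,-628],[1455,-318,430,-706,811,663,471,-751,340,375,-458,-817,-604,-631,528,721,61,-513,
   -154,426,321,-82,-49,585,975,-743,-1025,-294,-344,43,-568,-251,-474],[2878,212,2821,-155,630,
   3041,1640,-22,3305,43,174,48,1112,-1341,426,-924,-1165,-2653,-1049,-702,-26,422,-2823,1350,
   -1650,50,-178,-1550,412,76,-566,113],[1741,-1498,912,1087,2382,-14,-28,876,202,-666,-772,147,
   -755,1439,939,-276,-866,167,1077,236,626,-854,2818,-2571,-1203,-750,584,500,-1133,-1134,-873],
   [2818,-537,-412,-827,-97,43,640,-416,435,256,293,746,-472,-1329,-445,-203,-85,-1181,-276,-602,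
   173,-2166,922,-5,422,-1610,-432,714,870,582],[1493,612,590,-392,436,768,-276,-899,-450,-659,307,
   502,-74,-505,-323,180,90,-63,121,233,1009,-639,-817,-190,-332,29,-374,-252,-318],[1672,717,-44,
   81,9,-313,-969,-417,-571,-28,-98,351,-456,-170,54,286,-129,-303,1241,387,-483,-573,-102,-448,
   -219,-356,-178,-275],[2488,600,-331,1382,529,269,157,1378,-763,1178,42,-404,-1245,-177,381,252,
   487,-1758,1625,-1675,-282,-607,-27,690,-477,-798,-312],[1507,-84,-179,143,446,36,-53,-737,-513,
   392,392,-57,-423,73,21,202,-859,243,78,752,171,676,-18,200,-140,108],[806,450,-238,-454,-269,
   -1013,183,-178,-92,-66,34,-108,-214,-113,236,-263,515,216,-37,159,197,-106,43,-1,-34],[1838,291,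
   71,366,841,314,881,-618,-472,-585,104,-165,87,189,-867,440,-416,-301,-335,-427,446,-80,-203,
   -43],[1383,-109,423,548,125,442,-25,-118,-41,68,104,177,171,132,171,-21,-105,-290,92,304,-188,
   -113,-16],[1785,-225,130,-375,-44,92,486,-43,-204,-105,-19,221,-1663,-10,-249,385,173,615,-46,
   196,17,68],[1434,613,401,329,-247,-395,-92,96,-6,53,-153,476,-204,319,4,-233,-340,244,-11,-8,
   40],[1612,455,687,-222,-434,-212,202,43,72,-167,262,-211,-170,-381,-338,-425,246,-179,-17,-69],
   [1527,297,-240,-453,63,253,-63,-90,-397,796,-554,156,-414,-153,-545,-31,-63,157,-36],[1465,-43,
   -155,-154,161,101,117,135,-2,267,-360,-420,-221,-104,217,-241,-67,-122],[1320,85,79,-46,197,20,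
   11,102,136,-139,-7,-35,306,-22,-97,-79,-79],[1338,138,-45,-28,69,269,-555,143,-83,130,125,407,
   -16,82,-6,49],[1252,60,7,-13,-50,216,-212,115,-17,43,112,-86,45,65,23],[1186,23,9,-42,215,-58,
   -60,-182,-46,-101,0,-61,21,-33],[1211,18,0,121,187,-91,-25,-75,103,53,-99,-93,-77],[1165,147,31,
   122,-18,-38,-22,38,86,-50,1,7],[1310,-388,372,-96,36,15,223,133,-17,-61,12],[1948,-338,244,-269,
   -73,-428,-37,-153,157,0],[1458,-128,48,-81,158,177,-114,-198,-89],[1393,341,58,1,55,130,53,96],
   [1299,45,124,23,105,-49,48],[1155,13,-59,52,43,37],[1320,-7,24,-59,-15],[1192,-43,-30,-6],[1145,
   9,70],[1183,31],[1138]]"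

text \<open>
  Automorphisms, written as lists of images, of the graphs on \<open>n\<close> vertices in the order in which
  the enumeration below produces them. They only serve to discard isomorphic extensions, and any
  selection of automorphisms is sound.
\<close>

definition symmetries_1 :: "nat list list list" where
  "symmetries_1 =
   [[]]"

definition symmetries_2 :: "nat list list list" where
  "symmetries_2 =
   [[[1,0]],[[1,0]]]"

definition symmetries_3 :: "nat list list list" where
  "symmetries_3 =
   [[[1,2,0],[0,2,1]],[[0,2,1]],[[1,0,2]],[[1,2,0],[0,2,1]]]"

definition symmetries_4 :: "nat list list list" where
  "symmetries_4 =
   [[[1,2,3,0],[0,2,3,1],[0,1,3,2]],[[1,0,3,2],[0,1,3,2]],[[0,2,1,3]],[[1,2,0,3],[0,2,1,3]],[[0,2,
   3,1],[0,1,3,2]],[[1,3,0,2],[0,2,1,3]],[[1,0,3,2]],[[0,2,1,3]],[[2,3,1,0],[0,1,3,2],[1,0,2,3]],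
   [[1,0,3,2],[0,1,3,2]],[[1,2,3,0],[0,2,3,1],[0,1,3,2]]]"

definition symmetries_5 :: "nat list list list" where
  "symmetries_5 =
   [[[1,2,3,4,0],[0,2,3,4,1],[0,1,3,4,2],[0,1,2,4,3]],[[1,2,0,4,3],[0,2,1,4,3],[0,1,2,4,3]],[[1,0,
   3,2,4],[0,1,3,2,4]],[[0,2,3,1,4],[0,1,3,2,4]],[[1,2,3,0,4],[0,2,3,1,4],[0,1,3,2,4]],[[1,0,3,4,
   2],[0,1,4,2,3],[0,1,3,2,4]],[[0,2,4,1,3],[0,1,3,2,4]],[[0,2,1,4,3]],[[0,1,3,2,4]],[[1,0,3,2,4],
   [0,1,3,2,4]],[[1,0,2,3,4]],[[1,0,3,2,4],[0,1,3,2,4]],[[0,3,4,2,1],[0,1,2,4,3],[0,2,1,3,4]],[[0,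
   2,1,4,3],[0,1,2,4,3]],[[1,0,2,4,3]],[[0,2,1,3,4]],[[0,2,1,3,4]],[[1,2,0,4,3],[0,2,1,4,3],[0,1,2,
   4,3]],[[1,2,0,4,3],[0,2,1,4,3],[0,1,2,4,3]],[[0,2,3,4,1],[0,1,3,4,2],[0,1,2,4,3]],[[0,2,3,1,4],
   [0,1,3,2,4]],[[1,0,3,2,4]],[[3,2,4,0,1],[0,4,1,3,2],[0,2,1,3,4]],[[0,2,1,3,4]],[[1,3,0,2,4],[0,
   2,1,3,4]],[[0,1,4,3,2]],[[1,3,0,4,2],[0,2,1,4,3],[3,1,4,0,2]],[[0,2,1,4,3]],[[1,0,3,2,4]],[[0,2,
   1,4,3],[0,1,2,4,3]],[[0,4,3,2,1],[0,1,3,2,4]],[[2,3,1,0,4],[0,1,3,2,4],[1,0,2,3,4]],[[1,0,3,4,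
   2],[0,1,4,2,3],[0,1,3,2,4]],[[1,2,3,4,0],[0,2,3,4,1],[0,1,3,4,2],[0,1,2,4,3]]]"

definition symmetries_6 :: "nat list list list" where
  "symmetries_6 =
   [[[1,2,3,4,5,0],[0,2,3,4,5,1],[0,1,3,4,5,2],[0,1,2,4,5,3],[0,1,2,3,5,4]],[[1,2,3,0,5,4],[0,2,3,
   1,5,4],[0,1,3,2,5,4],[0,1,2,3,5,4]],[[1,2,0,4,3,5],[0,2,1,4,3,5],[0,1,2,4,3,5]],[[1,0,3,4,2,5],
   [0,1,4,2,3,5],[0,1,3,2,4,5]],[[0,2,3,4,1,5],[0,1,3,4,2,5],[0,1,2,4,3,5]],[[1,2,3,4,0,5],[0,2,3,
   4,1,5],[0,1,3,4,2,5],[0,1,2,4,3,5]],[[1,2,0,4,5,3],[0,2,1,5,3,4],[0,1,2,4,5,3],[0,1,2,3,5,4]],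
   [[1,0,3,5,2,4],[0,1,4,2,5,3],[0,1,3,2,5,4]],[[1,0,3,2,5,4],[0,1,3,2,5,4]],[[1,0,2,4,3,5],[0,1,2,
   4,3,5]],[[0,2,1,4,3,5],[0,1,2,4,3,5]],[[0,2,1,3,4,5]],[[0,2,1,4,3,5],[0,1,2,4,3,5]],[[1,2,0,4,3,
   5],[0,2,1,4,3,5],[0,1,2,4,3,5]],[[1,2,0,3,4,5],[0,2,1,3,4,5]],[[1,2,0,4,3,5],[0,2,1,4,3,5],[0,1,
   2,4,3,5]],[[1,0,4,5,3,2],[0,1,3,2,5,4],[0,1,5,4,2,3]],[[1,0,3,2,5,4],[0,1,2,3,5,4],[0,1,3,2,4,
   5]],[[0,2,1,3,5,4]],[[0,1,3,2,4,5]],[[0,1,3,2,4,5]],[[2,3,1,0,5,4],[0,1,3,2,4,5],[1,0,2,3,4,5],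
   [2,3,0,1,5,4]],[[2,3,1,0,5,4],[0,1,3,2,4,5],[1,0,2,3,4,5],[2,3,0,1,5,4]],[[1,0,2,3,4,5]],[[1,0,
   2,3,4,5]],[[1,0,3,2,4,5],[0,1,3,2,4,5]],[[1,0,3,2,4,5],[0,1,3,2,4,5]],[[0,2,3,1,5,4],[0,1,3,2,5,
   4],[0,1,2,3,5,4]],[[0,2,3,1,5,4],[0,1,3,2,5,4],[0,1,2,3,5,4]],[[1,0,3,2,5,4],[0,1,3,2,4,5],[1,0,
   2,3,5,4]],[[1,0,3,2,5,4],[0,1,3,2,4,5],[1,0,2,3,5,4]],[[0,2,3,1,4,5],[0,1,3,2,4,5]],[[0,2,3,1,4,
   5],[0,1,3,2,4,5]],[[1,2,3,0,5,4],[0,2,3,1,5,4],[0,1,3,2,5,4],[0,1,2,3,5,4]],[[1,2,3,0,5,4],[0,2,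
   3,1,5,4],[0,1,3,2,5,4],[0,1,2,3,5,4]],[[1,0,3,4,5,2],[0,1,5,2,3,4],[0,1,4,2,3,5],[0,1,3,2,4,5]],
   [[0,1,3,4,2,5],[0,1,2,4,3,5]],[[1,0,2,4,3,5],[0,1,2,4,3,5]],[[1,0,3,4,2,5],[0,1,4,2,3,5],[0,1,3,
   2,4,5]],[[0,2,1,4,3,5]],[[0,4,3,5,1,2],[0,1,5,2,4,3],[0,1,3,2,4,5]],[[0,1,3,2,4,5]],[[0,2,4,1,3,
   5],[0,1,3,2,4,5]],[[1,2,5,0,3,4],[0,3,1,4,2,5],[0,2,1,4,3,5],[1,0,2,3,5,4]],[[1,0,3,2,5,4],[0,1,
   3,2,4,5],[1,0,2,3,5,4]],[[0,2,1,4,3,5]],[[0,4,3,2,1,5],[0,1,3,2,4,5]],[[0,1,3,2,4,5]],[[0,2,4,1,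
   3,5],[0,1,3,2,4,5]],[[0,1,2,5,4,3]],[[0,2,4,1,5,3],[0,1,3,2,5,4],[0,4,2,5,1,3]],[[0,1,3,2,5,4]],
   [[0,2,1,4,3,5]],[[1,2,0,5,3,4],[0,2,1,4,3,5],[1,0,2,3,5,4]],[[1,0,3,2,5,4]],[],[[0,2,1,4,3,5]],
   [],[[0,2,1,4,3,5]],[[0,1,3,2,5,4],[0,1,2,3,5,4]],[[1,0,3,2,5,4],[0,1,3,2,4,5],[1,0,2,3,5,4]],
   [[0,1,3,2,4,5]],[[0,1,3,2,4,5]],[[1,0,3,5,4,2],[0,1,5,2,4,3],[0,1,3,2,4,5]],[[1,0,3,2,4,5],[0,1,
   3,2,4,5]],[[2,5,0,4,3,1]],[],[[0,1,3,2,4,5]],[[0,1,3,2,4,5]],[[4,5,3,2,1,0],[0,1,3,2,5,4],[1,0,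
   2,3,5,4],[0,1,2,3,5,4]],[[1,0,3,2,5,4],[0,1,2,3,5,4],[0,1,3,2,4,5]],[[1,0,2,3,4,5]],[[1,0,2,3,4,
   5]],[[1,0,3,2,4,5],[0,1,3,2,4,5]],[[1,0,3,2,4,5],[0,1,3,2,4,5]],[],[[1,0,2,3,5,4],[0,1,2,3,5,
   4]],[[1,0,2,3,5,4],[0,1,2,3,5,4]],[[1,0,3,2,5,4],[0,1,3,2,5,4]],[[1,0,3,2,5,4],[0,1,3,2,5,4]],
   [[1,0,2,3,4,5]],[[1,0,2,3,4,5]],[[1,0,3,2,5,4],[0,1,2,3,5,4],[0,1,3,2,4,5]],[[1,0,3,2,5,4],[0,1,
   2,3,5,4],[0,1,3,2,4,5]],[[0,1,5,4,3,2],[0,1,2,4,3,5]],[[0,3,4,2,1,5],[0,1,2,4,3,5],[0,2,1,3,4,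
   5]],[[0,2,1,4,3,5],[0,1,2,4,3,5]],[[0,1,2,4,3,5]],[[0,3,4,2,1,5],[0,1,2,4,3,5],[0,2,1,3,4,5]],
   [[0,2,1,4,5,3],[0,1,2,5,3,4],[0,1,2,4,3,5]],[[0,2,1,4,3,5],[0,1,2,4,3,5]],[[0,1,2,5,4,3]],[[1,2,
   0,4,5,3],[0,2,1,3,5,4],[1,0,2,4,3,5]],[[1,0,2,4,3,5]],[[0,2,1,5,4,3],[0,1,2,5,4,3]],[[0,2,1,3,4,
   5]],[],[[3,4,5,0,2,1],[0,2,1,3,5,4],[0,1,2,3,5,4]],[[0,2,1,3,5,4],[0,1,2,3,5,4]],[[0,2,1,3,4,
   5]],[[0,2,1,3,4,5]],[[0,2,1,3,5,4],[0,1,2,3,5,4]],[[0,2,1,4,3,5],[0,1,2,4,3,5]],[[3,4,5,1,2,0],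
   [0,1,2,4,5,3],[2,0,1,3,5,4],[1,0,2,3,5,4]],[[1,2,0,3,5,4],[0,2,1,3,5,4],[0,1,2,3,5,4]],[[1,2,0,
   4,3,5],[0,2,1,4,3,5],[0,1,2,4,3,5]],[[1,2,0,4,5,3],[0,2,1,5,3,4],[0,1,2,4,5,3],[0,1,2,3,5,4]],
   [[0,2,3,4,5,1],[0,1,3,4,5,2],[0,1,2,4,5,3],[0,1,2,3,5,4]],[[0,2,3,4,1,5],[0,1,3,4,2,5],[0,1,2,4,
   3,5]],[[0,2,3,1,5,4],[0,1,3,2,5,4],[0,1,2,3,5,4]],[[1,0,3,2,5,4],[0,1,2,3,5,4]],[[0,2,1,3,5,4]],
   [[0,1,5,3,4,2]],[],[],[[3,5,1,4,2,0],[0,4,2,5,1,3],[1,0,3,2,4,5],[2,3,0,1,5,4]],[[2,3,0,1,5,4],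
   [1,0,3,2,4,5],[3,2,1,0,5,4]],[[0,4,2,5,1,3]],[],[[1,0,3,2,4,5]],[[1,0,3,2,4,5]],[[0,1,4,3,2,5]],
   [[3,2,4,0,5,1],[0,5,1,3,2,4],[0,4,1,3,2,5],[0,2,1,3,4,5]],[[0,2,4,3,1,5],[0,1,4,3,2,5]],[[1,3,0,
   4,5,2],[0,2,4,5,1,3],[1,0,5,2,3,4],[0,1,4,3,2,5]],[[1,3,0,2,5,4],[0,2,1,3,4,5],[1,0,3,2,5,4]],
   [[3,1,4,0,2,5],[0,1,4,3,2,5]],[[3,2,4,0,1,5],[0,4,1,3,2,5],[0,2,1,3,4,5]],[[0,2,1,3,5,4],[0,1,2,
   3,5,4]],[[0,2,1,3,5,4],[0,1,2,3,5,4]],[[1,0,3,2,5,4],[0,1,4,5,2,3]],[[1,0,3,2,5,4]],[[3,2,1,0,5,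
   4],[0,2,1,3,4,5],[3,1,2,0,5,4]],[[0,2,1,3,4,5]],[[0,2,1,3,4,5]],[[1,3,0,2,5,4],[0,2,1,3,5,4],[0,
   1,2,3,5,4]],[[1,3,0,2,5,4],[0,2,1,3,5,4],[0,1,2,3,5,4]],[[0,1,4,3,5,2],[0,1,2,3,5,4]],[[1,0,3,4,
   5,2],[0,1,2,5,4,3],[0,1,4,3,2,5],[1,0,3,2,5,4]],[[0,1,4,3,2,5]],[[1,0,3,2,4,5]],[[3,5,4,0,2,1],
   [0,5,2,3,4,1],[3,1,4,0,2,5]],[[0,2,1,4,3,5]],[[1,3,0,4,2,5],[0,2,1,4,3,5],[3,1,4,0,2,5]],[[0,2,
   1,4,3,5]],[[0,1,2,5,4,3]],[[1,3,0,5,2,4],[0,2,1,4,3,5],[3,1,5,0,4,2],[1,0,3,2,5,4]],[[1,0,3,2,5,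
   4]],[[0,2,1,4,3,5]],[[1,0,3,2,5,4],[0,1,2,3,5,4]],[[0,2,1,4,5,3],[0,1,2,5,3,4],[0,1,2,4,3,5]],
   [[0,4,3,2,5,1],[0,1,2,3,5,4],[0,1,3,2,4,5]],[[1,0,3,2,5,4],[0,1,3,2,4,5],[1,0,2,3,5,4]],[[2,3,0,
   4,5,1],[0,1,2,5,4,3],[0,4,2,3,1,5],[2,3,0,1,5,4]],[[0,4,3,2,1,5],[0,1,3,2,4,5]],[[2,3,4,5,1,0],
   [0,1,4,5,3,2],[0,1,3,2,5,4],[0,1,2,3,5,4],[1,0,2,3,4,5]],[[2,3,1,0,5,4],[0,1,3,2,5,4],[1,0,2,3,
   5,4],[0,1,2,3,5,4]],[[1,0,3,4,5,2],[0,1,5,2,3,4],[0,1,4,2,3,5],[0,1,3,2,4,5]],[[1,2,3,4,5,0],[0,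
   2,3,4,5,1],[0,1,3,4,5,2],[0,1,2,4,5,3],[0,1,2,3,5,4]]]"

text \<open>Which graphs on four vertices are paws, indexed by the pairs \<open>01, 02, 03, 12, 13, 23\<close>.\<close>

definition paw_table :: "int list" where
  "paw_table = [0,0,0,0,0,0,0,0,0,0,0,0,0,0,0,1,0,0,0,0,0,0,0,1,0,0,0,1,0,1,0,0,0,0,0,0,0,0,0,1,0,0,0,1,0,0,1,0,0,0,0,0,0,1,1,0,0,1,1,0,1,0,0,0]"

definition class_1 :: "bool list \<Rightarrow> nat" where "class_1 bs = lookup bs classes_1"
definition class_E :: "bool list \<Rightarrow> nat" where "class_E bs = lookup bs classes_E"
definition class_P :: "bool list \<Rightarrow> nat" where "class_P bs = lookup bs classes_P"
definition is_paw :: "bool list \<Rightarrow> int" where "is_paw bs = lookup bs paw_table"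
definition value_1 :: "nat \<Rightarrow> nat \<Rightarrow> int" where "value_1 = entry form_1"
definition value_E :: "nat \<Rightarrow> nat \<Rightarrow> int" where "value_E = entry form_E"
definition value_P :: "nat \<Rightarrow> nat \<Rightarrow> int" where "value_P = entry form_P"

lemma length_classes: "length classes_1 = 2 ^ Suc (Suc (Suc (Suc (Suc (Suc 0)))))"
    "length classes_E = 2 ^ Suc (Suc (Suc (Suc (Suc (Suc (Suc 0))))))"
    "length classes_P = 2 ^ Suc (Suc (Suc (Suc (Suc (Suc (Suc 0))))))"
    "length paw_table = 2 ^ Suc (Suc (Suc (Suc (Suc (Suc 0)))))"
  by code_simp+

text \<open>
  The tables are turned into one rewrite rule per entry, since the simplifier finds the matching
  rule faster than it evaluates the lookup.
\<close>

lemmas class_1_rules = lookup_bool_lists[OF length_classes(1), folded class_1_def,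
  unfolded classes_1_def bool_lists.simps list.map append.simps list_all2_Cons list_all2_Nil simp_thms]
lemmas class_E_rules = lookup_bool_lists[OF length_classes(2), folded class_E_def,
  unfolded classes_E_def bool_lists.simps list.map append.simps list_all2_Cons list_all2_Nil simp_thms]
lemmas class_P_rules = lookup_bool_lists[OF length_classes(3), folded class_P_def,
  unfolded classes_P_def bool_lists.simps list.map append.simps list_all2_Cons list_all2_Nil simp_thms]
lemmas is_paw_rules = lookup_bool_lists[OF length_classes(4), folded is_paw_def,
  unfolded paw_table_def bool_lists.simps list.map append.simps list_all2_Cons list_all2_Nil simp_thms]

primrec row_rule :: "(nat \<Rightarrow> nat \<Rightarrow> int) \<Rightarrow> nat \<Rightarrow> nat \<Rightarrow> int list \<Rightarrow> bool" where
  "row_rule f i j [] = True"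
| "row_rule f i j (v # vs) = ((f i j = v \<and> f j i = v) \<and> row_rule f i (j + 1) vs)"

primrec table_rule :: "(nat \<Rightarrow> nat \<Rightarrow> int) \<Rightarrow> nat \<Rightarrow> int list list \<Rightarrow> bool" where
  "table_rule f i [] = True"
| "table_rule f i (r # R) = (row_rule f i i r \<and> table_rule f (i + 1) R)"

lemma table_rule_entry: "table_rule (entry Q) 0 Q"
proof -
  have row: "row_rule (entry Q) i j (drop (j - i) (Q ! i))" if "i \<le> j" for i j
    using that
  proof (induction "length (Q ! i) - (j - i)" arbitrary: j)
    case (Suc n)
    then have lt: "j - i < length (Q ! i)" by simp
    have "row_rule (entry Q) i (j + 1) (drop (j + 1 - i) (Q ! i))"
      using Suc by (intro Suc.hyps) auto
    moreover have "drop (j - i) (Q ! i) = (Q ! i ! (j - i)) # drop (j + 1 - i) (Q ! i)"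
      using lt Suc.prems by (simp add: Cons_nth_drop_Suc Suc_diff_le)
    ultimately show ?case using Suc.prems by (auto simp: entry_def)
  qed simp
  have "table_rule (entry Q) i (drop i Q)" for i
  proof (induction "length Q - i" arbitrary: i)
    case (Suc n)
    then have "drop i Q = Q ! i # drop (i + 1) Q"
      by (simp add: Cons_nth_drop_Suc)
    then show ?case using Suc row[of i i] by auto
  qed simp
  from this[of 0] show ?thesis by simp
qed

lemmas value_1_rules = table_rule_entry[of form_1, folded value_1_def,
  unfolded form_1_def table_rule.simps row_rule.simps add_0 one_add_one numeral_plus_one add_num_simps simp_thms]
lemmas value_E_rules = table_rule_entry[of form_E, folded value_E_def,
  unfolded form_E_def table_rule.simps row_rule.simps add_0 one_add_one numeral_plus_one add_num_simps simp_thms]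
lemmas value_P_rules = table_rule_entry[of form_P, folded value_P_def,
  unfolded form_P_def table_rule.simps row_rule.simps add_0 one_add_one numeral_plus_one add_num_simps simp_thms]

section \<open>The quadratic terms of the calculation\<close>

text \<open>
  The value of a form at the flags spanned by two disjoint groups of vertices over the same roots.
  In the average over independent vertices these terms become the form at the vector of flag
  densities.
\<close>

definition root_term :: "('v \<Rightarrow> 'v \<Rightarrow> bool) \<Rightarrow> 'v \<Rightarrow> 'v \<Rightarrow> 'v \<Rightarrow> 'v \<Rightarrow> 'v \<Rightarrow> 'v \<Rightarrow> 'v \<Rightarrow> int" where
  "root_term e r x y z u v w =
     value_1 (class_1 [e r x, e r y, e r z, e x y, e x z, e y z])
             (class_1 [e r u, e r v, e r w, e u v, e u w, e v w])"

definition empty_term :: "('v \<Rightarrow> 'v \<Rightarrow> bool) \<Rightarrow> 'v \<Rightarrow> 'v \<Rightarrow> 'v \<Rightarrow> 'v \<Rightarrow> 'v \<Rightarrow> 'v \<Rightarrow> 'v \<Rightarrow> int" where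
  "empty_term e a b c x y u v =
     (if \<not> e a b \<and> \<not> e a c \<and> \<not> e b c
      then value_E (class_E [e a x, e b x, e c x, e a y, e b y, e c y, e x y])
                   (class_E [e a u, e b u, e c u, e a v, e b v, e c v, e u v])
      else 0)"

definition path_term :: "('v \<Rightarrow> 'v \<Rightarrow> bool) \<Rightarrow> 'v \<Rightarrow> 'v \<Rightarrow> 'v \<Rightarrow> 'v \<Rightarrow> 'v \<Rightarrow> 'v \<Rightarrow> 'v \<Rightarrow> int" where
  "path_term e a b c x y u v =
     (if e a b \<and> e a c \<and> \<not> e b c
      then value_P (class_P [e a x, e b x, e c x, e a y, e b y, e c y, e x y])
                   (class_P [e a u, e b u, e c u, e a v, e b v, e c v, e u v])
      else 0)"

definition paw :: "('v \<Rightarrow> 'v \<Rightarrow> bool) \<Rightarrow> 'v \<Rightarrow> 'v \<Rightarrow> 'v \<Rightarrow> 'v \<Rightarrow> bool" where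
  "paw e a b c d \<longleftrightarrow> e a b \<and> e a c \<and> e a d \<and> e b d \<and> \<not> e b c \<and> \<not> e c d"

text \<open>
  Labelled induced copies of \<open>F27\<close> with its vertices in the order \<open>0, ..., 5\<close>, but \<open>b\<close> and \<open>d\<close> may
  coincide, and so may \<open>u\<close> and \<open>v\<close>, if the vertices carry loops.
\<close>

definition copy :: "('v \<Rightarrow> 'v \<Rightarrow> bool) \<Rightarrow> 'v \<Rightarrow> 'v \<Rightarrow> 'v \<Rightarrow> 'v \<Rightarrow> 'v \<Rightarrow> 'v \<Rightarrow> bool" where
  "copy e a b c d u v \<longleftrightarrow> paw e a b c d \<and> e u v \<and>
     \<not> e u a \<and> \<not> e u b \<and> \<not> e u c \<and> \<not> e u d \<and> \<not> e v a \<and> \<not> e v b \<and> \<not> e v c \<and> \<not> e v d"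

definition seven :: "(nat \<Rightarrow> nat \<Rightarrow> nat \<Rightarrow> nat \<Rightarrow> nat \<Rightarrow> nat \<Rightarrow> nat \<Rightarrow> 'a) \<Rightarrow> nat list \<Rightarrow> 'a" where
  "seven F l = F (l!0) (l!1) (l!2) (l!3) (l!4) (l!5) (l!6)"

lemma class_1_sym:
  "class_1 [p,q,r,s,t,w] = class_1 [q,p,r,s,w,t]"
  "class_1 [p,q,r,s,t,w] = class_1 [p,r,q,t,s,w]"
  by (cases p; cases q; cases r; cases s; cases t; cases w; simp only: class_1_rules)+

lemma class_E_sym:
  "class_E [p,q,r,s,t,w,z] = class_E [s,t,w,p,q,r,z]"
  "class_E [p,q,r,s,t,w,z] = class_E [q,p,r,t,s,w,z]"
  "class_E [p,q,r,s,t,w,z] = class_E [p,r,q,s,w,t,z]"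
  by (cases p; cases q; cases r; cases s; cases t; cases w; cases z; simp only: class_E_rules)+

lemma class_P_sym:
  "class_P [p,q,r,s,t,w,z] = class_P [s,t,w,p,q,r,z]"
  "class_P [p,q,r,s,t,w,z] = class_P [p,r,q,s,w,t,z]"
  by (cases p; cases q; cases r; cases s; cases t; cases w; cases z; simp only: class_P_rules)+

lemma value_sym: "value_1 i j = value_1 j i" "value_E i j = value_E j i" "value_P i j = value_P j i"
  by (simp_all add: value_1_def value_E_def value_P_def entry_sym)

context
  fixes e :: "'v \<Rightarrow> 'v \<Rightarrow> bool"
  assumes e: "\<And>x y. e x y = e y x"
begin

lemma root_term_sym:
  "root_term e r y x z u v w = root_term e r x y z u v w"
  "root_term e r x z y u v w = root_term e r x y z u v w"
  "root_term e r u v w x y z = root_term e r x y z u v w"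
proof -
  show "root_term e r y x z u v w = root_term e r x y z u v w"
    unfolding root_term_def by (subst class_1_sym(1)) (simp only: e)
  show "root_term e r x z y u v w = root_term e r x y z u v w"
    unfolding root_term_def by (subst class_1_sym(2)) (simp only: e)
  show "root_term e r u v w x y z = root_term e r x y z u v w"
    unfolding root_term_def by (rule value_sym)
qed

lemma empty_term_sym:
  "empty_term e b a c x y u v = empty_term e a b c x y u v"
  "empty_term e a c b x y u v = empty_term e a b c x y u v"
  "empty_term e a b c y x u v = empty_term e a b c x y u v"
  "empty_term e a b c u v x y = empty_term e a b c x y u v"
proof -
  show "empty_term e b a c x y u v = empty_term e a b c x y u v"
    unfolding empty_term_def class_E_sym(2)[of "e b _"] by (simp only: e[of b a] conj_ac)
  show "empty_term e a c b x y u v = empty_term e a b c x y u v"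
    unfolding empty_term_def class_E_sym(3)[of _ "e c _"] by (simp only: e[of c b] conj_ac)
  show "empty_term e a b c y x u v = empty_term e a b c x y u v"
    unfolding empty_term_def by (subst class_E_sym(1)[of "e a y"]) (simp only: e[of y x])
  show "empty_term e a b c u v x y = empty_term e a b c x y u v"
    unfolding empty_term_def by (subst value_sym) (rule refl)
qed

lemma path_term_sym:
  "path_term e a c b x y u v = path_term e a b c x y u v"
  "path_term e a b c y x u v = path_term e a b c x y u v"
  "path_term e a b c u v x y = path_term e a b c x y u v"
proof -
  show "path_term e a c b x y u v = path_term e a b c x y u v"
    unfolding path_term_def class_P_sym(2)[of _ "e c _"] by (simp only: e[of c b] conj_ac)
  show "path_term e a b c y x u v = path_term e a b c x y u v"
    unfolding path_term_def by (subst class_P_sym(1)[of "e a y"]) (simp only: e[of y x])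
  show "path_term e a b c u v x y = path_term e a b c x y u v"
    unfolding path_term_def by (subst value_sym) (rule refl)
qed

end

text \<open>
  The sums over all orderings with one representative for each orbit of the symmetries of the
  terms. The conditions are nested, so that in the expanded sum they are decided before the term
  is looked at.
\<close>

definition root_sum :: "(nat \<Rightarrow> nat \<Rightarrow> bool) \<Rightarrow> int" where
  "root_sum m = (\<Sum>l\<in>orderings. if l!1 < l!4 then if l!5 < l!6 then if l!4 < l!5 \<and> l!4 < l!6 then
     if l!2 < l!3 then if l!1 < l!2 \<and> l!1 < l!3 then seven (root_term m) l else 0 else 0 else 0 else 0 else 0)"

definition empty_sum :: "(nat \<Rightarrow> nat \<Rightarrow> bool) \<Rightarrow> int" where
  "empty_sum m = (\<Sum>l\<in>orderings. if l!3 < l!5 then if l!5 < l!6 then if l!3 < l!4 then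
     if l!1 < l!2 then if l!0 < l!1 \<and> l!0 < l!2 then seven (empty_term m) l else 0 else 0 else 0 else 0 else 0)"

definition path_sum :: "(nat \<Rightarrow> nat \<Rightarrow> bool) \<Rightarrow> int" where
  "path_sum m = (\<Sum>l\<in>orderings. if l!3 < l!5 then if l!5 < l!6 then if l!3 < l!4 then
     if l!1 < l!2 then seven (path_term m) l else 0 else 0 else 0 else 0)"

definition copy_sum :: "(nat \<Rightarrow> nat \<Rightarrow> bool) \<Rightarrow> int" where
  "copy_sum m = perm_sum 3 [0,1,2,3,4,5,6] (\<lambda>l. if l!1 < l!2 then if m (l!1) (l!2) then
     (let r = fold remove1 l [0,1,2,3,4,5,6] in
      if list_ex (\<lambda>z. m (l!1) z \<or> m (l!2) z) r then 0
      else is_paw [m (r!0) (r!1), m (r!0) (r!2), m (r!0) (r!3), m (r!1) (r!2), m (r!1) (r!3), m (r!2) (r!3)])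
      else 0 else 0)"

lemma distinct_orderings: "l \<in> orderings \<Longrightarrow> i < 7 \<Longrightarrow> j < 7 \<Longrightarrow> i \<noteq> j \<Longrightarrow> l ! i \<noteq> l ! j"
  by (rule ordering_nth(2))

lemma third_condition:
  fixes a b c :: nat
  assumes "a \<noteq> b" "a \<noteq> c" "b \<noteq> c"
  shows "of_bool (a < b \<and> a < c) + of_bool (b < c \<and> b < a) + of_bool (c < a \<and> c < b) = (1::int)"
  using assms by (auto simp: of_bool_def)

context
  fixes m :: "nat \<Rightarrow> nat \<Rightarrow> bool"
  assumes m: "\<And>x y. m x y = m y x"
begin

text \<open>
  The factor \<open>72 = 3! * 3! * 2\<close> counts the permutations of either group of three vertices and the
  exchange of the groups.
\<close>

lemma sum_root_term: "(\<Sum>l\<in>orderings. seven (root_term m) l) = 72 * root_sum m"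
proof -
  note sym = root_term_sym[of m, OF m]
  have cyc: "root_term m r y z x u v w = root_term m r x y z u v w"
    "root_term m r z x y u v w = root_term m r x y z u v w"
    "root_term m r x y z v w u = root_term m r x y z u v w"
    "root_term m r x y z w u v = root_term m r x y z u v w"
    "root_term m r x y z u w v = root_term m r x y z u v w" for r x y z u v w
    by (metis sym)+
  let ?H = "seven (root_term m)"
  define H1 where "H1 l = (if l!1 < l!2 \<and> l!1 < l!3 then ?H l else 0)" for l
  define H2 where "H2 l = (if l!2 < l!3 then H1 l else 0)" for l
  define H3 where "H3 l = (if l!4 < l!5 \<and> l!4 < l!6 then H2 l else 0)" for l
  define H4 where "H4 l = (if l!5 < l!6 then H3 l else 0)" for l
  note Hs = H1_def H2_def H3_def H4_def seven_def
  have "(\<Sum>l\<in>orderings. ?H l) = 3 * (\<Sum>l\<in>orderings. H1 l)"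
    unfolding H1_def
    by (rule sum_orderings_third[of "[0,2,3,1,4,5,6]" "[0,3,1,2,4,5,6]"], simp, force, simp, force)
       (simp_all add: seven_def cyc third_condition distinct_orderings)
  also have "(\<Sum>l\<in>orderings. H1 l) = 2 * (\<Sum>l\<in>orderings. H2 l)"
    unfolding H2_def
    by (rule sum_orderings_half[of "[0,1,3,2,4,5,6]"], simp, force)
       (auto simp: Hs sym not_less le_less distinct_orderings dest: distinct_orderings[of _ 2 3])
  also have "(\<Sum>l\<in>orderings. H2 l) = 3 * (\<Sum>l\<in>orderings. H3 l)"
    unfolding H3_def
    by (rule sum_orderings_third[of "[0,1,2,3,5,6,4]" "[0,1,2,3,6,4,5]"], simp, force, simp, force)
       (simp_all add: Hs cyc third_condition distinct_orderings)
  also have "(\<Sum>l\<in>orderings. H3 l) = 2 * (\<Sum>l\<in>orderings. H4 l)"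
    unfolding H4_def
    by (rule sum_orderings_half[of "[0,1,2,3,4,6,5]"], simp, force)
       (auto simp: Hs cyc not_less le_less distinct_orderings dest: distinct_orderings[of _ 5 6])
  also have "(\<Sum>l\<in>orderings. H4 l) = 2 * (\<Sum>l\<in>orderings. if l!1 < l!4 then H4 l else 0)"
    by (rule sum_orderings_half[of "[0,4,5,6,1,2,3]"], simp, force)
       (auto simp: Hs sym cyc not_less le_less distinct_orderings dest: distinct_orderings[of _ 1 4])
  finally show ?thesis unfolding root_sum_def H4_def H3_def H2_def H1_def by simp
qed

lemma sum_empty_term: "(\<Sum>l\<in>orderings. seven (empty_term m) l) = 48 * empty_sum m"
proof -
  note sym = empty_term_sym[of m, OF m]
  have cyc: "empty_term m b c a x y u v = empty_term m a b c x y u v"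
    "empty_term m c a b x y u v = empty_term m a b c x y u v"
    "empty_term m a b c x y v u = empty_term m a b c x y u v" for a b c x y u v
    by (metis sym)+
  let ?H = "seven (empty_term m)"
  define H1 where "H1 l = (if l!0 < l!1 \<and> l!0 < l!2 then ?H l else 0)" for l
  define H2 where "H2 l = (if l!1 < l!2 then H1 l else 0)" for l
  define H3 where "H3 l = (if l!3 < l!4 then H2 l else 0)" for l
  define H4 where "H4 l = (if l!5 < l!6 then H3 l else 0)" for l
  note Hs = H1_def H2_def H3_def H4_def seven_def
  have "(\<Sum>l\<in>orderings. ?H l) = 3 * (\<Sum>l\<in>orderings. H1 l)"
    unfolding H1_def
    by (rule sum_orderings_third[of "[1,2,0,3,4,5,6]" "[2,0,1,3,4,5,6]"], simp, force, simp, force)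
       (simp_all add: seven_def cyc third_condition distinct_orderings)
  also have "(\<Sum>l\<in>orderings. H1 l) = 2 * (\<Sum>l\<in>orderings. H2 l)"
    unfolding H2_def
    by (rule sum_orderings_half[of "[0,2,1,3,4,5,6]"], simp, force)
       (auto simp: Hs sym not_less le_less distinct_orderings dest: distinct_orderings[of _ 1 2])
  also have "(\<Sum>l\<in>orderings. H2 l) = 2 * (\<Sum>l\<in>orderings. H3 l)"
    unfolding H3_def
    by (rule sum_orderings_half[of "[0,1,2,4,3,5,6]"], simp, force)
       (auto simp: Hs sym not_less le_less distinct_orderings dest: distinct_orderings[of _ 3 4])
  also have "(\<Sum>l\<in>orderings. H3 l) = 2 * (\<Sum>l\<in>orderings. H4 l)"
    unfolding H4_def
    by (rule sum_orderings_half[of "[0,1,2,3,4,6,5]"], simp, force)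
       (auto simp: Hs cyc not_less le_less distinct_orderings dest: distinct_orderings[of _ 5 6])
  also have "(\<Sum>l\<in>orderings. H4 l) = 2 * (\<Sum>l\<in>orderings. if l!3 < l!5 then H4 l else 0)"
    by (rule sum_orderings_half[of "[0,1,2,5,6,3,4]"], simp, force)
       (auto simp: Hs sym cyc not_less le_less distinct_orderings dest: distinct_orderings[of _ 3 5])
  finally show ?thesis unfolding empty_sum_def H4_def H3_def H2_def H1_def by simp
qed

lemma sum_path_term: "(\<Sum>l\<in>orderings. seven (path_term m) l) = 16 * path_sum m"
proof -
  note sym = path_term_sym[of m, OF m]
  have cyc: "path_term m a b c x y v u = path_term m a b c x y u v" for a b c x y u v
    by (metis sym)+
  let ?H = "seven (path_term m)"
  define H2 where "H2 l = (if l!1 < l!2 then ?H l else 0)" for l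
  define H3 where "H3 l = (if l!3 < l!4 then H2 l else 0)" for l
  define H4 where "H4 l = (if l!5 < l!6 then H3 l else 0)" for l
  note Hs = H2_def H3_def H4_def seven_def
  have "(\<Sum>l\<in>orderings. ?H l) = 2 * (\<Sum>l\<in>orderings. H2 l)"
    unfolding H2_def
    by (rule sum_orderings_half[of "[0,2,1,3,4,5,6]"], simp, force)
       (auto simp: Hs sym not_less le_less distinct_orderings dest: distinct_orderings[of _ 1 2])
  also have "(\<Sum>l\<in>orderings. H2 l) = 2 * (\<Sum>l\<in>orderings. H3 l)"
    unfolding H3_def
    by (rule sum_orderings_half[of "[0,1,2,4,3,5,6]"], simp, force)
       (auto simp: Hs sym not_less le_less distinct_orderings dest: distinct_orderings[of _ 3 4])
  also have "(\<Sum>l\<in>orderings. H3 l) = 2 * (\<Sum>l\<in>orderings. H4 l)"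
    unfolding H4_def
    by (rule sum_orderings_half[of "[0,1,2,3,4,6,5]"], simp, force)
       (auto simp: Hs cyc not_less le_less distinct_orderings dest: distinct_orderings[of _ 5 6])
  also have "(\<Sum>l\<in>orderings. H4 l) = 2 * (\<Sum>l\<in>orderings. if l!3 < l!5 then H4 l else 0)"
    by (rule sum_orderings_half[of "[0,1,2,5,6,3,4]"], simp, force)
       (auto simp: Hs sym cyc not_less le_less distinct_orderings dest: distinct_orderings[of _ 3 5])
  finally show ?thesis unfolding path_sum_def H4_def H3_def H2_def by simp
qed


end

lemma perm_sum_append:
  "perm_sum (a + b) xs F = perm_sum a xs (\<lambda>l. perm_sum b (fold remove1 l xs) (\<lambda>k. F (l @ k)))"
proof (induction a arbitrary: xs F)
  case (Suc a)
  show ?case by (simp only: add_Suc perm_sum.simps Suc.IH fold.simps comp_def append.simps)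
qed (simp only: add_0 perm_sum.simps fold.simps id_def append.simps)

lemma perm_sum_cong:
  assumes "distinct xs" "\<And>l. distinct l \<Longrightarrow> set l \<subseteq> set xs \<Longrightarrow> length l = n \<Longrightarrow> F l = G l"
  shows "perm_sum n xs F = perm_sum n xs G"
  using assms
proof (induction n arbitrary: xs F G)
  case (Suc n)
  have "perm_sum n (remove1 x xs) (\<lambda>l. F (x # l)) = perm_sum n (remove1 x xs) (\<lambda>l. G (x # l))"
    if x: "x \<in> set xs" for x
  proof (rule Suc.IH)
    show "distinct (remove1 x xs)" using Suc.prems by simp
    fix l assume l: "distinct l" "set l \<subseteq> set (remove1 x xs)" "length l = n"
    have eq: "set (remove1 x xs) = set xs - {x}" using Suc.prems(1) by (rule set_remove1_eq)
    have "distinct (x # l)" "set (x # l) \<subseteq> set xs" "length (x # l) = Suc n"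
      using l(1,3) l(2)[unfolded eq] x by auto
    then show "F (x # l) = G (x # l)" by (rule Suc.prems(2))
  qed
  then have "map (\<lambda>x. perm_sum n (remove1 x xs) (\<lambda>l. F (x # l))) xs
      = map (\<lambda>x. perm_sum n (remove1 x xs) (\<lambda>l. G (x # l))) xs"
    by (intro map_cong refl)
  then show ?case by (simp only: perm_sum.simps)
qed simp

lemma perm_sum_mult: "perm_sum n xs (\<lambda>l. c * F l) = c * perm_sum n xs F"
  by (induction n arbitrary: xs F) (simp_all add: sum_list_const_mult)

lemma perm_sum_paw:
  assumes "distinct [a,b,c,d]" and m: "\<And>x y. m x y = m y x"
  shows "perm_sum 4 [a,b,c,d] (\<lambda>k. of_bool (paw m (k!0) (k!1) (k!2) (k!3))) =
    2 * is_paw [m a b, m a c, m a d, m b c, m b d, m c d]"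
proof -
  have "perm_sum 4 [a,b,c,d] (\<lambda>k. of_bool (paw m (k!0) (k!1) (k!2) (k!3))) =
    (\<Sum>k\<leftarrow>[[a,b,c,d],[a,b,d,c],[a,c,b,d],[a,c,d,b],[a,d,b,c],[a,d,c,b],
         [b,a,c,d],[b,a,d,c],[b,c,a,d],[b,c,d,a],[b,d,a,c],[b,d,c,a],
         [c,a,b,d],[c,a,d,b],[c,b,a,d],[c,b,d,a],[c,d,a,b],[c,d,b,a],
         [d,a,b,c],[d,a,c,b],[d,b,a,c],[d,b,c,a],[d,c,a,b],[d,c,b,a]]. of_bool (paw m (k!0) (k!1) (k!2) (k!3)))"
  proof -
    have ne: "a \<noteq> b" "b \<noteq> a" "a \<noteq> c" "c \<noteq> a" "a \<noteq> d" "d \<noteq> a" "b \<noteq> c" "c \<noteq> b" "b \<noteq> d" "d \<noteq> b" "c \<noteq> d" "d \<noteq> c"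
      using assms(1) by auto
    have four: "4 = Suc (Suc (Suc (Suc 0)))" by simp
    show ?thesis
      unfolding four perm_sum.simps
      by (simp only: list.map sum_list.Nil sum_list.Cons remove1.simps ne if_True if_False simp_thms add_0_right add.assoc)
  qed
  also have "\<dots> = 2 * is_paw [m a b, m a c, m a d, m b c, m b d, m c d]"
    unfolding paw_def
    by (cases "m a b"; cases "m a c"; cases "m a d"; cases "m b c"; cases "m b d"; cases "m c d")
       (simp_all add: is_paw_rules m[of b a] m[of c a] m[of d a] m[of c b] m[of d b] m[of d c])
  finally show ?thesis .
qed

lemma length_fold_remove1:
  "distinct xs \<Longrightarrow> distinct l \<Longrightarrow> set l \<subseteq> set xs \<Longrightarrow>
    length (fold remove1 l xs) = length xs - length l \<and> distinct (fold remove1 l xs)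
      \<and> set (fold remove1 l xs) = set xs - set l"
proof (induction l arbitrary: xs)
  case (Cons a l)
  have "set (remove1 a xs) = set xs - {a}" using Cons.prems(1) by (rule set_remove1_eq)
  then show ?case
    using Cons.IH[of "remove1 a xs"] Cons.prems by (auto simp: length_remove1)
qed simp


context
  fixes m :: "nat \<Rightarrow> nat \<Rightarrow> bool"
  assumes m: "\<And>x y. m x y = m y x"
begin

lemma sum_copy: "(\<Sum>l\<in>orderings. of_bool (copy m (l!0) (l!1) (l!2) (l!3) (l!4) (l!5))) = 4 * copy_sum m"
proof -
  let ?H = "\<lambda>l. of_bool (copy m (l!3) (l!4) (l!5) (l!6) (l!1) (l!2)) :: int"
  have "(\<Sum>l\<in>orderings. of_bool (copy m (l!0) (l!1) (l!2) (l!3) (l!4) (l!5))) = (\<Sum>l\<in>orderings. ?H l)"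
  proof -
    have "distinct [3,4,5,6,1,2,0::nat]" "set [3,4,5,6,1,2,0] = {..<7::nat}" by auto
    from sum_orderings_rearrange[OF this, of "\<lambda>l. of_bool (copy m (l!0) (l!1) (l!2) (l!3) (l!4) (l!5)) :: int"]
    show ?thesis by (simp del: sum_of_bool_eq)
  qed
  also have "\<dots> = 2 * (\<Sum>l\<in>orderings. if l!1 < l!2 then ?H l else 0)"
  proof (rule sum_orderings_half[of "[0,2,1,3,4,5,6]"], simp, force)
    fix l :: "nat list" assume l: "l \<in> orderings"
    show "?H (map ((!) l) [0, 2, 1, 3, 4, 5, 6]) = ?H l"
      using m[of "l!1" "l!2"] by (simp add: copy_def conj_ac)
    show "map ((!) l) [0, 2, 1, 3, 4, 5, 6] ! 1 < map ((!) l) [0, 2, 1, 3, 4, 5, 6] ! 2 \<longleftrightarrow> \<not> l!1 < l!2"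
      using distinct_orderings[OF l, of 1 2] by auto
  qed
  also have "(\<Sum>l\<in>orderings. if l!1 < l!2 then ?H l else 0)
      = perm_sum (3 + 4) [0,1,2,3,4,5,6] (\<lambda>l. if l!1 < l!2 then ?H l else 0)"
    by (simp add: sum_orderings)
  also have "\<dots> = perm_sum 3 [0,1,2,3,4,5,6] (\<lambda>l. 2 * (if l!1 < l!2 then if m (l!1) (l!2) then
     (let r = fold remove1 l [0,1,2,3,4,5,6] in
      if list_ex (\<lambda>z. m (l!1) z \<or> m (l!2) z) r then 0
      else is_paw [m (r!0) (r!1), m (r!0) (r!2), m (r!0) (r!3), m (r!1) (r!2), m (r!1) (r!3), m (r!2) (r!3)])
      else 0 else 0))"
    unfolding perm_sum_append
  proof (rule perm_sum_cong)
    fix l :: "nat list" assume l: "distinct l" "set l \<subseteq> set [0,1,2,3,4,5,6]" "length l = 3"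
    obtain p u v where luv: "l = [p,u,v]" using l(3) by (auto simp: numeral_eq_Suc length_Suc_conv)
    define r where "r = fold remove1 l [0,1,2,3,4,5,6::nat]"
    have lr: "length r = 4" "distinct r"
      using length_fold_remove1[of "[0,1,2,3,4,5,6]" l] l by (auto simp: r_def)
    then obtain a b c d where r: "r = [a,b,c,d]" by (auto simp: numeral_eq_Suc length_Suc_conv)
    have "perm_sum 4 r (\<lambda>k. if (l @ k)!1 < (l @ k)!2 then ?H (l @ k) else 0)
      = perm_sum 4 r (\<lambda>k. of_bool (u < v \<and> m u v \<and> \<not> list_ex (\<lambda>z. m u z \<or> m v z) r)
          * of_bool (paw m (k!0) (k!1) (k!2) (k!3)))"
    proof (rule perm_sum_cong[OF lr(2)])
      fix k assume k: "distinct k" "set k \<subseteq> set r" "length k = 4"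
      then have "set k = set r" using lr by (metis card_subset_eq distinct_card finite_set)
      moreover obtain x y z w where xyz: "k = [x,y,z,w]" using k(3) by (auto simp: numeral_eq_Suc length_Suc_conv)
      ultimately have "set r = {x,y,z,w}" by simp
      then show "(if (l @ k)!1 < (l @ k)!2 then ?H (l @ k) else 0) =
        of_bool (u < v \<and> m u v \<and> \<not> list_ex (\<lambda>z. m u z \<or> m v z) r) * of_bool (paw m (k!0) (k!1) (k!2) (k!3))"
        by (auto simp: luv xyz copy_def list_ex_iff)
    qed
    also have "\<dots> = of_bool (u < v \<and> m u v \<and> \<not> list_ex (\<lambda>z. m u z \<or> m v z) r)
        * (2 * is_paw [m a b, m a c, m a d, m b c, m b d, m c d])"
      unfolding perm_sum_mult using lr r m by (simp only: perm_sum_paw)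
    finally show "perm_sum 4 (fold remove1 l [0,1,2,3,4,5,6]) (\<lambda>k. if (l @ k)!1 < (l @ k)!2 then ?H (l @ k) else 0)
      = 2 * (if l!1 < l!2 then if m (l!1) (l!2) then
       (let r = fold remove1 l [0,1,2,3,4,5,6] in
        if list_ex (\<lambda>z. m (l!1) z \<or> m (l!2) z) r then 0
        else is_paw [m (r!0) (r!1), m (r!0) (r!2), m (r!0) (r!3), m (r!1) (r!2), m (r!1) (r!3), m (r!2) (r!3)])
        else 0 else 0)"
      unfolding r_def[symmetric] Let_def unfolding r luv by simp
  qed simp
  also have "\<dots> = 2 * copy_sum m" by (simp only: perm_sum_mult copy_sum_def)
  finally show ?thesis by simp
qed

end

section \<open>The surplus of a graph on seven vertices\<close>

text \<open>
  A graph is given by the rows of its adjacency matrix below the diagonal, the longest row first, so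
  that a vertex is added at the front of the list.
\<close>

definition mat :: "bool list list \<Rightarrow> nat \<Rightarrow> nat \<Rightarrow> bool" where
  "mat rows i j = (if j < i then rows ! (length rows - i) ! j else rows ! (length rows - j) ! i)"

lemma mat_rules:
  fixes b10 b20 b21 b30 b31 b32 b40 b41 b42 b43 b50 b51 b52 b53 b54 b60 b61 b62 b63 b64 b65 :: bool
  defines "m \<equiv> mat [[b60,b61,b62,b63,b64,b65],[b50,b51,b52,b53,b54],[b40,b41,b42,b43],[b30,b31,b32],[b20,b21],[b10]]"
  shows
    "m 0 1 = b10" "m 0 2 = b20" "m 0 3 = b30" "m 0 4 = b40" "m 0 5 = b50" "m 0 6 = b60"
    "m 1 0 = b10" "m 1 2 = b21" "m 1 3 = b31" "m 1 4 = b41" "m 1 5 = b51" "m 1 6 = b61"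
    "m 2 0 = b20" "m 2 1 = b21" "m 2 3 = b32" "m 2 4 = b42" "m 2 5 = b52" "m 2 6 = b62"
    "m 3 0 = b30" "m 3 1 = b31" "m 3 2 = b32" "m 3 4 = b43" "m 3 5 = b53" "m 3 6 = b63"
    "m 4 0 = b40" "m 4 1 = b41" "m 4 2 = b42" "m 4 3 = b43" "m 4 5 = b54" "m 4 6 = b64"
    "m 5 0 = b50" "m 5 1 = b51" "m 5 2 = b52" "m 5 3 = b53" "m 5 4 = b54" "m 5 6 = b65"
    "m 6 0 = b60" "m 6 1 = b61" "m 6 2 = b62" "m 6 3 = b63" "m 6 4 = b64" "m 6 5 = b65"
  unfolding m_def mat_def by simp_all

text \<open>
  The weights are chosen such that averages turn into sums over orderings: \<open>74317824000 * 4 / 7! = 58982400\<close>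
  for the copies, and the three sums stand for \<open>7! / 16 = 315\<close>, \<open>7! / 48 = 105\<close> and \<open>7! / 72 = 70\<close>
  times the average of the respective term.
\<close>

definition surplus :: "(nat \<Rightarrow> nat \<Rightarrow> bool) \<Rightarrow> int" where
  "surplus m = 54432000 - 58982400 * copy_sum m - path_sum m - empty_sum m - root_sum m"

lemma perm_sum_numeral: "perm_sum 7 xs F = (\<Sum>x\<leftarrow>xs. perm_sum 6 (remove1 x xs) (\<lambda>l. F (x # l)))"
  "perm_sum 6 xs F = (\<Sum>x\<leftarrow>xs. perm_sum 5 (remove1 x xs) (\<lambda>l. F (x # l)))"
  "perm_sum 5 xs F = (\<Sum>x\<leftarrow>xs. perm_sum 4 (remove1 x xs) (\<lambda>l. F (x # l)))"
  "perm_sum 4 xs F = (\<Sum>x\<leftarrow>xs. perm_sum 3 (remove1 x xs) (\<lambda>l. F (x # l)))"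
  "perm_sum 3 xs F = (\<Sum>x\<leftarrow>xs. perm_sum 2 (remove1 x xs) (\<lambda>l. F (x # l)))"
  "perm_sum 2 xs F = (\<Sum>x\<leftarrow>xs. perm_sum 1 (remove1 x xs) (\<lambda>l. F (x # l)))"
  "perm_sum 1 xs F = (\<Sum>x\<leftarrow>xs. perm_sum 0 (remove1 x xs) (\<lambda>l. F (x # l)))"
  by (simp_all add: numeral_eq_Suc)

lemma nth_numeral_rules: "(x # xs) ! 0 = x" "(x # xs) ! 1 = xs ! 0" "(x # xs) ! 2 = xs ! 1" "(x # xs) ! 3 = xs ! 2"
  "(x # xs) ! 4 = xs ! 3" "(x # xs) ! 5 = xs ! 4" "(x # xs) ! 6 = xs ! 5"
  by (simp_all add: numeral_eq_Suc)

lemma list_ex_rules: "list_ex P [] = False" "list_ex P (x # xs) = (if P x then True else list_ex P xs)"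
  by simp_all

lemmas expand_rules = perm_sum_numeral perm_sum.simps(1) list.map sum_list.Nil sum_list.Cons remove1.simps
     nth_numeral_rules rel_simps simp_thms if_True if_False add_0_left add_0_right seven_def
     mat_rules zero_neq_numeral numeral_neq_zero zero_neq_one one_neq_zero

text \<open>
  For a graph with symbolic entries the sums are expanded once and for all, to avoid that each of the
  many graphs repeats this work.
\<close>

schematic_goal path_sum_expl:
  "path_sum (mat [[b60,b61,b62,b63,b64,b65],[b50,b51,b52,b53,b54],[b40,b41,b42,b43],[b30,b31,b32],[b20,b21],[b10]]) = ?e"
  unfolding path_sum_def sum_orderings
  by (simp only: expand_rules path_term_def)

schematic_goal empty_sum_expl:
  "empty_sum (mat [[b60,b61,b62,b63,b64,b65],[b50,b51,b52,b53,b54],[b40,b41,b42,b43],[b30,b31,b32],[b20,b21],[b10]]) = ?e"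
  unfolding empty_sum_def sum_orderings
  by (simp only: expand_rules empty_term_def)

schematic_goal root_sum_expl:
  "root_sum (mat [[b60,b61,b62,b63,b64,b65],[b50,b51,b52,b53,b54],[b40,b41,b42,b43],[b30,b31,b32],[b20,b21],[b10]]) = ?e"
  unfolding root_sum_def sum_orderings
  by (simp only: expand_rules root_term_def)

schematic_goal copy_sum_expl:
  "copy_sum (mat [[b60,b61,b62,b63,b64,b65],[b50,b51,b52,b53,b54],[b40,b41,b42,b43],[b30,b31,b32],[b20,b21],[b10]]) = ?e"
  unfolding copy_sum_def
  by (simp only: expand_rules Let_def fold.simps comp_def id_def list_ex_rules)

lemma merge_conditions: "(if P then a else 0) + (if P then b else 0) = (if P then a + b else (0::int))"
  by simp

lemmas surplus_expl = surplus_def[of "mat [[b60,b61,b62,b63,b64,b65],[b50,b51,b52,b53,b54],[b40,b41,b42,b43],[b30,b31,b32],[b20,b21],[b10]]" for b60 b61 b62 b63 b64 b65 b50 b51 b52 b53 b54 b40 b41 b42 b43 b30 b31 b32 b20 b21 b10,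
  unfolded path_sum_expl[unfolded merge_conditions] empty_sum_expl[unfolded merge_conditions]
    root_sum_expl copy_sum_expl]

section \<open>Enumerating the graphs on seven vertices\<close>

text \<open>
  Every graph on \<open>n + 1\<close> vertices arises from one on \<open>n\<close> vertices by adding a vertex of highest
  rank, where vertices are ranked by their degree and then by the sum of the degrees of their
  neighbours. An extension is discarded if its new vertex does not have highest rank, or if an
  automorphism of the smaller graph makes the row of the new vertex lexicographically smaller.
\<close>

primrec rows_of :: "nat \<Rightarrow> (nat \<Rightarrow> nat \<Rightarrow> bool) \<Rightarrow> bool list list" where
  "rows_of 0 m = []"
| "rows_of (Suc n) m = (if n = 0 then [] else map (m n) [0..<n] # rows_of n m)"

primrec lex_less :: "bool list \<Rightarrow> bool list \<Rightarrow> bool" where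
  "lex_less [] bs = False"
| "lex_less (a # as) bs = (if a then (if hd bs then lex_less as (tl bs) else False)
                            else (if hd bs then True else lex_less as (tl bs)))"

text \<open>Some automorphism in \<open>ps\<close> makes the row \<open>x\<close> of the new vertex smaller.\<close>

definition reducible :: "nat list list \<Rightarrow> bool list \<Rightarrow> bool" where
  "reducible ps x = list_ex (\<lambda>p. lex_less (map ((!) x) p) x) ps"

primrec count_true :: "bool list \<Rightarrow> nat" where
  "count_true [] = 0"
| "count_true (b # bs) = (if b then count_true bs + 1 else count_true bs)"

primrec masked_sum :: "bool list \<Rightarrow> nat list \<Rightarrow> nat" where
  "masked_sum [] ds = 0"
| "masked_sum (b # bs) ds = (if b then masked_sum bs (tl ds) + hd ds else masked_sum bs (tl ds))"

primrec masked_add :: "nat \<Rightarrow> bool list \<Rightarrow> nat list \<Rightarrow> nat list" where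
  "masked_add c [] ds = []"
| "masked_add c (b # bs) ds = (if b then hd ds + c else hd ds) # masked_add c bs (tl ds)"

primrec degrees :: "bool list list \<Rightarrow> nat list" where
  "degrees [] = [0]"
| "degrees (x # g) = masked_add 1 x (degrees g) @ [count_true x]"

primrec degree_sums :: "bool list list \<Rightarrow> nat list \<Rightarrow> nat list" where
  "degree_sums [] ds = [0]"
| "degree_sums (x # g) ds = masked_add (last ds) x (degree_sums g (butlast ds)) @ [masked_sum x ds]"

primrec outranked :: "nat list \<Rightarrow> nat list \<Rightarrow> nat \<Rightarrow> nat \<Rightarrow> bool" where
  "outranked [] ss d s = False"
| "outranked (d' # ds) ss d s =
     (if d < d' then True else if d = d' then if s < hd ss then True else outranked ds (tl ss) d s
      else outranked ds (tl ss) d s)"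

definition dominated_from :: "nat list \<Rightarrow> nat list \<Rightarrow> bool" where
  "dominated_from ds ss = outranked ds ss (last ds) (last ss)"

definition dominated_by :: "bool list list \<Rightarrow> nat list \<Rightarrow> bool" where
  "dominated_by g ds =
     (if list_ex ((<) (last ds)) ds then True else dominated_from ds (degree_sums g ds))"

definition dominated :: "bool list list \<Rightarrow> bool" where
  "dominated g = dominated_by g (degrees g)"

definition extensions :: "nat \<Rightarrow> bool list list list \<Rightarrow> nat list list list \<Rightarrow> bool list list list" where
  "extensions n L G = concat (map2 (\<lambda>g ps. map (\<lambda>x. x # g)
     (filter (\<lambda>x. \<not> (if reducible ps x then True else dominated (x # g))) (bool_lists n))) L G)"

definition level_2 :: "bool list list list" where "level_2 = extensions 1 [[]] symmetries_1"
definition level_3 :: "bool list list list" where "level_3 = extensions 2 level_2 symmetries_2"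
definition level_4 :: "bool list list list" where "level_4 = extensions 3 level_3 symmetries_3"
definition level_5 :: "bool list list list" where "level_5 = extensions 4 level_4 symmetries_4"
definition level_6 :: "bool list list list" where "level_6 = extensions 5 level_5 symmetries_5"

text \<open>
  The adjacency of the pattern \<open>B27\<close>: vertices of the same cycle are adjacent unless they are
  opposite.
\<close>

definition looped_adj :: "nat \<Rightarrow> nat \<Rightarrow> bool" where
  "looped_adj p q \<longleftrightarrow> (p < 4 \<longleftrightarrow> q < 4) \<and> p \<noteq> q + 2 \<and> q \<noteq> p + 2"

primrec embed_rest :: "bool list list \<Rightarrow> nat list \<Rightarrow> bool" where
  "embed_rest [] \<phi> = True"
| "embed_rest (r # rs) \<phi> =
     list_ex (\<lambda>p. if list_all2 (\<lambda>b q. b = looped_adj p q) r \<phi> then embed_rest rs (\<phi> @ [p]) else False) [0,1,2,3,4,5,6,7]"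

text \<open>By symmetry the first vertex may be placed at \<open>0\<close>.\<close>

definition embeddable :: "bool list list \<Rightarrow> bool" where
  "embeddable g = embed_rest (rev g) [0]"

definition acceptable_surplus :: "bool list list \<Rightarrow> int \<Rightarrow> bool" where
  "acceptable_surplus g s = (if s = 0 then embeddable g else 41784 \<le> s)"

definition acceptable :: "bool list list \<Rightarrow> bool" where
  "acceptable g = acceptable_surplus g (surplus (mat g))"

text \<open>
  The degrees of the smaller graph are shared by all its extensions, hence they are passed on.
\<close>

definition check_extension :: "bool list list \<Rightarrow> nat list list \<Rightarrow> nat list \<Rightarrow> bool list \<Rightarrow> bool" where
  "check_extension g ps ds x = (if reducible ps x then True
     else if dominated_by (x # g) (masked_add 1 x ds @ [count_true x]) then True else acceptable (x # g))"

definition check_extensions_from :: "bool list list \<Rightarrow> nat list list \<Rightarrow> nat list \<Rightarrow> bool" where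
  "check_extensions_from g ps ds = list_all (check_extension g ps ds) (bool_lists 6)"

definition check_extensions :: "bool list list \<Rightarrow> nat list list \<Rightarrow> bool" where
  "check_extensions g ps = check_extensions_from g ps (degrees g)"

definition symmetric_list :: "nat \<Rightarrow> bool list list \<Rightarrow> nat list \<Rightarrow> bool" where
  "symmetric_list n g p = (distinct p \<and> length p = n \<and> list_all (\<lambda>i. i < n) p \<and>
     list_all (\<lambda>i. list_all (\<lambda>j. mat g (p!i) (p!j) = mat g i j) [0..<i]) [0..<n])"

definition symmetries_ok :: "nat \<Rightarrow> bool list list list \<Rightarrow> nat list list list \<Rightarrow> bool" where
  "symmetries_ok n L G = list_all2 (\<lambda>g ps. list_all (symmetric_list n g) ps) L G"

lemma levels_ok: "symmetries_ok 1 [[]] symmetries_1" "symmetries_ok 2 level_2 symmetries_2"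
  "symmetries_ok 3 level_3 symmetries_3" "symmetries_ok 4 level_4 symmetries_4"
  "symmetries_ok 5 level_5 symmetries_5"  "symmetries_ok 6 level_6 symmetries_6"
  by code_simp+


schematic_goal bool_lists_6: "bool_lists 6 = ?L"
  by code_simp

lemma list_all_rules: "list_all P [] = True" "list_all P (x # xs) = (if P x then list_all P xs else False)"
  by simp_all

lemma list_all2_rules: "list_all2 P [] [] = True" "list_all2 P (x # xs) (y # ys) = (if P x y then list_all2 P xs ys else False)"
  by simp_all

lemma last_rules: "last [x] = x" "last (x # y # ys) = last (y # ys)" "butlast [x] = []" "butlast (x # y # ys) = x # butlast (y # ys)"
  by simp_all

lemma less_rules: "\<not> (x::nat) < x" "(0::nat) < 1" "\<not> (1::nat) < 0"
  by simp_all

primrec bool_row :: "(nat \<Rightarrow> nat \<Rightarrow> bool) \<Rightarrow> nat \<Rightarrow> nat \<Rightarrow> bool list \<Rightarrow> bool" where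
  "bool_row f i j [] = True"
| "bool_row f i j (v # vs) = (f i j = v \<and> bool_row f i (j + 1) vs)"

lemma looped_adj_rows:
  "bool_row looped_adj 0 0 [True,True,False,True,False,False,False,False]"
  "bool_row looped_adj 1 0 [True,True,True,False,False,False,False,False]"
  "bool_row looped_adj 2 0 [False,True,True,True,False,False,False,False]"
  "bool_row looped_adj 3 0 [True,False,True,True,False,False,False,False]"
  "bool_row looped_adj 4 0 [False,False,False,False,True,True,False,True]"
  "bool_row looped_adj 5 0 [False,False,False,False,True,True,True,False]"
  "bool_row looped_adj 6 0 [False,False,False,False,False,True,True,True]"
  "bool_row looped_adj 7 0 [False,False,False,False,True,False,True,True]"
  by (simp_all add: looped_adj_def)

lemmas looped_adj_rules = looped_adj_rows[unfolded bool_row.simps add_0 one_add_one numeral_plus_one add_num_simps]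

text \<open>
  The computation is a rewriting of closed terms. Conditionals, instead of conjunctions and
  disjunctions, let it skip the branches that are not taken.
\<close>

lemmas check_rules = list_all2_rules check_extensions_def check_extensions_from_def check_extension_def bool_lists_6 list_all_rules list_ex_rules last_rules
  reducible_def lex_less.simps list.map nth_numeral_rules list.sel if_True if_False simp_thms
  dominated_by_def dominated_from_def degrees.simps masked_add.simps count_true.simps masked_sum.simps degree_sums.simps
  append.simps outranked.simps less_rules rel_simps zero_neq_one one_neq_zero zero_neq_numeral numeral_neq_zero
  add_0_left add_0_right one_add_one numeral_plus_one one_plus_numeral arith_simps add_neg_numeral_special diff_numeral_special
  diff_0 diff_0_right minus_zero minus_minus mult_zero_left mult_zero_right mult_1_right mult_1_left
  acceptable_def acceptable_surplus_def surplus_expl class_1_rules class_E_rules class_P_rules is_paw_rules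
  value_1_rules value_E_rules value_P_rules
  embeddable_def rev.simps embed_rest.simps looped_adj_rules


schematic_goal level_6_expl: "level_6 = ?L"
  by code_simp

lemma all_extensions_checked: "list_all2 check_extensions level_6 symmetries_6"
  unfolding level_6_expl symmetries_6_def by (simp only: check_rules cong: if_weak_cong)

section \<open>Completeness of the enumeration\<close>

definition relabel :: "(nat \<Rightarrow> nat) \<Rightarrow> (nat \<Rightarrow> nat \<Rightarrow> bool) \<Rightarrow> nat \<Rightarrow> nat \<Rightarrow> bool" where
  "relabel \<sigma> m i j = m (\<sigma> i) (\<sigma> j)"

definition symmetric :: "('v \<Rightarrow> 'v \<Rightarrow> bool) \<Rightarrow> bool" where
  "symmetric e \<longleftrightarrow> (\<forall>x y. e x y = e y x)"

lemma symmetricD: "symmetric e \<Longrightarrow> e x y = e y x"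
  by (simp add: symmetric_def)

lemma symmetric_relabel: "symmetric m \<Longrightarrow> symmetric (relabel \<sigma> m)"
  by (simp add: symmetric_def relabel_def)

lemma relabel_comp: "relabel \<pi> (relabel \<sigma> m) = relabel (\<sigma> \<circ> \<pi>) m"
  by (simp add: relabel_def fun_eq_iff)

definition complete :: "nat \<Rightarrow> bool list list list \<Rightarrow> bool" where
  "complete n L \<longleftrightarrow> (\<forall>m. symmetric m \<longrightarrow> (\<exists>\<sigma>. \<sigma> permutes {..<n} \<and> rows_of n (relabel \<sigma> m) \<in> set L))"

lemma length_rows_of: "length (rows_of n m) = n - 1"
  by (induction n) auto

lemma nth_rows_of: "0 < i \<Longrightarrow> i < n \<Longrightarrow> rows_of n m ! (n - 1 - i) = map (m i) [0..<i]"
proof (induction n)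
  case (Suc n)
  show ?case
  proof (cases "i = n")
    case False
    with Suc.prems have "i < n" "n \<noteq> 0" by auto
    moreover from this have "Suc n - 1 - i = Suc (n - 1 - i)" by simp
    ultimately show ?thesis using Suc.IH Suc.prems by simp
  qed (use Suc.prems in auto)
qed simp

lemma mat_sym: "mat r i j = mat r j i"
  by (auto simp: mat_def dest: order.asym intro: linorder_cases[of i j])

lemma mat_rows_of:
  assumes m: "symmetric m" and ij: "i \<noteq> j" "i < n" "j < n"
  shows "mat (rows_of n m) i j = m i j"
proof -
  have *: "mat (rows_of n m) i j = m i j" if "j < i" "i < n" for i j
    using that nth_rows_of[of i n m] by (auto simp: mat_def length_rows_of)
  show ?thesis
    using ij *[of j i] *[of i j] mat_sym[of "rows_of n m" i j] symmetricD[OF m, of i j]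
    by (cases "j < i") auto
qed

lemma rows_of_cong:
  "(\<And>i j. j < i \<Longrightarrow> i < n \<Longrightarrow> m i j = m' i j) \<Longrightarrow> rows_of n m = rows_of n m'"
  by (induction n) auto

subsection \<open>Ranking the vertices\<close>

definition degree :: "nat \<Rightarrow> (nat \<Rightarrow> nat \<Rightarrow> bool) \<Rightarrow> nat \<Rightarrow> nat" where
  "degree n m i = (\<Sum>j<n. if j \<noteq> i \<and> m i j then 1 else 0)"

definition neighbour_degrees :: "nat \<Rightarrow> (nat \<Rightarrow> nat \<Rightarrow> bool) \<Rightarrow> (nat \<Rightarrow> nat) \<Rightarrow> nat \<Rightarrow> nat" where
  "neighbour_degrees n m h i = (\<Sum>j<n. if j \<noteq> i \<and> m i j then h j else 0)"

lemma masked_add_map: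
  "masked_add c (map f xs) (map g xs) = map (\<lambda>x. if f x then g x + c else g x) xs"
  by (induction xs) auto

lemma masked_sum_map: "masked_sum (map f xs) (map g xs) = (\<Sum>x\<leftarrow>xs. if f x then g x else 0)"
  by (induction xs) auto

lemma count_true_map: "count_true (map f xs) = (\<Sum>x\<leftarrow>xs. if f x then 1 else 0)"
  by (induction xs) auto

lemma sum_list_upt: "(\<Sum>x\<leftarrow>[0..<n]. f x) = (\<Sum>x<n. f x :: nat)"
  by (simp add: interv_sum_list_conv_sum_set_nat atLeast0LessThan)

lemma degree_Suc:
  "i < n \<Longrightarrow> degree (Suc n) m i = (if m i n then degree n m i + 1 else degree n m i)"
  "degree (Suc n) m n = (\<Sum>j<n. if m n j then 1 else 0)"
  by (auto simp: degree_def intro!: sum.cong)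

lemma neighbour_degrees_Suc:
  "i < n \<Longrightarrow> neighbour_degrees (Suc n) m h i =
     (if m i n then neighbour_degrees n m h i + h n else neighbour_degrees n m h i)"
  "neighbour_degrees (Suc n) m h n = (\<Sum>j<n. if m n j then h j else 0)"
  by (auto simp: neighbour_degrees_def intro!: sum.cong)

lemma degrees_rows_of:
  assumes m: "symmetric m" and "n > 0"
  shows "degrees (rows_of n m) = map (degree n m) [0..<n]"
  using \<open>n > 0\<close>
proof (induction n)
  case (Suc n)
  show ?case
  proof (cases "n = 0")
    case False
    have "degrees (rows_of (Suc n) m)
        = map (\<lambda>x. if m n x then degree n m x + 1 else degree n m x) [0..<n] @ [\<Sum>j<n. if m n j then 1 else 0]"
      using False Suc.IH by (simp add: masked_add_map count_true_map sum_list_upt)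
    also have "\<dots> = map (degree (Suc n) m) [0..<Suc n]"
      using symmetricD[OF m, of n] by (auto simp: degree_Suc)
    finally show ?thesis .
  qed (simp add: degree_def)
qed simp

lemma degree_sums_rows_of:
  assumes m: "symmetric m" and "n > 0"
  shows "degree_sums (rows_of n m) (map h [0..<n]) = map (neighbour_degrees n m h) [0..<n]"
  using \<open>n > 0\<close>
proof (induction n)
  case (Suc n)
  show ?case
  proof (cases "n = 0")
    case False
    have "map h [0..<Suc n] = map h [0..<n] @ [h n]" by simp
    then have lb: "last (map h [0..<Suc n]) = h n" "butlast (map h [0..<Suc n]) = map h [0..<n]"
      by (simp_all del: upt_Suc)
    have "masked_sum (map (m n) [0..<n]) (map h [0..<Suc n]) = masked_sum (map (m n) [0..<n]) (map h [0..<n])"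
    proof -
      have "masked_sum bs (ds @ ds') = masked_sum bs ds" if "length bs = length ds" for bs ds ds'
        using that by (induction bs ds rule: list_induct2) auto
      then show ?thesis by simp
    qed
    then have "degree_sums (rows_of (Suc n) m) (map h [0..<Suc n])
        = map (\<lambda>x. if m n x then neighbour_degrees n m h x + h n else neighbour_degrees n m h x) [0..<n]
          @ [\<Sum>j<n. if m n j then h j else 0]"
      using False Suc.IH by (simp add: lb masked_add_map masked_sum_map sum_list_upt del: upt_Suc)
    also have "\<dots> = map (neighbour_degrees (Suc n) m h) [0..<Suc n]"
      using symmetricD[OF m, of n] by (auto simp: neighbour_degrees_Suc)
    finally show ?thesis .
  qed (simp add: neighbour_degrees_def)
qed simp

text \<open>
  The degree and the sum of the degrees of the neighbours, combined into one number that orders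
  them lexicographically.
\<close>

definition rank :: "nat \<Rightarrow> (nat \<Rightarrow> nat \<Rightarrow> bool) \<Rightarrow> nat \<Rightarrow> nat" where
  "rank n m i = degree n m i * (n * n + 1) + neighbour_degrees n m (degree n m) i"

lemma neighbour_degrees_le: "neighbour_degrees n m (degree n m) i \<le> n * n"
proof -
  have "degree n m j \<le> n" for j
    unfolding degree_def by (rule order.trans[OF sum_bounded_above[where K = 1]]) auto
  then have "neighbour_degrees n m (degree n m) i \<le> (\<Sum>j<n. n)"
    unfolding neighbour_degrees_def by (intro sum_mono) auto
  then show ?thesis by simp
qed

lemma rank_less:
  assumes "degree n m i < degree n m j \<or> (degree n m i = degree n m j \<and>
    neighbour_degrees n m (degree n m) i < neighbour_degrees n m (degree n m) j)"
  shows "rank n m i < rank n m j"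
  using assms
proof
  assume "degree n m i < degree n m j"
  then have "(degree n m i + 1) * (n * n + 1) \<le> degree n m j * (n * n + 1)"
    by (intro mult_right_mono) auto
  then show ?thesis using neighbour_degrees_le[of n m i] by (simp add: rank_def)
qed (simp add: rank_def)

lemma outranked_map:
  "outranked (map f xs) (map g xs) d s \<Longrightarrow> \<exists>x\<in>set xs. d < f x \<or> (d = f x \<and> s < g x)"
  by (induction xs) (auto split: if_splits)

lemma dominated_rank:
  assumes m: "symmetric m" and n: "n > 0" and dom: "dominated (rows_of (Suc n) m)"
  shows "\<exists>i<Suc n. rank (Suc n) m n < rank (Suc n) m i"
proof -
  let ?d = "degree (Suc n) m" and ?s = "neighbour_degrees (Suc n) m (degree (Suc n) m)"
  have ds: "degrees (rows_of (Suc n) m) = map ?d [0..<Suc n]"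
    using m by (intro degrees_rows_of) auto
  have ss: "degree_sums (rows_of (Suc n) m) (map ?d [0..<Suc n]) = map ?s [0..<Suc n]"
    using m by (intro degree_sums_rows_of) auto
  have "map f [0..<Suc n] = map f [0..<n] @ [f n]" for f :: "nat \<Rightarrow> nat" by simp
  then have last: "last (map f [0..<Suc n]) = f n" for f :: "nat \<Rightarrow> nat"
    by (simp del: upt_Suc)
  have "(\<exists>i<Suc n. ?d n < ?d i) \<or> (\<exists>i<Suc n. ?d n < ?d i \<or> (?d n = ?d i \<and> ?s n < ?s i))"
    using dom outranked_map[of ?d "[0..<Suc n]" ?s "?d n" "?s n"]
    unfolding dominated_def dominated_by_def dominated_from_def ds ss last
    by (auto simp: list_ex_iff simp del: upt_Suc split: if_splits)
  then show ?thesis using rank_less[of "Suc n" m n] by blast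
qed

lemma rank_relabel:
  assumes "\<sigma> permutes {..<n}"
  shows "rank n (relabel \<sigma> m) i = rank n m (\<sigma> i)"
proof -
  have inj: "\<sigma> j = \<sigma> i \<longleftrightarrow> j = i" for i j
    using permutes_inj[OF assms] by (auto dest: injD)
  have sum: "(\<Sum>j<n. f (\<sigma> j)) = (\<Sum>j<n. f j)" for f :: "nat \<Rightarrow> nat"
    using sum.permute[OF assms, of f] by (simp add: comp_def)
  have deg: "degree n (relabel \<sigma> m) i = degree n m (\<sigma> i)" for i
    using sum[of "\<lambda>j. if j \<noteq> \<sigma> i \<and> m (\<sigma> i) j then 1 else 0"] by (simp add: degree_def relabel_def inj)
  have "neighbour_degrees n (relabel \<sigma> m) (degree n (relabel \<sigma> m)) i = neighbour_degrees n m (degree n m) (\<sigma> i)"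
    using sum[of "\<lambda>j. if j \<noteq> \<sigma> i \<and> m (\<sigma> i) j then degree n m j else 0"]
    unfolding neighbour_degrees_def deg by (simp add: relabel_def inj)
  then show ?thesis by (simp add: rank_def deg)
qed

primrec bit_value :: "bool list \<Rightarrow> nat" where
  "bit_value [] = 0"
| "bit_value (b # bs) = (if b then 2 ^ length bs else 0) + bit_value bs"

lemma bit_value_less: "bit_value bs < 2 ^ length bs"
  by (induction bs) auto

lemma lex_less_bit_value:
  "length as = length bs \<Longrightarrow> lex_less as bs \<Longrightarrow> bit_value as < bit_value bs"
proof (induction as bs rule: list_induct2)
  case (Cons a as b bs)
  then show ?case
    using bit_value_less[of as] by (auto split: if_splits)
qed simp

subsection \<open>Adding a vertex of highest rank\<close>

text \<open>
  Some vertex of highest rank may be taken as the last one, and the others may be arranged as in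
  the list. Among these arrangements the one whose last row is lexicographically least survives
  the pruning by the symmetries of the smaller graph.
\<close>

lemma complete_extensions:
  assumes L: "complete n L" and n: "n > 0" and ok: "symmetries_ok n L G"
  shows "complete (Suc n) (extensions n L G)"
  unfolding complete_def
proof (intro allI impI)
  fix m :: "nat \<Rightarrow> nat \<Rightarrow> bool" assume m: "symmetric m"
  have "finite (rank (Suc n) m ` {..<Suc n})" "rank (Suc n) m ` {..<Suc n} \<noteq> {}" by auto
  from Max_in[OF this] obtain v where v: "v < Suc n" "rank (Suc n) m v = Max (rank (Suc n) m ` {..<Suc n})"
    by auto
  have vmax: "rank (Suc n) m i \<le> rank (Suc n) m v" if "i < Suc n" for i
    using that unfolding v(2) by (intro Max_ge) auto
  let ?\<tau> = "transpose v n"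
  have \<tau>: "?\<tau> permutes {..<Suc n}" using v(1) by (intro permutes_swap_id) auto
  from L obtain \<sigma>1 where \<sigma>1: "\<sigma>1 permutes {..<n}" "rows_of n (relabel \<sigma>1 (relabel ?\<tau> m)) \<in> set L"
    using symmetric_relabel[OF m] unfolding complete_def by blast
  define g where "g = rows_of n (relabel \<sigma>1 (relabel ?\<tau> m))"
  define S where "S = {\<sigma>. \<sigma> permutes {..<Suc n} \<and> \<sigma> n = v \<and> rows_of n (relabel \<sigma> m) = g}"
  have "\<sigma>1 permutes {..<Suc n}" using \<sigma>1(1) by (rule permutes_subset) auto
  then have "?\<tau> \<circ> \<sigma>1 permutes {..<Suc n}" using \<tau> by (rule permutes_compose)
  moreover have "(?\<tau> \<circ> \<sigma>1) n = v" using permutes_not_in[OF \<sigma>1(1), of n] by simp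
  ultimately have "?\<tau> \<circ> \<sigma>1 \<in> S" by (simp add: S_def g_def relabel_comp)
  define last_row where "last_row \<sigma> = map (relabel \<sigma> m n) [0..<n]" for \<sigma>
  obtain \<sigma> where \<sigma>: "\<sigma> \<in> S" and least: "\<And>\<sigma>'. \<sigma>' \<in> S \<Longrightarrow> bit_value (last_row \<sigma>) \<le> bit_value (last_row \<sigma>')"
    using ex_has_least_nat[of "\<lambda>\<sigma>. \<sigma> \<in> S" "?\<tau> \<circ> \<sigma>1" "\<lambda>\<sigma>. bit_value (last_row \<sigma>)"] \<open>?\<tau> \<circ> \<sigma>1 \<in> S\<close> by blast
  let ?m = "relabel \<sigma> m"
  have sm: "symmetric ?m" using m by (rule symmetric_relabel)
  have perm: "\<sigma> permutes {..<Suc n}" and \<sigma>n: "\<sigma> n = v" and g: "rows_of n ?m = g"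
    using \<sigma> by (auto simp: S_def)
  have rows: "rows_of (Suc n) ?m = last_row \<sigma> # g"
    using n g by (simp add: last_row_def)
  have nd: "\<not> dominated (last_row \<sigma> # g)"
  proof
    assume "dominated (last_row \<sigma> # g)"
    then obtain i where "i < Suc n" "rank (Suc n) ?m n < rank (Suc n) ?m i"
      using dominated_rank[OF sm n] unfolding rows by blast
    moreover have "\<sigma> i < Suc n" using permutes_in_image[OF perm, of i] \<open>i < Suc n\<close> by simp
    ultimately show False using vmax[of "\<sigma> i"] by (simp add: rank_relabel[OF perm] \<sigma>n)
  qed
  from \<sigma>1(2) obtain k where k: "k < length L" "L ! k = g" by (auto simp: in_set_conv_nth g_def)
  have lenG: "length G = length L" and symG: "list_all (symmetric_list n g) (G ! k)"
    using ok k by (auto simp: symmetries_ok_def list_all2_conv_all_nth)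
  have nr: "\<not> reducible (G ! k) (last_row \<sigma>)"
  proof
    assume "reducible (G ! k) (last_row \<sigma>)"
    then obtain p where p: "p \<in> set (G ! k)" and less: "lex_less (map ((!) (last_row \<sigma>)) p) (last_row \<sigma>)"
      by (auto simp: reducible_def list_ex_iff)
    have "symmetric_list n g p" using symG p by (auto simp: list_all_iff)
    then have p': "distinct p" "length p = n" "\<And>i. i < n \<Longrightarrow> p ! i < n"
      and aut: "\<And>i j. j < i \<Longrightarrow> i < n \<Longrightarrow> mat g (p!i) (p!j) = mat g i j"
      by (auto simp: symmetric_list_def list_all_iff)
    define \<pi> where "\<pi> i = (if i < n then p ! i else i)" for i
    have "bij_betw \<pi> {..<n} {..<n}"
    proof (rule bij_betwI')
      show "(\<pi> i = \<pi> j) = (i = j)" if "i \<in> {..<n}" "j \<in> {..<n}" for i j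
        using that p' by (auto simp: \<pi>_def nth_eq_iff_index_eq)
      show "\<pi> i \<in> {..<n}" if "i \<in> {..<n}" for i using that p' by (auto simp: \<pi>_def)
      show "\<exists>i\<in>{..<n}. j = \<pi> i" if "j \<in> {..<n}" for j
      proof -
        have "set p \<subseteq> {..<n}" using p' by (auto simp: set_conv_nth)
        moreover have "card (set p) = card {..<n}" using p' by (simp add: distinct_card)
        ultimately have "set p = {..<n}" by (intro card_subset_eq) auto
        then show ?thesis using that p' by (auto simp: \<pi>_def in_set_conv_nth set_eq_iff) (metis lessThan_iff)
      qed
    qed
    then have \<pi>: "\<pi> permutes {..<n}" by (rule bij_imp_permutes) (simp add: \<pi>_def)
    have "rows_of n (relabel \<pi> ?m) = rows_of n ?m"
    proof (rule rows_of_cong)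
      fix i j assume ij: "j < i" "i < n"
      have "p ! i \<noteq> p ! j" using ij p' by (simp add: nth_eq_iff_index_eq)
      then have "relabel \<pi> ?m i j = mat g (p ! i) (p ! j)"
        using ij p' mat_rows_of[OF sm, of "p ! i" "p ! j" n] by (simp add: relabel_def \<pi>_def g)
      also have "\<dots> = ?m i j" using ij aut mat_rows_of[OF sm, of i j n] by (simp add: g)
      finally show "relabel \<pi> ?m i j = ?m i j" .
    qed
    moreover have "\<pi> permutes {..<Suc n}" using \<pi> by (rule permutes_subset) auto
    ultimately have "\<sigma> \<circ> \<pi> \<in> S"
      using perm \<sigma>n g by (auto simp: S_def relabel_comp \<pi>_def intro: permutes_compose)
    moreover have "last_row (\<sigma> \<circ> \<pi>) = map ((!) (last_row \<sigma>)) p"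
      using p' by (intro nth_equalityI) (auto simp: last_row_def relabel_def \<pi>_def)
    ultimately have "bit_value (last_row \<sigma>) \<le> bit_value (map ((!) (last_row \<sigma>)) p)"
      using least by metis
    moreover have "bit_value (map ((!) (last_row \<sigma>)) p) < bit_value (last_row \<sigma>)"
      using less p' by (intro lex_less_bit_value) (auto simp: last_row_def)
    ultimately show False by simp
  qed
  have "last_row \<sigma> # g \<in> set (extensions n L G)"
  proof -
    have "(g, G ! k) \<in> set (zip L G)" using k lenG by (auto simp: set_zip)
    moreover have "last_row \<sigma> \<in> set (bool_lists n)" by (simp add: set_bool_lists last_row_def)
    then have "last_row \<sigma> # g \<in> set (map (\<lambda>x. x # g)
        (filter (\<lambda>x. \<not> (if reducible (G ! k) x then True else dominated (x # g))) (bool_lists n)))"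
      using nr nd by simp
    moreover have "map (\<lambda>x. x # g) (filter (\<lambda>x. \<not> (if reducible (G ! k) x then True else dominated (x # g))) (bool_lists n))
        \<in> set (map2 (\<lambda>g ps. map (\<lambda>x. x # g)
            (filter (\<lambda>x. \<not> (if reducible ps x then True else dominated (x # g))) (bool_lists n))) L G)"
      unfolding set_map by (rule image_eqI[where x = "(g, G ! k)"]) (simp, fact)
    ultimately show ?thesis
      unfolding extensions_def set_concat by blast
  qed
  then show "\<exists>\<sigma>. \<sigma> permutes {..<Suc n} \<and> rows_of (Suc n) (relabel \<sigma> m) \<in> set (extensions n L G)"
    using perm rows by metis
qed

lemma complete_level_6: "complete 6 level_6"
proof -
  have "complete 1 [[]]" by (auto simp: complete_def intro: permutes_id)
  from complete_extensions[OF this _ levels_ok(1)] have 2: "complete 2 level_2"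
    by (simp add: level_2_def numeral_2_eq_2)
  from complete_extensions[OF 2 _ levels_ok(2)] have 3: "complete 3 level_3"
    by (simp add: level_3_def numeral_3_eq_3)
  from complete_extensions[OF 3 _ levels_ok(3)] have 4: "complete 4 level_4"
    by (simp add: level_4_def)
  from complete_extensions[OF 4 _ levels_ok(4)] have 5: "complete 5 level_5"
    by (simp add: level_5_def)
  from complete_extensions[OF 5 _ levels_ok(5)] show "complete 6 level_6"
    by (simp add: level_6_def)
qed

section \<open>The surplus is nonnegative\<close>

text \<open>
  The integrand of the flag algebra calculation. Its sum over all orderings is a multiple of the
  surplus, which shows in particular that the surplus does not depend on the labelling.
\<close>

definition weight :: "(nat \<Rightarrow> nat \<Rightarrow> bool) \<Rightarrow> nat list \<Rightarrow> int" where
  "weight m l = 54432000 - 74317824000 * of_bool (copy m (l!0) (l!1) (l!2) (l!3) (l!4) (l!5))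
     - 315 * seven (path_term m) l - 105 * seven (empty_term m) l - 70 * seven (root_term m) l"

lemma sum_weight:
  assumes "symmetric m"
  shows "(\<Sum>l\<in>orderings. weight m l) = 5040 * surplus m"
proof -
  have m: "m x y = m y x" for x y using assms by (rule symmetricD)
  have "card orderings = fact 7" by simp
  then have c: "int (card orderings) = 5040" by (simp add: fact_numeral)
  have "(\<Sum>l\<in>orderings. weight m l) = 54432000 * int (card orderings)
     - 74317824000 * (\<Sum>l\<in>orderings. of_bool (copy m (l!0) (l!1) (l!2) (l!3) (l!4) (l!5)))
     - 315 * (\<Sum>l\<in>orderings. seven (path_term m) l) - 105 * (\<Sum>l\<in>orderings. seven (empty_term m) l)
     - 70 * (\<Sum>l\<in>orderings. seven (root_term m) l)"
    unfolding weight_def sum_subtractf sum_distrib_left[symmetric] by simp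
  then show ?thesis
    unfolding c sum_copy[OF m] sum_path_term[OF m] sum_empty_term[OF m] sum_root_term[OF m]
    by (simp add: surplus_def)
qed

lemma weight_cong:
  assumes l: "l \<in> orderings" and mm': "\<And>i j. i \<noteq> j \<Longrightarrow> i < 7 \<Longrightarrow> j < 7 \<Longrightarrow> m i j = m' i j"
  shows "weight m l = weight m' l"
proof -
  have *: "m (l!i) (l!j) = m' (l!i) (l!j)" if "i \<noteq> j" "i < 7" "j < 7" for i j
    using that ordering_nth[OF l] by (intro mm') auto
  show ?thesis
    unfolding weight_def seven_def copy_def paw_def path_term_def empty_term_def root_term_def
    by (simp only: * rel_simps simp_thms zero_neq_numeral numeral_neq_zero zero_neq_one one_neq_zero
       zero_less_numeral zero_less_one one_less_numeral_iff)
qed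

lemma surplus_cong:
  assumes "symmetric m" "symmetric m'" "\<And>i j. i \<noteq> j \<Longrightarrow> i < 7 \<Longrightarrow> j < 7 \<Longrightarrow> m i j = m' i j"
  shows "surplus m = surplus m'"
proof -
  have "(\<Sum>l\<in>orderings. weight m l) = (\<Sum>l\<in>orderings. weight m' l)"
    using assms(3) by (intro sum.cong refl weight_cong)
  then show ?thesis using assms(1,2) by (simp add: sum_weight)
qed

lemma surplus_relabel:
  assumes "symmetric m" "\<sigma> permutes {..<7}"
  shows "surplus (relabel \<sigma> m) = surplus m"
proof -
  have "weight (relabel \<sigma> m) l = weight m (map \<sigma> l)" if "l \<in> orderings" for l
    using length_ordering[OF that]
    by (simp add: weight_def seven_def copy_def paw_def path_term_def empty_term_def root_term_def relabel_def)
  then have "(\<Sum>l\<in>orderings. weight (relabel \<sigma> m) l) = (\<Sum>l\<in>orderings. weight m (map \<sigma> l))"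
    by (intro sum.cong refl)
  also have "\<dots> = (\<Sum>l\<in>orderings. weight m l)" by (rule sum_orderings_relabel[OF assms(2)])
  finally show ?thesis using assms by (simp add: sum_weight symmetric_relabel)
qed

definition realizable :: "(nat \<Rightarrow> nat \<Rightarrow> bool) \<Rightarrow> bool" where
  "realizable m \<longleftrightarrow> (\<exists>\<phi>. (\<forall>i<7. \<phi> i < 8) \<and> (\<forall>i<7. \<forall>j<7. i \<noteq> j \<longrightarrow> m i j = looped_adj (\<phi> i) (\<phi> j)))"

lemma looped_adj_sym: "looped_adj p q = looped_adj q p"
  by (auto simp: looped_adj_def)

lemma embed_rest_sound:
  "embed_rest rs \<phi> \<Longrightarrow> \<exists>\<psi>. length \<psi> = length \<phi> + length rs \<and> take (length \<phi>) \<psi> = \<phi> \<and>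
     (\<forall>k<length rs. \<psi> ! (length \<phi> + k) < 8 \<and>
        list_all2 (\<lambda>b q. b = looped_adj (\<psi> ! (length \<phi> + k)) q) (rs ! k) (take (length \<phi> + k) \<psi>))"
proof (induction rs arbitrary: \<phi>)
  case Nil
  then show ?case by (intro exI[of _ \<phi>]) auto
next
  case (Cons r rs)
  from Cons.prems obtain p where p: "p < 8" "list_all2 (\<lambda>b q. b = looped_adj p q) r \<phi>" "embed_rest rs (\<phi> @ [p])"
  proof -
    from Cons.prems obtain p where "p \<in> set [0,1,2,3,4,5,6,7]"
      "if list_all2 (\<lambda>b q. b = looped_adj p q) r \<phi> then embed_rest rs (\<phi> @ [p]) else False"
      unfolding embed_rest.simps list_ex_iff by blast
    then show ?thesis using that[of p] by (auto split: if_splits)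
  qed
  from Cons.IH[OF p(3)] obtain \<psi> where \<psi>: "length \<psi> = length (\<phi> @ [p]) + length rs"
    "take (length (\<phi> @ [p])) \<psi> = \<phi> @ [p]"
    "\<And>k. k < length rs \<Longrightarrow> \<psi> ! (length (\<phi> @ [p]) + k) < 8 \<and>
        list_all2 (\<lambda>b q. b = looped_adj (\<psi> ! (length (\<phi> @ [p]) + k)) q) (rs ! k) (take (length (\<phi> @ [p]) + k) \<psi>)"
    by blast
  have len: "length \<phi> < length \<psi>" using \<psi>(1) by simp
  have "take (length \<phi>) (take (length (\<phi> @ [p])) \<psi>) = \<phi>" unfolding \<psi>(2) by simp
  then have t: "take (length \<phi>) \<psi> = \<phi>" by (simp add: min_def)
  have "take (length (\<phi> @ [p])) \<psi> ! length \<phi> = p" unfolding \<psi>(2) by simp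
  then have "\<psi> ! length \<phi> = p" by simp
  then have "\<psi> ! (length \<phi> + k) < 8 \<and>
        list_all2 (\<lambda>b q. b = looped_adj (\<psi> ! (length \<phi> + k)) q) ((r # rs) ! k) (take (length \<phi> + k) \<psi>)"
    if "k < length (r # rs)" for k
    using that p(1,2) t \<psi>(3)[of "k - 1"] by (cases k) auto
  then show ?case using t \<psi>(1) by (intro exI[of _ \<psi>]) auto
qed

lemma realizable_rows_of:
  assumes m: "symmetric m" and emb: "embeddable (rows_of 7 m)"
  shows "realizable m"
proof -
  have "embed_rest (rev (rows_of 7 m)) [0]" using emb by (simp add: embeddable_def)
  from embed_rest_sound[OF this] obtain \<psi> where \<psi>: "length \<psi> = 7" "take 1 \<psi> = [0]"
    "\<And>k. k < 6 \<Longrightarrow> \<psi> ! (1 + k) < 8 \<and>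
      list_all2 (\<lambda>b q. b = looped_adj (\<psi> ! (1 + k)) q) (rev (rows_of 7 m) ! k) (take (1 + k) \<psi>)"
    by (auto simp: length_rows_of)
  have row: "rev (rows_of 7 m) ! k = map (m (k + 1)) [0..<k + 1]" if "k < 6" for k
    using that nth_rows_of[of "k + 1" 7 m] by (simp add: rev_nth length_rows_of)
  have "\<psi> ! 0 = 0" using \<psi>(1,2) by (cases \<psi>) auto
  then have lt: "\<psi> ! i < 8" if "i < 7" for i
    using that \<psi>(3)[of "i - 1"] by (cases i) auto
  have adj: "m i j = looped_adj (\<psi> ! i) (\<psi> ! j)" if "j < i" "i < 7" for i j
  proof -
    have "list_all2 (\<lambda>b q. b = looped_adj (\<psi> ! i) q) (map (m i) [0..<i]) (take i \<psi>)"
      using that \<psi>(3)[of "i - 1"] row[of "i - 1"] by (cases i) auto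
    then show ?thesis using that \<psi>(1) by (auto simp: list_all2_conv_all_nth)
  qed
  have "m i j = looped_adj (\<psi> ! i) (\<psi> ! j)" if "i < 7" "j < 7" "i \<noteq> j" for i j
    using that adj[of i j] adj[of j i] symmetricD[OF m, of i j] looped_adj_sym[of "\<psi> ! i" "\<psi> ! j"]
    by (cases "j < i") auto
  then show ?thesis using lt unfolding realizable_def by blast
qed

text \<open>
  The finite part of the upper bound, by inspection of all graphs on seven vertices. The gap between
  blowups and other graphs is the source of all stability results below.
\<close>

theorem surplus_dichotomy:
  assumes m: "symmetric m"
  shows "surplus m \<ge> 0" "realizable m \<or> surplus m \<ge> 41784"
proof -
  have "complete 7 (extensions 6 level_6 symmetries_6)"
    using complete_extensions[OF complete_level_6 _ levels_ok(6)] by simp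
  then obtain \<sigma> where \<sigma>: "\<sigma> permutes {..<7}"
    and r: "rows_of 7 (relabel \<sigma> m) \<in> set (extensions 6 level_6 symmetries_6)"
    using m unfolding complete_def by blast
  let ?m = "relabel \<sigma> m"
  let ?r = "rows_of 7 ?m"
  have sm: "symmetric ?m" using m by (rule symmetric_relabel)
  from r obtain g ps x where gx: "?r = x # g" "(g, ps) \<in> set (zip level_6 symmetries_6)"
    "x \<in> set (bool_lists 6)" "\<not> (if reducible ps x then True else dominated (x # g))"
    unfolding extensions_def set_concat set_map by auto
  have "check_extensions g ps" using all_extensions_checked gx(2) by (auto simp: list_all2_iff)
  then have "check_extension g ps (degrees g) x"
    using gx(3) by (simp add: check_extensions_def check_extensions_from_def list_all_iff)
  moreover have "dominated_by (x # g) (masked_add 1 x (degrees g) @ [count_true x]) = dominated (x # g)"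
    by (simp add: dominated_def)
  ultimately have acc: "acceptable ?r"
    using gx(1,4) unfolding check_extension_def by (metis (full_types))
  have "surplus (mat ?r) = surplus ?m"
    using mat_rows_of[OF sm] by (intro surplus_cong sm) (auto simp: symmetric_def mat_sym)
  then have s: "surplus (mat ?r) = surplus m" using surplus_relabel[OF m \<sigma>] by simp
  have "surplus m = 0 \<and> embeddable ?r \<or> surplus m \<ge> 41784"
    using acc by (simp add: acceptable_def acceptable_surplus_def s split: if_splits)
  moreover have "realizable m" if "embeddable ?r"
  proof -
    from realizable_rows_of[OF sm that] obtain \<phi> where \<phi>: "\<And>i. i < 7 \<Longrightarrow> \<phi> i < 8"
      "\<And>i j. i < 7 \<Longrightarrow> j < 7 \<Longrightarrow> i \<noteq> j \<Longrightarrow> ?m i j = looped_adj (\<phi> i) (\<phi> j)"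
      unfolding realizable_def by blast
    let ?\<tau> = "inv \<sigma>"
    have lt: "?\<tau> i < 7" if "i < 7" for i
      using permutes_in_image[OF permutes_inv[OF \<sigma>], of i] that by simp
    have "m i j = looped_adj (\<phi> (?\<tau> i)) (\<phi> (?\<tau> j))" if "i < 7" "j < 7" "i \<noteq> j" for i j
    proof -
      have "?\<tau> i \<noteq> ?\<tau> j" using permutes_inj[OF permutes_inv[OF \<sigma>]] that(3) by (auto dest: injD)
      then have "?m (?\<tau> i) (?\<tau> j) = looped_adj (\<phi> (?\<tau> i)) (\<phi> (?\<tau> j))" using lt that by (intro \<phi>(2)) auto
      then show ?thesis by (simp add: relabel_def permutes_inverses(1)[OF \<sigma>])
    qed
    moreover have "\<phi> (?\<tau> i) < 8" if "i < 7" for i using lt[OF that] \<phi>(1) by simp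
    ultimately show ?thesis unfolding realizable_def by (intro exI[of _ "\<lambda>i. \<phi> (?\<tau> i)"]) auto
  qed
  ultimately show "surplus m \<ge> 0" "realizable m \<or> surplus m \<ge> 41784" by auto
qed

section \<open>Random vertices of a weighted graph\<close>

text \<open>
  Tuples of vertices are drawn with replacement. A vertex that is drawn twice stands for two
  adjacent twins if it carries a loop, so that a graph with loops behaves like the limit of its
  blowups and the inequality below holds without an error term.
\<close>

definition mean :: "'v set \<Rightarrow> ('v \<Rightarrow> real) \<Rightarrow> ('v \<Rightarrow> real) \<Rightarrow> real" where
  "mean V w f = (\<Sum>x\<in>V. w x * f x)"

definition tuple_mean :: "nat set \<Rightarrow> 'v set \<Rightarrow> ('v \<Rightarrow> real) \<Rightarrow> ((nat \<Rightarrow> 'v) \<Rightarrow> real) \<Rightarrow> real" where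
  "tuple_mean I V w F = (\<Sum>t\<in>PiE I (\<lambda>_. V). (\<Prod>i\<in>I. w (t i)) * F t)"

lemma tuple_mean_insert:
  assumes "finite I" "i \<notin> I" "finite V"
  shows "tuple_mean (insert i I) V w F = mean V w (\<lambda>x. tuple_mean I V w (\<lambda>t. F (t(i := x))))"
proof -
  have inj: "inj_on (\<lambda>(y, g). g(i := y)) (V \<times> PiE I (\<lambda>_. V))"
    using inj_combinator[of i I "\<lambda>_. V"] assms(2) by simp
  have "tuple_mean (insert i I) V w F
      = (\<Sum>(y, g)\<in>V \<times> PiE I (\<lambda>_. V). (\<Prod>j\<in>insert i I. w ((g(i := y)) j)) * F (g(i := y)))"
    unfolding tuple_mean_def PiE_insert_eq by (subst sum.reindex[OF inj]) (simp add: case_prod_beta)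
  also have "\<dots> = (\<Sum>y\<in>V. \<Sum>g\<in>PiE I (\<lambda>_. V). (\<Prod>j\<in>insert i I. w ((g(i := y)) j)) * F (g(i := y)))"
    by (simp add: sum.cartesian_product)
  also have "\<dots> = (\<Sum>y\<in>V. \<Sum>g\<in>PiE I (\<lambda>_. V). w y * ((\<Prod>j\<in>I. w (g j)) * F (g(i := y))))"
  proof (intro sum.cong refl)
    fix y g
    have "(\<Prod>j\<in>I. w ((g(i := y)) j)) = (\<Prod>j\<in>I. w (g j))"
      using assms(2) by (intro prod.cong) auto
    then show "(\<Prod>j\<in>insert i I. w ((g(i := y)) j)) * F (g(i := y)) = w y * ((\<Prod>j\<in>I. w (g j)) * F (g(i := y)))"
      using assms(1,2) by simp
  qed
  finally show ?thesis by (simp add: mean_def tuple_mean_def sum_distrib_left)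
qed

lemma tuple_mean_empty: "tuple_mean {} V w F = F (\<lambda>_. undefined)"
  by (simp add: tuple_mean_def)

lemma tuple_mean_seven:
  assumes "finite V"
  shows "tuple_mean {..<7} V w (\<lambda>t. F (t 0) (t 1) (t 2) (t 3) (t 4) (t 5) (t 6)) =
    mean V w (\<lambda>a. mean V w (\<lambda>b. mean V w (\<lambda>c. mean V w (\<lambda>d. mean V w (\<lambda>f. mean V w (\<lambda>g. mean V w (\<lambda>h.
      F a b c d f g h)))))))"
proof -
  have "{..<7} = insert 0 (insert 1 (insert 2 (insert 3 (insert 4 (insert 5 (insert 6 ({}::nat set)))))))"
    by auto
  then show ?thesis by (simp add: tuple_mean_insert tuple_mean_empty assms)
qed

lemma tuple_mean_permute:
  assumes \<sigma>: "\<sigma> permutes I"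
  shows "tuple_mean I V w (\<lambda>t. F (\<lambda>i\<in>I. t (\<sigma> i))) = tuple_mean I V w F"
  unfolding tuple_mean_def
proof (rule sum.reindex_bij_witness[where j = "\<lambda>t. \<lambda>i\<in>I. t (\<sigma> i)" and i = "\<lambda>t. \<lambda>i\<in>I. t (inv \<sigma> i)"])
  fix t assume t: "t \<in> PiE I (\<lambda>_. V)"
  have in_I: "\<sigma> i \<in> I \<longleftrightarrow> i \<in> I" "inv \<sigma> i \<in> I \<longleftrightarrow> i \<in> I" for i
    using permutes_in_image[OF \<sigma>] permutes_in_image[OF permutes_inv[OF \<sigma>]] by auto
  show "(\<lambda>i\<in>I. (\<lambda>i\<in>I. t (\<sigma> i)) (inv \<sigma> i)) = t"
    using t in_I permutes_inverses[OF \<sigma>] by (auto simp: fun_eq_iff PiE_def extensional_def restrict_def)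
  show "(\<lambda>i\<in>I. t (\<sigma> i)) \<in> PiE I (\<lambda>_. V)" using t in_I by auto
  show "(\<lambda>i\<in>I. (\<lambda>i\<in>I. t (inv \<sigma> i)) (\<sigma> i)) = t"
    using t in_I permutes_inverses[OF \<sigma>] by (auto simp: fun_eq_iff PiE_def extensional_def restrict_def)
  show "(\<lambda>i\<in>I. t (inv \<sigma> i)) \<in> PiE I (\<lambda>_. V)" using t in_I by auto
  have "(\<Prod>i\<in>I. w ((\<lambda>i\<in>I. t (\<sigma> i)) i)) = (\<Prod>i\<in>I. w (t (\<sigma> i)))" by (intro prod.cong) auto
  also have "\<dots> = (\<Prod>i\<in>I. w (t i))" using prod.permute[OF \<sigma>, of "\<lambda>i. w (t i)"] by (simp add: comp_def)
  finally show "(\<Prod>i\<in>I. w ((\<lambda>i\<in>I. t (\<sigma> i)) i)) * F (\<lambda>i\<in>I. t (\<sigma> i)) = (\<Prod>i\<in>I. w (t i)) * F (\<lambda>i\<in>I. t (\<sigma> i))"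
    by simp
qed

lemma mean_mono: "(\<And>x. x \<in> V \<Longrightarrow> 0 \<le> w x) \<Longrightarrow> (\<And>x. x \<in> V \<Longrightarrow> f x \<le> g x) \<Longrightarrow> mean V w f \<le> mean V w g"
  unfolding mean_def by (intro sum_mono mult_left_mono)

lemma mean_nonneg: "(\<And>x. x \<in> V \<Longrightarrow> 0 \<le> w x) \<Longrightarrow> (\<And>x. x \<in> V \<Longrightarrow> 0 \<le> f x) \<Longrightarrow> 0 \<le> mean V w f"
  unfolding mean_def by (intro sum_nonneg mult_nonneg_nonneg)

lemma mean_const: "sum w V = 1 \<Longrightarrow> mean V w (\<lambda>_. c) = c"
  unfolding mean_def by (simp add: sum_distrib_right[symmetric])

lemma mean_cmult: "mean V w (\<lambda>x. c * f x) = c * mean V w f"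
  by (simp add: mean_def sum_distrib_left mult_ac)

lemma mean_diff: "mean V w (\<lambda>x. f x - g x) = mean V w f - mean V w g"
  by (simp add: mean_def sum_subtractf right_diff_distrib)

lemma mean_add: "mean V w (\<lambda>x. f x + g x) = mean V w f + mean V w g"
  by (simp add: mean_def sum.distrib distrib_left)

lemma mean_swap: "mean V w (\<lambda>x. mean V' w' (\<lambda>y. f x y)) = mean V' w' (\<lambda>y. mean V w (\<lambda>x. f x y))"
  unfolding mean_def sum_distrib_left by (subst sum.swap) (simp add: mult_ac)

lemma form_mean_nonneg:
  fixes q :: "nat \<Rightarrow> nat \<Rightarrow> int"
  assumes X: "finite X" and c: "\<And>p. p \<in> X \<Longrightarrow> c p < N"
    and psd: "\<And>z. (\<Sum>i<N. \<Sum>j<N. of_int (q i j) * z i * z j) \<ge> (0::real)"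
  shows "(\<Sum>p\<in>X. \<Sum>r\<in>X. W p * W r * of_int (q (c p) (c r))) \<ge> (0::real)"
proof -
  define z where "z i = (\<Sum>p\<in>X. if c p = i then W p else 0)" for i
  have "(\<Sum>p\<in>X. \<Sum>r\<in>X. W p * W r * of_int (q (c p) (c r)))
      = (\<Sum>p\<in>X. \<Sum>r\<in>X. \<Sum>i<N. \<Sum>j<N. of_int (q i j) * (if c p = i then W p else 0) * (if c r = j then W r else 0))"
  proof (intro sum.cong refl)
    fix p r assume pr: "p \<in> X" "r \<in> X"
    have "(\<Sum>i<N. \<Sum>j<N. of_int (q i j) * (if c p = i then W p else 0) * (if c r = j then W r else 0))
       = (\<Sum>i<N. \<Sum>j<N. if j = c r then (if i = c p then of_int (q i j) * W p * W r else 0) else 0)"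
      by (intro sum.cong refl) auto
    also have "\<dots> = W p * W r * of_int (q (c p) (c r))"
      using c pr by (simp add: sum.delta)
    finally show "W p * W r * of_int (q (c p) (c r)) =
      (\<Sum>i<N. \<Sum>j<N. of_int (q i j) * (if c p = i then W p else 0) * (if c r = j then W r else 0))" by simp
  qed
  also have "\<dots> = (\<Sum>i<N. \<Sum>j<N. of_int (q i j) * z i * z j)"
  proof -
    let ?f = "\<lambda>p r i j. of_int (q i j) * (if c p = i then W p else 0) * (if c r = j then W r else (0::real))"
    have "(\<Sum>p\<in>X. \<Sum>r\<in>X. \<Sum>i<N. \<Sum>j<N. ?f p r i j) = (\<Sum>p\<in>X. \<Sum>i<N. \<Sum>r\<in>X. \<Sum>j<N. ?f p r i j)"
      by (intro sum.cong refl sum.swap)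
    also have "\<dots> = (\<Sum>i<N. \<Sum>p\<in>X. \<Sum>r\<in>X. \<Sum>j<N. ?f p r i j)" by (rule sum.swap)
    also have "\<dots> = (\<Sum>i<N. \<Sum>p\<in>X. \<Sum>j<N. \<Sum>r\<in>X. ?f p r i j)"
      by (intro sum.cong refl sum.swap)
    also have "\<dots> = (\<Sum>i<N. \<Sum>j<N. \<Sum>p\<in>X. \<Sum>r\<in>X. ?f p r i j)"
      by (intro sum.cong refl sum.swap)
    also have "\<dots> = (\<Sum>i<N. \<Sum>j<N. of_int (q i j) * z i * z j)"
      unfolding z_def mult.assoc sum_product unfolding sum_distrib_left ..
    finally show ?thesis .
  qed
  also have "\<dots> \<ge> 0" by (rule psd)
  finally show ?thesis .
qed

section \<open>The upper bound\<close>

lemma lookup_in_set: "length t = 2 ^ length bs \<Longrightarrow> lookup bs t \<in> set t"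
proof (induction bs arbitrary: t)
  case Nil
  then show ?case by (cases t) auto
next
  case (Cons b bs)
  have "lookup bs (if b then drop (2 ^ length bs) t else take (2 ^ length bs) t)
      \<in> set (if b then drop (2 ^ length bs) t else take (2 ^ length bs) t)"
    using Cons.prems by (intro Cons.IH) auto
  then show ?case using set_drop_subset set_take_subset by (fastforce split: if_splits)
qed

lemma class_less:
  "length bs = 6 \<Longrightarrow> class_1 bs < 20"
  "length bs = 7 \<Longrightarrow> class_E bs < 26"
  "length bs = 7 \<Longrightarrow> class_P bs < 48"
proof -
  have "list_all (\<lambda>v. v < 20) classes_1" "list_all (\<lambda>v. v < 26) classes_E" "list_all (\<lambda>v. v < 48) classes_P"
    by code_simp+
  moreover have "length bs = 6 \<Longrightarrow> lookup bs classes_1 \<in> set classes_1"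
    "length bs = 7 \<Longrightarrow> lookup bs classes_E \<in> set classes_E"
    "length bs = 7 \<Longrightarrow> lookup bs classes_P \<in> set classes_P"
    using length_classes by (auto intro!: lookup_in_set)
  ultimately show "length bs = 6 \<Longrightarrow> class_1 bs < 20"
    "length bs = 7 \<Longrightarrow> class_E bs < 26" "length bs = 7 \<Longrightarrow> class_P bs < 48"
    by (auto simp: class_1_def class_E_def class_P_def list_all_iff)
qed

lemma form_1_checks: "triangular form_1" "length form_1 = Suc 19" "length kernel_1 = Suc 19" "kernel_1 ! 19 \<noteq> 0"
  "list_all (\<lambda>i. sum_list (map2 (*) (map (entry form_1 i) [0..<Suc 19]) kernel_1) = 0) [0..<Suc 19]"
  "gram_check (map (map ((*) 64)) (map butlast (butlast form_1))) gram_1"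
  by code_simp+

lemma form_E_checks: "triangular form_E" "length form_E = Suc 25" "length kernel_E = Suc 25" "kernel_E ! 25 \<noteq> 0"
  "list_all (\<lambda>i. sum_list (map2 (*) (map (entry form_E i) [0..<Suc 25]) kernel_E) = 0) [0..<Suc 25]"
  "gram_check (map (map ((*) 64)) (map butlast (butlast form_E))) gram_E"
  by code_simp+

lemma form_P_checks: "triangular form_P" "length form_P = Suc 47" "length kernel_P = Suc 47" "kernel_P ! 47 \<noteq> 0"
  "list_all (\<lambda>i. sum_list (map2 (*) (map (entry form_P i) [0..<Suc 47]) kernel_P) = 0) [0..<Suc 47]"
  "gram_check (map (map ((*) 576)) (map butlast (butlast form_P))) gram_P"
  by code_simp+

lemma value_nonneg:
  "(\<Sum>i<20. \<Sum>j<20. of_int (value_1 i j) * z i * z j) \<ge> (0::real)"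
  "(\<Sum>i<26. \<Sum>j<26. of_int (value_E i j) * z i * z j) \<ge> (0::real)"
  "(\<Sum>i<48. \<Sum>j<48. of_int (value_P i j) * z i * z j) \<ge> (0::real)"
proof -
  have "Suc 19 = 20" "Suc 25 = 26" "Suc 47 = 48" by simp_all
  then show "(\<Sum>i<20. \<Sum>j<20. of_int (value_1 i j) * z i * z j) \<ge> (0::real)"
    "(\<Sum>i<26. \<Sum>j<26. of_int (value_E i j) * z i * z j) \<ge> (0::real)"
    "(\<Sum>i<48. \<Sum>j<48. of_int (value_P i j) * z i * z j) \<ge> (0::real)"
    using form_nonneg[OF form_1_checks, of z] form_nonneg[OF form_E_checks, of z] form_nonneg[OF form_P_checks, of z]
    by (simp_all only: value_1_def value_E_def value_P_def zero_less_numeral simp_thms HOL.True_implies_equals)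
qed

definition induces_blowup :: "('v \<Rightarrow> 'v \<Rightarrow> bool) \<Rightarrow> 'v list \<Rightarrow> bool" where
  "induces_blowup e xs \<longleftrightarrow> (\<exists>\<phi>. (\<forall>i<length xs. \<phi> i < (8::nat)) \<and>
     (\<forall>i<length xs. \<forall>j<length xs. i \<noteq> j \<longrightarrow> e (xs!i) (xs!j) = looped_adj (\<phi> i) (\<phi> j)))"

locale weighted_graph =
  fixes V :: "'v set" and w :: "'v \<Rightarrow> real" and e :: "'v \<Rightarrow> 'v \<Rightarrow> bool"
  assumes finite_V: "finite V" and w_nonneg: "\<And>x. x \<in> V \<Longrightarrow> 0 \<le> w x" and w_sum: "sum w V = 1"
    and e_sym: "e x y = e y x"
begin

abbreviation M :: "('v \<Rightarrow> real) \<Rightarrow> real" where "M \<equiv> mean V w"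

definition copy_density :: real where
  "copy_density = M (\<lambda>a. M (\<lambda>b. M (\<lambda>c. M (\<lambda>d. M (\<lambda>u. M (\<lambda>v. of_bool (copy e a b c d u v)))))))"

text \<open>The probability that seven random vertices do not look like part of a blowup.\<close>

definition defect :: real where
  "defect = M (\<lambda>a. M (\<lambda>b. M (\<lambda>c. M (\<lambda>d. M (\<lambda>f. M (\<lambda>g. M (\<lambda>h. of_bool (\<not> induces_blowup e [a,b,c,d,f,g,h])))))))) "

lemma M2: "M (\<lambda>x. M (\<lambda>y. f x y)) = (\<Sum>p\<in>V \<times> V. w (fst p) * w (snd p) * f (fst p) (snd p))"
  by (simp add: mean_def sum.cartesian_product sum_distrib_left case_prod_beta mult.assoc)

lemma M3: "M (\<lambda>x. M (\<lambda>y. M (\<lambda>z. f x y z))) =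
  (\<Sum>p\<in>V \<times> V \<times> V. w (fst p) * w (fst (snd p)) * w (snd (snd p)) * f (fst p) (fst (snd p)) (snd (snd p)))"
  by (simp add: mean_def sum.cartesian_product sum_distrib_left case_prod_beta mult.assoc)

lemma path_term_nonneg:
  "M (\<lambda>x. M (\<lambda>y. M (\<lambda>u. M (\<lambda>v. of_int (path_term e a b c x y u v))))) \<ge> 0"
proof (cases "e a b \<and> e a c \<and> \<not> e b c")
  case True
  define C where "C p = class_P [e a (fst p), e b (fst p), e c (fst p), e a (snd p), e b (snd p), e c (snd p), e (fst p) (snd p)]" for p
  define W where "W p = w (fst p) * w (snd p)" for p
  have "M (\<lambda>x. M (\<lambda>y. M (\<lambda>u. M (\<lambda>v. of_int (path_term e a b c x y u v)))))
     = (\<Sum>p\<in>V \<times> V. \<Sum>r\<in>V \<times> V. W p * W r * of_int (value_P (C p) (C r)))"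
    using True by (simp add: path_term_def M2 W_def C_def sum_distrib_left mult.assoc)
  also have "\<dots> \<ge> 0"
    by (rule form_mean_nonneg[where N = 48]) (auto simp: finite_V C_def value_nonneg class_less)
  finally show ?thesis .
qed (auto simp: path_term_def mean_def)

lemma empty_term_nonneg:
  "M (\<lambda>x. M (\<lambda>y. M (\<lambda>u. M (\<lambda>v. of_int (empty_term e a b c x y u v))))) \<ge> 0"
proof (cases "\<not> e a b \<and> \<not> e a c \<and> \<not> e b c")
  case True
  define C where "C p = class_E [e a (fst p), e b (fst p), e c (fst p), e a (snd p), e b (snd p), e c (snd p), e (fst p) (snd p)]" for p
  define W where "W p = w (fst p) * w (snd p)" for p
  have "M (\<lambda>x. M (\<lambda>y. M (\<lambda>u. M (\<lambda>v. of_int (empty_term e a b c x y u v)))))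
     = (\<Sum>p\<in>V \<times> V. \<Sum>r\<in>V \<times> V. W p * W r * of_int (value_E (C p) (C r)))"
    using True by (simp add: empty_term_def M2 W_def C_def sum_distrib_left mult.assoc)
  also have "\<dots> \<ge> 0"
    by (rule form_mean_nonneg[where N = 26]) (auto simp: finite_V C_def value_nonneg class_less)
  finally show ?thesis .
qed (auto simp: empty_term_def mean_def)

lemma root_term_nonneg:
  "M (\<lambda>x. M (\<lambda>y. M (\<lambda>z. M (\<lambda>u. M (\<lambda>v. M (\<lambda>s. of_int (root_term e r x y z u v s))))))) \<ge> 0"
proof -
  define C where "C p = class_1 [e r (fst p), e r (fst (snd p)), e r (snd (snd p)),
     e (fst p) (fst (snd p)), e (fst p) (snd (snd p)), e (fst (snd p)) (snd (snd p))]" for p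
  define W where "W p = w (fst p) * w (fst (snd p)) * w (snd (snd p))" for p
  have "M (\<lambda>x. M (\<lambda>y. M (\<lambda>z. M (\<lambda>u. M (\<lambda>v. M (\<lambda>s. of_int (root_term e r x y z u v s)))))))
     = (\<Sum>p\<in>V \<times> V \<times> V. \<Sum>p'\<in>V \<times> V \<times> V. W p * W p' * of_int (value_1 (C p) (C p')))"
    by (simp add: root_term_def M3 W_def C_def sum_distrib_left mult.assoc)
  also have "\<dots> \<ge> 0"
    by (rule form_mean_nonneg[where N = 20]) (auto simp: finite_V C_def value_nonneg class_less)
  finally show ?thesis .
qed

definition pattern :: "(nat \<Rightarrow> 'v) \<Rightarrow> nat \<Rightarrow> nat \<Rightarrow> bool" where
  "pattern t i j = e (t i) (t j)"

lemma symmetric_pattern: "symmetric (pattern t)"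
  by (auto simp: symmetric_def pattern_def e_sym)

lemma realizable_pattern:
  "realizable (pattern t) \<longleftrightarrow> induces_blowup e [t 0, t 1, t 2, t 3, t 4, t 5, t 6]"
proof -
  have "[t 0, t 1, t 2, t 3, t 4, t 5, t 6] ! i = t i" if "i < 7" for i
    using that by (auto simp: less_Suc_eq numeral_eq_Suc)
  moreover have len: "length [t 0, t 1, t 2, t 3, t 4, t 5, t 6] = 7" by simp
  ultimately show ?thesis
    unfolding realizable_def induces_blowup_def len by (auto simp: pattern_def)
qed

lemma weight_pattern_mean:
  assumes l: "l \<in> orderings"
  shows "tuple_mean {..<7} V w (\<lambda>t. of_int (weight (pattern t) l))
       = tuple_mean {..<7} V w (\<lambda>t. of_int (weight (pattern t) [0,1,2,3,4,5,6]))"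
proof -
  have len: "length l = 7" by (rule length_ordering[OF l])
  define \<sigma> where "\<sigma> i = (if i < 7 then l ! i else i)" for i
  have "bij_betw (\<lambda>i. l ! i) {..<7} {..<7}"
    using l len by (intro bij_betw_nth) (auto dest: permutations_of_setD)
  then have "bij_betw \<sigma> {..<7} {..<7}" by (rule bij_betw_cong[THEN iffD1, rotated]) (auto simp: \<sigma>_def)
  then have \<sigma>: "\<sigma> permutes {..<7}" by (rule bij_imp_permutes) (simp add: \<sigma>_def)
  have "weight (pattern (\<lambda>i\<in>{..<7}. t (\<sigma> i))) [0,1,2,3,4,5,6] = weight (pattern t) l" for t
  proof -
    have *: "(\<lambda>i\<in>{..<7}. t (\<sigma> i)) i = t (l ! i)" if "i < 7" for i using that by (simp add: \<sigma>_def)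
    show ?thesis
      unfolding weight_def seven_def copy_def paw_def path_term_def empty_term_def root_term_def pattern_def nth_numeral_rules
      by (simp only: * zero_less_numeral one_less_numeral_iff rel_simps)
  qed
  then show ?thesis
    using tuple_mean_permute[OF \<sigma>, of V w "\<lambda>t. of_int (weight (pattern t) [0,1,2,3,4,5,6])"] by simp
qed

text \<open>
  The averages of the three quadratic terms are averages of nonnegative forms, whereas averaging over all
  orderings of the seven vertices turns their combination with the copies into the surplus.
\<close>

theorem copy_density_bound: "74317824000 * copy_density + 41784 * defect \<le> 54432000"
proof -
  let ?T = "tuple_mean {..<7} V w"
  let ?id = "[0,1,2,3,4,5,6::nat]"
  have lin: "?T (\<lambda>t. \<Sum>l\<in>X. F l t) = (\<Sum>l\<in>X. ?T (F l))" if "finite X" for X :: "nat list set" and F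
    unfolding tuple_mean_def by (subst sum.swap) (simp add: sum_distrib_left)
  have mono: "?T F \<le> ?T G" if "\<And>t. F t \<le> G t" for F G
    unfolding tuple_mean_def using that w_nonneg by (intro sum_mono mult_left_mono prod_nonneg) (auto simp: PiE_iff)
  have "defect = ?T (\<lambda>t. of_bool (\<not> induces_blowup e [t 0, t 1, t 2, t 3, t 4, t 5, t 6]))"
    unfolding defect_def by (rule tuple_mean_seven[OF finite_V, symmetric])
  then have "5040 * 41784 * defect = ?T (\<lambda>t. 5040 * 41784 * of_bool (\<not> realizable (pattern t)))"
    unfolding realizable_pattern tuple_mean_def by (simp only: sum_distrib_left mult_ac)
  also have "\<dots> \<le> ?T (\<lambda>t. of_int (5040 * surplus (pattern t)))"
  proof (rule mono)
    fix t
    have "41784 * of_bool (\<not> realizable (pattern t)) \<le> surplus (pattern t)"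
      using surplus_dichotomy[OF symmetric_pattern, of t] by auto
    then show "5040 * 41784 * of_bool (\<not> realizable (pattern t)) \<le> real_of_int (5040 * surplus (pattern t))"
      by (cases "realizable (pattern t)") auto
  qed
  also have "\<dots> = ?T (\<lambda>t. \<Sum>l\<in>orderings. of_int (weight (pattern t) l))"
    by (simp only: sum_weight[OF symmetric_pattern, symmetric] of_int_sum)
  also have "\<dots> = (\<Sum>l\<in>orderings. ?T (\<lambda>t. of_int (weight (pattern t) l)))"
    by (rule lin) simp
  also have "\<dots> = (\<Sum>l\<in>orderings. ?T (\<lambda>t. of_int (weight (pattern t) ?id)))"
    by (intro sum.cong refl weight_pattern_mean)
  also have "\<dots> = 5040 * ?T (\<lambda>t. of_int (weight (pattern t) ?id))"
    by (simp add: fact_numeral)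
  finally have "41784 * defect \<le> ?T (\<lambda>t. of_int (weight (pattern t) ?id))" by simp
  also have "\<dots> = ?T (\<lambda>t. 54432000 - 74317824000 * of_bool (copy e (t 0) (t 1) (t 2) (t 3) (t 4) (t 5))
     - 315 * of_int (path_term e (t 0) (t 1) (t 2) (t 3) (t 4) (t 5) (t 6))
     - 105 * of_int (empty_term e (t 0) (t 1) (t 2) (t 3) (t 4) (t 5) (t 6))
     - 70 * of_int (root_term e (t 0) (t 1) (t 2) (t 3) (t 4) (t 5) (t 6)))"
    unfolding weight_def seven_def copy_def paw_def path_term_def empty_term_def root_term_def pattern_def nth_numeral_rules
    by simp
  also have "\<dots> = M (\<lambda>a. M (\<lambda>b. M (\<lambda>c. M (\<lambda>d. M (\<lambda>f. M (\<lambda>g. M (\<lambda>h.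
       54432000 - 74317824000 * of_bool (copy e a b c d f g)
     - 315 * of_int (path_term e a b c d f g h) - 105 * of_int (empty_term e a b c d f g h)
     - 70 * of_int (root_term e a b c d f g h))))))))"
    by (rule tuple_mean_seven[OF finite_V, of w "\<lambda>a b c d f g h.
       54432000 - 74317824000 * of_bool (copy e a b c d f g)
     - 315 * of_int (path_term e a b c d f g h) - 105 * of_int (empty_term e a b c d f g h)
     - 70 * of_int (root_term e a b c d f g h)"])
  also have "\<dots> = 54432000 - 74317824000 * copy_density
     - 315 * M (\<lambda>a. M (\<lambda>b. M (\<lambda>c. M (\<lambda>d. M (\<lambda>f. M (\<lambda>g. M (\<lambda>h. of_int (path_term e a b c d f g h))))))))
     - 105 * M (\<lambda>a. M (\<lambda>b. M (\<lambda>c. M (\<lambda>d. M (\<lambda>f. M (\<lambda>g. M (\<lambda>h. of_int (empty_term e a b c d f g h))))))))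
     - 70 * M (\<lambda>a. M (\<lambda>b. M (\<lambda>c. M (\<lambda>d. M (\<lambda>f. M (\<lambda>g. M (\<lambda>h. of_int (root_term e a b c d f g h))))))))"
    by (simp add: mean_diff mean_cmult mean_const[OF w_sum] copy_density_def)
  also have "\<dots> \<le> 54432000 - 74317824000 * copy_density"
  proof -
    have "0 \<le> M (\<lambda>a. M (\<lambda>b. M (\<lambda>c. M (\<lambda>d. M (\<lambda>f. M (\<lambda>g. M (\<lambda>h. of_int (path_term e a b c d f g h))))))))"
      "0 \<le> M (\<lambda>a. M (\<lambda>b. M (\<lambda>c. M (\<lambda>d. M (\<lambda>f. M (\<lambda>g. M (\<lambda>h. of_int (empty_term e a b c d f g h))))))))"
      "0 \<le> M (\<lambda>a. M (\<lambda>b. M (\<lambda>c. M (\<lambda>d. M (\<lambda>f. M (\<lambda>g. M (\<lambda>h. of_int (root_term e a b c d f g h))))))))"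
      by (intro mean_nonneg w_nonneg path_term_nonneg empty_term_nonneg root_term_nonneg; assumption)+
    then show ?thesis by linarith
  qed
  finally show ?thesis by simp
qed

end

section \<open>Recognising the parts of a blowup\<close>

definition class3 :: "bool \<Rightarrow> bool \<Rightarrow> bool \<Rightarrow> nat" where
  "class3 a b c = (if b then (if a then (if c then 1 else 0) else (if c then 2 else 4))
                   else (if a \<and> c then 3 else 4))"

definition seed :: "('v \<Rightarrow> 'v \<Rightarrow> bool) \<Rightarrow> 'v \<Rightarrow> 'v \<Rightarrow> 'v \<Rightarrow> bool" where
  "seed e a b c \<longleftrightarrow> e a b \<and> e b c \<and> \<not> e a c"

text \<open>
  An induced path \<open>a b c\<close> of a blowup occupies three consecutive parts of one of the two cycles.
  The adjacencies to the path determine which of the four parts of this cycle a vertex belongs to,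
  if any; the class \<open>4\<close> stands for the other cycle.
\<close>

definition class_of :: "('v \<Rightarrow> 'v \<Rightarrow> bool) \<Rightarrow> 'v \<Rightarrow> 'v \<Rightarrow> 'v \<Rightarrow> 'v \<Rightarrow> nat" where
  "class_of e a b c x = class3 (e x a) (e x b) (e x c)"

lemma class3_le: "class3 a b c \<le> 4"
  by (simp add: class3_def)

lemma looped_adj_refl [simp]: "looped_adj p p"
  by (simp add: looped_adj_def)

text \<open>The two facts about \<open>B27\<close> behind the recognition, verified for all placements of the vertices.\<close>

lemma seed_classes_check:
  "list_all (\<lambda>f0. list_all (\<lambda>f1. list_all (\<lambda>f2.
     if looped_adj f0 f1 \<and> looped_adj f1 f2 \<and> \<not> looped_adj f0 f2 then
       list_all (\<lambda>f. list_all (\<lambda>g.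
         (let p = class3 (looped_adj f f0) (looped_adj f f1) (looped_adj f f2);
              q = class3 (looped_adj g f0) (looped_adj g f1) (looped_adj g f2)
          in looped_adj f f0 = looped_adj p 0 \<and> looped_adj f f1 = looped_adj p 1 \<and> looped_adj f f2 = looped_adj p 2 \<and>
             (p < 4 \<or> q < 4 \<longrightarrow> looped_adj f g = looped_adj p q))) [0..<8]) [0..<8]
     else True) [0..<8]) [0..<8]) [0..<8]"
  by code_simp

lemma seed_classes_check2:
  "list_all (\<lambda>f0. list_all (\<lambda>f1. list_all (\<lambda>f2.
     if looped_adj f0 f1 \<and> looped_adj f1 f2 \<and> \<not> looped_adj f0 f2 then
       list_all (\<lambda>g0. if looped_adj g0 f0 \<or> looped_adj g0 f1 \<or> looped_adj g0 f2 then True else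
        list_all (\<lambda>g1. if \<not> looped_adj g0 g1 then True else list_all (\<lambda>g2. if looped_adj g0 g2 \<or> \<not> looped_adj g1 g2 then True else
        list_all (\<lambda>f. (class3 (looped_adj f f0) (looped_adj f f1) (looped_adj f f2) < 4) \<noteq>
            (class3 (looped_adj f g0) (looped_adj f g1) (looped_adj f g2) < 4)) [0..<8]) [0..<8]) [0..<8]) [0..<8]
     else True) [0..<8]) [0..<8]) [0..<8]"
  by code_simp

lemma length_five: "length [a, b, c, d, f] = 5"
  and length_seven: "length [a, b, c, d, f, g, h] = 7"
  by simp_all

text \<open>
  The classes with respect to a seed also determine the adjacency of two vertices unless both are
  in the other cycle, so a failure of this shows within five vertices.
\<close>

lemma seed_determines:
  assumes e: "\<And>x y. e x y = e y x" and good: "induces_blowup e [a,b,c,x,y]" and seed: "seed e a b c"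
  defines "p \<equiv> class_of e a b c x" and "q \<equiv> class_of e a b c y"
  shows "e x a = looped_adj p 0" "e x b = looped_adj p 1" "e x c = looped_adj p 2"
    and "p < 4 \<or> q < 4 \<Longrightarrow> e x y = looped_adj p q"
proof -
  obtain \<phi> where lt: "\<forall>i<5. \<phi> i < (8::nat)"
    and adj: "\<forall>i<5. \<forall>j<5. i \<noteq> j \<longrightarrow> e ([a,b,c,x,y]!i) ([a,b,c,x,y]!j) = looped_adj (\<phi> i) (\<phi> j)"
    using good[unfolded induces_blowup_def, unfolded length_five] by blast
  have E: "e a b = looped_adj (\<phi> 0) (\<phi> 1)" "e b c = looped_adj (\<phi> 1) (\<phi> 2)" "e a c = looped_adj (\<phi> 0) (\<phi> 2)"
    "e x a = looped_adj (\<phi> 3) (\<phi> 0)" "e x b = looped_adj (\<phi> 3) (\<phi> 1)" "e x c = looped_adj (\<phi> 3) (\<phi> 2)"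
    "e y a = looped_adj (\<phi> 4) (\<phi> 0)" "e y b = looped_adj (\<phi> 4) (\<phi> 1)" "e y c = looped_adj (\<phi> 4) (\<phi> 2)"
    "e x y = looped_adj (\<phi> 3) (\<phi> 4)"
    using adj[rule_format, of 0 1] adj[rule_format, of 1 2] adj[rule_format, of 0 2]
      adj[rule_format, of 3 0] adj[rule_format, of 3 1] adj[rule_format, of 3 2]
      adj[rule_format, of 4 0] adj[rule_format, of 4 1] adj[rule_format, of 4 2] adj[rule_format, of 3 4]
    by simp_all
  have "looped_adj (\<phi> 0) (\<phi> 1) \<and> looped_adj (\<phi> 1) (\<phi> 2) \<and> \<not> looped_adj (\<phi> 0) (\<phi> 2)"
    using seed by (simp add: seed_def E)
  moreover have "\<phi> 0 \<in> set [0..<8]" "\<phi> 1 \<in> set [0..<8]" "\<phi> 2 \<in> set [0..<8]" "\<phi> 3 \<in> set [0..<8]" "\<phi> 4 \<in> set [0..<8]"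
    using lt by (auto simp del: upt_Suc)
  ultimately have "e x a = looped_adj p 0 \<and> e x b = looped_adj p 1 \<and> e x c = looped_adj p 2 \<and>
      (p < 4 \<or> q < 4 \<longrightarrow> e x y = looped_adj p q)"
    using seed_classes_check[unfolded list_all_iff Let_def]
    unfolding p_def q_def class_of_def E by (metis (no_types, lifting))
  then show "e x a = looped_adj p 0" "e x b = looped_adj p 1" "e x c = looped_adj p 2"
    "p < 4 \<or> q < 4 \<Longrightarrow> e x y = looped_adj p q" by auto
qed

text \<open>
  As the vertex \<open>a'\<close> has no neighbour on the first path, it is in the other cycle, and so is the
  whole second path.
\<close>

definition two_seeds :: "('v \<Rightarrow> 'v \<Rightarrow> bool) \<Rightarrow> 'v \<Rightarrow> 'v \<Rightarrow> 'v \<Rightarrow> 'v \<Rightarrow> 'v \<Rightarrow> 'v \<Rightarrow> bool" where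
  "two_seeds e a b c a' b' c' \<longleftrightarrow> seed e a b c \<and> seed e a' b' c' \<and>
     \<not> e a' a \<and> \<not> e a' b \<and> \<not> e a' c"

lemma two_seeds_exclusive:
  assumes good: "induces_blowup e [a,b,c,a',b',c',x]" and seeds: "two_seeds e a b c a' b' c'"
  shows "(class_of e a b c x < 4) \<noteq> (class_of e a' b' c' x < 4)"
proof -
  obtain \<phi> where lt: "\<forall>i<7. \<phi> i < (8::nat)"
    and adj: "\<forall>i<7. \<forall>j<7. i \<noteq> j \<longrightarrow> e ([a,b,c,a',b',c',x]!i) ([a,b,c,a',b',c',x]!j) = looped_adj (\<phi> i) (\<phi> j)"
    using good[unfolded induces_blowup_def, unfolded length_seven] by blast
  have E: "e a b = looped_adj (\<phi> 0) (\<phi> 1)" "e b c = looped_adj (\<phi> 1) (\<phi> 2)" "e a c = looped_adj (\<phi> 0) (\<phi> 2)"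
    "e a' b' = looped_adj (\<phi> 3) (\<phi> 4)" "e b' c' = looped_adj (\<phi> 4) (\<phi> 5)" "e a' c' = looped_adj (\<phi> 3) (\<phi> 5)"
    "e a' a = looped_adj (\<phi> 3) (\<phi> 0)" "e a' b = looped_adj (\<phi> 3) (\<phi> 1)" "e a' c = looped_adj (\<phi> 3) (\<phi> 2)"
    "e x a = looped_adj (\<phi> 6) (\<phi> 0)" "e x b = looped_adj (\<phi> 6) (\<phi> 1)" "e x c = looped_adj (\<phi> 6) (\<phi> 2)"
    "e x a' = looped_adj (\<phi> 6) (\<phi> 3)" "e x b' = looped_adj (\<phi> 6) (\<phi> 4)" "e x c' = looped_adj (\<phi> 6) (\<phi> 5)"
    using adj[rule_format, of 0 1] adj[rule_format, of 1 2] adj[rule_format, of 0 2]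
      adj[rule_format, of 3 4] adj[rule_format, of 4 5] adj[rule_format, of 3 5]
      adj[rule_format, of 3 0] adj[rule_format, of 3 1] adj[rule_format, of 3 2]
      adj[rule_format, of 6 0] adj[rule_format, of 6 1] adj[rule_format, of 6 2]
      adj[rule_format, of 6 3] adj[rule_format, of 6 4] adj[rule_format, of 6 5]
    by simp_all
  have S: "looped_adj (\<phi> 0) (\<phi> 1) \<and> looped_adj (\<phi> 1) (\<phi> 2) \<and> \<not> looped_adj (\<phi> 0) (\<phi> 2)"
    "looped_adj (\<phi> 3) (\<phi> 4)" "looped_adj (\<phi> 4) (\<phi> 5)" "\<not> looped_adj (\<phi> 3) (\<phi> 5)"
    "\<not> (looped_adj (\<phi> 3) (\<phi> 0) \<or> looped_adj (\<phi> 3) (\<phi> 1) \<or> looped_adj (\<phi> 3) (\<phi> 2))"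
    using seeds by (auto simp: two_seeds_def seed_def E)
  have I: "\<phi> i \<in> set [0..<8]" if "i < 7" for i
    using lt that by (auto simp del: upt_Suc)
  have "list_all (\<lambda>g0. if looped_adj g0 (\<phi> 0) \<or> looped_adj g0 (\<phi> 1) \<or> looped_adj g0 (\<phi> 2) then True else
        list_all (\<lambda>g1. if \<not> looped_adj g0 g1 then True else list_all (\<lambda>g2. if looped_adj g0 g2 \<or> \<not> looped_adj g1 g2 then True else
        list_all (\<lambda>f. (class3 (looped_adj f (\<phi> 0)) (looped_adj f (\<phi> 1)) (looped_adj f (\<phi> 2)) < 4) \<noteq>
            (class3 (looped_adj f g0) (looped_adj f g1) (looped_adj f g2) < 4)) [0..<8]) [0..<8]) [0..<8]) [0..<8]"
    using seed_classes_check2[unfolded list_all_iff[of _ "[0..<8]"], rule_format, OF I I I, of 0 1 2] S(1)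
    unfolding list_all_iff by (simp del: upt_Suc set_upt)
  note * = this[unfolded list_all_iff]
  have I': "\<phi> 3 \<in> set [0..<8]" "\<phi> 4 \<in> set [0..<8]" "\<phi> 5 \<in> set [0..<8]" "\<phi> 6 \<in> set [0..<8]"
    by (rule I, simp)+
  show ?thesis
    using bspec[OF bspec[OF bspec[OF bspec[OF * I'(1), unfolded if_not_P[OF S(5)]] I'(2),
      simplified S(2) not_True_eq_False if_False] I'(3), simplified S(3,4) not_True_eq_False disj_not1 simp_thms if_False] I'(4)]
    unfolding class_of_def E by blast
qed

lemma induces_blowup_sub:
  assumes "induces_blowup e xs" "distinct is" "set is \<subseteq> {..<length xs}"
  shows "induces_blowup e (map ((!) xs) is)"
proof -
  obtain \<phi> where \<phi>: "\<forall>i<length xs. \<phi> i < (8::nat)"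
    "\<forall>i<length xs. \<forall>j<length xs. i \<noteq> j \<longrightarrow> e (xs!i) (xs!j) = looped_adj (\<phi> i) (\<phi> j)"
    using assms(1) unfolding induces_blowup_def by blast
  have "is ! i < length xs" if "i < length is" for i
    using assms(3) that nth_mem by (metis lessThan_iff subsetD)
  then show ?thesis
    using \<phi> assms(2) unfolding induces_blowup_def
    by (intro exI[of _ "\<lambda>i. \<phi> (is ! i)"]) (auto simp: nth_eq_iff_index_eq)
qed


section \<open>Copies in blowups\<close>

definition pattern_density :: "(nat \<Rightarrow> real) \<Rightarrow> real" where
  "pattern_density x = (let M = mean {..<8} x in
     M (\<lambda>a. M (\<lambda>b. M (\<lambda>c. M (\<lambda>d. M (\<lambda>u. M (\<lambda>v. of_bool (copy looped_adj a b c d u v))))))))"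

definition opposite :: "nat \<Rightarrow> nat" where
  "opposite i = (if i mod 4 < 2 then i + 2 else i - 2)"

text \<open>
  A copy of the paw in a blowup occupies three consecutive parts of one cycle, with the vertex of
  degree three in the middle part and the triangle over two of the parts; the remaining edge lies
  in the other cycle.
\<close>

lemma copy_looped_adj:
  assumes "a < 8" "b < 8" "c < 8" "d < 8" "u < 8" "v < 8"
  shows "copy looped_adj a b c d u v \<longleftrightarrow>
    d = b \<and> c = opposite b \<and> looped_adj a b \<and> a \<noteq> b \<and> (u < 4) \<noteq> (a < 4) \<and> looped_adj u v"
proof -
  have paws: "list_all (\<lambda>a. list_all (\<lambda>b. if looped_adj a b then list_all (\<lambda>d. if looped_adj a d \<and> looped_adj b d then
      list_all (\<lambda>c. paw looped_adj a b c d = (d = b \<and> c = opposite b \<and> a \<noteq> b)) [0..<8] else d \<noteq> b) [0..<8] else True) [0..<8]) [0..<8]"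
    by code_simp
  have edges: "list_all (\<lambda>a. list_all (\<lambda>b. if looped_adj a b \<and> a \<noteq> b then list_all (\<lambda>u. list_all (\<lambda>v. if looped_adj u v then
      (\<not> looped_adj u a \<and> \<not> looped_adj u b \<and> \<not> looped_adj u (opposite b) \<and> \<not> looped_adj v a \<and> \<not> looped_adj v b \<and> \<not> looped_adj v (opposite b))
      = ((u < 4) \<noteq> (a < 4)) else True) [0..<8]) [0..<8] else True) [0..<8]) [0..<8]"
    by code_simp
  have I: "a \<in> set [0..<8]" "b \<in> set [0..<8]" "c \<in> set [0..<8]" "d \<in> set [0..<8]" "u \<in> set [0..<8]" "v \<in> set [0..<8]"
    using assms by auto
  note paws' = bspec[OF bspec[OF paws[unfolded list_all_iff] I(1)] I(2)]
  note edges' = bspec[OF bspec[OF edges[unfolded list_all_iff] I(1)] I(2)]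
  have P: "paw looped_adj a b c d = (d = b \<and> c = opposite b \<and> looped_adj a b \<and> a \<noteq> b)"
  proof (cases "looped_adj a b")
    case True
    note * = bspec[OF paws'[unfolded if_P[OF True]] I(4)]
    show ?thesis
    proof (cases "looped_adj a d \<and> looped_adj b d")
      case t: True
      show ?thesis using bspec[OF *[unfolded if_P[OF t]] I(3)] True by blast
    next
      case False
      have "d \<noteq> b" using *[unfolded if_not_P[OF False]] .
      then show ?thesis using False unfolding paw_def by blast
    qed
  qed (simp add: paw_def)
  show ?thesis
  proof (cases "looped_adj a b \<and> a \<noteq> b \<and> looped_adj u v")
    case True
    then have t: "looped_adj a b \<and> a \<noteq> b" and uv: "looped_adj u v" by auto
    show ?thesis
      using bspec[OF bspec[OF edges'[unfolded if_P[OF t]] I(5)] I(6), unfolded if_P[OF uv]] True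
      unfolding copy_def P by blast
  qed (auto simp: copy_def P)
qed

lemma mean_of_bool_eq:
  assumes "finite V" "y \<in> V"
  shows "mean V w (\<lambda>x. of_bool (x = y) * f x) = w y * f y"
proof -
  have "(\<Sum>x\<in>V. w x * (of_bool (x = y) * f x)) = (\<Sum>x\<in>V. if x = y then w x * f x else 0)"
    by (intro sum.cong) auto
  then show ?thesis using assms by (simp add: mean_def)
qed

lemma pattern_density_eq:
  defines "P \<equiv> \<lambda>x :: nat \<Rightarrow> real. x 0 + x 2" and "Q \<equiv> \<lambda>x. x 1 + x 3" and "R \<equiv> \<lambda>x. x 4 + x 6" and "S \<equiv> \<lambda>x. x 5 + x 7"
    and "\<alpha> \<equiv> \<lambda>x. x 0 * x 2 + x 1 * x 3" and "\<beta> \<equiv> \<lambda>x. x 4 * x 6 + x 5 * x 7"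
  shows "pattern_density x = P x * Q x * \<alpha> x * ((R x + S x)\<^sup>2 - 2 * \<beta> x) + R x * S x * \<beta> x * ((P x + Q x)\<^sup>2 - 2 * \<alpha> x)"
proof -
  let ?M = "mean {..<8} x"
  define N where "N a = ?M (\<lambda>u. ?M (\<lambda>v. of_bool ((u < 4) \<noteq> (a < 4) \<and> looped_adj u v)))" for a :: nat
  have opp: "opposite b < 8" if "b < 8" for b using that unfolding opposite_def by presburger
  have paws: "?M (\<lambda>c. ?M (\<lambda>d. ?M (\<lambda>u. ?M (\<lambda>v. of_bool (copy looped_adj a b c d u v)))))
      = of_bool (looped_adj a b \<and> a \<noteq> b) * x b * x (opposite b) * N a" if "a < 8" "b < 8" for a b
  proof -
    have "?M (\<lambda>c. ?M (\<lambda>d. ?M (\<lambda>u. ?M (\<lambda>v. of_bool (copy looped_adj a b c d u v)))))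
        = ?M (\<lambda>c. ?M (\<lambda>d. ?M (\<lambda>u. ?M (\<lambda>v. of_bool (c = opposite b) * (of_bool (d = b) *
             (of_bool (looped_adj a b \<and> a \<noteq> b) * of_bool ((u < 4) \<noteq> (a < 4) \<and> looped_adj u v)))))))"
      unfolding mean_def by (intro sum.cong refl arg_cong2[of _ _ _ _ "(*)"]) (auto simp: copy_looped_adj that)
    also have "\<dots> = x (opposite b) * (x b * (of_bool (looped_adj a b \<and> a \<noteq> b) * N a))"
      unfolding N_def mean_cmult using that opp by (simp only: mean_of_bool_eq finite_lessThan lessThan_iff)
    finally show ?thesis by (simp add: mult_ac)
  qed
  have *: "pattern_density x = (\<Sum>a<8. x a * (\<Sum>b<8. x b * (of_bool (looped_adj a b \<and> a \<noteq> b) * x b * x (opposite b) * N a)))"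
  proof -
    have "pattern_density x = (\<Sum>a<8. x a * (\<Sum>b<8. x b * ?M (\<lambda>c. ?M (\<lambda>d. ?M (\<lambda>u. ?M (\<lambda>v. of_bool (copy looped_adj a b c d u v)))))))"
      by (simp add: pattern_density_def mean_def)
    then show ?thesis using paws by simp
  qed
  have less: "{..<8::nat} = {0,1,2,3,4,5,6,7}" by auto
  have N: "N a = (if a < 4 then (R x + S x)\<^sup>2 - 2 * \<beta> x else (P x + Q x)\<^sup>2 - 2 * \<alpha> x)" for a
    unfolding N_def mean_def P_def Q_def R_def S_def \<alpha>_def \<beta>_def
    by (simp add: less looped_adj_def algebra_simps power2_eq_square)
  have opps: "opposite 0 = 2" "opposite 1 = 3" "opposite 2 = 0" "opposite 3 = 1"
    "opposite 4 = 6" "opposite 5 = 7" "opposite 6 = 4" "opposite 7 = 5"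
    by (simp_all add: opposite_def)
  define n where "n = (R x + S x)\<^sup>2 - 2 * \<beta> x"
  define n' where "n' = (P x + Q x)\<^sup>2 - 2 * \<alpha> x"
  show ?thesis
    unfolding * N less n_def[symmetric] n'_def[symmetric] unfolding P_def Q_def R_def S_def \<alpha>_def \<beta>_def
    by (simp add: looped_adj_def opps del: One_nat_def) (simp add: algebra_simps del: One_nat_def)
qed


text \<open>
  The number of copies is bilinear in the non-edge densities \<open>\<alpha>\<close> and \<open>\<beta>\<close> of the two cycles, once these
  are capped at the values \<open>s\<^sup>2 / 8\<close> and \<open>r\<^sup>2 / 8\<close> beyond which they only hurt. A bilinear function
  attains its maximum over a rectangle at a corner.
\<close>

lemma capped_product:
  fixes P Q \<alpha> :: real
  assumes "0 \<le> P" "0 \<le> Q" "0 \<le> \<alpha>" "4 * \<alpha> \<le> P\<^sup>2 + Q\<^sup>2"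
  shows "P * Q * \<alpha> \<le> (P + Q)\<^sup>2 / 4 * min \<alpha> ((P + Q)\<^sup>2 / 8)"
proof (cases "\<alpha> \<le> (P + Q)\<^sup>2 / 8")
  case True
  have "4 * (P * Q) \<le> (P + Q)\<^sup>2" using zero_le_square[of "P - Q"] by (simp add: power2_eq_square algebra_simps)
  then have "P * Q * \<alpha> \<le> (P + Q)\<^sup>2 / 4 * \<alpha>" using assms(3) by (intro mult_right_mono) auto
  then show ?thesis using True by simp
next
  case False
  have "32 * (P * Q * \<alpha>) \<le> 8 * (P * Q) * (P\<^sup>2 + Q\<^sup>2)"
    using mult_left_mono[OF assms(4), of "8 * (P * Q)"] assms by (simp add: algebra_simps)
  also have "\<dots> \<le> ((P + Q)\<^sup>2)\<^sup>2"
    using zero_le_square[of "(P - Q)\<^sup>2"] by (simp add: power2_eq_square algebra_simps)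
  finally show ?thesis using False by (simp add: power2_eq_square)
qed

lemma edge_deficit:
  fixes a b c d :: real
  shows "4 * (a * c + b * d) \<le> (a + c)\<^sup>2 + (b + d)\<^sup>2"
  using zero_le_square[of "a - c"] zero_le_square[of "b - d"] by (simp add: power2_eq_square algebra_simps)

lemma cubic_bound:
  fixes s r :: real
  assumes "0 \<le> s" "0 \<le> r" "s + r = 1"
  shows "s\<^sup>2 * s\<^sup>2 * r\<^sup>2 / 32 \<le> 1 / 1458"
proof -
  have "(2 - 3 * s)\<^sup>2 * (1 + 3 * s) \<ge> 0" using assms by simp
  moreover have "27 * (s\<^sup>2 * r) = 4 - (2 - 3 * s)\<^sup>2 * (1 + 3 * s)" using assms(3) by algebra
  ultimately have "27 * (s\<^sup>2 * r) \<le> 4" by linarith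
  moreover have "0 \<le> s\<^sup>2 * r" using assms by simp
  ultimately have le: "(27 * (s\<^sup>2 * r))\<^sup>2 \<le> 4\<^sup>2" by (intro power_mono) auto
  define X where "X = s\<^sup>2 * s\<^sup>2 * r\<^sup>2"
  have "(27 * (s\<^sup>2 * r))\<^sup>2 = 729 * X" unfolding X_def by algebra
  then show ?thesis using le unfolding X_def[symmetric] by simp
qed

text \<open>
  The three corners other than the origin have the values \<open>A\<close>, \<open>B\<close> and \<open>C\<close> below. The first two are
  at most \<open>1 / 1458\<close>, which is less than \<open>3 / 4096\<close>, so only the third one can be optimal.
\<close>

lemma bilinear_bound:
  fixes s r \<sigma> \<tau> :: real
  assumes s: "0 \<le> s" "0 \<le> r" "s + r = 1" and \<sigma>: "0 \<le> \<sigma>" "\<sigma> \<le> s\<^sup>2 / 8" and \<tau>: "0 \<le> \<tau>" "\<tau> \<le> r\<^sup>2 / 8"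
    and big: "3 / 4096 \<le> s\<^sup>2 / 4 * \<sigma> * (r\<^sup>2 - 2 * \<tau>) + r\<^sup>2 / 4 * \<tau> * (s\<^sup>2 - 2 * \<sigma>)"
  shows "s = 1 / 2 \<and> \<sigma> = 1 / 32 \<and> \<tau> = 1 / 32"
proof -
  have pos: "s > 0" "r > 0" using big \<sigma> \<tau> s by (auto simp: less_le)
  define u where "u = 8 * \<sigma> / s\<^sup>2"
  define v where "v = 8 * \<tau> / r\<^sup>2"
  have u: "0 \<le> u" "u \<le> 1" "\<sigma> = u * s\<^sup>2 / 8" using \<sigma> pos by (simp_all add: u_def field_simps)
  have v: "0 \<le> v" "v \<le> 1" "\<tau> = v * r\<^sup>2 / 8" using \<tau> pos by (simp_all add: v_def field_simps)
  define A where "A = s\<^sup>2 * s\<^sup>2 * r\<^sup>2 / 32"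
  define B where "B = s\<^sup>2 * r\<^sup>2 * r\<^sup>2 / 32"
  define C where "C = 3 / 128 * s\<^sup>2 * r\<^sup>2 * (s\<^sup>2 + r\<^sup>2)"
  have A: "A \<le> 1 / 1458" using cubic_bound[of s r] s by (simp add: A_def)
  have B: "B \<le> 1 / 1458" using cubic_bound[of r s] s by (simp add: B_def mult_ac)
  have q: "4 * (s * r) = 1 - (s - r)\<^sup>2" using s(3) by algebra
  have C_eq: "C = 3 / 4096 * (1 - (s - r)\<^sup>2)\<^sup>2 * (1 + (s - r)\<^sup>2)"
  proof -
    have "C = 3 / 128 * (s * r)\<^sup>2 * (1 - 2 * (s * r))" unfolding C_def using s(3) by algebra
    then show ?thesis using q by algebra
  qed
  have C: "C \<le> 3 / 4096 * (1 - (s - r)\<^sup>2)"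
  proof -
    define t where "t = (s - r)\<^sup>2"
    have t: "0 \<le> 1 - t" "0 \<le> t" using mult_nonneg_nonneg[OF s(1,2)] q by (simp_all add: t_def)
    then have "(1 - t) * ((1 - t) * (1 + t)) \<le> (1 - t) * 1"
      by (intro mult_left_mono) (auto simp: algebra_simps)
    moreover have "C = 3 / 4096 * ((1 - t) * ((1 - t) * (1 + t)))"
      unfolding C_eq t_def[symmetric] by algebra
    ultimately show ?thesis unfolding t_def[symmetric] by linarith
  qed
  have "3 / 4096 \<le> u * (1 - v) * A + (1 - u) * v * B + u * v * C"
  proof -
    have "s\<^sup>2 / 4 * \<sigma> * (r\<^sup>2 - 2 * \<tau>) + r\<^sup>2 / 4 * \<tau> * (s\<^sup>2 - 2 * \<sigma>)
        = u * (1 - v) * A + (1 - u) * v * B + u * v * C"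
      unfolding u(3) v(3) A_def B_def C_def by (simp add: field_simps)
    then show ?thesis using big by simp
  qed
  also have "\<dots> \<le> u * (1 - v) * (1 / 1458) + (1 - u) * v * (1 / 1458) + u * v * (3 / 4096 * (1 - (s - r)\<^sup>2))"
    using u v A B C by (intro add_mono mult_left_mono) auto
  also have "\<dots> \<le> 3 / 4096 - (3 / 4096 - 1 / 1458) * (1 - u * v) - 3 / 4096 * (u * v) * (s - r)\<^sup>2"
  proof -
    have "u * (1 - v) + (1 - u) * v \<le> 1 - u * v"
      using mult_nonneg_nonneg[of "1 - u" "1 - v"] u v by (simp add: algebra_simps)
    then have "(u * (1 - v) + (1 - u) * v) * (1 / 1458) \<le> (1 - u * v) * (1 / 1458)"
      by (intro mult_right_mono) auto
    then have le: "(u * (1 - v) + (1 - u) * v) * (1 / 1458) - (1 - u * v) * (1 / 1458) \<le> 0" by (simp only: diff_le_0_iff_le)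
    have "u * (1 - v) * c + (1 - u) * v * c + u * v * (d * (1 - t)) - (d - (d - c) * (1 - u * v) - d * (u * v) * t)
      = (u * (1 - v) + (1 - u) * v) * c - (1 - u * v) * c" for c d t
      by (simp add: algebra_simps)
    from le[folded this[of "1 / 1458" "3 / 4096" "(s - r)\<^sup>2"]] show ?thesis by (simp only: diff_le_0_iff_le)
  qed
  finally have "3 / 4096 \<le> 3 / 4096 - (3 / 4096 - 1 / 1458) * (1 - u * v) - 3 / 4096 * (u * v) * (s - r)\<^sup>2" .
  moreover have "k \<le> k - a - b \<Longrightarrow> a + b \<le> 0" for k a b :: real by linarith
  ultimately have le: "(3 / 4096 - 1 / 1458) * (1 - u * v) + 3 / 4096 * (u * v) * (s - r)\<^sup>2 \<le> 0" by blast
  have "u * v \<le> 1 * 1" using u v by (intro mult_mono) auto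
  then have uv_le: "u * v \<le> 1" by simp
  have "0 \<le> 3 / 4096 * (u * v) * (s - r)\<^sup>2" using u v by simp
  then have "(3 / 4096 - 1 / 1458) * (1 - u * v) \<le> 0" using le by (meson add_increasing2 order_trans order_refl)
  then have uv: "u * v = 1" using uv_le by (auto simp: mult_le_0_iff)
  have "u * v \<le> u * 1" "u * v \<le> 1 * v" using u v by (intro mult_mono; simp)+
  then have "u = 1" "v = 1" using uv u(2) v(2) by auto
  moreover have "s = r" using le uv by (auto simp: power2_eq_square mult_le_0_iff)
  then have half: "s = 1 / 2" "r = 1 / 2" using s(3) by auto
  ultimately show ?thesis using u(3) v(3) unfolding half by (simp add: power2_eq_square)
qed

lemma capped_bound:
  fixes P Q R S \<alpha> \<beta> :: real
  assumes nn: "0 \<le> P" "0 \<le> Q" "0 \<le> R" "0 \<le> S" and sum: "P + Q + (R + S) = 1"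
    and \<alpha>: "0 \<le> \<alpha>" "4 * \<alpha> \<le> P\<^sup>2 + Q\<^sup>2" and \<beta>: "0 \<le> \<beta>" "4 * \<beta> \<le> R\<^sup>2 + S\<^sup>2"
  defines "f \<equiv> P * Q * \<alpha> * ((R + S)\<^sup>2 - 2 * \<beta>) + R * S * \<beta> * ((P + Q)\<^sup>2 - 2 * \<alpha>)"
  shows "\<beta> = 0 \<Longrightarrow> f \<le> 1 / 1458"
    and "3 / 4096 \<le> f \<Longrightarrow> P = 1 / 4 \<and> Q = 1 / 4 \<and> R = 1 / 4 \<and> S = 1 / 4 \<and> \<alpha> = 1 / 32 \<and> \<beta> = 1 / 32"
proof -
  define s where "s = P + Q"
  define r where "r = R + S"
  have sr: "0 \<le> s" "0 \<le> r" "s + r = 1" using nn sum by (auto simp: s_def r_def)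
  have \<alpha>s: "2 * \<alpha> \<le> s\<^sup>2" and \<beta>r: "2 * \<beta> \<le> r\<^sup>2"
  proof -
    have "0 \<le> P * Q" "0 \<le> R * S" using nn by auto
    then show "2 * \<alpha> \<le> s\<^sup>2" "2 * \<beta> \<le> r\<^sup>2" using \<alpha> \<beta> by (auto simp: s_def r_def power2_eq_square algebra_simps)
  qed
  have a: "P * Q * \<alpha> \<le> s\<^sup>2 / 4 * min \<alpha> (s\<^sup>2 / 8)" and b: "R * S * \<beta> \<le> r\<^sup>2 / 4 * min \<beta> (r\<^sup>2 / 8)"
    unfolding s_def r_def using capped_product nn \<alpha> \<beta> by auto
  show "f \<le> 1 / 1458" if "\<beta> = 0"
  proof -
    have "f = P * Q * \<alpha> * r\<^sup>2" using that by (simp add: f_def r_def)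
    also have "\<dots> \<le> s\<^sup>2 / 4 * (s\<^sup>2 / 8) * r\<^sup>2"
      using a by (intro mult_right_mono order_trans[OF a] mult_left_mono) auto
    also have "\<dots> \<le> 1 / 1458" using cubic_bound[of s r] sr by simp
    finally show ?thesis .
  qed
  assume big: "3 / 4096 \<le> f"
  have "f \<le> s\<^sup>2 / 4 * min \<alpha> (s\<^sup>2 / 8) * (r\<^sup>2 - 2 * \<beta>) + r\<^sup>2 / 4 * min \<beta> (r\<^sup>2 / 8) * (s\<^sup>2 - 2 * \<alpha>)"
    unfolding f_def s_def[symmetric] r_def[symmetric] using a b \<alpha>s \<beta>r by (intro add_mono mult_right_mono) auto
  also have "\<dots> \<le> s\<^sup>2 / 4 * min \<alpha> (s\<^sup>2 / 8) * (r\<^sup>2 - 2 * min \<beta> (r\<^sup>2 / 8)) + r\<^sup>2 / 4 * min \<beta> (r\<^sup>2 / 8) * (s\<^sup>2 - 2 * min \<alpha> (s\<^sup>2 / 8))"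
    using \<alpha>(1) \<beta>(1) by (intro add_mono mult_left_mono mult_nonneg_nonneg) auto
  finally have "s = 1 / 2 \<and> min \<alpha> (s\<^sup>2 / 8) = 1 / 32 \<and> min \<beta> (r\<^sup>2 / 8) = 1 / 32"
    using big \<alpha>(1) \<beta>(1) by (intro bilinear_bound[OF sr]) auto
  then have s: "s = 1 / 2" and m: "min \<alpha> (s\<^sup>2 / 8) = 1 / 32" "min \<beta> (r\<^sup>2 / 8) = 1 / 32" by auto
  have r: "r = 1 / 2" using s sr by simp
  have ge: "\<alpha> \<ge> 1 / 32" "\<beta> \<ge> 1 / 32" using m by linarith+
  have a': "P * Q * \<alpha> \<le> 1 / 512" and b': "R * S * \<beta> \<le> 1 / 512"
    using a b unfolding m unfolding s r by (simp_all add: power2_eq_square)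
  have \<alpha>8: "2 * \<alpha> \<le> 1 / 4" and \<beta>8: "2 * \<beta> \<le> 1 / 4" using \<alpha>s \<beta>r by (simp_all add: s r power2_eq_square)
  have feq: "f = P * Q * \<alpha> * (1 / 4 - 2 * \<beta>) + R * S * \<beta> * (1 / 4 - 2 * \<alpha>)"
    unfolding f_def s_def[symmetric] r_def[symmetric] by (simp add: s r power2_eq_square)
  have "f \<le> 1 / 512 * (1 / 4 - 2 * \<beta>) + 1 / 512 * (1 / 4 - 2 * \<alpha>)"
    unfolding feq using a' b' \<alpha>8 \<beta>8 by (intro add_mono mult_right_mono) auto
  then have "\<alpha> + \<beta> \<le> 1 / 16" using big by (simp add: field_simps)
  then have \<alpha>\<beta>: "\<alpha> = 1 / 32" "\<beta> = 1 / 32" using ge by auto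
  have "P * Q \<ge> 1 / 16" "R * S \<ge> 1 / 16" using big a' b' unfolding feq \<alpha>\<beta> by simp_all
  moreover have "Q = 1 / 2 - P" "S = 1 / 2 - R" using s r by (simp_all add: s_def r_def)
  ultimately have "(P - 1 / 4)\<^sup>2 \<le> 0" "(R - 1 / 4)\<^sup>2 \<le> 0" by (simp_all add: power2_eq_square algebra_simps)
  then show "P = 1 / 4 \<and> Q = 1 / 4 \<and> R = 1 / 4 \<and> S = 1 / 4 \<and> \<alpha> = 1 / 32 \<and> \<beta> = 1 / 32"
    using \<alpha>\<beta> \<open>Q = 1 / 2 - P\<close> \<open>S = 1 / 2 - R\<close> by auto
qed

lemma sum_eight: "(\<Sum>i<8. x i) = x 0 + x 1 + x 2 + x 3 + x 4 + x 5 + x 6 + x 7"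
  for x :: "nat \<Rightarrow> 'a :: comm_monoid_add"
  by (simp add: numeral_eq_Suc add.assoc)

text \<open>
  This is the situation as seen from one seed, when the other cycle appears as a single class. The
  value is well below \<open>3 / 4096\<close>.
\<close>

lemma pattern_density_small:
  assumes "\<And>i. i < 8 \<Longrightarrow> 0 \<le> x i" "(\<Sum>i<8. x i) = 1" "x 5 = 0" "x 6 = 0" "x 7 = 0"
  shows "pattern_density x \<le> 1 / 1458"
proof -
  have "0 \<le> x 0" "0 \<le> x 1" "0 \<le> x 2" "0 \<le> x 3" "0 \<le> x 4" by (simp_all add: assms)
  then show ?thesis unfolding pattern_density_eq using assms(2-)
    by (intro capped_bound(1) edge_deficit) (auto simp: sum_eight add_ac)
qed

lemma pattern_density_uniform: "pattern_density (\<lambda>_. 1 / 8) = 3 / 4096"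
  by (simp add: pattern_density_eq power2_eq_square)

lemma pattern_density_maximal:
  assumes x: "\<And>i. i < 8 \<Longrightarrow> 0 \<le> x i" "(\<Sum>i<8. x i) = 1" and big: "3 / 4096 \<le> pattern_density x" and i: "i < 8"
  shows "x i = 1 / 8"
proof -
  have nn: "0 \<le> x 0" "0 \<le> x 1" "0 \<le> x 2" "0 \<le> x 3" "0 \<le> x 4" "0 \<le> x 5" "0 \<le> x 6" "0 \<le> x 7" by (simp_all add: x)
  have *: "x 0 + x 2 = 1 / 4 \<and> x 1 + x 3 = 1 / 4 \<and> x 4 + x 6 = 1 / 4 \<and> x 5 + x 7 = 1 / 4 \<and>
      x 0 * x 2 + x 1 * x 3 = 1 / 32 \<and> x 4 * x 6 + x 5 * x 7 = 1 / 32"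
    using nn x(2) big unfolding pattern_density_eq
    by (intro capped_bound(2) edge_deficit) (auto simp: sum_eight add_ac)
  have pair: "a = 1 / 8 \<and> b = 1 / 8 \<and> c = 1 / 8 \<and> d = 1 / 8" if "a + c = 1 / 4" "b + d = 1 / 4" "a * c + b * d = 1 / 32" for a b c d :: real
  proof -
    have c: "c = 1 / 4 - a" and d: "d = 1 / 4 - b" using that by auto
    have "(a - 1 / 8)\<^sup>2 + (b - 1 / 8)\<^sup>2 = 0" using that(3) unfolding c d by (simp add: power2_eq_square algebra_simps)
    then show ?thesis using c d by (simp add: sum_power2_eq_zero_iff)
  qed
  have "x 0 = 1 / 8 \<and> x 1 = 1 / 8 \<and> x 2 = 1 / 8 \<and> x 3 = 1 / 8" "x 4 = 1 / 8 \<and> x 5 = 1 / 8 \<and> x 6 = 1 / 8 \<and> x 7 = 1 / 8"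
    using pair[of "x 0" "x 2" "x 1" "x 3"] pair[of "x 4" "x 6" "x 5" "x 7"] * by auto
  then show ?thesis using i by (auto simp: less_Suc_eq numeral_eq_Suc)
qed


lemma convergent_subsequences:
  fixes X :: "nat \<Rightarrow> nat \<Rightarrow> real"
  assumes "\<And>n i. i < k \<Longrightarrow> \<bar>X n i\<bar> \<le> K"
  shows "\<exists>r. strict_mono r \<and> (\<forall>i<k. convergent (\<lambda>n. X (r n) i))"
  using assms
proof (induction k)
  case 0
  then show ?case by (intro exI[of _ id]) (simp add: strict_mono_def)
next
  case (Suc k)
  then obtain r where r: "strict_mono r" "\<forall>i<k. convergent (\<lambda>n. X (r n) i)" by force
  obtain f where f: "strict_mono f" "monoseq (\<lambda>n. X (r (f n)) k)"
    using seq_monosub[of "\<lambda>n. X (r n) k"] by auto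
  have "Bseq (\<lambda>n. X (r (f n)) k)"
    using Suc.prems[of k] by (intro BseqI'[of _ K]) auto
  then have "convergent (\<lambda>n. X (r (f n)) k)" using f(2) by (rule Bseq_monoseq_convergent)
  moreover have "convergent (\<lambda>n. X (r (f n)) i)" if "i < k" for i
    using convergent_subseq_convergent[OF r(2)[rule_format, OF that] f(1)] by (simp add: comp_def)
  ultimately show ?case
    using strict_mono_o[OF r(1) f(1)] by (intro exI[of _ "r \<circ> f"]) (auto simp: less_Suc_eq comp_def)
qed

lemma pattern_density_tendsto:
  assumes "\<And>i. i < 8 \<Longrightarrow> ((\<lambda>n. X n i) \<longlongrightarrow> x i) F"
  shows "((\<lambda>n. pattern_density (X n)) \<longlongrightarrow> pattern_density x) F"
  unfolding pattern_density_eq by (intro tendsto_intros assms) simp_all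

text \<open>By compactness, near-optimal part sizes are nearly equal.\<close>

lemma pattern_density_near_maximal:
  assumes "0 < \<kappa>"
  shows "\<exists>\<epsilon>>0. \<forall>x. (\<forall>i<8. 0 \<le> x i) \<and> (\<Sum>i<8. x i) = 1 \<and> 3 / 4096 - \<epsilon> \<le> pattern_density x
     \<longrightarrow> (\<forall>i<8. \<bar>x i - 1 / 8\<bar> < \<kappa>)"
proof (rule ccontr)
  assume "\<not> ?thesis"
  then have "\<exists>x. (\<forall>i<8. 0 \<le> x i) \<and> (\<Sum>i<8. x i) = 1 \<and> 3 / 4096 - 1 / real (Suc n) \<le> pattern_density x
     \<and> \<not> (\<forall>i<8. \<bar>x i - 1 / 8\<bar> < \<kappa>)" for n
    by (auto dest: spec[of _ "1 / real (Suc n)"])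
  then obtain X where X: "\<And>n i. i < 8 \<Longrightarrow> 0 \<le> X n i" "\<And>n. (\<Sum>i<8. X n i) = 1"
    "\<And>n. 3 / 4096 - 1 / real (Suc n) \<le> pattern_density (X n)" "\<And>n. \<not> (\<forall>i<8. \<bar>X n i - 1 / 8\<bar> < \<kappa>)"
    by metis
  have "\<bar>X n i\<bar> \<le> 1" if "i < 8" for n i
    using X(1)[of _ n] X(2)[of n] that member_le_sum[of i "{..<8}" "X n"] by auto
  then obtain r where r: "strict_mono r" "\<forall>i<8. convergent (\<lambda>n. X (r n) i)"
    using convergent_subsequences[of 8 X 1] by blast
  define L where "L i = lim (\<lambda>n. X (r n) i)" for i
  have L: "(\<lambda>n. X (r n) i) \<longlonglongrightarrow> L i" if "i < 8" for i
    using r(2) that by (simp add: L_def convergent_LIMSEQ_iff)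
  have "0 \<le> L i" if "i < 8" for i
    using L[OF that] X(1)[OF that] by (intro LIMSEQ_le_const[of _ "L i"]) auto
  moreover have "(\<Sum>i<8. L i) = 1"
  proof -
    have "(\<lambda>n. \<Sum>i<8. X (r n) i) \<longlonglongrightarrow> (\<Sum>i<8. L i)" by (intro tendsto_sum L) simp
    then show ?thesis using X(2) LIMSEQ_unique[OF _ tendsto_const] by auto
  qed
  moreover have "3 / 4096 \<le> pattern_density L"
  proof (rule tendsto_le[OF sequentially_bot])
    show "(\<lambda>n. pattern_density (X (r n))) \<longlonglongrightarrow> pattern_density L" by (intro pattern_density_tendsto L)
    have "(\<lambda>n. 1 / real (Suc (r n))) \<longlonglongrightarrow> 0"
      using LIMSEQ_subseq_LIMSEQ[OF LIMSEQ_inverse_real_of_nat r(1)] by (simp add: comp_def inverse_eq_divide)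
    from tendsto_diff[OF tendsto_const this, of "3 / 4096"]
    show "(\<lambda>n. 3 / 4096 - 1 / real (Suc (r n))) \<longlonglongrightarrow> 3 / 4096" by simp
  qed (intro always_eventually allI X(3))
  ultimately have L8: "L i = 1 / 8" if "i < 8" for i
    using pattern_density_maximal that by blast
  have "\<forall>\<^sub>F n in sequentially. \<bar>X (r n) i - 1 / 8\<bar> < \<kappa>" if "i < 8" for i
    using tendstoD[OF L[OF that] assms] unfolding L8[OF that] dist_real_def .
  then have "\<forall>\<^sub>F n in sequentially. \<forall>i\<in>{..<8}. \<bar>X (r n) i - 1 / 8\<bar> < \<kappa>"
    by (intro eventually_ball_finite) auto
  then show False using X(4) eventually_happens'[OF sequentially_bot] by fastforce
qed


section \<open>Near-optimal graphs are close to blowups\<close>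

lemma mean_pushforward:
  assumes "finite V" "\<And>x. x \<in> V \<Longrightarrow> p x < (n::nat)"
  shows "mean V w (\<lambda>x. g (p x)) = mean {..<n} (\<lambda>i. mean V w (\<lambda>x. of_bool (p x = i))) g"
proof -
  have "mean V w (\<lambda>x. g (p x)) = (\<Sum>x\<in>V. \<Sum>i<n. w x * (of_bool (p x = i) * g i))"
    unfolding mean_def using assms(2) by (intro sum.cong refl) (simp add: of_bool_def if_distrib[of "\<lambda>z. z * _"] if_distrib[of "\<lambda>z. _ * z"] cong: if_cong)
  also have "\<dots> = (\<Sum>i<n. (\<Sum>x\<in>V. w x * of_bool (p x = i)) * g i)"
    by (subst sum.swap) (simp add: sum_distrib_right mult.assoc)
  finally show ?thesis by (simp add: mean_def)
qed

definition part_weights :: "'v set \<Rightarrow> ('v \<Rightarrow> real) \<Rightarrow> ('v \<Rightarrow> nat) \<Rightarrow> nat \<Rightarrow> real" where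
  "part_weights V w p i = mean V w (\<lambda>x. of_bool (p x = i))"

context weighted_graph
begin

lemma mono: "(\<And>x. x \<in> V \<Longrightarrow> f x \<le> g x) \<Longrightarrow> M f \<le> M g"
  by (rule mean_mono) (auto simp: w_nonneg)

lemma const: "M (\<lambda>_. c) = c"
  by (rule mean_const[OF w_sum])

lemma nonneg: "(\<And>x. x \<in> V \<Longrightarrow> 0 \<le> f x) \<Longrightarrow> 0 \<le> M f"
  by (rule mean_nonneg) (auto simp: w_nonneg)

lemma exists_ge_mean:
  assumes "M f \<ge> c" shows "\<exists>x\<in>V. f x \<ge> c"
proof (rule ccontr)
  assume "\<not> ?thesis"
  then have less: "f x < c" if "x \<in> V" for x using that by force
  have "\<exists>x\<in>V. w x > 0"
  proof (rule ccontr)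
    assume "\<not> (\<exists>x\<in>V. w x > 0)"
    then have "sum w V \<le> 0" by (intro sum_nonpos) force
    then show False using w_sum by simp
  qed
  then have "M f < (\<Sum>x\<in>V. w x * c)"
    unfolding mean_def using less w_nonneg finite_V
    by (intro sum_strict_mono_ex1) (force intro: mult_left_mono mult_strict_left_mono less_imp_le)+
  then show False using assms w_sum by (simp add: sum_distrib_right[symmetric])
qed

lemma part_weights_nonneg: "0 \<le> part_weights V w p i"
  unfolding part_weights_def by (rule nonneg) simp

lemma sum_part_weights: "(\<And>x. x \<in> V \<Longrightarrow> p x < n) \<Longrightarrow> (\<Sum>i<n. part_weights V w p i) = 1"
  using mean_pushforward[OF finite_V, of p n w "\<lambda>_. 1"] by (simp add: const) (simp add: mean_def part_weights_def)

lemma pattern_density_pushforward: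
  assumes "\<And>x. x \<in> V \<Longrightarrow> p x < 8"
  shows "M (\<lambda>a. M (\<lambda>b. M (\<lambda>c. M (\<lambda>d. M (\<lambda>u. M (\<lambda>v. of_bool (copy looped_adj (p a) (p b) (p c) (p d) (p u) (p v)))))))) =
     pattern_density (part_weights V w p)"
proof -
  have push: "M (\<lambda>x. g (p x)) = mean {..<8} (part_weights V w p) g" for g
    unfolding part_weights_def[abs_def] using assms by (intro mean_pushforward finite_V)
  show ?thesis
    unfolding push[of "\<lambda>v. of_bool (copy looped_adj _ _ _ _ _ v)"]
    unfolding push[of "\<lambda>u. mean {..<8} _ (\<lambda>v. of_bool (copy looped_adj _ _ _ _ u v))"]
    unfolding push[of "\<lambda>d. mean {..<8} _ (\<lambda>u. mean {..<8} _ (\<lambda>v. of_bool (copy looped_adj _ _ _ d u v)))"]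
    unfolding push[of "\<lambda>c. mean {..<8} _ (\<lambda>d. mean {..<8} _ (\<lambda>u. mean {..<8} _ (\<lambda>v. of_bool (copy looped_adj _ _ c d u v))))"]
    unfolding push[of "\<lambda>b. mean {..<8} _ (\<lambda>c. mean {..<8} _ (\<lambda>d. mean {..<8} _ (\<lambda>u. mean {..<8} _ (\<lambda>v. of_bool (copy looped_adj _ b c d u v)))))"]
    unfolding push[of "\<lambda>a. mean {..<8} _ (\<lambda>b. mean {..<8} _ (\<lambda>c. mean {..<8} _ (\<lambda>d. mean {..<8} _ (\<lambda>u. mean {..<8} _ (\<lambda>v. of_bool (copy looped_adj a b c d u v))))))"]
    by (simp add: pattern_density_def Let_def)
qed

end


lemma seed_class_4: "seed e a b c \<Longrightarrow> class_of e a b c x < 4 \<or> class_of e a b c x = 4"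
  using class3_le by (force simp: class_of_def le_less)

text \<open>
  A seed splits the copies into two kinds: either the paw lies in the cycle of the seed, and then the
  copy is recognised from the classes of its vertices, or the paw provides a seed of the other cycle.
\<close>

lemma copy_cases:
  assumes e: "\<And>x y. e x y = e y x" and seed: "seed e a b c" and copy: "copy e x0 x1 x2 x3 x4 x5"
    and good: "\<And>x y. (x, y) \<in> {(x0,x1),(x0,x2),(x0,x3),(x1,x2),(x1,x3),(x2,x3),(x0,x4),(x1,x4),(x2,x4),(x3,x4),
        (x0,x5),(x1,x5),(x2,x5),(x3,x5),(x4,x5)} \<Longrightarrow> induces_blowup e [a,b,c,x,y]"
  defines "k \<equiv> class_of e a b c"
  shows "copy looped_adj (k x0) (k x1) (k x2) (k x3) (k x4) (k x5) \<or> two_seeds e a b c x1 x0 x2"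
proof (cases "k x0 < 4")
  case True
  have D: "e x y = looped_adj (k x) (k y)" if "(x, y) \<in> {(x0,x1),(x0,x2),(x0,x3),(x1,x2),(x1,x3),(x2,x3),(x0,x4),(x1,x4),(x2,x4),(x3,x4),
        (x0,x5),(x1,x5),(x2,x5),(x3,x5),(x4,x5)}" "k x < 4 \<or> k y < 4" for x y
    unfolding k_def using good[OF that(1)] seed that(2)[unfolded k_def] by (rule seed_determines(4)[OF e])
  have lt: "k x1 < 4" "k x2 < 4" "k x3 < 4"
    using D[of x0 x1] D[of x0 x2] D[of x0 x3] True copy by (auto simp: copy_def paw_def looped_adj_def)
  have "e x0 x1 = looped_adj (k x0) (k x1)" "e x0 x2 = looped_adj (k x0) (k x2)" "e x0 x3 = looped_adj (k x0) (k x3)"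
    "e x1 x2 = looped_adj (k x1) (k x2)" "e x1 x3 = looped_adj (k x1) (k x3)" "e x2 x3 = looped_adj (k x2) (k x3)"
    "e x0 x4 = looped_adj (k x0) (k x4)" "e x1 x4 = looped_adj (k x1) (k x4)" "e x2 x4 = looped_adj (k x2) (k x4)" "e x3 x4 = looped_adj (k x3) (k x4)"
    "e x0 x5 = looped_adj (k x0) (k x5)" "e x1 x5 = looped_adj (k x1) (k x5)" "e x2 x5 = looped_adj (k x2) (k x5)" "e x3 x5 = looped_adj (k x3) (k x5)"
    using True lt by (intro D; simp)+
  moreover have "looped_adj (k x4) (k x5)"
    using D[of x4 x5] seed_class_4[OF seed, of x4] seed_class_4[OF seed, of x5] copy
    unfolding k_def[symmetric] by (auto simp: copy_def)
  moreover have "looped_adj p q = looped_adj q p" for p q by (auto simp: looped_adj_def)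
  ultimately show ?thesis using copy e unfolding copy_def paw_def by metis
next
  case False
  then have 4: "k x0 = 4" using seed_class_4[OF seed, of x0] unfolding k_def by auto
  have good01: "induces_blowup e [a,b,c,x0,x1]" and good10: "induces_blowup e [a,b,c,x1,x2]" by (intro good; simp)+
  have "e x0 x1" using copy by (simp add: copy_def paw_def)
  then have "\<not> k x1 < 4"
    using seed_determines(4)[OF e good01 seed] 4 unfolding k_def[symmetric] by (auto simp: looped_adj_def)
  then have "k x1 = 4" using seed_class_4[OF seed, of x1] unfolding k_def by auto
  then have "\<not> e x1 a" "\<not> e x1 b" "\<not> e x1 c"
    using seed_determines(1-3)[OF e good10 seed] unfolding k_def[symmetric] by (auto simp: looped_adj_def)
  then show ?thesis using copy seed e[of x0 x1] by (auto simp: two_seeds_def seed_def copy_def paw_def)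
qed

text \<open>The value \<open>0\<close> for vertices that neither seed recognises is arbitrary; such vertices are rare.\<close>

definition place :: "('v \<Rightarrow> 'v \<Rightarrow> bool) \<Rightarrow> 'v \<Rightarrow> 'v \<Rightarrow> 'v \<Rightarrow> 'v \<Rightarrow> 'v \<Rightarrow> 'v \<Rightarrow> 'v \<Rightarrow> nat" where
  "place e a b c a' b' c' x = (if class_of e a b c x < 4 then class_of e a b c x
     else if class_of e a' b' c' x < 4 then 4 + class_of e a' b' c' x else 0)"

lemma place_less: "place e a b c a' b' c' x < 8"
  by (simp add: place_def)

lemma place_adjacent:
  assumes e: "\<And>x y. e x y = e y x" and seeds: "two_seeds e a b c a' b' c'"
    and good: "induces_blowup e [a,b,c,a',b',c',x]" "induces_blowup e [a,b,c,a',b',c',y]"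
      "induces_blowup e [a,b,c,x,y]" "induces_blowup e [a',b',c',x,y]"
  shows "e x y = looped_adj (place e a b c a' b' c' x) (place e a b c a' b' c' y)"
proof -
  have seed: "seed e a b c" "seed e a' b' c'" using seeds by (auto simp: two_seeds_def)
  have x: "(class_of e a b c x < 4) \<noteq> (class_of e a' b' c' x < 4)"
    and y: "(class_of e a b c y < 4) \<noteq> (class_of e a' b' c' y < 4)"
    using two_seeds_exclusive[OF _ seeds] good by auto
  note 1 = seed_determines(4)[OF e good(3) seed(1)] and 2 = seed_determines(4)[OF e good(4) seed(2)]
  note 4 = seed_class_4[OF seed(1), of x] seed_class_4[OF seed(1), of y] seed_class_4[OF seed(2), of x] seed_class_4[OF seed(2), of y]
  show ?thesis
  proof (cases "class_of e a b c x < 4 \<or> class_of e a b c y < 4")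
    case True
    then show ?thesis using 1 x y 4 by (auto simp: place_def looped_adj_def)
  next
    case False
    then show ?thesis using 2 x y 4 by (auto simp: place_def looped_adj_def)
  qed
qed

context weighted_graph
begin

definition deviation :: "('v \<Rightarrow> nat) \<Rightarrow> real" where
  "deviation p = M (\<lambda>x. M (\<lambda>y. of_bool (e x y \<noteq> looped_adj (p x) (p y))))"

definition bad :: "'v list \<Rightarrow> real" where
  "bad xs = of_bool (\<not> induces_blowup e xs)"

lemma bad_nonneg: "0 \<le> bad xs"
  by (simp add: bad_def)

lemma bad_sub:
  assumes "distinct is" "set is \<subseteq> {..<length xs}"
  shows "bad (map ((!) xs) is) \<le> bad xs"
  using induces_blowup_sub[OF _ assms] by (auto simp: bad_def)

lemma bad_five: "M (\<lambda>a. M (\<lambda>b. M (\<lambda>c. M (\<lambda>x. M (\<lambda>y. bad [a,b,c,x,y]))))) \<le> defect"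
proof -
  have "bad [a,b,c,x,y] \<le> M (\<lambda>g. M (\<lambda>h. bad [a,b,c,x,y,g,h]))" for a b c x y
  proof -
    have "M (\<lambda>g. M (\<lambda>h. bad [a,b,c,x,y])) \<le> M (\<lambda>g. M (\<lambda>h. bad [a,b,c,x,y,g,h]))"
      using bad_sub[of "[0,1,2,3,4]" "[a,b,c,x,y,_,_]"] by (intro mono) simp
    then show ?thesis by (simp add: const)
  qed
  then show ?thesis unfolding defect_def bad_def[symmetric] by (intro mono)
qed

text \<open>
  Replace every vertex by its class with respect to the seed. The copies of the first kind become
  copies in a blowup whose second cycle is a clique, and these are too few for a near-optimal graph.
\<close>

lemma copy_density_seed:
  assumes seed: "seed e a b c"
  shows "copy_density \<le> 1 / 1458 + M (\<lambda>a'. M (\<lambda>b'. M (\<lambda>c'. of_bool (two_seeds e a b c a' b' c'))))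
     + 15 * M (\<lambda>x. M (\<lambda>y. bad [a,b,c,x,y]))"
proof -
  let ?k = "class_of e a b c"
  let ?B = "\<lambda>x y. bad [a,b,c,x,y]"
  have k5: "?k x < 5" for x using class3_le[of "e x a" "e x b" "e x c"] by (simp add: class_of_def)
  have k8: "?k x < 8" for x using k5[of x] by simp
  have "copy_density \<le> M (\<lambda>x0. M (\<lambda>x1. M (\<lambda>x2. M (\<lambda>x3. M (\<lambda>x4. M (\<lambda>x5.
      of_bool (copy looped_adj (?k x0) (?k x1) (?k x2) (?k x3) (?k x4) (?k x5)) + of_bool (two_seeds e a b c x1 x0 x2) +
      (?B x0 x1 + ?B x0 x2 + ?B x0 x3 + ?B x1 x2 + ?B x1 x3 + ?B x2 x3 + ?B x0 x4 + ?B x1 x4 + ?B x2 x4 + ?B x3 x4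
       + ?B x0 x5 + ?B x1 x5 + ?B x2 x5 + ?B x3 x5 + ?B x4 x5)))))))"
    unfolding copy_density_def
  proof (intro mono)
    fix x0 x1 x2 x3 x4 x5
    show "of_bool (copy e x0 x1 x2 x3 x4 x5) \<le>
      of_bool (copy looped_adj (?k x0) (?k x1) (?k x2) (?k x3) (?k x4) (?k x5)) + of_bool (two_seeds e a b c x1 x0 x2) +
      (?B x0 x1 + ?B x0 x2 + ?B x0 x3 + ?B x1 x2 + ?B x1 x3 + ?B x2 x3 + ?B x0 x4 + ?B x1 x4 + ?B x2 x4 + ?B x3 x4
       + ?B x0 x5 + ?B x1 x5 + ?B x2 x5 + ?B x3 x5 + ?B x4 x5)" (is "?l \<le> ?c + ?t + ?S")
    proof (cases "\<forall>(x, y) \<in> {(x0,x1),(x0,x2),(x0,x3),(x1,x2),(x1,x3),(x2,x3),(x0,x4),(x1,x4),(x2,x4),(x3,x4),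
        (x0,x5),(x1,x5),(x2,x5),(x3,x5),(x4,x5)}. induces_blowup e [a,b,c,x,y]")
      case True
      then have "?l \<le> ?c + ?t" using copy_cases[OF e_sym seed, of x0 x1 x2 x3 x4 x5] by (cases "copy e x0 x1 x2 x3 x4 x5") auto
      moreover have "0 \<le> ?S" by (intro add_nonneg_nonneg bad_nonneg)
      ultimately show ?thesis by linarith
    next
      case False
      then have "?B x0 x1 = 1 \<or> ?B x0 x2 = 1 \<or> ?B x0 x3 = 1 \<or> ?B x1 x2 = 1 \<or> ?B x1 x3 = 1 \<or> ?B x2 x3 = 1 \<or>
         ?B x0 x4 = 1 \<or> ?B x1 x4 = 1 \<or> ?B x2 x4 = 1 \<or> ?B x3 x4 = 1
       \<or> ?B x0 x5 = 1 \<or> ?B x1 x5 = 1 \<or> ?B x2 x5 = 1 \<or> ?B x3 x5 = 1 \<or> ?B x4 x5 = 1"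
        by (auto simp: bad_def)
      moreover have "?B x y \<ge> 0" for x y by (rule bad_nonneg)
      then have "?B x0 x1 \<ge> 0" "?B x0 x2 \<ge> 0" "?B x0 x3 \<ge> 0" "?B x1 x2 \<ge> 0" "?B x1 x3 \<ge> 0" "?B x2 x3 \<ge> 0" "?B x0 x4 \<ge> 0" "?B x1 x4 \<ge> 0" "?B x2 x4 \<ge> 0" "?B x3 x4 \<ge> 0"
       "?B x0 x5 \<ge> 0" "?B x1 x5 \<ge> 0" "?B x2 x5 \<ge> 0" "?B x3 x5 \<ge> 0" "?B x4 x5 \<ge> 0" by blast+
      ultimately have "1 \<le> ?S" by (elim disjE) linarith+
      moreover have "?l \<le> 1" "0 \<le> ?c" "0 \<le> ?t" by auto
      ultimately show ?thesis by linarith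
    qed
  qed
  also have "\<dots> = pattern_density (part_weights V w ?k) + M (\<lambda>x0. M (\<lambda>x1. M (\<lambda>x2. of_bool (two_seeds e a b c x1 x0 x2))))
     + 15 * M (\<lambda>x. M (\<lambda>y. ?B x y))"
    by (simp add: mean_add mean_cmult const pattern_density_pushforward[OF k8, symmetric])
  also have "M (\<lambda>x0. M (\<lambda>x1. M (\<lambda>x2. of_bool (two_seeds e a b c x1 x0 x2)))) = M (\<lambda>a'. M (\<lambda>b'. M (\<lambda>c'. of_bool (two_seeds e a b c a' b' c'))))"
    by (rule mean_swap)
  also have "pattern_density (part_weights V w ?k) \<le> 1 / 1458"
  proof (rule pattern_density_small)
    have "part_weights V w ?k i = 0" if "i \<ge> 5" for i
    proof -
      have "?k x \<noteq> i" for x using k5[of x] that by simp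
      then show ?thesis by (simp add: part_weights_def mean_def)
    qed
    then show "part_weights V w ?k 5 = 0" "part_weights V w ?k 6 = 0" "part_weights V w ?k 7 = 0" by simp_all
  qed (simp_all add: part_weights_nonneg sum_part_weights k8)
  finally show ?thesis by simp
qed

text \<open>
  A seed that has few partners in the other cycle would imply too few copies, and seeds are frequent,
  as each copy of \<open>F27\<close> contains one.
\<close>

lemma many_two_seeds:
  assumes "copy_density \<ge> 7 / 10000" "defect \<le> 1 / 10^10"
  shows "M (\<lambda>a. M (\<lambda>b. M (\<lambda>c. M (\<lambda>a'. M (\<lambda>b'. M (\<lambda>c'. of_bool (two_seeds e a b c a' b' c'))))))) \<ge> 8 / 10^9"
    (is "?T \<ge> _")
proof -
  let ?S = "M (\<lambda>a. M (\<lambda>b. M (\<lambda>c. of_bool (seed e a b c))))"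
  have "copy_density \<le> M (\<lambda>b. M (\<lambda>a. M (\<lambda>c. M (\<lambda>d. M (\<lambda>u. M (\<lambda>v. of_bool (seed e a b c)))))))"
    unfolding copy_density_def by (intro mono) (auto simp: copy_def paw_def seed_def e_sym)
  also have "\<dots> = ?S" unfolding const by (rule mean_swap)
  finally have S: "7 / 10000 \<le> ?S" using assms(1) by linarith
  have "(copy_density - 1 / 1458) * ?S = M (\<lambda>a. M (\<lambda>b. M (\<lambda>c. (copy_density - 1 / 1458) * of_bool (seed e a b c))))"
    by (simp only: mean_cmult)
  also have "\<dots> \<le> M (\<lambda>a. M (\<lambda>b. M (\<lambda>c. M (\<lambda>a'. M (\<lambda>b'. M (\<lambda>c'. of_bool (two_seeds e a b c a' b' c'))))
     + 15 * M (\<lambda>x. M (\<lambda>y. bad [a,b,c,x,y])))))"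
  proof (intro mono)
    fix a b c
    have "0 \<le> M (\<lambda>a'. M (\<lambda>b'. M (\<lambda>c'. of_bool (two_seeds e a b c a' b' c'))))" "0 \<le> M (\<lambda>x. M (\<lambda>y. bad [a,b,c,x,y]))"
      by (intro nonneg; simp add: bad_nonneg)+
    then show "(copy_density - 1 / 1458) * of_bool (seed e a b c) \<le> M (\<lambda>a'. M (\<lambda>b'. M (\<lambda>c'. of_bool (two_seeds e a b c a' b' c'))))
     + 15 * M (\<lambda>x. M (\<lambda>y. bad [a,b,c,x,y]))"
      using copy_density_seed[of a b c] by (cases "seed e a b c") auto
  qed
  also have "\<dots> = ?T + 15 * M (\<lambda>a. M (\<lambda>b. M (\<lambda>c. M (\<lambda>x. M (\<lambda>y. bad [a,b,c,x,y])))))"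
    by (simp only: mean_add mean_cmult)
  also have "\<dots> \<le> ?T + 15 * defect" using bad_five by simp
  finally have "(copy_density - 1 / 1458) * ?S \<le> ?T + 15 * (1 / 10^10)" using assms(2) by linarith
  moreover have "(7 / 10000 - 1 / 1458) * (7 / 10000) \<le> (copy_density - 1 / 1458) * ?S"
    using assms(1) S by (intro mult_mono) auto
  moreover have "(8 / 10^9 + 15 * (1 / 10^10) :: real) \<le> (7 / 10000 - 1 / 1458) * (7 / 10000)" by simp
  ultimately show ?thesis by linarith
qed

text \<open>
  Choose two seeds at random. On average few vertices and pairs of vertices are inconsistent with
  them, so this holds for some choice, and then the pairs that are placed wrongly are among these.
\<close>

theorem close_to_blowup:
  assumes cd: "copy_density \<ge> 7 / 10000" and \<kappa>: "0 < \<kappa>" "\<kappa> \<le> 1 / 10" and D: "defect \<le> \<kappa> / 10^9"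
  shows "\<exists>p. (\<forall>x. p x < 8) \<and> deviation p \<le> 2 * \<kappa>"
proof -
  let ?ts = "\<lambda>a b c a' b' c'. of_bool (two_seeds e a b c a' b' c') :: real"
  define q where "q a b c a' b' c' = M (\<lambda>x. M (\<lambda>y. bad [a,b,c,x,y])) + M (\<lambda>x. M (\<lambda>y. bad [a',b',c',x,y]))
     + M (\<lambda>x. bad [a,b,c,a',b',c',x])" for a b c a' b' c'
  have q0: "0 \<le> q a b c a' b' c'" for a b c a' b' c'
    unfolding q_def by (intro add_nonneg_nonneg nonneg bad_nonneg)
  have "M (\<lambda>a. M (\<lambda>b. M (\<lambda>c. M (\<lambda>a'. M (\<lambda>b'. M (\<lambda>c'. q a b c a' b' c'))))))
      = 2 * M (\<lambda>a. M (\<lambda>b. M (\<lambda>c. M (\<lambda>x. M (\<lambda>y. bad [a,b,c,x,y]))))) + defect"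
    unfolding q_def defect_def by (simp add: mean_add const bad_def)
  then have q3: "M (\<lambda>a. M (\<lambda>b. M (\<lambda>c. M (\<lambda>a'. M (\<lambda>b'. M (\<lambda>c'. q a b c a' b' c')))))) \<le> 3 * (\<kappa> / 10^9)"
    using bad_five D by linarith
  \<comment> \<open>On average over the pairs of seeds the inconsistency \<open>q\<close> is below \<open>\<kappa>\<close>.\<close>
  have "8 / 10^9 - 1 / \<kappa> * (3 * (\<kappa> / 10^9)) \<le>
      M (\<lambda>a. M (\<lambda>b. M (\<lambda>c. M (\<lambda>a'. M (\<lambda>b'. M (\<lambda>c'. ?ts a b c a' b' c')))))) -
      1 / \<kappa> * M (\<lambda>a. M (\<lambda>b. M (\<lambda>c. M (\<lambda>a'. M (\<lambda>b'. M (\<lambda>c'. q a b c a' b' c'))))))"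
    using \<kappa> D by (intro diff_mono mult_left_mono q3 many_two_seeds cd) auto
  also have "\<dots> = M (\<lambda>a. M (\<lambda>b. M (\<lambda>c. M (\<lambda>a'. M (\<lambda>b'. M (\<lambda>c'. ?ts a b c a' b' c' - 1 / \<kappa> * q a b c a' b' c'))))))"
    by (simp only: mean_diff mean_cmult)
  finally have *: "M (\<lambda>a. M (\<lambda>b. M (\<lambda>c. M (\<lambda>a'. M (\<lambda>b'. M (\<lambda>c'. ?ts a b c a' b' c' - 1 / \<kappa> * q a b c a' b' c')))))) \<ge> 5 / 10^9"
    using \<kappa> by simp
  obtain a b c a' b' c' where "?ts a b c a' b' c' - 1 / \<kappa> * q a b c a' b' c' \<ge> 5 / 10^9"
    using exists_ge_mean[OF *] by (blast dest: exists_ge_mean)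
  then have **: "?ts a b c a' b' c' > 1 / \<kappa> * q a b c a' b' c'" by (simp add: less_le_trans[of _ "5 / 10^9 + 1 / \<kappa> * q a b c a' b' c'"])
  then have ts: "two_seeds e a b c a' b' c'" using q0[of a b c a' b' c'] \<kappa>(1) by (cases "two_seeds e a b c a' b' c'") (auto simp: field_simps)
  have q\<kappa>: "q a b c a' b' c' \<le> \<kappa>" using ** ts \<kappa>(1) by (simp add: field_simps)
  let ?p = "place e a b c a' b' c'"
  have "deviation ?p \<le> M (\<lambda>x. M (\<lambda>y. bad [a,b,c,a',b',c',x] + bad [a,b,c,a',b',c',y] + bad [a,b,c,x,y] + bad [a',b',c',x,y]))"
    unfolding deviation_def
  proof (intro mono)
    fix x y
    show "of_bool (e x y \<noteq> looped_adj (?p x) (?p y)) \<le> bad [a,b,c,a',b',c',x] + bad [a,b,c,a',b',c',y] + bad [a,b,c,x,y] + bad [a',b',c',x,y]"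
      using place_adjacent[OF e_sym ts, of x y] by (auto simp: bad_def)
  qed
  also have "\<dots> \<le> 2 * q a b c a' b' c'"
  proof -
    have "0 \<le> M (\<lambda>x. M (\<lambda>y. bad [a,b,c,x,y]))" "0 \<le> M (\<lambda>x. M (\<lambda>y. bad [a',b',c',x,y]))" by (intro nonneg bad_nonneg)+
    then show ?thesis by (simp add: mean_add const q_def)
  qed
  finally show ?thesis using q\<kappa> place_less by (intro exI[of _ ?p]) auto
qed

end


section \<open>Few wrong pairs cost few copies\<close>

lemma class_of_right:
  assumes "e y a = looped_adj p z" "e y b = looped_adj p (Suc z)" "e y c = looped_adj p (Suc (Suc z))" "p < 8" "z = 0 \<or> z = 4"
  shows "class_of e a b c y = (if (p < 4) = (z < 4) then p - z else 4)"
proof -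
  have "list_all (\<lambda>z. list_all (\<lambda>p. class3 (looped_adj p z) (looped_adj p (Suc z)) (looped_adj p (Suc (Suc z)))
      = (if (p < 4) = (z < 4) then p - z else 4)) [0..<8]) [0,4]"
    by code_simp
  moreover have "z \<in> set [0,4]" "p \<in> set [0..<8]" using assms(4,5) by (auto simp del: upt_Suc)
  ultimately show ?thesis unfolding class_of_def assms(1-3) list_all_iff by blast
qed

lemma one_le_of_bool: "(1 :: real) \<le> of_bool P \<longleftrightarrow> P"
  by (cases P) auto

lemma of_bool_le_zero: "(of_bool P :: real) \<le> 0 \<longleftrightarrow> \<not> P"
  by simp

lemma mean_multc: "mean V w (\<lambda>x. f x * c) = mean V w f * c"
  by (simp add: mean_def sum_distrib_right mult.assoc)

context weighted_graph
begin

context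
  fixes p :: "'v \<Rightarrow> nat"
  assumes p: "\<And>x. p x < 8" and mass: "\<And>i. i < 8 \<Longrightarrow> M (\<lambda>x. of_bool (p x = i)) = 1 / 8"
begin

definition wrong :: "'v \<Rightarrow> 'v \<Rightarrow> real" where
  "wrong x y = of_bool (e x y \<noteq> looped_adj (p x) (p y))"

lemma wrong_sym: "wrong x y = wrong y x"
  by (auto simp: wrong_def e_sym looped_adj_def)

lemma wrong_nonneg: "0 \<le> wrong x y"
  by (simp add: wrong_def)

definition wrong_degree :: "'v \<Rightarrow> real" where
  "wrong_degree x = M (\<lambda>y. wrong x y)"

lemma mean_wrong_degree: "M wrong_degree = deviation p"
  unfolding deviation_def wrong_degree_def[abs_def] wrong_def ..

definition bad_at :: "'v \<Rightarrow> real" where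
  "bad_at x = M (\<lambda>a. M (\<lambda>b. M (\<lambda>c. M (\<lambda>d. M (\<lambda>f. M (\<lambda>g. bad [x,a,b,c,d,f,g]))))))"

lemma mean_bad_at: "M bad_at = defect"
  by (simp add: defect_def bad_at_def[abs_def] bad_def)

lemma right_eq: "\<not> 1 \<le> wrong x y \<Longrightarrow> e x y = looped_adj (p x) (p y)"
  by (cases "e x y = looped_adj (p x) (p y)") (auto simp: wrong_def)

lemma seed_right:
  assumes "p a = z" "p b = Suc z" "p c = Suc (Suc z)" "z = 0 \<or> z = 4"
    and "\<not> 1 \<le> wrong a b" "\<not> 1 \<le> wrong b c" "\<not> 1 \<le> wrong a c"
  shows "seed e a b c"
  using assms right_eq by (auto simp: seed_def looped_adj_def)

lemma class_of_right':
  assumes "p a = z" "p b = Suc z" "p c = Suc (Suc z)" "z = 0 \<or> z = 4"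
    and "\<not> 1 \<le> wrong y a" "\<not> 1 \<le> wrong y b" "\<not> 1 \<le> wrong y c"
  shows "class_of e a b c y = (if (p y < 4) = (z < 4) then p y - z else 4)"
  using assms right_eq by (intro class_of_right p) simp_all

text \<open>
  A wrong pair together with a seed of the cycle of one of its vertices is not induced in a
  blowup, unless the seed is wrong itself or misjudges one of the two vertices.
\<close>

lemma wrong_pair_bad:
  "wrong x y * (1 / 8 ^ 3 - 3 * deviation p - 3 * wrong_degree x - 3 * wrong_degree y)
    \<le> M (\<lambda>a. M (\<lambda>b. M (\<lambda>c. bad [a,b,c,x,y])))"
proof (cases "1 \<le> wrong x y")
  case False
  then have "wrong x y = 0" using right_eq[OF False] by (simp add: wrong_def)
  moreover have "0 \<le> M (\<lambda>a. M (\<lambda>b. M (\<lambda>c. bad [a,b,c,x,y])))" by (intro nonneg bad_nonneg)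
  ultimately show ?thesis by simp
next
  case True
  then have w1: "wrong x y = 1" by (cases "e x y = looped_adj (p x) (p y)") (auto simp: wrong_def)
  \<comment> \<open>The seed is taken from the first three parts of the cycle of \<open>x\<close>.\<close>
  define z :: nat where "z = (if p x < 4 then 0 else 4)"
  have z: "z = 0 \<or> z = 4" "Suc (Suc z) < 8" "(p x < 4) = (z < 4)" by (auto simp: z_def)
  let ?I = "\<lambda>a b c. of_bool (p a = z) * (of_bool (p b = Suc z) * of_bool (p c = Suc (Suc z))) :: real"
  have le: "M (\<lambda>a. M (\<lambda>b. M (\<lambda>c. ?I a b c - (wrong a b + wrong b c + wrong a c) - (wrong x a + wrong x b + wrong x c) - (wrong y a + wrong y b + wrong y c))))
      \<le> M (\<lambda>a. M (\<lambda>b. M (\<lambda>c. bad [a,b,c,x,y])))"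
  proof (intro mono)
    fix a b c
    show "?I a b c - (wrong a b + wrong b c + wrong a c) - (wrong x a + wrong x b + wrong x c) - (wrong y a + wrong y b + wrong y c) \<le> bad [a,b,c,x,y]"
    proof (rule ccontr)
      assume *: "\<not> ?thesis"
      have nn: "0 \<le> wrong a b" "0 \<le> wrong b c" "0 \<le> wrong a c" "0 \<le> wrong x a" "0 \<le> wrong x b" "0 \<le> wrong x c"
        "0 \<le> wrong y a" "0 \<le> wrong y b" "0 \<le> wrong y c" "0 \<le> bad [a,b,c,x,y]" by (simp_all add: wrong_nonneg bad_nonneg)
      define i where "i = ?I a b c"
      have "i \<le> 1" by (simp add: i_def)
      then have r: "\<not> 1 \<le> wrong a b" "\<not> 1 \<le> wrong b c" "\<not> 1 \<le> wrong a c" "\<not> 1 \<le> wrong x a" "\<not> 1 \<le> wrong x b" "\<not> 1 \<le> wrong x c"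
        "\<not> 1 \<le> wrong y a" "\<not> 1 \<le> wrong y b" "\<not> 1 \<le> wrong y c" "\<not> 1 \<le> bad [a,b,c,x,y]" "\<not> i \<le> 0"
        using *[folded i_def] nn by linarith+
      have I: "p a = z" "p b = Suc z" "p c = Suc (Suc z)"
        using r(11) unfolding i_def by (cases "p a = z"; cases "p b = Suc z"; cases "p c = Suc (Suc z)"; simp)+
      have good: "induces_blowup e [a,b,c,x,y]" using r(10) unfolding bad_def one_le_of_bool by blast
      have seed: "seed e a b c" by (rule seed_right[OF I z(1) r(1,2,3)])
      have cx: "class_of e a b c x = p x - z" using class_of_right'[OF I z(1) r(4,5,6)] z(3) by simp
      note cy = class_of_right'[OF I z(1) r(7,8,9)]
      have "class_of e a b c x < 4 \<or> class_of e a b c y < 4" unfolding cx using p[of x] by (auto simp: z_def)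
      from seed_determines(4)[OF e_sym good seed this]
      have "e x y = looped_adj (p x - z) (if (p y < 4) = (z < 4) then p y - z else 4)" unfolding cx cy .
      also have "\<dots> = looped_adj (p x) (p y)" using p[of x] p[of y] by (auto simp: looped_adj_def z_def)
      finally show False using w1 by (simp add: wrong_def)
    qed
  qed
  have eq: "M (\<lambda>a. M (\<lambda>b. M (\<lambda>c. ?I a b c - (wrong a b + wrong b c + wrong a c) - (wrong x a + wrong x b + wrong x c) - (wrong y a + wrong y b + wrong y c))))
    = 1 / 8 ^ 3 - 3 * deviation p - 3 * wrong_degree x - 3 * wrong_degree y"
  proof -
    have "M (\<lambda>a. M (\<lambda>b. M (\<lambda>c. ?I a b c))) = 1 / 8 ^ 3"
    proof -
      have lt: "z < 8" "Suc z < 8" "Suc (Suc z) < 8" using z(2) by auto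
      show ?thesis unfolding mean_cmult mean_multc mass[OF lt(1)] mass[OF lt(2)] mass[OF lt(3)] by simp
    qed
    then show ?thesis unfolding mean_wrong_degree[symmetric]
    by (simp add: mean_diff mean_add mean_cmult const mass wrong_degree_def[abs_def, symmetric] wrong_degree_def[symmetric])
  qed
  show ?thesis using le unfolding eq by (simp add: w1)
qed

text \<open>
  Suppose that no placement of \<open>x\<close> fits the adjacencies of \<open>x\<close> much better than the given one. Two seeds
  that judge \<open>x\<close> consistently would provide a placement that fits most of them.
\<close>

lemma wrong_degree_bad:
  assumes best: "\<And>j. j < 8 \<Longrightarrow> wrong_degree x \<le> 2 * M (\<lambda>y. of_bool (e x y \<noteq> looped_adj j (p y)))"
  shows "wrong_degree x / 8 ^ 6 \<le> 6 * bad_at x + 21 * deviation p"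
proof -
  let ?I = "\<lambda>a b c a' b' c'. of_bool (p a = 0) * (of_bool (p b = 1) * (of_bool (p c = 2) *
    (of_bool (p a' = 4) * (of_bool (p b' = 5) * of_bool (p c' = 6))))) :: real"
  let ?S = "\<lambda>a b c a' b' c'. wrong a b + wrong b c + wrong a c + wrong a' b' + wrong b' c' + wrong a' c' + wrong a a' + wrong b a' + wrong c a'"
  let ?Y = "\<lambda>a b c a' b' c'. M (\<lambda>y. bad [a,b,c,x,y] + bad [a',b',c',x,y] + (wrong a y + wrong b y + wrong c y + wrong a' y + wrong b' y + wrong c' y))"
  have one: "wrong_degree x \<le> 1"
  proof -
    have "wrong_degree x \<le> M (\<lambda>y. 1)" unfolding wrong_degree_def by (intro mono) (simp add: wrong_def)
    then show ?thesis by (simp add: const)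
  qed
  have "wrong_degree x * M (\<lambda>a. M (\<lambda>b. M (\<lambda>c. M (\<lambda>a'. M (\<lambda>b'. M (\<lambda>c'. ?I a b c a' b' c'))))))
     = M (\<lambda>a. M (\<lambda>b. M (\<lambda>c. M (\<lambda>a'. M (\<lambda>b'. M (\<lambda>c'. wrong_degree x * ?I a b c a' b' c'))))))"
    by (simp only: mean_cmult)
  also have "\<dots> \<le> M (\<lambda>a. M (\<lambda>b. M (\<lambda>c. M (\<lambda>a'. M (\<lambda>b'. M (\<lambda>c'. ?S a b c a' b' c' + 2 * (bad [a,b,c,a',b',c',x] + ?Y a b c a' b' c')))))))"
  proof (intro mono)
    fix a b c a' b' c'
    have S0: "0 \<le> ?S a b c a' b' c'" by (intro add_nonneg_nonneg wrong_nonneg)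
    have Y0: "0 \<le> ?Y a b c a' b' c'" by (intro add_nonneg_nonneg wrong_nonneg bad_nonneg nonneg)
    note B0 = bad_nonneg[of "[a,b,c,a',b',c',x]"]
    show "wrong_degree x * ?I a b c a' b' c' \<le> ?S a b c a' b' c' + 2 * (bad [a,b,c,a',b',c',x] + ?Y a b c a' b' c')"
    proof (cases "(p a = 0 \<and> p b = 1 \<and> p c = 2 \<and> p a' = 4 \<and> p b' = 5 \<and> p c' = 6) \<and> ?S a b c a' b' c' < 1 \<and> bad [a,b,c,a',b',c',x] < 1")
      case True
      have nn: "0 \<le> wrong a b" "0 \<le> wrong b c" "0 \<le> wrong a c" "0 \<le> wrong a' b'" "0 \<le> wrong b' c'" "0 \<le> wrong a' c'"
        "0 \<le> wrong a a'" "0 \<le> wrong b a'" "0 \<le> wrong c a'" by (simp_all add: wrong_nonneg)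
      have r: "\<not> 1 \<le> wrong a b" "\<not> 1 \<le> wrong b c" "\<not> 1 \<le> wrong a c" "\<not> 1 \<le> wrong a' b'" "\<not> 1 \<le> wrong b' c'" "\<not> 1 \<le> wrong a' c'"
        "\<not> 1 \<le> wrong a a'" "\<not> 1 \<le> wrong b a'" "\<not> 1 \<le> wrong c a'" using True nn by linarith+
      have I: "p a = 0" "p b = Suc 0" "p c = Suc (Suc 0)" and I': "p a' = 4" "p b' = Suc 4" "p c' = Suc (Suc 4)"
        using True by auto
      have good: "induces_blowup e [a,b,c,a',b',c',x]" using True by (cases "induces_blowup e [a,b,c,a',b',c',x]") (auto simp: bad_def)
      have seeds: "seed e a b c" "seed e a' b' c'"
        using seed_right[OF I _ r(1-3)] seed_right[OF I' _ r(4-6)] by auto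
      have "\<not> e a' a" "\<not> e a' b" "\<not> e a' c"
        using right_eq[OF r(7)] right_eq[OF r(8)] right_eq[OF r(9)] I I' e_sym by (auto simp: looped_adj_def)
      then have ts: "two_seeds e a b c a' b' c'" using seeds by (simp add: two_seeds_def)
      define j where "j = place e a b c a' b' c' x"
      have "M (\<lambda>y. of_bool (e x y \<noteq> looped_adj j (p y))) \<le> ?Y a b c a' b' c'"
      proof (rule mono)
        fix y
        show "of_bool (e x y \<noteq> looped_adj j (p y)) \<le> bad [a,b,c,x,y] + bad [a',b',c',x,y] + (wrong a y + wrong b y + wrong c y + wrong a' y + wrong b' y + wrong c' y)"
        proof (rule ccontr)
          assume *: "\<not> ?thesis"
          have nn: "0 \<le> bad [a,b,c,x,y]" "0 \<le> bad [a',b',c',x,y]" "0 \<le> wrong a y" "0 \<le> wrong b y" "0 \<le> wrong c y" "0 \<le> wrong a' y" "0 \<le> wrong b' y" "0 \<le> wrong c' y"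
            by (simp_all add: wrong_nonneg bad_nonneg)
          have "of_bool (e x y \<noteq> looped_adj j (p y)) \<le> (1::real)" by simp
          then have s: "\<not> 1 \<le> bad [a,b,c,x,y]" "\<not> 1 \<le> bad [a',b',c',x,y]" "\<not> 1 \<le> wrong y a" "\<not> 1 \<le> wrong y b" "\<not> 1 \<le> wrong y c" "\<not> 1 \<le> wrong y a'" "\<not> 1 \<le> wrong y b'" "\<not> 1 \<le> wrong y c'"
            "\<not> of_bool (e x y \<noteq> looped_adj j (p y)) \<le> (0::real)"
            using * nn unfolding wrong_sym[of y] by linarith+
          have g: "induces_blowup e [a,b,c,x,y]" "induces_blowup e [a',b',c',x,y]" using s(1,2) by (simp_all add: bad_def one_le_of_bool)
          have ne: "e x y \<noteq> looped_adj j (p y)" using s(9) unfolding of_bool_le_zero by blast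
          have cy: "class_of e a b c y = (if p y < 4 then p y else 4)" "class_of e a' b' c' y = (if p y < 4 then 4 else p y - 4)"
            using class_of_right'[OF I _ s(3-5)] class_of_right'[OF I' _ s(6-8)] by auto
          show False
          proof (cases "class_of e a b c x < 4")
            case True
            then have "e x y = looped_adj j (if p y < 4 then p y else 4)"
              using seed_determines(4)[OF e_sym g(1) seeds(1)] cy by (simp add: j_def place_def)
            moreover have "j < 4" using True by (simp add: j_def place_def)
            then have "looped_adj j (if p y < 4 then p y else 4) = looped_adj j (p y)"
              using p[of y] by (auto simp: looped_adj_def)
            ultimately show False using ne by blast
          next
            case False
            then have c': "class_of e a' b' c' x < 4" using two_seeds_exclusive[OF good ts] by auto
            then have "e x y = looped_adj (j - 4) (if p y < 4 then 4 else p y - 4)" "j \<ge> 4"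
              using seed_determines(4)[OF e_sym g(2) seeds(2)] cy False by (simp_all add: j_def place_def)
            moreover have "j < 8" by (simp add: j_def place_less)
            then have "looped_adj (j - 4) (if p y < 4 then 4 else p y - 4) = looped_adj j (p y)"
              using p[of y] \<open>j \<ge> 4\<close> by (auto simp: looped_adj_def)
            ultimately show False using ne by blast
          qed
        qed
      qed
      moreover have "wrong_degree x \<le> 2 * M (\<lambda>y. of_bool (e x y \<noteq> looped_adj j (p y)))"
        unfolding j_def by (rule best[OF place_less])
      ultimately have "wrong_degree x \<le> 2 * ?Y a b c a' b' c'" by linarith
      moreover have "wrong_degree x * ?I a b c a' b' c' = wrong_degree x" using True by simp
      moreover have "d * i \<le> s + 2 * (t + y)" if "d \<le> 2 * y" "d * i = d" "0 \<le> s" "0 \<le> t" for d i s t y :: real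
        unfolding that(2) using that(1,3,4) by argo
      ultimately show ?thesis using S0 B0 by blast
    next
      case False
      have 01: "?I a b c a' b' c' = 0 \<or> ?I a b c a' b' c' = 1 \<and> (p a = 0 \<and> p b = 1 \<and> p c = 2 \<and> p a' = 4 \<and> p b' = 5 \<and> p c' = 6)" by auto
      have "?I a b c a' b' c' = 0 \<or> ?I a b c a' b' c' = 1 \<and> (1 \<le> ?S a b c a' b' c' \<or> 1 \<le> bad [a,b,c,a',b',c',x])"
        using 01 False unfolding not_less[symmetric] by argo
      moreover have "d * i \<le> s + 2 * (t + y)" if "i = 0 \<or> i = 1 \<and> (1 \<le> s \<or> 1 \<le> t)" "d \<le> 1" "0 \<le> s" "0 \<le> t" "0 \<le> y" for d i s t y :: real
        using that by auto
      ultimately show ?thesis using one S0 B0 Y0 by blast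
    qed
  qed
  also have "\<dots> = 9 * deviation p + 2 * (M (\<lambda>a. M (\<lambda>b. M (\<lambda>c. M (\<lambda>a'. M (\<lambda>b'. M (\<lambda>c'. bad [a,b,c,a',b',c',x]))))))
      + 2 * M (\<lambda>a. M (\<lambda>b. M (\<lambda>c. M (\<lambda>y. bad [a,b,c,x,y])))) + 6 * deviation p)"
    unfolding mean_wrong_degree[symmetric]
    by (simp add: mean_add mean_cmult const wrong_degree_def[abs_def, symmetric] wrong_degree_def[symmetric])
  also have "M (\<lambda>a. M (\<lambda>b. M (\<lambda>c. M (\<lambda>a'. M (\<lambda>b'. M (\<lambda>c'. bad [a,b,c,a',b',c',x])))))) \<le> bad_at x"
    unfolding bad_at_def using bad_sub[of "[1,2,3,4,5,6,0]" "[x,_,_,_,_,_,_]"] by (intro mono) simp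
  also have "M (\<lambda>a. M (\<lambda>b. M (\<lambda>c. M (\<lambda>y. bad [a,b,c,x,y])))) \<le> bad_at x"
  proof -
    have "M (\<lambda>a. M (\<lambda>b. M (\<lambda>c. M (\<lambda>y. M (\<lambda>g. M (\<lambda>h. bad [a,b,c,x,y])))))) \<le> bad_at x"
      unfolding bad_at_def using bad_sub[of "[1,2,3,0,4]" "[x,_,_,_,_,_,_]"] by (intro mono) simp
    then show ?thesis by (simp add: const)
  qed
  also have "M (\<lambda>a. M (\<lambda>b. M (\<lambda>c. M (\<lambda>a'. M (\<lambda>b'. M (\<lambda>c'. ?I a b c a' b' c')))))) = 1 / 8 ^ 6"
  proof -
    have "(0::nat) < 8" "(1::nat) < 8" "(2::nat) < 8" "(4::nat) < 8" "(5::nat) < 8" "(6::nat) < 8" by simp_all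
    note this[THEN mass]
    then show ?thesis unfolding mean_cmult mean_multc by (simp only:) simp
  qed
  finally show ?thesis by simp
qed

text \<open>
  Call a vertex heavy if the proportion of its wrong pairs is at least \<open>\<eta>\<close>. Wrong pairs at heavy vertices
  are accounted for by the tuples through these vertices. For a wrong pair of light vertices most
  seeds judge both of them correctly.
\<close>

theorem deviation_le_defect:
  assumes best: "\<And>x j. x \<in> V \<Longrightarrow> j < 8 \<Longrightarrow> wrong_degree x \<le> 2 * M (\<lambda>y. of_bool (e x y \<noteq> looped_adj j (p y)))"
    and small: "deviation p \<le> 1 / 10 ^ 12"
  shows "deviation p \<le> 10 ^ 7 * defect"
proof -
  let ?\<eta> = "1 / 10 ^ 4 :: real"
  let ?h = "\<lambda>x. of_bool (?\<eta> \<le> wrong_degree x) :: real"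
  have heavy: "?h x * wrong_degree x \<le> 12 * 8 ^ 6 * bad_at x" if "x \<in> V" for x
  proof (cases "?\<eta> \<le> wrong_degree x")
    case True
    have "wrong_degree x / 8 ^ 6 \<le> 6 * bad_at x + 21 * deviation p" by (rule wrong_degree_bad[OF best[OF that]])
    moreover have "21 * deviation p \<le> 1 / 10 ^ 4 / (2 * 8 ^ 6)" using small by simp
    moreover have "1 / 10 ^ 4 / (2 * 8 ^ 6) \<le> wrong_degree x / (2 * 8 ^ 6)" using True by (intro divide_right_mono) auto
    ultimately have "wrong_degree x / (2 * 8 ^ 6) \<le> 6 * bad_at x" by simp
    then show ?thesis using True by simp
  next
    case False
    have "0 \<le> bad_at x" unfolding bad_at_def by (intro nonneg bad_nonneg)
    then show ?thesis using False by simp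
  qed
  have light: "wrong x y \<le> ?h x * wrong x y + ?h y * wrong x y + 1024 * M (\<lambda>a. M (\<lambda>b. M (\<lambda>c. bad [a,b,c,x,y])))" for x y
  proof -
    have nn: "0 \<le> M (\<lambda>a. M (\<lambda>b. M (\<lambda>c. bad [a,b,c,x,y])))" by (intro nonneg bad_nonneg)
    show ?thesis
    proof (cases "?\<eta> \<le> wrong_degree x \<or> ?\<eta> \<le> wrong_degree y")
      case True
      then show ?thesis using nn wrong_nonneg[of x y] by auto
    next
      case False
      have "wrong x y * (1 / 1024) \<le> wrong x y * (1 / 8 ^ 3 - 3 * deviation p - 3 * wrong_degree x - 3 * wrong_degree y)"
        using False small wrong_nonneg[of x y] by (intro mult_left_mono) auto
      then show ?thesis using wrong_pair_bad[of x y] False by simp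
    qed
  qed
  have "deviation p = M (\<lambda>x. M (\<lambda>y. wrong x y))" by (simp add: deviation_def wrong_def)
  also have "\<dots> \<le> M (\<lambda>x. M (\<lambda>y. ?h x * wrong x y + ?h y * wrong x y + 1024 * M (\<lambda>a. M (\<lambda>b. M (\<lambda>c. bad [a,b,c,x,y])))))"
    using light by (intro mono)
  also have "\<dots> = M (\<lambda>x. ?h x * wrong_degree x) + M (\<lambda>x. M (\<lambda>y. ?h y * wrong x y)) + 1024 * M (\<lambda>x. M (\<lambda>y. M (\<lambda>a. M (\<lambda>b. M (\<lambda>c. bad [a,b,c,x,y])))))"
    unfolding mean_add mean_cmult wrong_degree_def[symmetric] ..
  also have "M (\<lambda>x. M (\<lambda>y. ?h y * wrong x y)) = M (\<lambda>x. ?h x * wrong_degree x)"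
  proof -
    have "M (\<lambda>x. wrong x y) = wrong_degree y" for y
      unfolding wrong_degree_def wrong_sym[of y] ..
    then show ?thesis by (subst mean_swap) (simp only: mean_cmult)
  qed
  also have "M (\<lambda>x. ?h x * wrong_degree x) \<le> M (\<lambda>x. 12 * 8 ^ 6 * bad_at x)" by (intro mono heavy)
  also have "M (\<lambda>x. 12 * 8 ^ 6 * bad_at x) = 12 * 8 ^ 6 * defect" by (simp only: mean_cmult mean_bad_at)
  also have "M (\<lambda>x. M (\<lambda>y. M (\<lambda>a. M (\<lambda>b. M (\<lambda>c. bad [a,b,c,x,y]))))) \<le> defect"
  proof -
    have "M (\<lambda>x. M (\<lambda>y. M (\<lambda>a. M (\<lambda>b. M (\<lambda>c. M (\<lambda>g. M (\<lambda>h. bad [a,b,c,x,y]))))))) \<le> defect"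
      unfolding defect_def bad_def[symmetric] using bad_sub[of "[2,3,4,0,1]" "[_,_,_,_,_,_,_]"] by (intro mono) simp
    then show ?thesis by (simp add: const)
  qed
  finally have "deviation p \<le> (24 * 8 ^ 6 + 1024) * defect" by simp
  moreover have "0 \<le> defect" unfolding defect_def by (intro nonneg) simp
  ultimately show ?thesis by simp
qed

end
end


definition pair_sum :: "('v \<Rightarrow> 'v \<Rightarrow> real) \<Rightarrow> 'v \<Rightarrow> 'v \<Rightarrow> 'v \<Rightarrow> 'v \<Rightarrow> 'v \<Rightarrow> 'v \<Rightarrow> real" where
  "pair_sum g a b c d u v = g a b + g a c + g a d + g b c + g b d + g c d + g a u + g b u + g c u + g d u
     + g a v + g b v + g c v + g d v + g u v"

lemma (in weighted_graph) mean_pair_sum: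
  "M (\<lambda>a. M (\<lambda>b. M (\<lambda>c. M (\<lambda>d. M (\<lambda>u. M (\<lambda>v. pair_sum g a b c d u v)))))) = 15 * M (\<lambda>x. M (\<lambda>y. g x y))"
  by (simp add: pair_sum_def mean_add mean_cmult const)

lemma copy_pair_sum:
  assumes e: "\<And>x y. e x y = e y x" and h: "\<And>x y. h x y = h y x"
  shows "\<bar>of_bool (copy h a b c d u v) - of_bool (copy e a b c d u v)\<bar> \<le> pair_sum (\<lambda>x y. of_bool (e x y \<noteq> h x y)) a b c d u v"
    (is "?l \<le> pair_sum ?g a b c d u v")
proof (cases "e a b = h a b \<and> e a c = h a c \<and> e a d = h a d \<and> e b c = h b c \<and> e b d = h b d \<and> e c d = h c d \<and>
    e a u = h a u \<and> e b u = h b u \<and> e c u = h c u \<and> e d u = h d u \<and> e a v = h a v \<and> e b v = h b v \<and> e c v = h c v \<and> e d v = h d v \<and> e u v = h u v")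
  case True
  then have "copy e a b c d u v = copy h a b c d u v"
    unfolding copy_def paw_def e[of u a] e[of u b] e[of u c] e[of u d] e[of v a] e[of v b] e[of v c] e[of v d]
      h[of u a] h[of u b] h[of u c] h[of u d] h[of v a] h[of v b] h[of v c] h[of v d] by blast
  moreover have "0 \<le> pair_sum ?g a b c d u v" by (simp add: pair_sum_def)
  ultimately show ?thesis by simp
next
  case False
  have g0: "0 \<le> ?g x y" for x y by simp
  note nn = g0[of a b] g0[of a c] g0[of a d] g0[of b c] g0[of b d] g0[of c d] g0[of a u] g0[of b u] g0[of c u] g0[of d u]
    g0[of a v] g0[of b v] g0[of c v] g0[of d v] g0[of u v]
  have "?g a b = 1 \<or> ?g a c = 1 \<or> ?g a d = 1 \<or> ?g b c = 1 \<or> ?g b d = 1 \<or> ?g c d = 1 \<or> ?g a u = 1 \<or> ?g b u = 1 \<or> ?g c u = 1 \<or> ?g d u = 1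
    \<or> ?g a v = 1 \<or> ?g b v = 1 \<or> ?g c v = 1 \<or> ?g d v = 1 \<or> ?g u v = 1"
    using False by auto
  then have "1 \<le> pair_sum ?g a b c d u v" unfolding pair_sum_def using nn by (elim disjE) linarith+
  moreover have "?l \<le> 1" by (auto simp: abs_if)
  ultimately show ?thesis by linarith
qed

text \<open>A pair of vertices that coincide makes one position of the tuple redundant.\<close>

lemma pair_sum_coincide:
  assumes g0: "\<And>x y. 0 \<le> g x y" and g_sym: "\<And>x y. g x y = g y x" and g_refl: "\<And>x. g x x = 0"
  shows "(of_bool (b = d) + of_bool (u = v)) * pair_sum g a b c d u v
    \<le> of_bool (d = b) * (2 * (g a b + g a c + g b c + g a u + g b u + g c u + g a v + g b v + g c v + g u v))
      + of_bool (v = u) * (2 * (g a b + g a c + g a d + g b c + g b d + g c d + g a u + g b u + g c u + g d u))"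
proof -
  have s: "g c b = g b c" by (rule g_sym)
  have 1: "of_bool (b = d) * pair_sum g a b c d u v \<le> of_bool (d = b) * (2 * (g a b + g a c + g b c + g a u + g b u + g c u + g a v + g b v + g c v + g u v))"
    using s g0[of a b] g0[of a c] g0[of b c] g0[of a u] g0[of b u] g0[of c u] g0[of a v] g0[of b v] g0[of c v] g0[of u v]
    by (cases "b = d") (auto simp: pair_sum_def g_refl)
  have 2: "of_bool (u = v) * pair_sum g a b c d u v \<le> of_bool (v = u) * (2 * (g a b + g a c + g a d + g b c + g b d + g c d + g a u + g b u + g c u + g d u))"
    using g0[of a b] g0[of a c] g0[of a d] g0[of b c] g0[of b d] g0[of c d] g0[of a u] g0[of b u] g0[of c u] g0[of d u]
    by (cases "u = v") (auto simp: pair_sum_def g_refl)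
  show ?thesis using add_mono[OF 1 2] by (simp only: distrib_right)
qed

lemma product_near_one:
  fixes x y :: real
  assumes "\<bar>x - 1\<bar> \<le> k * \<theta>" "\<bar>y - 1\<bar> \<le> \<theta>" "k * \<theta> \<le> 1" "0 \<le> \<theta>"
  shows "\<bar>x * y - 1\<bar> \<le> (k + 2) * \<theta>"
proof -
  have "\<bar>x - 1\<bar> * \<bar>y - 1\<bar> \<le> 1 * \<theta>" using assms by (intro mult_mono) auto
  moreover have "x * y - 1 = (x - 1) * (y - 1) + (x - 1) + (y - 1)" by (simp add: algebra_simps)
  then have "\<bar>x * y - 1\<bar> \<le> \<bar>x - 1\<bar> * \<bar>y - 1\<bar> + \<bar>x - 1\<bar> + \<bar>y - 1\<bar>"
    using abs_triangle_ineq[of "(x - 1) * (y - 1) + (x - 1)" "y - 1"] abs_triangle_ineq[of "(x - 1) * (y - 1)" "x - 1"]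
    by (simp only: abs_mult[symmetric])
  ultimately show ?thesis using assms by (simp add: algebra_simps)
qed

lemma mean_reweight:
  assumes "\<And>x. x \<in> V \<Longrightarrow> w x = u x * \<rho> x"
  shows "mean V w f = mean V u (\<lambda>x. \<rho> x * f x)"
  unfolding mean_def using assms by (intro sum.cong) (auto simp: mult.assoc)

context weighted_graph
begin

definition distinct_density :: "('v \<Rightarrow> 'v \<Rightarrow> bool) \<Rightarrow> real" where
  "distinct_density h = M (\<lambda>a. M (\<lambda>b. M (\<lambda>c. M (\<lambda>d. M (\<lambda>u. M (\<lambda>v. of_bool (copy h a b c d u v \<and> b \<noteq> d \<and> u \<noteq> v)))))))"

lemma deviation_nonneg: "0 \<le> deviation p"
  unfolding deviation_def by (intro nonneg) simp

lemma pattern_density_close: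
  assumes p: "\<And>x. p x < 8"
  shows "\<bar>pattern_density (part_weights V w p) - copy_density\<bar> \<le> 15 * deviation p"
proof -
  let ?h = "\<lambda>x y. looped_adj (p x) (p y)"
  have h: "?h x y = ?h y x" for x y by (auto simp: looped_adj_def)
  have cp: "copy looped_adj (p a) (p b) (p c) (p d) (p u) (p v) = copy ?h a b c d u v" for a b c d u v
    by (simp add: copy_def paw_def)
  have eq: "pattern_density (part_weights V w p) = M (\<lambda>a. M (\<lambda>b. M (\<lambda>c. M (\<lambda>d. M (\<lambda>u. M (\<lambda>v. of_bool (copy ?h a b c d u v)))))))"
    using pattern_density_pushforward[of p] p unfolding cp by simp
  have D: "\<bar>of_bool (copy ?h a b c d u v) - of_bool (copy e a b c d u v)\<bar> \<le> pair_sum (\<lambda>x y. of_bool (e x y \<noteq> ?h x y)) a b c d u v" for a b c d u v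
    by (rule copy_pair_sum[OF e_sym h])
  have D': "\<bar>of_bool (copy e a b c d u v) - of_bool (copy ?h a b c d u v)\<bar> \<le> pair_sum (\<lambda>x y. of_bool (e x y \<noteq> ?h x y)) a b c d u v" for a b c d u v
    by (subst abs_minus_commute) (rule D)
  have "pattern_density (part_weights V w p) - copy_density = M (\<lambda>a. M (\<lambda>b. M (\<lambda>c. M (\<lambda>d. M (\<lambda>u. M (\<lambda>v.
      of_bool (copy ?h a b c d u v) - of_bool (copy e a b c d u v)))))))"
    unfolding eq copy_density_def mean_diff ..
  moreover have "\<dots> \<le> 15 * deviation p" unfolding deviation_def mean_pair_sum[symmetric]
    by (intro mono abs_le_D1[OF D])
  moreover have "copy_density - pattern_density (part_weights V w p) = M (\<lambda>a. M (\<lambda>b. M (\<lambda>c. M (\<lambda>d. M (\<lambda>u. M (\<lambda>v.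
      of_bool (copy e a b c d u v) - of_bool (copy ?h a b c d u v)))))))"
    unfolding eq copy_density_def mean_diff ..
  moreover have "\<dots> \<le> 15 * deviation p" unfolding deviation_def mean_pair_sum[symmetric]
    by (intro mono abs_le_D1[OF D'])
  ultimately show ?thesis by linarith
qed

text \<open>
  The factor \<open>\<rho>\<close> gives all parts the same weight. The two error terms of the comparison come from
  replacing the weights by uniform ones and from the tuples with coinciding entries; both are small
  multiples of the deviation, as the compared indicators agree on all tuples without a wrong pair.
\<close>

lemma reweighted_gain:
  fixes p :: "'v \<Rightarrow> nat" and n :: nat
  assumes u: "\<And>x. x \<in> V \<Longrightarrow> w x = 1 / n" and n: "10 ^ 16 \<le> n" and refl: "\<And>x. e x x" and p: "\<And>x. p x < 8"
    and best: "\<And>x j. x \<in> V \<Longrightarrow> j < 8 \<Longrightarrow> M (\<lambda>y. of_bool (e x y \<noteq> looped_adj (p x) (p y))) \<le> M (\<lambda>y. of_bool (e x y \<noteq> looped_adj j (p y)))"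
    and parts: "\<And>i. i < 8 \<Longrightarrow> \<bar>part_weights V w p i - 1 / 8\<bar> < 1 / 10 ^ 18"
    and dev: "deviation p \<le> 1 / 10 ^ 13"
  shows "deviation p / 10 ^ 14 \<le> distinct_density (\<lambda>x y. looped_adj (p x) (p y)) - distinct_density e"
proof -
  let ?\<theta> = "1 / 10 ^ 17 :: real"
  let ?h = "\<lambda>x y. looped_adj (p x) (p y)"
  have hsym: "?h x y = ?h y x" for x y by (auto simp: looped_adj_def)
  \<comment> \<open>The quotient of the new and the old weight of \<open>x\<close>.\<close>
  define \<rho> where "\<rho> x = 1 / (8 * part_weights V w p (p x))" for x
  have \<rho>: "\<bar>\<rho> x - 1\<bar> \<le> ?\<theta>" for x
  proof -
    define q where "q = part_weights V w p (p x)"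
    have q: "\<bar>q - 1 / 8\<bar> < 1 / 10 ^ 18" unfolding q_def by (rule parts[OF p])
    then have q0: "q > 1 / 9" by (simp add: abs_if split: if_splits)
    have "\<rho> x - 1 = (1 / 8 - q) / q" using q0 by (simp add: \<rho>_def q_def[symmetric] field_simps)
    also have "\<bar>\<dots>\<bar> = \<bar>q - 1 / 8\<bar> / q" using q0 by (simp add: abs_minus_commute)
    also have "\<dots> \<le> (1 / 10 ^ 18) / (1 / 9)" using q q0 by (intro frac_le) auto
    finally show ?thesis by simp
  qed
  have \<rho>1: "\<rho> x \<le> 1 + ?\<theta>" "1 - ?\<theta> \<le> \<rho> x" for x using \<rho>[of x] by linarith+
  have \<rho>0: "0 \<le> \<rho> x" for x by (rule order_trans[OF _ \<rho>1(2)]) simp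
  define w' where "w' x = w x * \<rho> x" for x
  have rew: "mean V w' f = M (\<lambda>x. \<rho> x * f x)" for f
    by (rule mean_reweight) (simp add: w'_def)
  have mass: "mean V w' (\<lambda>x. of_bool (p x = i)) = 1 / 8" if "i < 8" for i
  proof -
    have "part_weights V w p i \<noteq> 0" using parts[OF that] by (auto simp: abs_if split: if_splits)
    have "mean V w' (\<lambda>x. of_bool (p x = i)) = M (\<lambda>x. 1 / (8 * part_weights V w p i) * of_bool (p x = i))"
      unfolding rew unfolding mean_def by (intro sum.cong) (auto simp: \<rho>_def)
    also have "\<dots> = 1 / (8 * part_weights V w p i) * part_weights V w p i"
      unfolding part_weights_def mean_cmult ..
    finally show ?thesis using \<open>part_weights V w p i \<noteq> 0\<close> by simp
  qed
  have "mean V w' (\<lambda>_. 1) = (\<Sum>i<8. mean V w' (\<lambda>x. of_bool (p x = i)) * 1)"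
    using mean_pushforward[OF finite_V, of p 8 w' "\<lambda>_. 1"] p by (simp add: mean_def)
  also have "\<dots> = 1" by (simp add: mass)
  finally have "sum w' V = 1" by (simp add: mean_def)
  then interpret W: weighted_graph V w' e
    by unfold_locales (auto simp: finite_V w'_def w_nonneg \<rho>0 e_sym)
  have W_le: "W.M f \<le> (1 + ?\<theta>) * M f" if "\<And>x. 0 \<le> f x" for f
    unfolding rew mean_cmult[symmetric] using \<rho>1(1) that by (intro mono mult_right_mono) auto
  have W_ge: "(1 - ?\<theta>) * M f \<le> W.M f" if "\<And>x. 0 \<le> f x" for f
    unfolding rew mean_cmult[symmetric] using \<rho>1(2) that by (intro mono mult_right_mono) auto
  let ?g = "\<lambda>x y. of_bool (e x y \<noteq> ?h x y) :: real"
  have dev_le: "W.deviation p \<le> 1 / 10 ^ 12"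
  proof -
    have "W.deviation p \<le> W.M (\<lambda>x. (1 + ?\<theta>) * M (\<lambda>y. ?g x y))"
      unfolding W.deviation_def by (intro W.mono W_le) simp
    also have "\<dots> \<le> (1 + ?\<theta>) * M (\<lambda>x. (1 + ?\<theta>) * M (\<lambda>y. ?g x y))"
      by (intro W_le mult_nonneg_nonneg nonneg) simp_all
    also have "\<dots> = (1 + ?\<theta>) * ((1 + ?\<theta>) * deviation p)" by (simp only: mean_cmult deviation_def)
    finally show ?thesis using dev by simp
  qed
  have dev_ge: "(1 - ?\<theta>) * ((1 - ?\<theta>) * deviation p) \<le> W.deviation p"
  proof -
    have "(1 - ?\<theta>) * ((1 - ?\<theta>) * deviation p) = (1 - ?\<theta>) * M (\<lambda>x. (1 - ?\<theta>) * M (\<lambda>y. ?g x y))"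
      by (simp only: mean_cmult deviation_def)
    also have "\<dots> \<le> W.M (\<lambda>x. (1 - ?\<theta>) * M (\<lambda>y. ?g x y))"
      by (intro W_ge mult_nonneg_nonneg nonneg) simp_all
    also have "\<dots> \<le> W.deviation p"
      unfolding W.deviation_def by (intro W.mono W_ge) simp
    finally show ?thesis .
  qed
  have "W.deviation p \<le> 10 ^ 7 * W.defect"
  proof (rule W.deviation_le_defect[OF p mass _ dev_le])
    fix x j assume xj: "x \<in> V" "j < (8::nat)"
    have "W.wrong_degree p x \<le> (1 + ?\<theta>) * M (\<lambda>y. ?g x y)"
    proof -
      have "W.wrong_degree p x = W.M (W.wrong p x)" by (rule W.wrong_degree_def[OF p mass])
      also have "W.wrong p x = ?g x" by (rule ext) (rule W.wrong_def[OF p mass])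
      finally show ?thesis using W_le[of "?g x"] by simp
    qed
    also have "\<dots> \<le> (1 + ?\<theta>) * M (\<lambda>y. of_bool (e x y \<noteq> looped_adj j (p y)))"
      using best[OF xj] by (intro mult_left_mono) auto
    also have "\<dots> \<le> 2 * ((1 - ?\<theta>) * M (\<lambda>y. of_bool (e x y \<noteq> looped_adj j (p y))))"
      using nonneg[of "\<lambda>y. of_bool (e x y \<noteq> looped_adj j (p y))"] by simp
    also have "\<dots> \<le> 2 * W.M (\<lambda>y. of_bool (e x y \<noteq> looped_adj j (p y)))"
      by (intro mult_left_mono W_ge) simp_all
    finally show "W.wrong_degree p x \<le> 2 * W.M (\<lambda>y. of_bool (e x y \<noteq> looped_adj j (p y)))" .
  qed
  then have "W.copy_density \<le> 3 / 4096 - W.deviation p / (2 * 10 ^ 13)"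
    using W.copy_density_bound W.deviation_nonneg[of p] by (simp add: field_simps)
  moreover have "W.M (\<lambda>a. W.M (\<lambda>b. W.M (\<lambda>c. W.M (\<lambda>d. W.M (\<lambda>u. W.M (\<lambda>v. of_bool (copy ?h a b c d u v))))))) = 3 / 4096"
  proof -
    have "pattern_density (part_weights V w' p) = pattern_density (\<lambda>_. 1 / 8)"
      unfolding pattern_density_eq by (simp add: part_weights_def mass)
    then show ?thesis using W.pattern_density_pushforward[of p] p
      by (simp add: pattern_density_uniform copy_def paw_def)
  qed
  ultimately have "W.deviation p / (2 * 10 ^ 13) \<le> W.M (\<lambda>a. W.M (\<lambda>b. W.M (\<lambda>c. W.M (\<lambda>d. W.M (\<lambda>u. W.M (\<lambda>v.
      of_bool (copy ?h a b c d u v) - of_bool (copy e a b c d u v)))))))"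
    unfolding W.copy_density_def mean_diff by linarith
  also have "\<dots> = M (\<lambda>a. M (\<lambda>b. M (\<lambda>c. M (\<lambda>d. M (\<lambda>u. M (\<lambda>v. \<rho> a * \<rho> b * \<rho> c * \<rho> d * \<rho> u * \<rho> v *
      (of_bool (copy ?h a b c d u v) - of_bool (copy e a b c d u v))))))))"
    unfolding rew mean_cmult[symmetric] mult.assoc ..
  also have "\<dots> \<le> M (\<lambda>a. M (\<lambda>b. M (\<lambda>c. M (\<lambda>d. M (\<lambda>u. M (\<lambda>v.
      of_bool (copy ?h a b c d u v \<and> b \<noteq> d \<and> u \<noteq> v) - of_bool (copy e a b c d u v \<and> b \<noteq> d \<and> u \<noteq> v)
      + 11 * ?\<theta> * pair_sum ?g a b c d u v
      + (of_bool (d = b) * (2 * (?g a b + ?g a c + ?g b c + ?g a u + ?g b u + ?g c u + ?g a v + ?g b v + ?g c v + ?g u v))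
      + of_bool (v = u) * (2 * (?g a b + ?g a c + ?g a d + ?g b c + ?g b d + ?g c d + ?g a u + ?g b u + ?g c u + ?g d u)))))))))"
  proof (intro mono)
    fix a b c d u v
    define R where "R = \<rho> a * \<rho> b * \<rho> c * \<rho> d * \<rho> u * \<rho> v"
    define D where "D = (of_bool (copy ?h a b c d u v) - of_bool (copy e a b c d u v) :: real)"
    define I where "I = (of_bool (b \<noteq> d \<and> u \<noteq> v) :: real)"
    have "\<bar>\<rho> a - 1\<bar> \<le> 1 * ?\<theta>" using \<rho> by simp
    then have "\<bar>\<rho> a * \<rho> b - 1\<bar> \<le> (1 + 2) * ?\<theta>" by (rule product_near_one[OF _ \<rho>]) simp_all
    then have "\<bar>\<rho> a * \<rho> b * \<rho> c - 1\<bar> \<le> (1 + 2 + 2) * ?\<theta>" by (rule product_near_one[OF _ \<rho>]) simp_all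
    then have "\<bar>\<rho> a * \<rho> b * \<rho> c * \<rho> d - 1\<bar> \<le> (1 + 2 + 2 + 2) * ?\<theta>" by (rule product_near_one[OF _ \<rho>]) simp_all
    then have "\<bar>\<rho> a * \<rho> b * \<rho> c * \<rho> d * \<rho> u - 1\<bar> \<le> (1 + 2 + 2 + 2 + 2) * ?\<theta>" by (rule product_near_one[OF _ \<rho>]) simp_all
    then have "\<bar>R - 1\<bar> \<le> (1 + 2 + 2 + 2 + 2 + 2) * ?\<theta>" unfolding R_def by (rule product_near_one[OF _ \<rho>]) simp_all
    then have R: "\<bar>R - 1\<bar> \<le> 11 * ?\<theta>" by simp
    have D: "\<bar>D\<bar> \<le> pair_sum ?g a b c d u v" unfolding D_def by (rule copy_pair_sum[OF e_sym hsym])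
    \<comment> \<open>Compare the weighted sum over all tuples with the uniform sum over distinct tuples.\<close>
    have "R * D - I * D = (R - 1) * D + (1 - I) * D" by (simp add: algebra_simps)
    also have "\<dots> \<le> \<bar>R - 1\<bar> * \<bar>D\<bar> + (1 - I) * \<bar>D\<bar>"
      by (intro add_mono mult_left_mono) (auto simp: I_def abs_mult[symmetric])
    also have "\<dots> \<le> 11 * ?\<theta> * pair_sum ?g a b c d u v + (of_bool (b = d) + of_bool (u = v)) * pair_sum ?g a b c d u v"
      using R D by (intro add_mono mult_mono) (auto simp: I_def)
    also have "(of_bool (b = d) + of_bool (u = v)) * pair_sum ?g a b c d u v \<le>
      of_bool (d = b) * (2 * (?g a b + ?g a c + ?g b c + ?g a u + ?g b u + ?g c u + ?g a v + ?g b v + ?g c v + ?g u v))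
      + of_bool (v = u) * (2 * (?g a b + ?g a c + ?g a d + ?g b c + ?g b d + ?g c d + ?g a u + ?g b u + ?g c u + ?g d u))"
      by (rule pair_sum_coincide) (auto simp: e_sym looped_adj_def refl)
    finally have "R * D \<le> I * D + (11 * ?\<theta> * pair_sum ?g a b c d u v + (of_bool (d = b) * (2 * (?g a b + ?g a c + ?g b c + ?g a u + ?g b u + ?g c u + ?g a v + ?g b v + ?g c v + ?g u v))
      + of_bool (v = u) * (2 * (?g a b + ?g a c + ?g a d + ?g b c + ?g b d + ?g c d + ?g a u + ?g b u + ?g c u + ?g d u))))"
      by simp
    moreover have "I * D = of_bool (copy ?h a b c d u v \<and> b \<noteq> d \<and> u \<noteq> v) - of_bool (copy e a b c d u v \<and> b \<noteq> d \<and> u \<noteq> v)"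
      by (auto simp: I_def D_def)
    ultimately show "\<rho> a * \<rho> b * \<rho> c * \<rho> d * \<rho> u * \<rho> v * (of_bool (copy ?h a b c d u v) - of_bool (copy e a b c d u v))
      \<le> of_bool (copy ?h a b c d u v \<and> b \<noteq> d \<and> u \<noteq> v) - of_bool (copy e a b c d u v \<and> b \<noteq> d \<and> u \<noteq> v)
      + 11 * ?\<theta> * pair_sum ?g a b c d u v
      + (of_bool (d = b) * (2 * (?g a b + ?g a c + ?g b c + ?g a u + ?g b u + ?g c u + ?g a v + ?g b v + ?g c v + ?g u v))
      + of_bool (v = u) * (2 * (?g a b + ?g a c + ?g a d + ?g b c + ?g b d + ?g c d + ?g a u + ?g b u + ?g c u + ?g d u)))"
      unfolding R_def D_def by linarith
  qed
  also have "\<dots> = distinct_density ?h - distinct_density e + 11 * ?\<theta> * (15 * deviation p)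
      + (M (\<lambda>a. M (\<lambda>b. M (\<lambda>c. M (\<lambda>d. of_bool (d = b) * M (\<lambda>u. M (\<lambda>v. 2 * (?g a b + ?g a c + ?g b c + ?g a u + ?g b u + ?g c u + ?g a v + ?g b v + ?g c v + ?g u v)))))))
      + M (\<lambda>a. M (\<lambda>b. M (\<lambda>c. M (\<lambda>d. M (\<lambda>u. M (\<lambda>v. of_bool (v = u) * (2 * (?g a b + ?g a c + ?g a d + ?g b c + ?g b d + ?g c d + ?g a u + ?g b u + ?g c u + ?g d u)))))))))"
    unfolding distinct_density_def deviation_def mean_pair_sum[symmetric] mean_add mean_diff mean_cmult ..
  also have "M (\<lambda>a. M (\<lambda>b. M (\<lambda>c. M (\<lambda>d. of_bool (d = b) * M (\<lambda>u. M (\<lambda>v. 2 * (?g a b + ?g a c + ?g b c + ?g a u + ?g b u + ?g c u + ?g a v + ?g b v + ?g c v + ?g u v)))))))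
      \<le> M (\<lambda>a. M (\<lambda>b. M (\<lambda>c. 1 / n * M (\<lambda>u. M (\<lambda>v. 2 * (?g a b + ?g a c + ?g b c + ?g a u + ?g b u + ?g c u + ?g a v + ?g b v + ?g c v + ?g u v))))))"
    by (intro mono) (simp add: mean_of_bool_eq[OF finite_V] u)
  also have "\<dots> = 20 / n * deviation p"
    unfolding mean_cmult by (simp add: mean_add mean_cmult const deviation_def)
  also have "M (\<lambda>a. M (\<lambda>b. M (\<lambda>c. M (\<lambda>d. M (\<lambda>u. M (\<lambda>v. of_bool (v = u) * (2 * (?g a b + ?g a c + ?g a d + ?g b c + ?g b d + ?g c d + ?g a u + ?g b u + ?g c u + ?g d u))))))))
      \<le> M (\<lambda>a. M (\<lambda>b. M (\<lambda>c. M (\<lambda>d. M (\<lambda>u. 1 / n * (2 * (?g a b + ?g a c + ?g a d + ?g b c + ?g b d + ?g c d + ?g a u + ?g b u + ?g c u + ?g d u)))))))"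
    by (intro mono) (simp add: mean_of_bool_eq[OF finite_V] u)
  also have "\<dots> = 20 / n * deviation p"
    unfolding mean_cmult by (simp add: mean_add mean_cmult const deviation_def)
  finally have fin: "W.deviation p / (2 * 10 ^ 13) \<le> distinct_density ?h - distinct_density e + 11 * ?\<theta> * (15 * deviation p) + (20 / n * deviation p + 20 / n * deviation p)"
    by simp
  have "20 / n * deviation p \<le> 20 / 10 ^ 16 * deviation p"
    using n deviation_nonneg[of p] by (intro mult_right_mono frac_le) auto
  then show ?thesis using fin dev_ge deviation_nonneg[of p] by simp
qed

end


context weighted_graph
begin

lemma deviation_card:
  assumes u: "\<And>x. x \<in> V \<Longrightarrow> w x = 1 / real n"
  shows "real n ^ 2 * deviation p = real (card {t \<in> V \<times> V. e (fst t) (snd t) \<noteq> looped_adj (p (fst t)) (p (snd t))})"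
proof -
  have "n \<noteq> 0"
  proof
    assume "n = 0"
    then have "sum w V = 0" using u by (intro sum.neutral) auto
    then show False using w_sum by simp
  qed
  have "deviation p = (\<Sum>t\<in>V \<times> V. 1 / real n ^ 2 * of_bool (e (fst t) (snd t) \<noteq> looped_adj (p (fst t)) (p (snd t))))"
    unfolding deviation_def M2 using u by (intro sum.cong) (auto simp: power2_eq_square)
  also have "\<dots> = 1 / real n ^ 2 * real (card {t \<in> V \<times> V. e (fst t) (snd t) \<noteq> looped_adj (p (fst t)) (p (snd t))})"
    using finite_V by (simp only: sum_distrib_left[symmetric] sum_of_bool_eq finite_cartesian_product) (simp add: Int_def)
  finally show ?thesis using \<open>n \<noteq> 0\<close> by simp
qed

text \<open>Moving \<open>x\<close> to another part only affects the pairs at \<open>x\<close>.\<close>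

lemma optimal_placement_best:
  assumes u: "\<And>x. x \<in> V \<Longrightarrow> w x = 1 / real n" and n: "n > 0" and refl: "\<And>x. e x x" and p: "\<And>x. p x < 8"
    and opt: "\<And>q. (\<And>x. q x < 8) \<Longrightarrow> deviation p \<le> deviation q"
    and x: "x \<in> V" and j: "j < 8"
  shows "M (\<lambda>y. of_bool (e x y \<noteq> looped_adj (p x) (p y))) \<le> M (\<lambda>y. of_bool (e x y \<noteq> looped_adj j (p y)))" (is "?W \<le> ?Z")
proof -
  let ?q = "p(x := j)"
  let ?g = "\<lambda>q a b. of_bool (e a b \<noteq> looped_adj (q a) (q b)) :: real"
  let ?z = "\<lambda>y. of_bool (e x y \<noteq> looped_adj j (p y)) :: real"
  have ladj: "looped_adj a b = looped_adj b a" for a b by (auto simp: looped_adj_def)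
  have "deviation p \<le> deviation ?q" by (rule opt) (simp add: p j)
  also have "\<dots> \<le> M (\<lambda>a. M (\<lambda>b. ?g p a b + of_bool (a = x) * (?z b - ?g p x b) + of_bool (b = x) * (?z a - ?g p x a)))"
    unfolding deviation_def
  proof (intro mono)
    fix a b
    have zx: "0 \<le> ?z x" and gx: "?g p x x = 0" "?g ?q x x = 0" by (simp_all add: refl)
    have sym: "?g p a x = ?g p x a" "?g ?q a x = ?z a" if "a \<noteq> x" using that e_sym[of a x] ladj[of "p a"] by auto
    show "?g ?q a b \<le> ?g p a b + of_bool (a = x) * (?z b - ?g p x b) + of_bool (b = x) * (?z a - ?g p x a)"
      using zx gx sym by (cases "a = x"; cases "b = x") (simp_all add: refl)
  qed
  also have "\<dots> = deviation p + 1 / real n * (?Z - ?W) + 1 / real n * (?Z - ?W)"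
    using x by (simp only: mean_add mean_cmult mean_of_bool_eq[OF finite_V x] u[OF x] mean_diff deviation_def)
  finally have "0 \<le> 1 / real n * (?Z - ?W)" by linarith
  then show ?thesis using n by (simp add: zero_le_divide_iff)
qed

end

text \<open>
  A near-optimal graph has fewer copies than the closest blowup, in proportion to their distance. For the
  comparison the vertices are reweighted such that all parts of the blowup have the same weight,
  as only then the closest blowup attains the upper bound.
\<close>

theorem gain_of_closest_blowup:
  "\<exists>\<epsilon>>0. \<forall>(V :: 'v set) e n. weighted_graph V (\<lambda>_. 1 / real n) e \<and> (\<forall>x. e x x) \<and> 10 ^ 16 \<le> n \<and>
     3 / 4096 - \<epsilon> \<le> weighted_graph.copy_density V (\<lambda>_. 1 / real n) e \<longrightarrow>
     (\<exists>p. (\<forall>x. p x < 8) \<and> weighted_graph.deviation V (\<lambda>_. 1 / real n) e p / 10 ^ 14 \<le>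
        weighted_graph.distinct_density V (\<lambda>_. 1 / real n) (\<lambda>x y. looped_adj (p x) (p y))
        - weighted_graph.distinct_density V (\<lambda>_. 1 / real n) e)"
proof -
  obtain \<epsilon>\<^sub>0 where \<epsilon>\<^sub>0: "\<epsilon>\<^sub>0 > 0" "\<And>x i. (\<And>i. i < 8 \<Longrightarrow> 0 \<le> x i) \<Longrightarrow> (\<Sum>i<8. x i) = 1 \<Longrightarrow> 3 / 4096 - \<epsilon>\<^sub>0 \<le> pattern_density x
     \<Longrightarrow> i < 8 \<Longrightarrow> \<bar>x i - 1 / 8\<bar> < 1 / 10 ^ 18"
    using pattern_density_near_maximal[of "1 / 10 ^ 18"] by auto
  define \<kappa> where "\<kappa> = min (1 / 10 ^ 14) (\<epsilon>\<^sub>0 / 60)"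
  have \<kappa>: "0 < \<kappa>" "\<kappa> \<le> 1 / 10 ^ 14" "\<kappa> \<le> \<epsilon>\<^sub>0 / 60" using \<epsilon>\<^sub>0(1) by (auto simp: \<kappa>_def)
  \<comment> \<open>The power of ten covers the quotient \<open>74317824000 / 41784\<close> of the upper bound and the factor
    \<open>10 ^ 9\<close> of the closeness theorem.\<close>
  define \<epsilon> where "\<epsilon> = \<kappa> / 10 ^ 16"
  have \<epsilon>: "0 < \<epsilon>" "\<epsilon> \<le> \<epsilon>\<^sub>0 / 2" "\<epsilon> \<le> 1 / 10 ^ 5" using \<kappa> \<epsilon>\<^sub>0(1) by (simp_all add: \<epsilon>_def)
  show ?thesis
  proof (intro exI[of _ \<epsilon>] conjI \<epsilon>(1) allI impI; elim conjE)
    fix V :: "'v set" and e n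
    assume wg: "weighted_graph V (\<lambda>_. 1 / real n) e" and refl: "\<forall>x. e x x" and n: "10 ^ 16 \<le> n"
      and cd: "3 / 4096 - \<epsilon> \<le> weighted_graph.copy_density V (\<lambda>_. 1 / real n) e"
    interpret weighted_graph V "\<lambda>_. 1 / real n" e by (rule wg)
    have "41784 * defect \<le> 54432000 - 74317824000 * (3 / 4096 - \<epsilon>)"
      using copy_density_bound cd by simp
    then have "defect \<le> \<kappa> / 10 ^ 9" using \<kappa>(1) by (simp add: \<epsilon>_def)
    moreover have "7 / 10000 \<le> copy_density" using cd \<epsilon>(3) by simp
    ultimately obtain p\<^sub>0 where p\<^sub>0: "\<forall>x. p\<^sub>0 x < 8" "deviation p\<^sub>0 \<le> 2 * \<kappa>"
      using close_to_blowup[of \<kappa>] \<kappa> by auto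
    define wr where "wr p = card {t \<in> V \<times> V. e (fst t) (snd t) \<noteq> looped_adj (p (fst t)) (p (snd t))}" for p
    have wr: "real n ^ 2 * deviation p = real (wr p)" for p
      unfolding wr_def by (rule deviation_card) simp
    obtain p where p: "\<forall>x. p x < 8" "\<And>q. \<forall>x. q x < 8 \<Longrightarrow> wr p \<le> wr q"
      using ex_has_least_nat[of "\<lambda>p. \<forall>x. p x < 8" p\<^sub>0 wr] p\<^sub>0(1) by blast
    have n0: "n > 0" using n by simp
    have opt: "deviation p \<le> deviation q" if "\<And>x. q x < 8" for q
    proof -
      have "real n ^ 2 * deviation p \<le> real n ^ 2 * deviation q" using p(2)[of q] that unfolding wr by simp
      then show ?thesis using n0 by simp
    qed
    have dev: "deviation p \<le> 2 * \<kappa>" using opt[of p\<^sub>0] p\<^sub>0 by auto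
    have parts: "\<bar>part_weights V (\<lambda>_. 1 / real n) p i - 1 / 8\<bar> < 1 / 10 ^ 18" if "i < 8" for i
    proof (rule \<epsilon>\<^sub>0(2)[OF _ _ _ that])
      show "3 / 4096 - \<epsilon>\<^sub>0 \<le> pattern_density (part_weights V (\<lambda>_. 1 / real n) p)"
        using pattern_density_close[of p] p(1) cd \<epsilon>(2) dev \<kappa>(3) by (auto simp: abs_le_iff)
    qed (use p(1) in \<open>auto simp: part_weights_nonneg sum_part_weights\<close>)
    have "deviation p / 10 ^ 14 \<le> distinct_density (\<lambda>x y. looped_adj (p x) (p y)) - distinct_density e"
    proof (rule reweighted_gain[OF _ n])
      show "M (\<lambda>y. of_bool (e x y \<noteq> looped_adj (p x) (p y))) \<le> M (\<lambda>y. of_bool (e x y \<noteq> looped_adj j (p y)))" if "x \<in> V" "j < 8" for x j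
        using p(1) refl opt by (intro optimal_placement_best[OF _ n0] that) auto
      show "deviation p \<le> 1 / 10 ^ 13" using dev \<kappa>(2) by simp
    qed (use p(1) refl parts in auto)
    then show "\<exists>p. (\<forall>x. p x < 8) \<and> deviation p / 10 ^ 14 \<le> distinct_density (\<lambda>x y. looped_adj (p x) (p y)) - distinct_density e"
      using p(1) by blast
  qed
qed

section \<open>Counting induced copies\<close>

type_synonym 'v six = "'v \<times> 'v \<times> 'v \<times> 'v \<times> 'v \<times> 'v"

text \<open>
  For a graph with loops the two inequalities make the six vertices distinct.
\<close>

fun copy_six :: "('v \<Rightarrow> 'v \<Rightarrow> bool) \<Rightarrow> 'v six \<Rightarrow> bool" where
  "copy_six h (a, b, c, d, u, v) \<longleftrightarrow> copy h a b c d u v \<and> b \<noteq> d \<and> u \<noteq> v"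

fun map_six :: "('v \<Rightarrow> 'w) \<Rightarrow> 'v six \<Rightarrow> 'w six" where
  "map_six f (a, b, c, d, u, v) = (f a, f b, f c, f d, f u, f v)"

fun set_six :: "'v six \<Rightarrow> 'v set" where
  "set_six (a, b, c, d, u, v) = {a, b, c, d, u, v}"

definition copies :: "'v set \<Rightarrow> ('v \<Rightarrow> 'v \<Rightarrow> bool) \<Rightarrow> 'v six set" where
  "copies V h = {t. set_six t \<subseteq> V \<and> copy_six h t}"

lemma finite_copies: "finite V \<Longrightarrow> finite (copies V h)"
  by (rule finite_subset[of _ "V \<times> V \<times> V \<times> V \<times> V \<times> V"]) (auto simp: copies_def)

lemma copy_six_proj:
  "copy_six h t \<longleftrightarrow> copy h (fst t) (fst (snd t)) (fst (snd (snd t))) (fst (snd (snd (snd t)))) (fst (snd (snd (snd (snd t)))))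
     (snd (snd (snd (snd (snd t))))) \<and> fst (snd t) \<noteq> fst (snd (snd (snd t))) \<and>
     fst (snd (snd (snd (snd t)))) \<noteq> snd (snd (snd (snd (snd t))))"
  by (cases t) simp

lemma (in weighted_graph) distinct_density_eq:
  assumes u: "\<And>x. x \<in> V \<Longrightarrow> w x = 1 / real n"
  shows "distinct_density h = real (card (copies V h)) / real n ^ 6"
proof -
  have eq: "copies V h = {t \<in> V \<times> V \<times> V \<times> V \<times> V \<times> V. copy_six h t}" by (auto simp: copies_def)
  have "distinct_density h = (\<Sum>t\<in>V \<times> V \<times> V \<times> V \<times> V \<times> V. w (fst t) * (w (fst (snd t)) * (w (fst (snd (snd t))) * (w (fst (snd (snd (snd t)))) *
     (w (fst (snd (snd (snd (snd t))))) * (w (snd (snd (snd (snd (snd t))))) * of_bool (copy_six h t)))))))"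
    by (simp add: distinct_density_def mean_def sum.cartesian_product sum_distrib_left case_prod_beta mult.assoc copy_six_proj)
  also have "\<dots> = (\<Sum>t\<in>V \<times> V \<times> V \<times> V \<times> V \<times> V. 1 / real n ^ 6 * of_bool (copy_six h t))"
    using u by (intro sum.cong refl) (auto simp: eval_nat_numeral)
  also have "\<dots> = 1 / real n ^ 6 * real (card (copies V h))"
    unfolding eq using finite_V by (simp only: sum_distrib_left[symmetric] sum_of_bool_eq finite_cartesian_product) (simp add: Int_def)
  finally show ?thesis by simp
qed

definition adjacent_or_equal :: "'v pattern \<Rightarrow> 'v \<Rightarrow> 'v \<Rightarrow> bool" where
  "adjacent_or_equal G x y \<longleftrightarrow> x = y \<or> {x, y} \<in> edges G"

lemma adjacent_or_equal_sym: "adjacent_or_equal G x y = adjacent_or_equal G y x"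
  by (auto simp: adjacent_or_equal_def insert_commute)

lemma adjacent_or_equal_refl: "adjacent_or_equal G x x"
  by (simp add: adjacent_or_equal_def)

lemma distinct_six:
  assumes "copy_six h t" "\<And>x. h x x" "\<And>x y. h x y = h y x"
  shows "card (set_six t) = 6"
proof -
  obtain a b c d u v where t: "t = (a, b, c, d, u, v)" by (cases t)
  have "a \<noteq> b" "a \<noteq> c" "a \<noteq> d" "b \<noteq> c" "b \<noteq> d" "c \<noteq> d" "a \<noteq> u" "b \<noteq> u" "c \<noteq> u" "d \<noteq> u"
    "a \<noteq> v" "b \<noteq> v" "c \<noteq> v" "d \<noteq> v" "u \<noteq> v"
    using assms(1) assms(2)[of a] assms(2)[of b] assms(2)[of c] assms(2)[of d] assms(3)[of c d] assms(3)[of b c]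
    by (auto simp: t copy_def paw_def)
  then show ?thesis by (simp add: t)
qed

lemma copies_F27: "card (copies {0..<6} (adjacent_or_equal F27)) = 4"
proof -
  define E :: "nat \<Rightarrow> nat \<Rightarrow> bool" where
    "E i j \<longleftrightarrow> i = j \<or> (i, j) \<in> set [(0,1),(1,0),(0,2),(2,0),(0,3),(3,0),(1,3),(3,1),(4,5),(5,4)]" for i j
  have E: "adjacent_or_equal F27 = E"
    by (intro ext) (auto simp: adjacent_or_equal_def E_def F27_def doubleton_eq_iff)
  have check: "list_all (\<lambda>a. list_all (\<lambda>b. if E a b then list_all (\<lambda>d. if E a d \<and> E b d \<and> b \<noteq> d then
      list_all (\<lambda>c. if paw E a b c d then list_all (\<lambda>u. if E u a \<or> E u b \<or> E u c \<or> E u d then True else list_all (\<lambda>v.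
        copy_six E (a,b,c,d,u,v) \<longrightarrow> (a,b,c,d,u,v) \<in> set [(0,1,2,3,4,5),(0,3,2,1,4,5),(0,1,2,3,5,4),(0,3,2,1,5,4)]) [0..<6]) [0..<6]
      else True) [0..<6] else True) [0..<6] else True) [0..<6]) [0..<6]"
    unfolding E_def by code_simp
  have "copies {0..<6} E \<subseteq> {(0,1,2,3,4,5),(0,3,2,1,4,5),(0,1,2,3,5,4),(0,3,2,1,5,4)}"
  proof
    fix t assume t: "t \<in> copies {0..<6} E"
    obtain a b c d u v where t_eq: "t = (a, b, c, d, u, v)" by (cases t)
    have I: "a \<in> set [0..<6]" "b \<in> set [0..<6]" "c \<in> set [0..<6]" "d \<in> set [0..<6]" "u \<in> set [0..<6]" "v \<in> set [0..<6]"
      and six: "copy_six E (a, b, c, d, u, v)" using t by (auto simp: copies_def t_eq)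
    have ab: "E a b" and abd: "E a d \<and> E b d \<and> b \<noteq> d" and paw: "paw E a b c d" and u: "\<not> (E u a \<or> E u b \<or> E u c \<or> E u d)"
      using six by (auto simp: copy_def paw_def)
    note 1 = bspec[OF bspec[OF check[unfolded list_all_iff] I(1)] I(2), unfolded if_P[OF ab]]
    note 2 = bspec[OF bspec[OF 1 I(4), unfolded if_P[OF abd]] I(3), unfolded if_P[OF paw]]
    from bspec[OF bspec[OF 2 I(5), unfolded if_not_P[OF u]] I(6)] six
    show "t \<in> {(0,1,2,3,4,5),(0,3,2,1,4,5),(0,1,2,3,5,4),(0,3,2,1,5,4)}" by (simp add: t_eq)
  qed
  moreover have "{(0,1,2,3,4,5),(0,3,2,1,4,5),(0,1,2,3,5,4),(0,3,2,1,5,4)} \<subseteq> copies {0..<6} E"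
    by (simp add: copies_def copy_def paw_def E_def)
  ultimately have "copies {0..<6} E = {(0,1,2,3,4,5),(0,3,2,1,4,5),(0,1,2,3,5,4),(0,3,2,1,5,4)}" by blast
  then show ?thesis unfolding E by simp
qed

lemma map_six_inverse: "(\<And>x. x \<in> set_six t \<Longrightarrow> g (f x) = x) \<Longrightarrow> map_six g (map_six f t) = t"
  by (cases t) simp

lemma set_map_six: "set_six (map_six f t) = f ` set_six t"
  by (cases t) simp

lemma copy_six_map:
  assumes "inj_on f (set_six t)" "\<And>x y. x \<in> set_six t \<Longrightarrow> y \<in> set_six t \<Longrightarrow> h' (f x) (f y) = h x y"
  shows "copy_six h' (map_six f t) = copy_six h t"
  using assms by (cases t) (auto simp: copy_def paw_def inj_on_def)

lemma copies_of_isomorphic: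
  assumes iso: "pattern_iso f G H" and GV: "\<And>x y. x \<in> verts G \<Longrightarrow> y \<in> verts G \<Longrightarrow> h x y = adjacent_or_equal G x y"
  shows "card (copies (verts G) h) = card (copies (verts H) (adjacent_or_equal H))"
proof -
  have bij: "bij_betw f (verts G) (verts H)" using iso by (simp add: pattern_iso_def)
  define g where "g = inv_into (verts G) f"
  have inj: "inj_on f (verts G)" and im: "f ` verts G = verts H" using bij by (auto simp: bij_betw_def)
  have gf: "g (f x) = x" if "x \<in> verts G" for x using that inj by (simp add: g_def)
  have fg: "f (g y) = y" "g y \<in> verts G" if "y \<in> verts H" for y
    using that im by (auto simp: g_def f_inv_into_f inv_into_into)
  have adj: "adjacent_or_equal H (f x) (f y) = h x y" if "x \<in> verts G" "y \<in> verts G" for x y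
    using iso that inj unfolding GV[OF that] by (auto simp: adjacent_or_equal_def pattern_iso_def inj_on_def)
  have "bij_betw (map_six f) (copies (verts G) h) (copies (verts H) (adjacent_or_equal H))"
  proof (rule bij_betw_byWitness[where f' = "map_six g"])
    show "\<forall>t\<in>copies (verts G) h. map_six g (map_six f t) = t"
      by (auto simp: copies_def intro!: map_six_inverse gf)
    show "\<forall>t\<in>copies (verts H) (adjacent_or_equal H). map_six f (map_six g t) = t"
      by (auto simp: copies_def intro!: map_six_inverse fg(1))
    have "map_six f t \<in> copies (verts H) (adjacent_or_equal H)" if "t \<in> copies (verts G) h" for t
    proof -
      have t: "set_six t \<subseteq> verts G" "copy_six h t" using that by (auto simp: copies_def)
      have "copy_six (adjacent_or_equal H) (map_six f t) = copy_six h t"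
        using t(1) adj by (intro copy_six_map inj_on_subset[OF inj]) auto
      then show ?thesis using t im by (auto simp: copies_def set_map_six)
    qed
    then show "map_six f ` copies (verts G) h \<subseteq> copies (verts H) (adjacent_or_equal H)" by blast
    have "map_six g t \<in> copies (verts G) h" if "t \<in> copies (verts H) (adjacent_or_equal H)" for t
    proof -
      have t: "set_six t \<subseteq> verts H" "copy_six (adjacent_or_equal H) t" using that by (auto simp: copies_def)
      have "copy_six h (map_six g t) = copy_six (adjacent_or_equal H) t"
      proof (rule copy_six_map)
        show "inj_on g (set_six t)" using t fg(1) by (metis inj_onI subsetD)
        show "h (g x) (g y) = adjacent_or_equal H x y" if "x \<in> set_six t" "y \<in> set_six t" for x y
        proof -
          have "x \<in> verts H" "y \<in> verts H" using that t(1) by auto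
          then show ?thesis using adj[of "g x" "g y"] fg by simp
        qed
      qed
      then show ?thesis using t fg(2) by (auto simp: copies_def set_map_six)
    qed
    then show "map_six g ` copies (verts H) (adjacent_or_equal H) \<subseteq> copies (verts G) h" by blast
  qed
  then show ?thesis by (rule bij_betw_same_card)
qed

lemma isomorphic_F27:
  assumes G: "\<And>x. {x} \<notin> edges G" and t: "copy_six (adjacent_or_equal G) t"
  shows "isomorphic (induced G (set_six t)) F27"
proof -
  obtain a b c d u v where t_eq: "t = (a, b, c, d, u, v)" by (cases t)
  have dist: "card (set_six t) = 6" by (rule distinct_six[OF t adjacent_or_equal_refl adjacent_or_equal_sym])
  define f where "f = (\<lambda>x. if x = a then 0 else if x = b then 1 else if x = c then 2 else if x = d then 3 else if x = u then 4 else (5::nat))"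
  have d: "distinct [a, b, c, d, u, v]"
    using dist card_distinct[of "[a,b,c,d,u,v]"] by (simp add: t_eq)
  then have f: "f a = 0" "f b = 1" "f c = 2" "f d = 3" "f u = 4" "f v = 5" by (auto simp: f_def)
  have ne: "a \<noteq> b" "a \<noteq> c" "a \<noteq> d" "b \<noteq> c" "b \<noteq> d" "c \<noteq> d" "u \<noteq> a" "u \<noteq> b" "u \<noteq> c" "u \<noteq> d" "v \<noteq> a" "v \<noteq> b" "v \<noteq> c" "v \<noteq> d" "u \<noteq> v"
    using d by auto
  have adj: "{a, b} \<in> edges G" "{a, c} \<in> edges G" "{a, d} \<in> edges G" "{b, d} \<in> edges G" "{b, c} \<notin> edges G" "{c, d} \<notin> edges G"
    "{u, v} \<in> edges G" "{u, a} \<notin> edges G" "{u, b} \<notin> edges G" "{u, c} \<notin> edges G" "{u, d} \<notin> edges G"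
    "{v, a} \<notin> edges G" "{v, b} \<notin> edges G" "{v, c} \<notin> edges G" "{v, d} \<notin> edges G"
    using t ne by (auto simp: t_eq copy_def paw_def adjacent_or_equal_def)
  have comm: "{b, a} = {a, b}" "{c, a} = {a, c}" "{d, a} = {a, d}" "{d, b} = {b, d}" "{c, b} = {b, c}" "{d, c} = {c, d}"
    "{v, u} = {u, v}" "{a, u} = {u, a}" "{b, u} = {u, b}" "{c, u} = {u, c}" "{d, u} = {u, d}"
    "{a, v} = {v, a}" "{b, v} = {v, b}" "{c, v} = {v, c}" "{d, v} = {v, d}" by auto
  have six: "{0..<6} = {0, 1, 2, 3, 4, 5::nat}" by auto
  have "inj_on f {a, b, c, d, u, v}" by (simp add: inj_on_def f)
  moreover have "f ` {a, b, c, d, u, v} = {0..<6}" by (simp add: f six)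
  moreover have "\<forall>x\<in>{a, b, c, d, u, v}. \<forall>y\<in>{a, b, c, d, u, v}. {x, y} \<in> edges G \<longleftrightarrow> {f x, f y} \<in> edges F27"
    by (simp add: f adj comm G) (simp add: F27_def doubleton_eq_iff)
  ultimately have "pattern_iso f (induced G (set_six t)) F27"
    by (simp add: pattern_iso_def induced_def bij_betw_def t_eq F27_def)
  then show ?thesis unfolding isomorphic_def by blast
qed

text \<open>
  An isomorphism identifies the labellings of an induced copy with those of \<open>F27\<close> itself, of which
  there are four.
\<close>

lemma card_copies:
  assumes G: "simple_graph G"
  shows "card (copies (verts G) (adjacent_or_equal G))
    = 4 * card {S. S \<subseteq> verts G \<and> card S = card (verts F27) \<and> isomorphic (induced G S) F27}" (is "_ = 4 * card ?S")
proof -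
  have fin: "finite (verts G)" using G by (simp add: simple_graph_def)
  have loop: "{x} \<notin> edges G" for x using G by (force simp: simple_graph_def)
  let ?L = "\<lambda>S. {t. set_six t = S \<and> copy_six (adjacent_or_equal G) t}"
  have sub: "?L S \<subseteq> copies S (adjacent_or_equal G)" for S by (auto simp: copies_def)
  have L: "card (?L S) = 4" if "S \<in> ?S" for S
  proof -
    have S: "S \<subseteq> verts G" "card S = 6" "isomorphic (induced G S) F27" using that by (auto simp: F27_def)
    have "?L S = copies S (adjacent_or_equal G)"
    proof
      show "copies S (adjacent_or_equal G) \<subseteq> ?L S"
      proof
        fix t assume t: "t \<in> copies S (adjacent_or_equal G)"
        then have "card (set_six t) = 6" using distinct_six[of "adjacent_or_equal G" t, OF _ adjacent_or_equal_refl adjacent_or_equal_sym] by (auto simp: copies_def)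
        moreover have "finite S" using S(2) by (metis card.infinite zero_neq_numeral)
        ultimately have "set_six t = S" using t S(2) by (intro card_subset_eq) (auto simp: copies_def)
        then show "t \<in> ?L S" using t by (simp add: copies_def)
      qed
    qed (rule sub)
    moreover obtain f where f: "pattern_iso f (induced G S) F27" using S(3) by (auto simp: isomorphic_def)
    have "card (copies S (adjacent_or_equal G)) = card (copies (verts F27) (adjacent_or_equal F27))"
      using copies_of_isomorphic[OF f, of "adjacent_or_equal G"] by (auto simp: adjacent_or_equal_def induced_def)
    ultimately show ?thesis using copies_F27 by (simp add: F27_def)
  qed
  have "copies (verts G) (adjacent_or_equal G) = (\<Union>S\<in>?S. ?L S)"
  proof (intro equalityI subsetI)
    fix t assume "t \<in> copies (verts G) (adjacent_or_equal G)"
    then have "set_six t \<subseteq> verts G" "copy_six (adjacent_or_equal G) t" by (auto simp: copies_def)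
    then show "t \<in> (\<Union>S\<in>?S. ?L S)"
      using isomorphic_F27[OF loop, of t] distinct_six[of "adjacent_or_equal G" t, OF _ adjacent_or_equal_refl adjacent_or_equal_sym] by (auto simp: F27_def)
  qed (auto simp: copies_def)
  also have "card \<dots> = (\<Sum>S\<in>?S. card (?L S))"
  proof (rule card_UN_disjoint)
    show "finite ?S" using fin by simp
    show "\<forall>S\<in>?S. finite (?L S)"
      using finite_subset[OF sub finite_copies] fin finite_subset by auto
  qed auto
  also have "\<dots> = (\<Sum>S\<in>?S. 4)" by (rule sum.cong[OF refl L])
  finally show ?thesis by simp
qed

lemma density_F27:
  assumes G: "simple_graph G" and h: "\<And>x y. x \<in> verts G \<Longrightarrow> y \<in> verts G \<Longrightarrow> h x y = adjacent_or_equal G x y"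
  shows "density F27 G = real (card (copies (verts G) h)) / (4 * real (card (verts G) choose 6))"
proof -
  have "copies (verts G) h = copies (verts G) (adjacent_or_equal G)"
    using h by (auto simp: copies_def copy_def paw_def)
  then show ?thesis using card_copies[OF G] by (simp add: density_def F27_def)
qed

section \<open>Blowups as graphs\<close>

lemma edges_B27:
  assumes "i < 8" "j < 8"
  shows "{i, j} \<in> edges B27 \<longleftrightarrow> looped_adj i j"
proof -
  have "i = 0 \<or> i = 1 \<or> i = 2 \<or> i = 3 \<or> i = 4 \<or> i = 5 \<or> i = 6 \<or> i = 7" "j = 0 \<or> j = 1 \<or> j = 2 \<or> j = 3 \<or> j = 4 \<or> j = 5 \<or> j = 6 \<or> j = 7"
    using assms by auto
  then show ?thesis by (elim disjE) (simp_all add: B27_def looped_adj_def doubleton_eq_iff)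
qed

lemma verts_B27: "verts B27 = {0..<8}"
  by (simp add: B27_def)

lemma blowup_graph:
  assumes P: "blowup_parts B27 P" and p: "\<And>x. p x < 8" "\<And>x i. i < 8 \<Longrightarrow> x \<in> P i \<Longrightarrow> p x = i"
  shows "simple_graph (blowup B27 P)"
    and "x \<in> verts (blowup B27 P) \<Longrightarrow> y \<in> verts (blowup B27 P) \<Longrightarrow> adjacent_or_equal (blowup B27 P) x y = looped_adj (p x) (p y)"
proof -
  let ?V = "\<Union>i\<in>{0..<8}. P i"
  have V: "verts (blowup B27 P) = ?V" by (simp add: blowup_def verts_B27)
  have part: "x \<in> P (p x)" if "x \<in> ?V" for x using that p(2) by fastforce
  have E: "{x, y} \<in> edges (blowup B27 P) \<longleftrightarrow> x \<noteq> y \<and> looped_adj (p x) (p y)" if x: "x \<in> ?V" and y: "y \<in> ?V" for x y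
  proof
    assume "{x, y} \<in> edges (blowup B27 P)"
    then obtain x' y' i j where *: "{x, y} = {x', y'}" "x' \<noteq> y'" "i < 8" "j < 8" "x' \<in> P i" "y' \<in> P j" "{i, j} \<in> edges B27"
      by (auto simp: blowup_def verts_B27)
    then have "p x' = i" "p y' = j" using p(2) by auto
    then have "looped_adj (p x') (p y')" "looped_adj (p y') (p x')" using * edges_B27[of i j] edges_B27[of j i] by (auto simp: insert_commute)
    then show "x \<noteq> y \<and> looped_adj (p x) (p y)" using *(1,2) by (auto simp: doubleton_eq_iff)
  next
    assume *: "x \<noteq> y \<and> looped_adj (p x) (p y)"
    have "{p x, p y} \<in> edges B27" using * edges_B27[OF p(1) p(1)] by auto
    then have "\<exists>i\<in>verts B27. \<exists>j\<in>verts B27. x \<in> P i \<and> y \<in> P j \<and> {i, j} \<in> edges B27"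
      using part[OF x] part[OF y] p(1) unfolding verts_B27 by (intro bexI[of _ "p x"] bexI[of _ "p y"]) auto
    then show "{x, y} \<in> edges (blowup B27 P)" using * unfolding blowup_def by auto
  qed
  show "adjacent_or_equal (blowup B27 P) x y = looped_adj (p x) (p y)"
    if "x \<in> verts (blowup B27 P)" "y \<in> verts (blowup B27 P)"
    using E that unfolding V adjacent_or_equal_def by auto
  have "finite ?V" using P by (auto simp: blowup_parts_def verts_B27)
  then show "simple_graph (blowup B27 P)"
    unfolding simple_graph_def V by (auto simp: blowup_def verts_B27)
qed

text \<open>The blowup that results from the placement \<open>p\<close> of the vertices.\<close>

definition placed :: "'v set \<Rightarrow> ('v \<Rightarrow> nat) \<Rightarrow> 'v pattern" where
  "placed V p = blowup B27 (\<lambda>i. {x \<in> V. p x = i})"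

lemma placed:
  assumes "finite V" "\<And>x. p x < 8"
  shows "verts (placed V p) = V" "simple_graph (placed V p)" "placed V p \<in> blowups B27"
    and "x \<in> V \<Longrightarrow> y \<in> V \<Longrightarrow> adjacent_or_equal (placed V p) x y = looped_adj (p x) (p y)"
proof -
  have P: "blowup_parts B27 (\<lambda>i. {x \<in> V. p x = i})"
    using assms(1) by (auto simp: blowup_parts_def disjoint_family_on_def)
  show V: "verts (placed V p) = V" using assms(2) by (auto simp: placed_def blowup_def verts_B27)
  show "simple_graph (placed V p)" unfolding placed_def by (rule blowup_graph(1)[OF P assms(2)]) simp
  show "placed V p \<in> blowups B27" using P by (auto simp: placed_def blowups_def)
  show "adjacent_or_equal (placed V p) x y = looped_adj (p x) (p y)" if "x \<in> V" "y \<in> V"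
    using blowup_graph(2)[OF P, of p x y] assms(2) that V unfolding placed_def by auto
qed

lemma edit_distance_le:
  assumes G: "simple_graph G" and p: "\<And>x. p x < 8"
  shows "edit_distance G B27 \<le> card {t \<in> verts G \<times> verts G. adjacent_or_equal G (fst t) (snd t) \<noteq> looped_adj (p (fst t)) (p (snd t))}"
    (is "_ \<le> card ?W")
proof -
  let ?V = "verts G"
  let ?H = "placed ?V p"
  have fin: "finite ?V" using G by (simp add: simple_graph_def)
  note H = placed[of ?V p, OF fin p]
  let ?D = "{card (sym_diff (edges G) (edges H)) | H. simple_graph H \<and> verts H = verts G \<and>
            (\<exists>K \<in> (blowups B27 :: 'a pattern set). isomorphic H K)}"
  have sub: "edges K \<subseteq> Pow ?V" if "simple_graph K" "verts K = ?V" for K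
    using that by (auto simp: simple_graph_def)
  have "?D \<subseteq> {..card (Pow ?V)}"
  proof
    fix d assume "d \<in> ?D"
    then obtain K where K: "d = card (sym_diff (edges G) (edges K))" "simple_graph K" "verts K = verts G" by blast
    have "sym_diff (edges G) (edges K) \<subseteq> Pow ?V" using sub[OF K(2,3)] sub[OF G refl] by blast
    then show "d \<in> {..card (Pow ?V)}" using fin K(1) by (auto intro: card_mono)
  qed
  then have "finite ?D" using finite_subset by blast
  moreover have "isomorphic ?H ?H" unfolding isomorphic_def pattern_iso_def by (intro exI[of _ id]) auto
  then have "card (sym_diff (edges G) (edges ?H)) \<in> ?D" using H by blast
  ultimately have "edit_distance G B27 \<le> card (sym_diff (edges G) (edges ?H))"
    unfolding edit_distance_def by (rule Min_le)
  also have "sym_diff (edges G) (edges ?H) \<subseteq> (\<lambda>t. {fst t, snd t}) ` ?W"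
  proof
    fix s assume s: "s \<in> sym_diff (edges G) (edges ?H)"
    then have "s \<subseteq> ?V" "card s = 2" using G H(1,2) by (auto simp: simple_graph_def)
    then obtain x y where xy: "s = {x, y}" "x \<noteq> y" "x \<in> ?V" "y \<in> ?V" by (auto simp: card_2_iff)
    have "(x, y) \<in> ?W" using s xy H(4)[OF xy(3,4)] by (auto simp: adjacent_or_equal_def)
    then show "s \<in> (\<lambda>t. {fst t, snd t}) ` ?W" using xy(1) by force
  qed
  then have "card (sym_diff (edges G) (edges ?H)) \<le> card ?W"
    using fin by (intro surj_card_le) auto
  finally show ?thesis .
qed

section \<open>Densities\<close>

lemma uniform_weighted_graph:
  assumes "simple_graph G" "verts G \<noteq> {}"
  shows "weighted_graph (verts G) (\<lambda>_. 1 / real (card (verts G))) (adjacent_or_equal G)"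
proof
  show "adjacent_or_equal G x y = adjacent_or_equal G y x" for x y by (rule adjacent_or_equal_sym)
qed (use assms in \<open>auto simp: simple_graph_def\<close>)

text \<open>The ratio between the density of induced copies and the probability of a labelled one.\<close>

definition normalisation :: "nat \<Rightarrow> real" where
  "normalisation n = real n ^ 6 / (4 * real (n choose 6))"

lemma normalisation_eq:
  assumes "n > 0"
  shows "normalisation n = 180 / (\<Prod>i=0..<6. 1 - real i / real n)"
proof -
  have "real (n choose 6) = (\<Prod>i=0..<6. real n - real i) / fact 6"
    unfolding binomial_gbinomial by (simp add: gbinomial_prod_rev)
  also have "(\<Prod>i=0..<6. real n - real i) = (\<Prod>i=0..<6. real n * (1 - real i / real n))"
    using assms by (intro prod.cong) (auto simp: field_simps)
  also have "\<dots> = real n ^ 6 * (\<Prod>i=0..<6. 1 - real i / real n)" by (simp add: prod.distrib)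
  finally have "real (n choose 6) = real n ^ 6 * (\<Prod>i=0..<6. 1 - real i / real n) / 720" by (simp add: fact_numeral)
  moreover define q where "q = (\<Prod>i=0..<6. 1 - real i / real n)"
  ultimately have C: "real (n choose 6) = real n ^ 6 * q / 720" by simp
  show ?thesis using assms unfolding normalisation_def q_def[symmetric] C by simp
qed

lemma normalisation_tendsto: "normalisation \<longlonglongrightarrow> 180"
proof -
  have "(\<lambda>n. 180 / (\<Prod>i=0..<6. 1 - real i / real n)) \<longlonglongrightarrow> 180 / (\<Prod>i=0..<(6::nat). 1 - 0)"
    by (intro tendsto_intros lim_const_over_n) simp
  then have "(\<lambda>n. 180 / (\<Prod>i=0..<6. 1 - real i / real n)) \<longlonglongrightarrow> 180" by simp
  then show ?thesis
    by (rule Lim_transform_eventually) (auto intro!: eventually_mono[OF eventually_gt_at_top[of 0]] simp: normalisation_eq)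
qed

lemma normalisation_ge:
  assumes "n \<ge> 6"
  shows "180 \<le> normalisation n"
proof -
  have "(\<Prod>i=0..<6. 1 - real i / real n) \<le> 1" using assms by (intro prod_le_1) auto
  moreover have "0 < (\<Prod>i=0..<6. 1 - real i / real n)" using assms by (intro prod_pos) auto
  ultimately show ?thesis using assms by (simp add: normalisation_eq le_divide_eq)
qed

lemma (in weighted_graph) density_eq:
  assumes G: "simple_graph G" "verts G = V" and u: "\<And>x. x \<in> V \<Longrightarrow> w x = 1 / real (card V)"
    and h: "\<And>x y. x \<in> V \<Longrightarrow> y \<in> V \<Longrightarrow> h x y = adjacent_or_equal G x y"
  shows "density F27 G = normalisation (card V) * distinct_density h"
proof -
  have "card V \<noteq> 0" using w_sum finite_V by auto
  moreover have "distinct_density h = real (card (copies V h)) / real (card V) ^ 6" by (rule distinct_density_eq[OF u])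
  ultimately show ?thesis
    using density_F27[OF G(1), of h] h unfolding G(2) normalisation_def by simp
qed

lemma (in weighted_graph) distinct_density_le: "distinct_density e \<le> copy_density"
  unfolding distinct_density_def copy_density_def by (intro mono) auto

lemma (in weighted_graph) distinct_density_ge:
  assumes u: "\<And>x. x \<in> V \<Longrightarrow> w x = 1 / real n"
  shows "copy_density - 2 / real n \<le> distinct_density e"
proof -
  have "copy_density - distinct_density e \<le> M (\<lambda>a. M (\<lambda>b. M (\<lambda>c. M (\<lambda>d. M (\<lambda>u. M (\<lambda>v. of_bool (d = b) * 1 + of_bool (v = u) * 1))))))"
    unfolding distinct_density_def copy_density_def mean_diff[symmetric] by (intro mono) auto
  also have "\<dots> = M (\<lambda>b. M (\<lambda>d. of_bool (d = b) * 1)) + M (\<lambda>u. M (\<lambda>v. of_bool (v = u) * 1))"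
    by (simp only: mean_add const)
  also have "\<dots> \<le> M (\<lambda>b. 1 / real n) + M (\<lambda>u. 1 / real n)"
    by (intro add_mono mono) (simp_all add: mean_of_bool_eq[OF finite_V, of _ _ "\<lambda>_. 1", simplified] u)
  finally show ?thesis by (simp add: const)
qed

lemma (in weighted_graph) copy_density_le: "copy_density \<le> 3 / 4096"
proof -
  have "0 \<le> defect" unfolding defect_def by (intro nonneg) simp
  then show ?thesis using copy_density_bound by linarith
qed

lemma density_le:
  assumes "simple_graph G" "verts G \<noteq> {}"
  shows "density F27 G \<le> normalisation (card (verts G)) * (3 / 4096)"
proof -
  interpret weighted_graph "verts G" "\<lambda>_. 1 / real (card (verts G))" "adjacent_or_equal G"
    by (rule uniform_weighted_graph[OF assms])
  have "density F27 G = normalisation (card (verts G)) * distinct_density (adjacent_or_equal G)"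
    by (rule density_eq[OF assms(1)]) simp_all
  also have "\<dots> \<le> normalisation (card (verts G)) * (3 / 4096)"
    using distinct_density_le copy_density_le by (intro mult_left_mono) (auto simp: normalisation_def)
  finally show ?thesis .
qed

lemma finite_densities:
  "finite {density F G | G :: nat pattern. simple_graph G \<and> card (verts G) = n}" (is "finite ?D")
proof (rule finite_subset)
  show "?D \<subseteq> (\<lambda>k. real k / real (n choose card (verts F))) ` {..2 ^ n}"
  proof
    fix d assume "d \<in> ?D"
    then obtain G :: "nat pattern" where G: "d = density F G" "simple_graph G" "card (verts G) = n" by blast
    have fin: "finite (verts G)" using G(2) by (simp add: simple_graph_def)
    have "card {S. S \<subseteq> verts G \<and> card S = card (verts F) \<and> isomorphic (induced G S) F} \<le> card (Pow (verts G))"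
      using fin by (intro card_mono) auto
    also have "\<dots> = 2 ^ n" using fin G(3) by (simp add: card_Pow)
    finally show "d \<in> (\<lambda>k. real k / real (n choose card (verts F))) ` {..2 ^ n}"
      using G by (auto simp: density_def)
  qed
qed simp

lemma density_le_max_density:
  "simple_graph (G :: nat pattern) \<Longrightarrow> density F G \<le> max_density F (card (verts G))"
  unfolding max_density_def by (intro Max_ge[OF finite_densities] CollectI exI[of _ G]) simp

lemma max_density_le:
  assumes "n > 0"
  shows "max_density F27 n \<le> normalisation n * (3 / 4096)"
proof -
  let ?D = "{density F27 G | G :: nat pattern. simple_graph G \<and> card (verts G) = n}"
  have "simple_graph ({0..<n}, {})" "card (verts ({0..<n}, {} :: nat set set)) = n" by (auto simp: simple_graph_def)
  then have "?D \<noteq> {}" by blast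
  moreover have "density F27 G \<le> normalisation n * (3 / 4096)" if "simple_graph G" "card (verts G) = n" for G :: "nat pattern"
    using density_le[OF that(1)] that(2) assms by force
  ultimately show ?thesis unfolding max_density_def by (subst Max_le_iff[OF finite_densities]) auto
qed

text \<open>
  The polynomial counts tuples drawn with replacement; the error is the probability that two of the
  six entries that may coincide in a copy do so.
\<close>

lemma blowup_density_close:
  fixes P :: "nat \<Rightarrow> 'v set"
  assumes P: "blowup_parts B27 P" and n: "n = card (verts (blowup B27 P))" "n > 0"
  shows "\<bar>density F27 (blowup B27 P) - normalisation n * pattern_density (\<lambda>i. real (card (P i)) / real n)\<bar> \<le> normalisation n * (2 / real n)"
proof -
  define V where "V = verts (blowup B27 P)"
  have V: "V = (\<Union>i\<in>{0..<8}. P i)" by (simp add: V_def blowup_def verts_B27)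
  define p where "p x = (if \<exists>i<8. x \<in> P i then (SOME i. i < 8 \<and> x \<in> P i) else 0)" for x
  have p: "p x = i" if "i < 8" "x \<in> P i" for x i
  proof -
    have "p x < 8 \<and> x \<in> P (p x)" using that someI[of "\<lambda>i. i < 8 \<and> x \<in> P i" i] by (auto simp: p_def)
    moreover have "P (p x) \<inter> P i = {}" if "p x \<noteq> i"
      using P that \<open>i < 8\<close> calculation by (simp add: blowup_parts_def disjoint_family_on_def verts_B27)
    ultimately show ?thesis using that by blast
  qed
  have p8: "p x < 8" for x
  proof (cases "\<exists>i<8. x \<in> P i")
    case True
    then show ?thesis using p by force
  next
    case False
    then show ?thesis unfolding p_def if_not_P[OF False] by simp
  qed
  note graph = blowup_graph[where p = p, OF P p8 p]
  have ne: "V \<noteq> {}" using n by (auto simp: V_def)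
  interpret weighted_graph V "\<lambda>_. 1 / real (card V)" "adjacent_or_equal (blowup B27 P)"
    using uniform_weighted_graph[OF graph(1)] ne unfolding V_def by blast
  have nV: "n = card V" using n by (simp add: V_def)
  have pw: "part_weights V (\<lambda>_. 1 / real (card V)) p i = real (card (P i)) / real n" if "i < 8" for i
  proof -
    have "{x \<in> V. p x = i} = P i"
    proof -
      have "x \<in> P (p x)" if "x \<in> V" for x using that p unfolding V by fastforce
      then show ?thesis using p that by (auto simp: V)
    qed
    then show ?thesis using finite_V by (simp add: part_weights_def mean_def nV sum_divide_distrib[symmetric] Int_def)
  qed
  have "deviation p = 0"
    unfolding deviation_def mean_def using graph(2) by (intro sum.neutral ballI) (simp add: V_def)
  then have cd: "copy_density = pattern_density (part_weights V (\<lambda>_. 1 / real (card V)) p)"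
    using pattern_density_close[of p, OF p8] by simp
  also have "\<dots> = pattern_density (\<lambda>i. real (card (P i)) / real n)"
    unfolding pattern_density_eq by (simp add: pw)
  finally have cd: "copy_density = pattern_density (\<lambda>i. real (card (P i)) / real n)" .
  have d: "density F27 (blowup B27 P) = normalisation n * distinct_density (adjacent_or_equal (blowup B27 P))"
    unfolding nV by (rule density_eq[OF graph(1)]) (simp_all add: V_def)
  have "\<bar>distinct_density (adjacent_or_equal (blowup B27 P)) - copy_density\<bar> \<le> 2 / real n"
    using distinct_density_le distinct_density_ge[of "card V"] by (auto simp: nV abs_le_iff)
  then have "normalisation n * \<bar>distinct_density (adjacent_or_equal (blowup B27 P)) - copy_density\<bar> \<le> normalisation n * (2 / real n)"
    by (intro mult_left_mono) (auto simp: normalisation_def)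
  moreover have "density F27 (blowup B27 P) - normalisation n * copy_density = normalisation n * (distinct_density (adjacent_or_equal (blowup B27 P)) - copy_density)"
    unfolding d by (simp add: right_diff_distrib)
  moreover have "0 \<le> normalisation n" by (simp add: normalisation_def)
  ultimately show ?thesis unfolding cd[symmetric] by (simp add: abs_mult)
qed

lemma blowup_density_tendsto:
  fixes P :: "nat \<Rightarrow> nat \<Rightarrow> 'v set"
  assumes P: "\<And>n. blowup_parts B27 (P n)" and x: "x \<in> simplex {0..<8}"
    and lim: "\<And>i. i < 8 \<Longrightarrow> (\<lambda>n. real (card (P n i)) / real n) \<longlonglongrightarrow> x i"
  shows "(\<lambda>n. density F27 (blowup B27 (P n))) \<longlonglongrightarrow> 180 * pattern_density x"
proof -
  define N where "N n = card (verts (blowup B27 (P n)))" for n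
  have N: "N n = (\<Sum>i\<in>{0..<8}. card (P n i))" for n
    using P[of n] unfolding N_def by (subst card_UN_disjoint[symmetric]) (auto simp: blowup_def blowup_parts_def disjoint_family_on_def verts_B27)
  have N1: "(\<lambda>n. real (N n) / real n) \<longlonglongrightarrow> 1"
  proof -
    have "(\<lambda>n. \<Sum>i\<in>{0..<8}. real (card (P n i)) / real n) \<longlonglongrightarrow> (\<Sum>i\<in>{0..<8}. x i)"
      by (intro tendsto_sum lim) simp
    then show ?thesis using x by (simp add: N sum_divide_distrib simplex_def)
  qed
  have ev: "\<forall>\<^sub>F n in sequentially. real n / 2 \<le> real (N n) \<and> n > 0"
  proof -
    have "\<forall>\<^sub>F n in sequentially. 1 / 2 < real (N n) / real n" by (rule order_tendstoD(1)[OF N1]) simp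
    then show ?thesis using eventually_gt_at_top[of 0] by eventually_elim (auto simp: field_simps)
  qed
  have N_top: "filterlim N at_top sequentially"
  proof -
    have "filterlim (\<lambda>n. real n / 2) at_top sequentially"
      by (intro filterlim_tendsto_pos_mult_at_top[of "\<lambda>_. 1 / 2" "1 / 2" _ real, simplified] filterlim_real_sequentially)
    then have "filterlim (\<lambda>n. real (N n)) at_top sequentially"
      by (rule filterlim_at_top_mono) (use ev in \<open>auto elim: eventually_mono\<close>)
    then show ?thesis using filterlim_sequentially_iff_filterlim_real by blast
  qed
  have nrm: "(\<lambda>n. normalisation (N n)) \<longlonglongrightarrow> 180" by (rule filterlim_compose[OF normalisation_tendsto N_top])
  have y: "(\<lambda>n. real (card (P n i)) / real (N n)) \<longlonglongrightarrow> x i" if "i < 8" for i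
  proof -
    have "(\<lambda>n. (real (card (P n i)) / real n) / (real (N n) / real n)) \<longlonglongrightarrow> x i / 1"
      by (intro tendsto_divide lim N1 that) simp
    moreover have "\<forall>\<^sub>F n in sequentially. (real (card (P n i)) / real n) / (real (N n) / real n) = real (card (P n i)) / real (N n)"
      using eventually_gt_at_top[of 0] by eventually_elim simp
    ultimately show ?thesis using Lim_transform_eventually by fastforce
  qed
  have main: "(\<lambda>n. normalisation (N n) * pattern_density (\<lambda>i. real (card (P n i)) / real (N n))) \<longlonglongrightarrow> 180 * pattern_density x"
    by (intro tendsto_mult nrm pattern_density_tendsto y)
  have err: "(\<lambda>n. normalisation (N n) * (2 / real (N n))) \<longlonglongrightarrow> 180 * 0"
    by (intro tendsto_mult nrm filterlim_compose[OF lim_const_over_n N_top])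
  have "(\<lambda>n. density F27 (blowup B27 (P n)) - normalisation (N n) * pattern_density (\<lambda>i. real (card (P n i)) / real (N n))) \<longlonglongrightarrow> 0"
  proof (rule tendsto_0_le[where K = 1])
    show "(\<lambda>n. normalisation (N n) * (2 / real (N n))) \<longlonglongrightarrow> 0" using err by simp
    show "\<forall>\<^sub>F n in sequentially. norm (density F27 (blowup B27 (P n)) - normalisation (N n) * pattern_density (\<lambda>i. real (card (P n i)) / real (N n)))
        \<le> norm (normalisation (N n) * (2 / real (N n))) * 1"
      using ev
    proof eventually_elim
      case (elim n)
      then have "N n > 0" by (metis gr0I half_gt_zero not_less of_nat_0 of_nat_0_less_iff)
      then show ?case using blowup_density_close[OF P[of n] N_def] by (simp add: abs_of_nonneg normalisation_def)
    qed
  qed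
  from tendsto_add[OF this main] show ?thesis by simp
qed

text \<open>
  The limit is unique because parts of sizes \<open>\<lfloor>x\<^sub>i n\<rfloor>\<close> form a sequence of the required kind.
\<close>

lemma blowup_density_eq:
  assumes x: "x \<in> simplex {0..<8}"
  shows "blowup_density F27 B27 x = 180 * pattern_density x"
  unfolding blowup_density_def
proof (rule the_equality)
  show "\<forall>V :: nat \<Rightarrow> nat \<Rightarrow> nat set. (\<forall>n. blowup_parts B27 (V n)) \<and> (\<forall>i\<in>verts B27. (\<lambda>n. real (card (V n i)) / real n) \<longlonglongrightarrow> x i)
      \<longrightarrow> (\<lambda>n. density F27 (blowup B27 (V n))) \<longlonglongrightarrow> 180 * pattern_density x"
  proof (intro allI impI; elim conjE)
    fix V :: "nat \<Rightarrow> nat \<Rightarrow> nat set"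
    assume "\<forall>n. blowup_parts B27 (V n)" "\<forall>i\<in>verts B27. (\<lambda>n. real (card (V n i)) / real n) \<longlonglongrightarrow> x i"
    then show "(\<lambda>n. density F27 (blowup B27 (V n))) \<longlonglongrightarrow> 180 * pattern_density x"
      by (intro blowup_density_tendsto[OF _ x]) (auto simp: verts_B27)
  qed
next
  fix l assume l: "\<forall>V :: nat \<Rightarrow> nat \<Rightarrow> nat set. (\<forall>n. blowup_parts B27 (V n)) \<and> (\<forall>i\<in>verts B27. (\<lambda>n. real (card (V n i)) / real n) \<longlonglongrightarrow> x i)
      \<longrightarrow> (\<lambda>n. density F27 (blowup B27 (V n))) \<longlonglongrightarrow> l"
  define P where "P n i = (\<lambda>k. 8 * k + i) ` {..<nat \<lfloor>x i * real n\<rfloor>}" for n i :: nat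
  have parts: "blowup_parts B27 (P n)" for n
  proof -
    have res: "m mod 8 = i" if "m \<in> P n i" "i < 8" for m i using that by (auto simp: P_def)
    have "disjoint_family_on (P n) {0..<8}" unfolding disjoint_family_on_def
    proof (intro ballI impI)
      fix a b :: nat assume "a \<in> {0..<8}" "b \<in> {0..<8}" "a \<noteq> b"
      then show "P n a \<inter> P n b = {}" using res[of _ a] res[of _ b] by fastforce
    qed
    then show ?thesis by (simp add: blowup_parts_def verts_B27 P_def)
  qed
  have lim: "(\<lambda>n. real (card (P n i)) / real n) \<longlonglongrightarrow> x i" if "i < 8" for i
  proof -
    have x0: "0 \<le> x i" using x that by (simp add: simplex_def)
    have c: "card (P n i) = nat \<lfloor>x i * real n\<rfloor>" for n
      unfolding P_def by (subst card_image) (auto simp: inj_on_def)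
    have r: "real (card (P n i)) = of_int \<lfloor>x i * real n\<rfloor>" for n using x0 by (simp add: c)
    show ?thesis
    proof (rule tendsto_sandwich[of "\<lambda>n. x i - 1 / real n" _ _ "\<lambda>_. x i"])
      show "(\<lambda>n. x i - 1 / real n) \<longlonglongrightarrow> x i" using tendsto_diff[OF tendsto_const lim_const_over_n, of "x i" 1] by simp
      show "\<forall>\<^sub>F n in sequentially. x i - 1 / real n \<le> real (card (P n i)) / real n"
        using eventually_gt_at_top[of 0]
      proof eventually_elim
        case (elim n)
        have "x i * real n - 1 \<le> of_int \<lfloor>x i * real n\<rfloor>" by linarith
        then have "(x i * real n - 1) / real n \<le> of_int \<lfloor>x i * real n\<rfloor> / real n" by (rule divide_right_mono) simp
        then show ?case using elim unfolding r by (simp add: diff_divide_distrib)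
      qed
      show "\<forall>\<^sub>F n in sequentially. real (card (P n i)) / real n \<le> x i"
        using eventually_gt_at_top[of 0] by eventually_elim (simp add: r divide_le_eq)
    qed simp
  qed
  have "(\<lambda>n. density F27 (blowup B27 (P n))) \<longlonglongrightarrow> l"
    using l parts lim by (auto simp: verts_B27)
  moreover have "(\<lambda>n. density F27 (blowup B27 (P n))) \<longlonglongrightarrow> 180 * pattern_density x"
    by (rule blowup_density_tendsto[OF parts x lim])
  ultimately show "l = 180 * pattern_density x" by (rule LIMSEQ_unique)
qed


section \<open>The extremal problem\<close>

lemma pattern_density_le:
  assumes "x \<in> simplex {0..<8}"
  shows "pattern_density x \<le> 3 / 4096"
proof (rule ccontr)
  assume "\<not> ?thesis"
  then have big: "3 / 4096 < pattern_density x" by simp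
  have "x i = 1 / 8" if "i < 8" for i
    using assms big that by (intro pattern_density_maximal) (auto simp: simplex_def lessThan_atLeast0)
  then have "x 0 = 1 / 8" "x 1 = 1 / 8" "x 2 = 1 / 8" "x 3 = 1 / 8" "x 4 = 1 / 8" "x 5 = 1 / 8" "x 6 = 1 / 8" "x 7 = 1 / 8"
    by simp_all
  then have "pattern_density x = pattern_density (\<lambda>_. 1 / 8)" unfolding pattern_density_eq by (simp only:)
  then show False using big by (simp add: pattern_density_uniform)
qed

lemma uniform_in_simplex: "(\<lambda>_. 1 / 8) \<in> simplex {0..<8 :: nat}"
  by (simp add: simplex_def)

text \<open>The maximiser is fixed by every automorphism, so it is even unique.\<close>

lemma unique_maximiser: "is_unique_maximiser F27 B27 (\<lambda>i. 1 / 8)"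
  unfolding is_unique_maximiser_def
proof (intro conjI allI impI)
  show max: "is_maximiser F27 B27 (\<lambda>i. 1 / 8)"
    unfolding is_maximiser_def verts_B27
  proof (intro conjI ballI uniform_in_simplex)
    show "blowup_density F27 B27 y \<le> blowup_density F27 B27 (\<lambda>i. 1 / 8)" if "y \<in> simplex {0..<8}" for y
      using pattern_density_le[OF that] by (simp add: blowup_density_eq that uniform_in_simplex pattern_density_uniform)
  qed
  fix y assume y: "is_maximiser F27 B27 y"
  then have sy: "y \<in> simplex {0..<8}" by (simp add: is_maximiser_def verts_B27)
  have "blowup_density F27 B27 (\<lambda>i. 1 / 8) \<le> blowup_density F27 B27 y"
    using y uniform_in_simplex by (simp add: is_maximiser_def verts_B27)
  then have "3 / 4096 \<le> pattern_density y"
    by (simp add: blowup_density_eq sy uniform_in_simplex pattern_density_uniform)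
  then have "y i = 1 / 8" if "i < 8" for i
    using sy that by (intro pattern_density_maximal) (auto simp: simplex_def lessThan_atLeast0)
  then show "\<exists>f. automorphism B27 f \<and> (\<forall>i\<in>verts B27. y i = 1 / 8)"
    by (intro exI[of _ id]) (auto simp: pattern_iso_def verts_B27)
qed

lemma card_residue_class:
  assumes "j < 8"
  shows "card {x \<in> {0..<n}. x mod 8 = j} = (n + 7 - j) div (8::nat)"
proof -
  have "{x \<in> {0..<n}. x mod 8 = j} = (\<lambda>k. 8 * k + j) ` {..<(n + 7 - j) div 8}"
  proof (intro equalityI subsetI)
    fix x assume "x \<in> {x \<in> {0..<n}. x mod 8 = j}"
    then have x: "x < n" "x mod 8 = j" by auto
    then have eq: "x = 8 * (x div 8) + j" by (metis mult_div_mod_eq)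
    then have "8 * (x div 8) + 8 \<le> n + 7 - j" using x(1) by linarith
    then have "Suc (x div 8) \<le> (n + 7 - j) div 8" by (simp add: less_eq_div_iff_mult_less_eq)
    then have "x div 8 < (n + 7 - j) div 8" by simp
    with eq show "x \<in> (\<lambda>k. 8 * k + j) ` {..<(n + 7 - j) div 8}" by blast
  next
    fix x assume "x \<in> (\<lambda>k. 8 * k + j) ` {..<(n + 7 - j) div 8}"
    then obtain k where k: "x = 8 * k + j" "Suc k \<le> (n + 7 - j) div 8" by auto
    then have "8 * k + 8 \<le> n + 7 - j" by (simp add: less_eq_div_iff_mult_less_eq)
    then have "x < n" using k(1) by linarith
    then show "x \<in> {x \<in> {0..<n}. x mod 8 = j}" using assms k(1) by simp
  qed
  then show ?thesis by (simp add: card_image inj_on_def)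
qed

text \<open>Blowups with parts of nearly equal sizes show that the upper bound is sharp.\<close>

lemma max_density_tendsto: "(\<lambda>n. max_density F27 n) \<longlonglongrightarrow> 135 / 1024"
proof (rule tendsto_sandwich)
  define P where "P n i = {x \<in> {0..<n}. x mod 8 = i}" for n i :: nat
  have parts: "blowup_parts B27 (P n)" for n
    by (auto simp: blowup_parts_def disjoint_family_on_def P_def)
  have lim: "(\<lambda>n. real (card (P n i)) / real n) \<longlonglongrightarrow> 1 / 8" if "i < 8" for i
  proof (rule tendsto_sandwich[of "\<lambda>n. 1 / 8 - 1 / real n" _ _ "\<lambda>n. 1 / 8 + 1 / real n"])
    show "(\<lambda>n. 1 / 8 - 1 / real n) \<longlonglongrightarrow> 1 / 8" using tendsto_diff[OF tendsto_const lim_const_over_n, of "1 / 8" 1] by simp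
    show "(\<lambda>n. 1 / 8 + 1 / real n) \<longlonglongrightarrow> 1 / 8" using tendsto_add[OF tendsto_const lim_const_over_n, of "1 / 8" 1] by simp
    have c: "n \<le> 8 * card (P n i) + 7 \<and> 8 * card (P n i) \<le> n + 7" for n
    proof -
      have "8 * ((n + 7 - i) div 8) \<le> n + 7 - i" "n + 7 - i < 8 + 8 * ((n + 7 - i) div 8)"
        by (simp_all add: dividend_less_times_div)
      then show ?thesis unfolding P_def card_residue_class[OF that] using that by linarith
    qed
    have r: "real n - 8 \<le> 8 * real (card (P n i)) \<and> 8 * real (card (P n i)) \<le> real n + 8" for n
      using c[of n] by linarith
    have "1 / 8 - 1 / real n \<le> real (card (P n i)) / real n \<and> real (card (P n i)) / real n \<le> 1 / 8 + 1 / real n" if "n > 0" for n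
    proof -
      have "(real n - 8) / 8 / real n \<le> real (card (P n i)) / real n" "real (card (P n i)) / real n \<le> (real n + 8) / 8 / real n"
        using r[of n] by (intro divide_right_mono; simp)+
      then show ?thesis using that by (simp add: diff_divide_distrib add_divide_distrib)
    qed
    then show "\<forall>\<^sub>F n in sequentially. 1 / 8 - 1 / real n \<le> real (card (P n i)) / real n"
      "\<forall>\<^sub>F n in sequentially. real (card (P n i)) / real n \<le> 1 / 8 + 1 / real n"
      by (auto intro!: eventually_mono[OF eventually_gt_at_top[of 0]])
  qed
  show "(\<lambda>n. density F27 (blowup B27 (P n))) \<longlonglongrightarrow> 135 / 1024"
    using blowup_density_tendsto[OF parts uniform_in_simplex lim] by (simp add: pattern_density_uniform)
  have "density F27 (blowup B27 (P n)) \<le> max_density F27 n" for n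
  proof -
    have "simple_graph (blowup B27 (P n))"
      by (rule blowup_graph(1)[OF parts, where p = "\<lambda>x. x mod 8"]) (auto simp: P_def)
    moreover have "verts (blowup B27 (P n)) = {0..<n}" by (auto simp: blowup_def verts_B27 P_def)
    ultimately show ?thesis using density_le_max_density by (metis card_atLeastLessThan diff_zero)
  qed
  then show "\<forall>\<^sub>F n in sequentially. density F27 (blowup B27 (P n)) \<le> max_density F27 n" by simp
  show "(\<lambda>n. normalisation n * (3 / 4096)) \<longlonglongrightarrow> 135 / 1024"
    using tendsto_mult[OF normalisation_tendsto tendsto_const, of "3 / 4096"] by simp
  show "\<forall>\<^sub>F n in sequentially. max_density F27 n \<le> normalisation n * (3 / 4096)"
    using eventually_gt_at_top[of 0] by eventually_elim (rule max_density_le)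
qed

text \<open>
  Graphs whose copy density is not close to the bound satisfy the inequality trivially, as the
  edit distance is at most \<open>n\<^sup>2\<close>.
\<close>

theorem stability: "perfectly_stable F27 B27"
proof -
  obtain \<epsilon> where \<epsilon>: "\<epsilon> > 0" and gain: "\<And>(V :: nat set) e n. weighted_graph V (\<lambda>_. 1 / real n) e \<Longrightarrow> (\<And>x. e x x) \<Longrightarrow> 10 ^ 16 \<le> n \<Longrightarrow>
     3 / 4096 - \<epsilon> \<le> weighted_graph.copy_density V (\<lambda>_. 1 / real n) e \<Longrightarrow>
     \<exists>p. (\<forall>x. p x < 8) \<and> weighted_graph.deviation V (\<lambda>_. 1 / real n) e p / 10 ^ 14 \<le>
        weighted_graph.distinct_density V (\<lambda>_. 1 / real n) (\<lambda>x y. looped_adj (p x) (p y))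
        - weighted_graph.distinct_density V (\<lambda>_. 1 / real n) e"
    using gain_of_closest_blowup[where ?'v = nat] by metis
  have "(\<lambda>n. max_density F27 n - normalisation n * (3 / 4096 - \<epsilon>)) \<longlonglongrightarrow> 135 / 1024 - 180 * (3 / 4096 - \<epsilon>)"
    by (intro tendsto_intros max_density_tendsto normalisation_tendsto)
  moreover have "90 * \<epsilon> < 135 / 1024 - 180 * (3 / 4096 - \<epsilon>)" using \<epsilon> by (simp add: algebra_simps)
  ultimately have "\<forall>\<^sub>F n in sequentially. 90 * \<epsilon> < max_density F27 n - normalisation n * (3 / 4096 - \<epsilon>)"
    by (rule order_tendstoD(1))
  then obtain n0 where n0: "\<And>n. n0 \<le> n \<Longrightarrow> 90 * \<epsilon> < max_density F27 n - normalisation n * (3 / 4096 - \<epsilon>)"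
    by (auto simp: eventually_sequentially)
  define C where "C = max (max (real n0) (10 ^ 16)) (1 / (90 * \<epsilon>))"
  have C: "real n0 \<le> C" "10 ^ 16 \<le> C" "1 / (90 * \<epsilon>) \<le> C" by (auto simp: C_def)
  have C0: "C > 0" using C(2) by (rule less_le_trans[rotated]) simp
  show ?thesis
    unfolding perfectly_stable_def
  proof (intro exI[of _ C] conjI C0 allI impI; elim conjE)
    fix G :: "nat pattern"
    assume G: "simple_graph G" and big: "C \<le> real (card (verts G))"
    define n where "n = card (verts G)"
    have fin: "finite (verts G)" using G by (simp add: simple_graph_def)
    have "real n0 \<le> real n" "real (10 ^ 16) \<le> real n" using C big by (auto simp: n_def)
    then have n: "n0 \<le> n" "10 ^ 16 \<le> n" by (simp_all only: of_nat_le_iff)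
    then have n6: "6 \<le> n" by simp
    let ?e = "adjacent_or_equal G"
    have "verts G \<noteq> {}" using n6 by (auto simp: n_def)
    then interpret weighted_graph "verts G" "\<lambda>_. 1 / real n" ?e
      using uniform_weighted_graph[OF G] unfolding n_def by blast
    have dG: "density F27 G = normalisation n * distinct_density ?e"
        using density_eq[OF G refl, of ?e] by (simp add: n_def[symmetric])
    have edit: "real (edit_distance G B27) \<le> real n ^ 2 * deviation p" if "\<And>x. p x < 8" for p
    proof -
      have "real n ^ 2 * deviation p = real (card {t \<in> verts G \<times> verts G. ?e (fst t) (snd t) \<noteq> looped_adj (p (fst t)) (p (snd t))})"
        by (rule deviation_card) simp
      then show ?thesis using edit_distance_le[OF G that] by simp
    qed
    show "real (edit_distance G B27) \<le> C * (max_density F27 (card (verts G)) - density F27 G) * real (card (verts G)) ^ 2"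
    proof (cases "3 / 4096 - \<epsilon> \<le> copy_density")
      case True
      then obtain p where p: "\<forall>x. p x < 8" and g: "deviation p / 10 ^ 14 \<le> distinct_density (\<lambda>x y. looped_adj (p x) (p y)) - distinct_density ?e"
        using gain[OF weighted_graph_axioms adjacent_or_equal_refl n(2)] by blast
      have p': "p x < 8" for x using p by blast
      note H = placed[of "verts G" p, OF fin p']
      have "density F27 (placed (verts G) p) = normalisation n * distinct_density (\<lambda>x y. looped_adj (p x) (p y))"
        using density_eq[OF H(2,1), of "\<lambda>x y. looped_adj (p x) (p y)"] by (simp add: n_def[symmetric] H(4))
      moreover have "density F27 (placed (verts G) p) \<le> max_density F27 n"
        using density_le_max_density[OF H(2), of F27] unfolding H(1) n_def .
      ultimately have "normalisation n * (distinct_density (\<lambda>x y. looped_adj (p x) (p y)) - distinct_density ?e) \<le> max_density F27 n - density F27 G"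
        unfolding dG by (simp add: right_diff_distrib)
      moreover have "180 * (deviation p / 10 ^ 14) \<le> normalisation n * (distinct_density (\<lambda>x y. looped_adj (p x) (p y)) - distinct_density ?e)"
        using normalisation_ge[OF n6] g deviation_nonneg[of p] by (intro mult_mono) auto
      ultimately have dev: "deviation p \<le> 10 ^ 14 / 180 * (max_density F27 n - density F27 G)" by simp
      then have "0 \<le> max_density F27 n - density F27 G" using deviation_nonneg[of p] by simp
      then have "deviation p \<le> C * (max_density F27 n - density F27 G)"
        using C(2) by (intro order_trans[OF dev] mult_right_mono order_trans[OF _ C(2)]) simp_all
      then have "real n ^ 2 * deviation p \<le> real n ^ 2 * (C * (max_density F27 n - density F27 G))" by (intro mult_left_mono) auto
      then show ?thesis using edit[of p, OF p'] by (simp add: n_def mult_ac)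
    next
      case False
      have "distinct_density ?e \<le> 3 / 4096 - \<epsilon>" using distinct_density_le False by linarith
      then have "density F27 G \<le> normalisation n * (3 / 4096 - \<epsilon>)"
        unfolding dG by (intro mult_left_mono) (auto simp: normalisation_def)
      then have d: "90 * \<epsilon> \<le> max_density F27 n - density F27 G" using n0[OF n(1)] by linarith
      have "deviation (\<lambda>_. 0) \<le> M (\<lambda>x. M (\<lambda>y. 1))" unfolding deviation_def by (intro mono) simp
      then have "real n ^ 2 * deviation (\<lambda>_. 0) \<le> real n ^ 2 * 1" by (intro mult_left_mono) (simp_all add: const)
      moreover have "1 \<le> C * (max_density F27 n - density F27 G)"
      proof -
        have "1 = 1 / (90 * \<epsilon>) * (90 * \<epsilon>)" using \<epsilon> by simp
        also have "\<dots> \<le> C * (max_density F27 n - density F27 G)" using C(3) C0 d \<epsilon> by (intro mult_mono) auto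
        finally show ?thesis .
      qed
      then have "real n ^ 2 * 1 \<le> real n ^ 2 * (C * (max_density F27 n - density F27 G))" by (intro mult_left_mono) auto
      ultimately have "real (edit_distance G B27) \<le> real n ^ 2 * (C * (max_density F27 n - density F27 G))"
        using edit[of "\<lambda>_. 0"] by simp
      then show ?thesis by (simp add: n_def mult_ac)
    qed
  qed
qed

theorem theorem3p12:
  shows "(\<lambda>n. max_density F27 n) \<longlonglongrightarrow> 135 / 1024
    \<and> perfectly_stable F27 B27
    \<and> is_unique_maximiser F27 B27 (\<lambda>i. 1 / 8)"
  using max_density_tendsto stability unique_maximiser by blast

end
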